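(* Let $\mathcal{Q}$ be a simplicial operad all of whose operation spaces $\mathcal{Q}(\underline{a},b)$ are Kan complexes. Then the homotopy coherent list nerve $N_\Delta^l\mathcal{Q}$ is a quasi-operad.
   Context: **Lists.** For a set $X$, $\mathcal{L}X=\coprod_{n\ge 0}X^n$. A listing from $A$ to $X$ is a function $A\to\mathcal{L}X$; listings compose by concatenation, giving the category $\mathsf{List}$ of sets and listings. A function is viewed as a listing with values of length $1$. $\mathcal{L}:\mathsf{List}\to\mathsf{Set}$ sends $A$ to $\mathcal{L}A$ and extends listings by concatenation. A simplicial list is a functor $X:\Delta^{op}\to\mathsf{List}$; morphisms of simplicial lists are natural transformations whose components are functions. $\mathcal{L}X$ is the simplicial set $\mathcal{L}\circ X$. $X$ is operadic if $\theta^*:X_n\to X_k$ is a function whenever $\theta:[k]\to[n]$ satisfies $\theta(k)=n$; $\mathsf{sList}_{Op}$ is the category of operadic simplicial lists. A quasi-operad is an operadic simplicial list $P$ such that $\mathcal{L}P$ is a quasi-category. **Operads.** "Operad" means coloured non-symmetric operad (nullary operations allowed); $\mathsf{Op}$ is the category of operads in sets, and $\mathsf{Op}_\Delta$ that of simplicial operads, i.e. operads enriched in simplicial sets. Equivalently, a simplicial operad is a simplicial object in $\mathsf{Op}$ with constant set of colours and simplicial operators that are the identity on colours. **Leveled trees and list nerve.** $\Delta_+$ is the category of finite (possibly empty) totally ordered sets and order-preserving maps, objects up to unique isomorphism. An $n$-simplex $\alpha$ of $N(\Delta_+)$ is a chain $A_0\xrightarrow{\alpha_1}\dots\xrightarrow{\alpha_n}A_n$,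 with composites $\alpha_{i,j}:A_i\to A_j$; it is rooted if $|A_n|=1$. For $a\in A_n$, $\alpha_a$ is the rooted simplex obtained by restricting the chain to preimages of $\{a\}$. $T_\alpha$ is the free operad with colours $\coprod_iA_i$ and generating operations $p_i^{(a)}:\alpha_i^{-1}(a)\to a$ ($1\le i\le n$, $a\in A_i$); $p_{i,j}^{(a)}:\alpha_{i,j}^{-1}(a)\to a$ denotes the evident composite. For $\theta:[k]\to[n]$, $\lambda_\theta:T_{\theta^*\alpha}\to T_\alpha$ sends a colour $b$ in level $i$ to $b\in A_{\theta(i)}$ and $p_i^{(b)}$ to $p^{(b)}_{\theta(i-1),\theta(i)}$. The list nerve $N^l:\mathsf{Op}\to\mathsf{sList}_{Op}$ is $N^l(\mathcal{P})_n=\coprod_{\alpha\in N(\Delta_+)_n\text{ rooted}}\mathsf{Op}(T_\alpha,\mathcal{P})$, with $\theta^*x=\big(T_{(\theta^*\alpha)_a}\subseteq T_{\theta^*\alpha}\xrightarrow{\lambda_\theta}T_\alpha\xrightarrow{x}\mathcal{P}\big)_{a\in A_{\theta(k)}}$. It has a left adjoint $\tau_1:\mathsf{sList}_{Op}\to\mathsf{Op}$. **Thick trees.** Let $\mathbb{\Delta}^n$ be the standard simplicial thickening of $[n]$: objects $0,\dots,n$; $m$-simplices of the mapping space from $i$ to $j$ are chains $U_0\subseteq\dots\subseteq U_m$ of subsets of $\{i,\dots,j\}$ containing $i$ and $j$ (none if $i>j$); composition is union. $\mathbb{\Delta}^n_m$ is the category with the same objects and the $m$-simplices as morphisms. For $\alpha\in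 N(\Delta_+)_n$ and $m\ge0$, $\mathbb{U}_\alpha^{(m)}$ is the operadic simplicial list whose $k$-simplices are pairs $(\theta,a)$ with $\theta:[k]\to\mathbb{\Delta}^n_m$ a functor and $a\in A_{\theta(k)}$. For $\eta:[l]\to[k]$, $\eta^*(\theta,a)$ is the list of all $(\theta\eta,b)$ with $b\in A_{\theta\eta(l)}$ and $\alpha_{\theta\eta(l),\theta(k)}(b)=a$, in the order of $A_{\theta\eta(l)}$. Simplicial operators in $m$ act by post-composition on $\theta$. Then $\mathbb{V}_\alpha=\tau_1\mathbb{U}_\alpha$ (applied levelwise in $m$) is a simplicial operad with colours $\coprod_iA_i$. Given rooted $\alpha\in N(\Delta_+)_n$, $\varphi:[k]\to[n]$ and $a\in A_{\varphi(k)}$, the map $(\theta,b)\mapsto(\varphi_*\theta,b)$ (with $\varphi_*:\mathbb{\Delta}^k\to\mathbb{\Delta}^n$) induces a morphism $\mathbb{V}_{(\varphi,a)}:\mathbb{V}_{(\varphi^*\alpha)_a}\to\mathbb{V}_\alpha$. **Homotopy coherent list nerve.** $(N_\Delta^l\mathcal{Q})_n=\coprod_{\alpha\in N(\Delta_+)_n\text{ rooted}}\mathsf{Op}_\Delta(\mathbb{V}_\alpha,\mathcal{Q})$, where for $\varphi:[k]\to[n]$ and $x:\mathbb{V}_\alpha\to\mathcal{Q}$ one sets $\varphi^*x=(x\circ\mathbb{V}_{(\varphi,a)})_{a\in A_{\varphi(k)}}$. This is an operadic simplicial list. *)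

theory Defs
  imports "HOL-Library.FuncSet"
begin

section \<open>Simplicial sets\<close>

definition simplex_maps :: "nat \<Rightarrow> nat \<Rightarrow> (nat \<Rightarrow> nat) set" where
  "simplex_maps k n = {\<theta> \<in> {..k} \<rightarrow>\<^sub>E {..n}. mono_on {..k} \<theta>}"

text \<open>The operator of \<open>\<theta> : [k] \<rightarrow> [n]\<close> is \<open>sact S k n \<theta> : S\<^sub>n \<rightarrow> S\<^sub>k\<close>.\<close>

record 's sset =
  splx :: "nat \<Rightarrow> 's set"
  sact :: "nat \<Rightarrow> nat \<Rightarrow> (nat \<Rightarrow> nat) \<Rightarrow> 's \<Rightarrow> 's"

definition simplicial_set :: "'s sset \<Rightarrow> bool" where
  "simplicial_set S \<longleftrightarrow>
    (\<forall>k n. \<forall>\<theta> \<in> simplex_maps k n. \<forall>x \<in> splx S n. sact S k n \<theta> x \<in> splx S k) \<and>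
    (\<forall>n. \<forall>x \<in> splx S n. sact S n n (\<lambda>i\<in>{..n}. i) x = x) \<and>
    (\<forall>l k n. \<forall>\<theta> \<in> simplex_maps k n. \<forall>\<eta> \<in> simplex_maps l k. \<forall>x \<in> splx S n.
       sact S l n (compose {..l} \<theta> \<eta>) x = sact S l k \<eta> (sact S k n \<theta> x))"

definition sset_hom :: "'s sset \<Rightarrow> 't sset \<Rightarrow> (nat \<Rightarrow> 's \<Rightarrow> 't) \<Rightarrow> bool" where
  "sset_hom S T f \<longleftrightarrow>
    (\<forall>n. \<forall>x \<in> splx S n. f n x \<in> splx T n) \<and>
    (\<forall>k n. \<forall>\<theta> \<in> simplex_maps k n. \<forall>x \<in> splx S n.
       f k (sact S k n \<theta> x) = sact T k n \<theta> (f n x))"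

definition std_simplex :: "nat \<Rightarrow> (nat \<Rightarrow> nat) sset" where
  "std_simplex n =
    \<lparr>splx = (\<lambda>k. simplex_maps k n), sact = (\<lambda>l k \<eta> \<theta>. compose {..l} \<theta> \<eta>)\<rparr>"

definition horn :: "nat \<Rightarrow> nat \<Rightarrow> (nat \<Rightarrow> nat) sset" where
  "horn n i =
    \<lparr>splx = (\<lambda>k. {\<theta> \<in> simplex_maps k n. insert i (\<theta> ` {..k}) \<noteq> {..n}}),
     sact = (\<lambda>l k \<eta> \<theta>. compose {..l} \<theta> \<eta>)\<rparr>"

definition fills_horn :: "'s sset \<Rightarrow> nat \<Rightarrow> nat \<Rightarrow> bool" where
  "fills_horn S n i \<longleftrightarrow>
    (\<forall>f. sset_hom (horn n i) S f \<longrightarrow>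
      (\<exists>g. sset_hom (std_simplex n) S g \<and> (\<forall>k. \<forall>\<theta> \<in> splx (horn n i) k. g k \<theta> = f k \<theta>)))"

definition kan_complex :: "'s sset \<Rightarrow> bool" where
  "kan_complex S \<longleftrightarrow> simplicial_set S \<and> (\<forall>n i. 1 \<le> n \<and> i \<le> n \<longrightarrow> fills_horn S n i)"

definition quasi_category :: "'s sset \<Rightarrow> bool" where
  "quasi_category S \<longleftrightarrow> simplicial_set S \<and> (\<forall>n i. 0 < i \<and> i < n \<longrightarrow> fills_horn S n i)"


section \<open>Simplicial lists\<close>

definition listing_comp :: "('b \<Rightarrow> 'c list) \<Rightarrow> ('a \<Rightarrow> 'b list) \<Rightarrow> 'a \<Rightarrow> 'c list" where
  "listing_comp g f = (\<lambda>a. concat (map g (f a)))"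

record 'x slist =
  lsplx :: "nat \<Rightarrow> 'x set"
  lact :: "nat \<Rightarrow> nat \<Rightarrow> (nat \<Rightarrow> nat) \<Rightarrow> 'x \<Rightarrow> 'x list"

definition simplicial_list :: "'x slist \<Rightarrow> bool" where
  "simplicial_list X \<longleftrightarrow>
    (\<forall>k n. \<forall>\<theta> \<in> simplex_maps k n. \<forall>x \<in> lsplx X n. lact X k n \<theta> x \<in> lists (lsplx X k)) \<and>
    (\<forall>n. \<forall>x \<in> lsplx X n. lact X n n (\<lambda>i\<in>{..n}. i) x = [x]) \<and>
    (\<forall>l k n. \<forall>\<theta> \<in> simplex_maps k n. \<forall>\<eta> \<in> simplex_maps l k. \<forall>x \<in> lsplx X n.
       lact X l n (compose {..l} \<theta> \<eta>) x = listing_comp (lact X l k \<eta>) (lact X k n \<theta>) x)"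

definition slist_hom :: "'x slist \<Rightarrow> 'y slist \<Rightarrow> (nat \<Rightarrow> 'x \<Rightarrow> 'y) \<Rightarrow> bool" where
  "slist_hom X Y f \<longleftrightarrow>
    (\<forall>n. \<forall>x \<in> lsplx X n. f n x \<in> lsplx Y n) \<and>
    (\<forall>k n. \<forall>\<theta> \<in> simplex_maps k n. \<forall>x \<in> lsplx X n.
       map (f k) (lact X k n \<theta> x) = lact Y k n \<theta> (f n x))"

definition list_sset :: "'x slist \<Rightarrow> 'x list sset" where
  "list_sset X =
    \<lparr>splx = (\<lambda>n. lists (lsplx X n)),
     sact = (\<lambda>k n \<theta> xs. concat (map (lact X k n \<theta>) xs))\<rparr>"

definition operadic :: "'x slist \<Rightarrow> bool" where
  "operadic X \<longleftrightarrow>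
    (\<forall>k n. \<forall>\<theta> \<in> simplex_maps k n. \<theta> k = n \<longrightarrow> (\<forall>x \<in> lsplx X n. length (lact X k n \<theta> x) = 1))"

definition quasi_operad :: "'x slist \<Rightarrow> bool" where
  "quasi_operad X \<longleftrightarrow> simplicial_list X \<and> operadic X \<and> quasi_category (list_sset X)"


section \<open>Coloured non-symmetric operads\<close>

text \<open>The operations of all arities form one set, with a source (a list of colours, possibly empty)
  and a target; \<open>P(as; b)\<close> is \<open>op_set P as b\<close>. The composite \<open>f \<circ> (g\<^sub>1, \<dots>, g\<^sub>r)\<close> is
  \<open>ocomp P f [g\<^sub>1, \<dots>, g\<^sub>r]\<close>.\<close>

record ('c, 'o) operad =
  Col :: "'c set"
  Ops :: "'o set"
  src :: "'o \<Rightarrow> 'c list"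
  tgt :: "'o \<Rightarrow> 'c"
  idop :: "'c \<Rightarrow> 'o"
  ocomp :: "'o \<Rightarrow> 'o list \<Rightarrow> 'o"

definition op_set :: "('c, 'o) operad \<Rightarrow> 'c list \<Rightarrow> 'c \<Rightarrow> 'o set" where
  "op_set P as b = {f \<in> Ops P. src P f = as \<and> tgt P f = b}"

definition composable :: "('c, 'o) operad \<Rightarrow> 'o \<Rightarrow> 'o list \<Rightarrow> bool" where
  "composable P f gs \<longleftrightarrow> f \<in> Ops P \<and> gs \<in> lists (Ops P) \<and> map (tgt P) gs = src P f"

definition operad :: "('c, 'o) operad \<Rightarrow> bool" where
  "operad P \<longleftrightarrow>
    (\<forall>f \<in> Ops P. src P f \<in> lists (Col P) \<and> tgt P f \<in> Col P) \<and>
    (\<forall>c \<in> Col P. idop P c \<in> op_set P [c] c) \<and>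
    (\<forall>f gs. composable P f gs \<longrightarrow>
       ocomp P f gs \<in> op_set P (concat (map (src P) gs)) (tgt P f)) \<and>
    (\<forall>f \<in> Ops P. ocomp P (idop P (tgt P f)) [f] = f) \<and>
    (\<forall>f \<in> Ops P. ocomp P f (map (idop P) (src P f)) = f) \<and>
    (\<forall>f gs hss. composable P f gs \<and> list_all2 (composable P) gs hss \<longrightarrow>
       ocomp P (ocomp P f gs) (concat hss) = ocomp P f (map2 (ocomp P) gs hss))"

definition operad_map ::
    "('c, 'o) operad \<Rightarrow> ('d, 'p) operad \<Rightarrow> ('c \<Rightarrow> 'd) \<Rightarrow> ('o \<Rightarrow> 'p) \<Rightarrow> bool" where
  "operad_map P Q F G \<longleftrightarrow>
    (\<forall>c \<in> Col P. F c \<in> Col Q) \<and>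
    (\<forall>f \<in> Ops P. G f \<in> op_set Q (map F (src P f)) (F (tgt P f))) \<and>
    (\<forall>c \<in> Col P. G (idop P c) = idop Q (F c)) \<and>
    (\<forall>f gs. composable P f gs \<longrightarrow> G (ocomp P f gs) = ocomp Q (G f) (map G gs))"

text \<open>Morphisms as elements of a set are pairs of extensional functions.\<close>

definition operad_Hom ::
    "('c, 'o) operad \<Rightarrow> ('d, 'p) operad \<Rightarrow> (('c \<Rightarrow> 'd) \<times> ('o \<Rightarrow> 'p)) set" where
  "operad_Hom P Q =
    {(F, G). F \<in> extensional (Col P) \<and> G \<in> extensional (Ops P) \<and> operad_map P Q F G}"

text \<open>\<open>operad_hcomp P G F\<close> is \<open>G \<circ> F\<close> for \<open>F\<close> with domain \<open>P\<close>.\<close>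

definition operad_hcomp ::
    "('c, 'o) operad \<Rightarrow> ('d \<Rightarrow> 'e) \<times> ('p \<Rightarrow> 'q) \<Rightarrow> ('c \<Rightarrow> 'd) \<times> ('o \<Rightarrow> 'p) \<Rightarrow> ('c \<Rightarrow> 'e) \<times> ('o \<Rightarrow> 'q)"
  where
  "operad_hcomp P G F = (compose (Col P) (fst G) (fst F), compose (Ops P) (snd G) (snd F))"


subsection \<open>Free operads and quotients\<close>

record ('c, 'g) collection =
  gCol :: "'c set"
  gens :: "'g set"
  gsrc :: "'g \<Rightarrow> 'c list"
  gtgt :: "'g \<Rightarrow> 'c"

datatype ('c, 'g) optree = Leaf 'c | Node 'g "('c, 'g) optree list"

primrec leaves :: "('c, 'g) optree \<Rightarrow> 'c list" where
  "leaves (Leaf c) = [c]"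
| "leaves (Node g ts) = concat (map leaves ts)"

fun tree_root :: "('c, 'g) collection \<Rightarrow> ('c, 'g) optree \<Rightarrow> 'c" where
  "tree_root K (Leaf c) = c"
| "tree_root K (Node g ts) = gtgt K g"

inductive_set optrees :: "('c, 'g) collection \<Rightarrow> ('c, 'g) optree set" for K where
  Leaf: "c \<in> gCol K \<Longrightarrow> Leaf c \<in> optrees K"
| Node: "g \<in> gens K \<Longrightarrow> \<forall>t \<in> set ts. t \<in> optrees K \<Longrightarrow> map (tree_root K) ts = gsrc K g \<Longrightarrow>
    Node g ts \<in> optrees K"

text \<open>\<open>graft t us\<close> glues the trees \<open>us\<close>, in order, onto the leaves of \<open>t\<close>.\<close>

fun graft :: "('c, 'g) optree \<Rightarrow> ('c, 'g) optree list \<Rightarrow> ('c, 'g) optree"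
  and grafts :: "('c, 'g) optree list \<Rightarrow> ('c, 'g) optree list \<Rightarrow> ('c, 'g) optree list" where
  "graft (Leaf c) us = hd us"
| "graft (Node g ts) us = Node g (grafts ts us)"
| "grafts [] us = []"
| "grafts (t # ts) us =
    graft t (take (length (leaves t)) us) # grafts ts (drop (length (leaves t)) us)"

definition free_operad :: "('c, 'g) collection \<Rightarrow> ('c, ('c, 'g) optree) operad" where
  "free_operad K =
    \<lparr>Col = gCol K, Ops = optrees K, src = leaves, tgt = tree_root K, idop = Leaf, ocomp = graft\<rparr>"

definition corolla :: "('c, 'g) collection \<Rightarrow> 'g \<Rightarrow> ('c, 'g) optree" where
  "corolla K g = Node g (map Leaf (gsrc K g))"

text \<open>The extension of an assignment on colours and generators to the free operad.\<close>

primrec eval_tree ::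
    "('d, 'p) operad \<Rightarrow> ('c \<Rightarrow> 'd) \<Rightarrow> ('g \<Rightarrow> 'p) \<Rightarrow> ('c, 'g) optree \<Rightarrow> 'p" where
  "eval_tree P F h (Leaf c) = idop P (F c)"
| "eval_tree P F h (Node g ts) = ocomp P (h g) (map (eval_tree P F h) ts)"

definition free_extension ::
    "('c, 'g) collection \<Rightarrow> ('d, 'p) operad \<Rightarrow> ('c \<Rightarrow> 'd) \<Rightarrow> ('g \<Rightarrow> 'p) \<Rightarrow>
     ('c \<Rightarrow> 'd) \<times> (('c, 'g) optree \<Rightarrow> 'p)" where
  "free_extension K P F h = (restrict F (gCol K), restrict (eval_tree P F h) (optrees K))"

inductive operad_cong :: "('c, 'o) operad \<Rightarrow> ('o \<times> 'o) set \<Rightarrow> 'o \<Rightarrow> 'o \<Rightarrow> bool"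
  for P R where
  base: "(f, g) \<in> R \<Longrightarrow> operad_cong P R f g"
| refl: "f \<in> Ops P \<Longrightarrow> operad_cong P R f f"
| sym: "operad_cong P R f g \<Longrightarrow> operad_cong P R g f"
| trans: "operad_cong P R f g \<Longrightarrow> operad_cong P R g h \<Longrightarrow> operad_cong P R f h"
| ocomp: "operad_cong P R f f' \<Longrightarrow> list_all2 (operad_cong P R) gs gs' \<Longrightarrow>
    map (tgt P) gs = src P f \<Longrightarrow> operad_cong P R (ocomp P f gs) (ocomp P f' gs')"

definition op_class :: "('c, 'o) operad \<Rightarrow> ('o \<times> 'o) set \<Rightarrow> 'o \<Rightarrow> 'o set" where
  "op_class P R f = {g. operad_cong P R f g}"

definition rep :: "'o set \<Rightarrow> 'o" where
  "rep F = (SOME f. f \<in> F)"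

definition operad_quotient :: "('c, 'o) operad \<Rightarrow> ('o \<times> 'o) set \<Rightarrow> ('c, 'o set) operad" where
  "operad_quotient P R =
    \<lparr>Col = Col P, Ops = op_class P R ` Ops P,
     src = (\<lambda>F. src P (rep F)), tgt = (\<lambda>F. tgt P (rep F)),
     idop = (\<lambda>c. op_class P R (idop P c)),
     ocomp = (\<lambda>F Gs. op_class P R (ocomp P (rep F) (map rep Gs)))\<rparr>"


section \<open>Simplicial operads\<close>

text \<open>Simplicial objects in operads with a constant set of colours, on which the simplicial
  operators are the identity; \<open>oact Q k m \<theta>\<close> is the action on operations.\<close>

record ('c, 'o) soperad =
  lvl :: "nat \<Rightarrow> ('c, 'o) operad"
  oact :: "nat \<Rightarrow> nat \<Rightarrow> (nat \<Rightarrow> nat) \<Rightarrow> 'o \<Rightarrow> 'o"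

definition simplicial_operad :: "('c, 'o) soperad \<Rightarrow> bool" where
  "simplicial_operad Q \<longleftrightarrow>
    (\<forall>m. operad (lvl Q m) \<and> Col (lvl Q m) = Col (lvl Q 0)) \<and>
    (\<forall>k m. \<forall>\<theta> \<in> simplex_maps k m. operad_map (lvl Q m) (lvl Q k) (\<lambda>c. c) (oact Q k m \<theta>)) \<and>
    (\<forall>m. \<forall>f \<in> Ops (lvl Q m). oact Q m m (\<lambda>i\<in>{..m}. i) f = f) \<and>
    (\<forall>l k m. \<forall>\<theta> \<in> simplex_maps k m. \<forall>\<eta> \<in> simplex_maps l k. \<forall>f \<in> Ops (lvl Q m).
       oact Q l m (compose {..l} \<theta> \<eta>) f = oact Q l k \<eta> (oact Q k m \<theta> f))"

definition op_space :: "('c, 'o) soperad \<Rightarrow> 'c list \<Rightarrow> 'c \<Rightarrow> 'o sset" where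
  "op_space Q as b = \<lparr>splx = (\<lambda>m. op_set (lvl Q m) as b), sact = oact Q\<rparr>"

definition soperad_Hom ::
    "('c, 'o) soperad \<Rightarrow> ('d, 'p) soperad \<Rightarrow> (('c \<Rightarrow> 'd) \<times> (nat \<Rightarrow> 'o \<Rightarrow> 'p)) set" where
  "soperad_Hom P Q =
    {(F, G). (\<forall>m. (F, G m) \<in> operad_Hom (lvl P m) (lvl Q m)) \<and>
      (\<forall>k m. \<forall>\<theta> \<in> simplex_maps k m. \<forall>f \<in> Ops (lvl P m).
         G k (oact P k m \<theta> f) = oact Q k m \<theta> (G m f))}"

definition soperad_hcomp ::
    "('c, 'o) soperad \<Rightarrow> ('d \<Rightarrow> 'e) \<times> (nat \<Rightarrow> 'p \<Rightarrow> 'q) \<Rightarrow> ('c \<Rightarrow> 'd) \<times> (nat \<Rightarrow> 'o \<Rightarrow> 'p) \<Rightarrow>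
     ('c \<Rightarrow> 'e) \<times> (nat \<Rightarrow> 'o \<Rightarrow> 'q)" where
  "soperad_hcomp P G F =
    (compose (Col (lvl P 0)) (fst G) (fst F), \<lambda>m. compose (Ops (lvl P m)) (snd G m) (snd F m))"


section \<open>Leveled trees and the list nerve\<close>

text \<open>The objects of the skeletal category of finite ordinals are represented by the sets
  \<open>{..<a}\<close>. A chain \<open>A\<^sub>0 \<rightarrow> \<dots> \<rightarrow> A\<^sub>n\<close> is stored with its composites, i.e. as a functor from
  \<open>[n]\<close>: \<open>lev \<alpha> i\<close> is the size of \<open>A\<^sub>i\<close> and \<open>lmap \<alpha> i j : A\<^sub>i \<rightarrow> A\<^sub>j\<close> for \<open>i \<le> j \<le> n\<close>.
  The components outside this range are fixed so that equal simplices are equal records.\<close>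

definition ord_maps :: "nat \<Rightarrow> nat \<Rightarrow> (nat \<Rightarrow> nat) set" where
  "ord_maps a b = {f \<in> {..<a} \<rightarrow>\<^sub>E {..<b}. mono_on {..<a} f}"

record chain =
  lev :: "nat \<Rightarrow> nat"
  lmap :: "nat \<Rightarrow> nat \<Rightarrow> nat \<Rightarrow> nat"

definition mk_chain :: "nat \<Rightarrow> (nat \<Rightarrow> nat) \<Rightarrow> (nat \<Rightarrow> nat \<Rightarrow> nat \<Rightarrow> nat) \<Rightarrow> chain" where
  "mk_chain n A f =
    \<lparr>lev = restrict A {..n},
     lmap = (\<lambda>i j. if i \<le> j \<and> j \<le> n then restrict (f i j) {..<A i} else (\<lambda>_. undefined))\<rparr>"

definition chains :: "nat \<Rightarrow> chain set" where
  "chains n = {\<alpha>. \<alpha> = mk_chain n (lev \<alpha>) (lmap \<alpha>) \<and>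
    (\<forall>i j. i \<le> j \<and> j \<le> n \<longrightarrow> lmap \<alpha> i j \<in> ord_maps (lev \<alpha> i) (lev \<alpha> j)) \<and>
    (\<forall>i \<le> n. \<forall>x < lev \<alpha> i. lmap \<alpha> i i x = x) \<and>
    (\<forall>i j l. i \<le> j \<and> j \<le> l \<and> l \<le> n \<longrightarrow>
       (\<forall>x < lev \<alpha> i. lmap \<alpha> i l x = lmap \<alpha> j l (lmap \<alpha> i j x)))}"

definition rooted_chains :: "nat \<Rightarrow> chain set" where
  "rooted_chains n = {\<alpha> \<in> chains n. lev \<alpha> n = 1}"

definition pull_chain :: "nat \<Rightarrow> (nat \<Rightarrow> nat) \<Rightarrow> chain \<Rightarrow> chain" where
  "pull_chain k \<theta> \<alpha> = mk_chain k (\<lambda>i. lev \<alpha> (\<theta> i)) (\<lambda>i j. lmap \<alpha> (\<theta> i) (\<theta> j))"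

definition fibre :: "chain \<Rightarrow> nat \<Rightarrow> nat \<Rightarrow> nat \<Rightarrow> nat list" where
  "fibre \<alpha> i j a = filter (\<lambda>b. lmap \<alpha> i j b = a) [0..<lev \<alpha> i]"

text \<open>For \<open>a \<in> A\<^sub>n\<close> the preimage of \<open>a\<close> in \<open>A\<^sub>i\<close> is the interval of length
  \<open>length (fibre \<alpha> i n a)\<close> starting at \<open>offset \<alpha> n a i\<close>. So the element \<open>b\<close> of level \<open>i\<close> of
  \<open>\<alpha>\<^sub>a = subchain n \<alpha> a\<close> stands for \<open>offset \<alpha> n a i + b\<close> in \<open>A\<^sub>i\<close>.\<close>

definition offset :: "chain \<Rightarrow> nat \<Rightarrow> nat \<Rightarrow> nat \<Rightarrow> nat" where
  "offset \<alpha> n a i = card {b. b < lev \<alpha> i \<and> lmap \<alpha> i n b < a}"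

definition subchain :: "nat \<Rightarrow> chain \<Rightarrow> nat \<Rightarrow> chain" where
  "subchain n \<alpha> a =
    mk_chain n (\<lambda>i. length (fibre \<alpha> i n a))
      (\<lambda>i j b. lmap \<alpha> i j (offset \<alpha> n a i + b) - offset \<alpha> n a j)"

text \<open>The colours \<open>(i, a)\<close> of \<open>T\<^sub>\<alpha>\<close> are the \<open>a \<in> A\<^sub>i\<close>; the generator \<open>(i, a)\<close>, for
  \<open>1 \<le> i\<close>, is \<open>p\<^sub>i\<close> at \<open>a\<close>.\<close>

definition tree_coll :: "nat \<Rightarrow> chain \<Rightarrow> (nat \<times> nat, nat \<times> nat) collection" where
  "tree_coll n \<alpha> =
    \<lparr>gCol = {(i, a). i \<le> n \<and> a < lev \<alpha> i},
     gens = {(i, a). 1 \<le> i \<and> i \<le> n \<and> a < lev \<alpha> i},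
     gsrc = (\<lambda>(i, a). map (Pair (i - 1)) (fibre \<alpha> (i - 1) i a)),
     gtgt = (\<lambda>p. p)\<rparr>"

definition tree_operad ::
    "nat \<Rightarrow> chain \<Rightarrow> (nat \<times> nat, (nat \<times> nat, nat \<times> nat) optree) operad" where
  "tree_operad n \<alpha> = free_operad (tree_coll n \<alpha>)"

text \<open>\<open>level_op \<alpha> i d a\<close> is the composite operation from level \<open>i\<close> to \<open>a\<close> in level \<open>i + d\<close>.\<close>

primrec level_op :: "chain \<Rightarrow> nat \<Rightarrow> nat \<Rightarrow> nat \<Rightarrow> (nat \<times> nat, nat \<times> nat) optree" where
  "level_op \<alpha> i 0 a = Leaf (i, a)"
| "level_op \<alpha> i (Suc d) a =
    Node (i + Suc d, a) (map (level_op \<alpha> i d) (fibre \<alpha> (i + d) (i + Suc d) a))"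

definition tree_map ::
    "nat \<Rightarrow> nat \<Rightarrow> (nat \<Rightarrow> nat) \<Rightarrow> chain \<Rightarrow>
     (nat \<times> nat \<Rightarrow> nat \<times> nat) \<times>
     ((nat \<times> nat, nat \<times> nat) optree \<Rightarrow> (nat \<times> nat, nat \<times> nat) optree)" where
  "tree_map k n \<theta> \<alpha> =
    free_extension (tree_coll k (pull_chain k \<theta> \<alpha>)) (tree_operad n \<alpha>)
      (\<lambda>(i, b). (\<theta> i, b)) (\<lambda>(i, b). level_op \<alpha> (\<theta> (i - 1)) (\<theta> i - \<theta> (i - 1)) b)"

definition subtree_incl ::
    "nat \<Rightarrow> chain \<Rightarrow> nat \<Rightarrow>
     (nat \<times> nat \<Rightarrow> nat \<times> nat) \<times>
     ((nat \<times> nat, nat \<times> nat) optree \<Rightarrow> (nat \<times> nat, nat \<times> nat) optree)" where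
  "subtree_incl n \<alpha> a =
    free_extension (tree_coll n (subchain n \<alpha> a)) (tree_operad n \<alpha>)
      (\<lambda>(i, b). (i, offset \<alpha> n a i + b))
      (\<lambda>(i, b). corolla (tree_coll n \<alpha>) (i, offset \<alpha> n a i + b))"

definition list_nerve ::
    "('c, 'o) operad \<Rightarrow>
     (chain \<times> (nat \<times> nat \<Rightarrow> 'c) \<times> ((nat \<times> nat, nat \<times> nat) optree \<Rightarrow> 'o)) slist" where
  "list_nerve P =
    \<lparr>lsplx = (\<lambda>n. {(\<alpha>, x). \<alpha> \<in> rooted_chains n \<and> x \<in> operad_Hom (tree_operad n \<alpha>) P}),
     lact = (\<lambda>k n \<theta> (\<alpha>, x).
       map (\<lambda>a. let \<beta> = subchain k (pull_chain k \<theta> \<alpha>) a in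
              (\<beta>, operad_hcomp (tree_operad k \<beta>) x
                    (operad_hcomp (tree_operad k \<beta>) (tree_map k n \<theta> \<alpha>)
                      (subtree_incl k (pull_chain k \<theta> \<alpha>) a))))
         [0..<lev \<alpha> (\<theta> k)])\<rparr>"

definition list_nerve_map ::
    "('c \<Rightarrow> 'd) \<times> ('o \<Rightarrow> 'p) \<Rightarrow> nat \<Rightarrow>
     chain \<times> (nat \<times> nat \<Rightarrow> 'c) \<times> ((nat \<times> nat, nat \<times> nat) optree \<Rightarrow> 'o) \<Rightarrow>
     chain \<times> (nat \<times> nat \<Rightarrow> 'd) \<times> ((nat \<times> nat, nat \<times> nat) optree \<Rightarrow> 'p)" where
  "list_nerve_map g n = (\<lambda>(\<alpha>, x). (\<alpha>, operad_hcomp (tree_operad n \<alpha>) g x))"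


section \<open>The left adjoint of the list nerve\<close>

text \<open>\<open>\<tau>\<^sub>1 X\<close> is presented by colours \<open>X\<^sub>0\<close>, generators \<open>X\<^sub>1\<close> and one relation for each
  degenerate 1-simplex and each 2-simplex.\<close>

definition vertex :: "nat \<Rightarrow> nat \<Rightarrow> nat" where
  "vertex i = (\<lambda>_\<in>{..0}. i)"

definition edge :: "nat \<Rightarrow> nat \<Rightarrow> nat \<Rightarrow> nat" where
  "edge i j = (\<lambda>p\<in>{..1}. if p = 0 then i else j)"

definition tau1_coll :: "'x slist \<Rightarrow> ('x, 'x) collection" where
  "tau1_coll X =
    \<lparr>gCol = lsplx X 0, gens = lsplx X 1,
     gsrc = lact X 0 1 (vertex 0), gtgt = (\<lambda>e. hd (lact X 0 1 (vertex 1) e))\<rparr>"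

definition tau1_rel :: "'x slist \<Rightarrow> (('x, 'x) optree \<times> ('x, 'x) optree) set" where
  "tau1_rel X =
    {(corolla (tau1_coll X) (hd (lact X 1 0 (edge 0 0) x)), Leaf x) | x. x \<in> lsplx X 0} \<union>
    {(Node (hd (lact X 1 2 (edge 1 2) s)) (map (corolla (tau1_coll X)) (lact X 1 2 (edge 0 1) s)),
      corolla (tau1_coll X) (hd (lact X 1 2 (edge 0 2) s))) | s. s \<in> lsplx X 2}"

definition tau1 :: "'x slist \<Rightarrow> ('x, ('x, 'x) optree set) operad" where
  "tau1 X = operad_quotient (free_operad (tau1_coll X)) (tau1_rel X)"

definition tau1_gen :: "'x slist \<Rightarrow> 'x \<Rightarrow> ('x, 'x) optree set" where
  "tau1_gen X e = op_class (free_operad (tau1_coll X)) (tau1_rel X) (corolla (tau1_coll X) e)"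

text \<open>The effect of \<open>\<tau>\<^sub>1\<close> on a morphism \<open>h : X \<rightarrow> Y\<close>.\<close>

definition tau1_map ::
    "'x slist \<Rightarrow> 'y slist \<Rightarrow> (nat \<Rightarrow> 'x \<Rightarrow> 'y) \<Rightarrow>
     ('x \<Rightarrow> 'y) \<times> (('x, 'x) optree set \<Rightarrow> ('y, 'y) optree set)" where
  "tau1_map X Y h =
    (restrict (h 0) (Col (tau1 X)),
     \<lambda>F\<in>Ops (tau1 X). eval_tree (tau1 Y) (h 0) (\<lambda>e. tau1_gen Y (h 1 e)) (rep F))"


section \<open>Thick trees\<close>

text \<open>A chain \<open>U\<^sub>0 \<subseteq> \<dots> \<subseteq> U\<^sub>m\<close> is represented by its extension to a sequence that is constant from
  \<open>m\<close> on. In this way the identity morphisms, and hence the 0-simplices of \<open>U\<^sub>\<alpha>\<^sup>(\<^sup>m\<^sup>)\<close>, do not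
  depend on \<open>m\<close>.\<close>

definition thick_mor :: "nat \<Rightarrow> nat \<Rightarrow> nat \<Rightarrow> (nat \<Rightarrow> nat set) set" where
  "thick_mor m i j =
    {U. (\<forall>r. i \<in> U r \<and> j \<in> U r \<and> U r \<subseteq> {i..j}) \<and> mono U \<and> (\<forall>r \<ge> m. U r = U m)}"

text \<open>A functor from \<open>[k]\<close>: its objects, and its morphisms for \<open>i \<le> j \<le> k\<close>.\<close>

record thick =
  tobj :: "nat \<Rightarrow> nat"
  tmor :: "nat \<Rightarrow> nat \<Rightarrow> nat \<Rightarrow> nat set"

definition mk_thick :: "nat \<Rightarrow> (nat \<Rightarrow> nat) \<Rightarrow> (nat \<Rightarrow> nat \<Rightarrow> nat \<Rightarrow> nat set) \<Rightarrow> thick" where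
  "mk_thick k t u =
    \<lparr>tobj = restrict t {..k}, tmor = (\<lambda>i j. if i \<le> j \<and> j \<le> k then u i j else (\<lambda>_. undefined))\<rparr>"

definition thick_functors :: "nat \<Rightarrow> nat \<Rightarrow> nat \<Rightarrow> thick set" where
  "thick_functors n m k = {\<theta>. \<theta> = mk_thick k (tobj \<theta>) (tmor \<theta>) \<and>
    (\<forall>i \<le> k. tobj \<theta> i \<le> n) \<and>
    (\<forall>i j. i \<le> j \<and> j \<le> k \<longrightarrow> tmor \<theta> i j \<in> thick_mor m (tobj \<theta> i) (tobj \<theta> j)) \<and>
    (\<forall>i \<le> k. tmor \<theta> i i = (\<lambda>r. {tobj \<theta> i})) \<and>
    (\<forall>i j l. i \<le> j \<and> j \<le> l \<and> l \<le> k \<longrightarrow>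
       tmor \<theta> i l = (\<lambda>r. tmor \<theta> j l r \<union> tmor \<theta> i j r))}"

definition thick_pre :: "nat \<Rightarrow> (nat \<Rightarrow> nat) \<Rightarrow> thick \<Rightarrow> thick" where
  "thick_pre l \<eta> \<theta> = mk_thick l (\<lambda>i. tobj \<theta> (\<eta> i)) (\<lambda>i j. tmor \<theta> (\<eta> i) (\<eta> j))"

text \<open>Post-composition with the operator of \<open>\<psi> : [m'] \<rightarrow> [m]\<close>, and with \<open>\<phi>\<^sub>*\<close>.\<close>

definition thick_op :: "nat \<Rightarrow> nat \<Rightarrow> (nat \<Rightarrow> nat) \<Rightarrow> thick \<Rightarrow> thick" where
  "thick_op k m' \<psi> \<theta> = mk_thick k (tobj \<theta>) (\<lambda>i j r. tmor \<theta> i j (\<psi> (min r m')))"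

definition thick_push :: "nat \<Rightarrow> (nat \<Rightarrow> nat) \<Rightarrow> thick \<Rightarrow> thick" where
  "thick_push k \<phi> \<theta> = mk_thick k (\<lambda>i. \<phi> (tobj \<theta> i)) (\<lambda>i j r. \<phi> ` tmor \<theta> i j r)"

definition thick_slist :: "nat \<Rightarrow> chain \<Rightarrow> nat \<Rightarrow> (thick \<times> nat) slist" where
  "thick_slist n \<alpha> m =
    \<lparr>lsplx = (\<lambda>k. {(\<theta>, a). \<theta> \<in> thick_functors n m k \<and> a < lev \<alpha> (tobj \<theta> k)}),
     lact = (\<lambda>l k \<eta> (\<theta>, a).
       map (\<lambda>b. (thick_pre l \<eta> \<theta>, b)) (fibre \<alpha> (tobj \<theta> (\<eta> l)) (tobj \<theta> k) a))\<rparr>"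

type_synonym thick_ops = "(thick \<times> nat, thick \<times> nat) optree set"

definition thick_operad :: "nat \<Rightarrow> chain \<Rightarrow> (thick \<times> nat, thick_ops) soperad" where
  "thick_operad n \<alpha> =
    \<lparr>lvl = (\<lambda>m. tau1 (thick_slist n \<alpha> m)),
     oact = (\<lambda>m' m \<psi>. snd (tau1_map (thick_slist n \<alpha> m) (thick_slist n \<alpha> m')
       (\<lambda>k (\<theta>, a). (thick_op k m' \<psi> \<theta>, a))))\<rparr>"

text \<open>The morphism into \<open>thick_operad n \<alpha>\<close> from the thick operad of \<open>(\<phi>\<^sup>*\<alpha>)\<^sub>a\<close>, for
  \<open>\<phi> : [k] \<rightarrow> [n]\<close>.\<close>

definition thick_operad_map ::
    "nat \<Rightarrow> nat \<Rightarrow> (nat \<Rightarrow> nat) \<Rightarrow> chain \<Rightarrow> nat \<Rightarrow>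
     (thick \<times> nat \<Rightarrow> thick \<times> nat) \<times> (nat \<Rightarrow> thick_ops \<Rightarrow> thick_ops)" where
  "thick_operad_map k n \<phi> \<alpha> a =
    (let \<beta> = pull_chain k \<phi> \<alpha>;
         h = (\<lambda>j (\<theta>, b). (thick_push j \<phi> \<theta>, offset \<beta> k a (tobj \<theta> j) + b));
         g = (\<lambda>m. tau1_map (thick_slist k (subchain k \<beta> a) m) (thick_slist n \<alpha> m) h)
     in (fst (g 0), \<lambda>m. snd (g m)))"


section \<open>The homotopy coherent list nerve\<close>

definition coherent_list_nerve ::
    "('c, 'o) soperad \<Rightarrow>
     (chain \<times> (thick \<times> nat \<Rightarrow> 'c) \<times> (nat \<Rightarrow> thick_ops \<Rightarrow> 'o)) slist" where
  "coherent_list_nerve Q =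
    \<lparr>lsplx = (\<lambda>n. {(\<alpha>, x). \<alpha> \<in> rooted_chains n \<and> x \<in> soperad_Hom (thick_operad n \<alpha>) Q}),
     lact = (\<lambda>k n \<phi> (\<alpha>, x).
       map (\<lambda>a. let \<beta> = subchain k (pull_chain k \<phi> \<alpha>) a in
              (\<beta>, soperad_hcomp (thick_operad k \<beta>) x (thick_operad_map k n \<phi> \<alpha> a)))
         [0..<lev \<alpha> (\<phi> k)])\<rparr>"


section \<open>The adjunction and the thick operads\<close>

text \<open>The explicit \<open>tau1 X\<close> is the value at \<open>X\<close> of the left adjoint of the list nerve:
  \<open>tau1_unit X : X \<rightarrow> list_nerve (tau1 X)\<close> is a universal arrow (\<open>operad_tau1\<close>, \<open>tau1_unit_hom\<close>,
  \<open>tau1_universal\<close>) and \<open>tau1_map\<close> is the induced action on morphisms (\<open>tau1_map\<close>,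
  \<open>tau1_map_unique\<close>). It applies to the simplicial lists \<open>thick_slist n \<alpha> m\<close>, and the resulting
  \<open>thick_operad n \<alpha>\<close> is a simplicial operad (\<open>thick_slist\<close>, \<open>simplicial_operad_thick\<close>).\<close>


subsection \<open>Free operads\<close>

lemma map_eq_concatD:
  "map f us = concat lss \<Longrightarrow> \<exists>uss. us = concat uss \<and> map (map f) uss = lss"
proof (induction lss arbitrary: us)
  case Nil then show ?case by (auto intro: exI[of _ "[]"])
next
  case (Cons l lss)
  then have "map f us = l @ concat lss" by simp
  then obtain u v where uv: "us = u @ v" "map f u = l" "map f v = concat lss"
    by (auto simp: map_eq_append_conv)
  from Cons.IH[OF uv(3)] obtain vss where "v = concat vss" "map (map f) vss = lss" by blast
  then show ?case using uv by (auto intro!: exI[of _ "u # vss"])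
qed

lemma grafts_concat:
  "map length uss = map (length \<circ> leaves) ts \<Longrightarrow> grafts ts (concat uss) = map2 graft ts uss"
  by (induction ts arbitrary: uss) (auto simp: Cons_eq_map_conv map_eq_Cons_conv)

lemma graft_Node:
  "map length uss = map (length \<circ> leaves) ts \<Longrightarrow>
    graft (Node g ts) (concat uss) = Node g (map2 graft ts uss)"
  by (simp add: grafts_concat)

definition coll_ok :: "('c, 'g) collection \<Rightarrow> bool" where
  "coll_ok K \<longleftrightarrow> (\<forall>g \<in> gens K. gsrc K g \<in> lists (gCol K) \<and> gtgt K g \<in> gCol K)"

lemma root_in: "coll_ok K \<Longrightarrow> t \<in> optrees K \<Longrightarrow> tree_root K t \<in> gCol K"
  by (erule optrees.cases) (auto simp: coll_ok_def)

lemma leaves_in: "t \<in> optrees K \<Longrightarrow> leaves t \<in> lists (gCol K)"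
  by (induction rule: optrees.induct) (auto simp: in_lists_conv_set)

lemma concat_map_concat: "concat (map f (concat xss)) = concat (map (\<lambda>xs. concat (map f xs)) xss)"
  by (induction xss) auto

lemma list_all2_map_eqI:
  "map f xs = map g ys \<longleftrightarrow> list_all2 (\<lambda>x y. f x = g y) xs ys"
  by (simp add: list_eq_iff_nth_eq list_all2_conv_all_nth) auto

lemma graft_typed:
  "t \<in> optrees K \<Longrightarrow> us \<in> lists (optrees K) \<Longrightarrow> map (tree_root K) us = leaves t \<Longrightarrow>
    graft t us \<in> optrees K \<and> leaves (graft t us) = concat (map leaves us) \<and>
    tree_root K (graft t us) = tree_root K t"
proof (induction t arbitrary: us rule: optrees.induct)
  case (Leaf c)
  then show ?case by (auto simp: map_eq_Cons_conv)
next
  case (Node g ts)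
  from Node.prems(2) have "map (tree_root K) us = concat (map leaves ts)" by simp
  from map_eq_concatD[OF this] obtain uss where
    uss: "us = concat uss" "map (map (tree_root K)) uss = map leaves ts" by blast
  have len: "map length uss = map (length \<circ> leaves) ts"
    using arg_cong[OF uss(2), of "map length"] by (simp add: comp_def)
  have l: "length uss = length ts" using arg_cong[OF uss(2), of length] by simp
  have mem: "uss ! i \<in> lists (optrees K)" if "i < length ts" for i
    using Node.prems(1) uss(1) l that by (force simp: in_set_conv_nth)
  have rt: "map (tree_root K) (uss ! i) = leaves (ts ! i)" if "i < length ts" for i
    using arg_cong[OF uss(2), of "\<lambda>x. x ! i"] l that by simp
  have ih: "graft (ts!i) (uss!i) \<in> optrees K \<and>
      leaves (graft (ts!i) (uss!i)) = concat (map leaves (uss!i)) \<and>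
      tree_root K (graft (ts!i) (uss!i)) = tree_root K (ts!i)" if "i < length ts" for i
    using Node.IH that mem rt by (metis nth_mem)
  have eq: "graft (Node g ts) us = Node g (map2 graft ts uss)"
    using graft_Node[OF len] uss(1) by simp
  have 1: "\<forall>t \<in> set (map2 graft ts uss). t \<in> optrees K"
    using ih l by (auto simp: in_set_conv_nth)
  have 2: "map (tree_root K) (map2 graft ts uss) = gsrc K g"
    using Node.hyps(2) ih l by (auto simp: list_eq_iff_nth_eq)
  have "map leaves (map2 graft ts uss) = map (\<lambda>us. concat (map leaves us)) uss"
    using ih l by (auto simp: list_eq_iff_nth_eq)
  then have 3: "concat (map leaves (map2 graft ts uss)) = concat (map leaves us)"
    using uss(1) by (simp add: concat_map_concat)
  show ?case unfolding eq using optrees.Node[OF Node.hyps(1) 1 2] 3 by simp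
qed

lemma concat_concat: "concat (concat xsss) = concat (map concat xsss)"
  by (induction xsss) auto

lemma split_len:
  "length us = length (concat lss) \<Longrightarrow>
    \<exists>uss. us = concat uss \<and> map (map (\<lambda>_. ())) uss = map (map (\<lambda>_. ())) lss"
proof -
  assume "length us = length (concat lss)"
  then have "map (\<lambda>_. ()) us = map (\<lambda>_. ()) (concat lss)"
    by (simp add: map_replicate_const)
  then have "map (\<lambda>_. ()) us = concat (map (map (\<lambda>_. ())) lss)"
    by (simp add: map_concat)
  then show ?thesis by (rule map_eq_concatD)
qed

lemma graft_id: "graft t (map Leaf (leaves t)) = t"
proof (induction t)
  case (Node g ts)
  have "map Leaf (leaves (Node g ts)) = concat (map (\<lambda>t. map Leaf (leaves t)) ts)"
    by (simp add: map_concat comp_def)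
  moreover have "graft (Node g ts) (concat (map (\<lambda>t. map Leaf (leaves t)) ts)) =
      Node g (map2 graft ts (map (\<lambda>t. map Leaf (leaves t)) ts))"
    by (rule graft_Node) simp
  moreover have "map2 graft ts (map (\<lambda>t. map Leaf (leaves t)) ts) = ts"
    using Node by (auto simp: list_eq_iff_nth_eq)
  ultimately show ?case by metis
qed simp

lemma graft_corolla:
  "length ts = length (gsrc K g) \<Longrightarrow> graft (corolla K g) ts = Node g ts"
proof -
  assume "length ts = length (gsrc K g)"
  then have "map length (map (\<lambda>t. [t]) ts) = map (length \<circ> leaves) (map Leaf (gsrc K g) :: ('a, 'b) optree list)"
    by (auto simp: list_eq_iff_nth_eq)
  from graft_Node[OF this, of g] have "graft (corolla K g) ts =
      Node g (map2 graft (map Leaf (gsrc K g)) (map (\<lambda>t. [t]) ts))"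
    by (simp add: corolla_def)
  also have "map2 graft (map Leaf (gsrc K g)) (map (\<lambda>t. [t]) ts) = ts"
    using \<open>length ts = _\<close> by (auto simp: list_eq_iff_nth_eq)
  finally show ?thesis .
qed

lemma length_leaves_graft:
  "length us = length (leaves t) \<Longrightarrow> leaves (graft t us) = concat (map leaves us)"
proof (induction t arbitrary: us)
  case (Leaf c)
  then show ?case by (cases us) auto
next
  case (Node g ts)
  have "length us = length (concat (map leaves ts))"
    using Node.prems by simp
  from split_len[OF this] obtain uss where
    uss: "us = concat uss" "map (map (\<lambda>_. ())) uss = map (map (\<lambda>_. ())) (map leaves ts)" by blast
  have len: "map length uss = map (length \<circ> leaves) ts"
    using arg_cong[OF uss(2), of "map length"] by (simp add: comp_def)
  have l: "length uss = length ts" using arg_cong[OF len, of length] by simp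
  have "map leaves (map2 graft ts uss) = map (\<lambda>us. concat (map leaves us)) uss"
  proof (rule nth_equalityI, goal_cases)
    case (2 i)
    then have i: "i < length ts" using l by simp
    then have "length (uss ! i) = length (leaves (ts ! i))"
      using arg_cong[OF len, of "\<lambda>x. x ! i"] l by simp
    then show ?case using Node.IH[of "ts ! i" "uss ! i"] i l by simp
  qed (use l in simp)
  then show ?case using graft_Node[OF len, of g] uss(1) by (simp add: concat_map_concat)
qed

lemma graft_assoc:
  "length us = length (leaves t) \<Longrightarrow> map length vss = map (length \<circ> leaves) us \<Longrightarrow>
   graft (graft t us) (concat vss) = graft t (map2 graft us vss)"
proof (induction t arbitrary: us vss)
  case (Leaf c)
  then show ?case by (cases us; cases vss) auto
next
  case (Node g ts)
  have lv: "length vss = length us" using arg_cong[OF Node.prems(2), of length] by simp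
  have "length (zip us vss) = length (concat (map leaves ts))"
    using Node.prems lv by simp
  from split_len[OF this] obtain pss where
    pss: "zip us vss = concat pss" "map (map (\<lambda>_. ())) pss = map (map (\<lambda>_. ())) (map leaves ts)" by blast
  define uss where "uss = map (map fst) pss"
  define wss where "wss = map (map snd) pss"
  have us: "us = concat uss" using arg_cong[OF pss(1), of "map fst"] lv
    by (simp add: uss_def map_concat)
  have vs: "vss = concat wss" using arg_cong[OF pss(1), of "map snd"] lv
    by (simp add: wss_def map_concat)
  have lenp: "map length pss = map (length \<circ> leaves) ts"
    using arg_cong[OF pss(2), of "map length"] by (simp add: comp_def)
  have len: "map length uss = map (length \<circ> leaves) ts"
    using lenp by (simp add: uss_def comp_def)
  have l: "length pss = length ts" "length uss = length ts" "length wss = length ts"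
    using arg_cong[OF lenp, of length] by (simp_all add: uss_def wss_def)
  have li: "length (pss ! i) = length (leaves (ts ! i))" if "i < length ts" for i
    using arg_cong[OF lenp, of "\<lambda>x. x ! i"] l that by simp
  have zp: "zip (uss ! i) (wss ! i) = pss ! i" if "i < length ts" for i
    using that l by (simp add: uss_def wss_def zip_map_fst_snd)
  have sub: "(u, v) \<in> set (pss ! i) \<Longrightarrow> length v = length (leaves u)" if "i < length ts" for i u v
  proof -
    assume "(u, v) \<in> set (pss ! i)"
    then have "(u, v) \<in> set (zip us vss)" using pss(1) l that by auto
    then show ?thesis using Node.prems(2)
      by (metis (no_types, lifting) comp_apply in_set_zip nth_map lv fst_conv snd_conv)
  qed
  have m: "map length (wss ! i) = map (length \<circ> leaves) (uss ! i)" if "i < length ts" for i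
    using sub[OF that] l that by (auto simp: uss_def wss_def)
  have 1: "graft (Node g ts) us = Node g (map2 graft ts uss)"
    using graft_Node[OF len, of g] us by simp
  have lu: "length (uss ! i) = length (leaves (ts ! i))" if "i < length ts" for i
    using li[OF that] that l by (simp add: uss_def)
  have "map length (map concat wss) = map (length \<circ> leaves) (map2 graft ts uss)"
  proof (rule nth_equalityI, goal_cases)
    case (2 i)
    then have i: "i < length ts" using l by simp
    have "length (concat (wss ! i)) = length (concat (map leaves (uss ! i)))"
      using m[OF i] by (simp add: length_concat comp_def)
    then show ?case using i l length_leaves_graft[OF lu[OF i]] by simp
  qed (use l in simp)
  from graft_Node[OF this, of g] have 2: "graft (graft (Node g ts) us) (concat vss) =
     Node g (map2 graft (map2 graft ts uss) (map concat wss))"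
    using 1 vs by (simp add: concat_concat)
  have "map2 graft us vss = concat (map (map (\<lambda>(u, v). graft u v)) pss)"
    using pss(1) by (simp add: map_concat)
  moreover have "map length (map (map (\<lambda>(u, v). graft u v)) pss) = map (length \<circ> leaves) ts"
    using lenp by (simp add: comp_def)
  ultimately have 3: "graft (Node g ts) (map2 graft us vss) =
      Node g (map2 graft ts (map (map (\<lambda>(u, v). graft u v)) pss))"
    using graft_Node by metis
  have "map2 graft (map2 graft ts uss) (map concat wss) =
      map2 graft ts (map (map (\<lambda>(u, v). graft u v)) pss)"
  proof (rule nth_equalityI, goal_cases)
    case (2 i)
    then have i: "i < length ts" using l by simp
    then show ?case using l Node.IH[OF nth_mem[OF i] lu[OF i] m[OF i]] zp[OF i] by simp
  qed (use l in simp)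
  then show ?case using 2 3 by simp
qed

lemma composable_free:
  "composable (free_operad K) t us \<longleftrightarrow>
    t \<in> optrees K \<and> us \<in> lists (optrees K) \<and> map (tree_root K) us = leaves t"
  by (simp add: composable_def free_operad_def)

lemma operad_free_operad:
  assumes K: "coll_ok K"
  shows "operad (free_operad K)"
proof -
  have assoc: "graft (graft t us) (concat vss) = graft t (map2 graft us vss)"
    if "composable (free_operad K) t us" "list_all2 (composable (free_operad K)) us vss" for t us vss
  proof (rule graft_assoc)
    show "length us = length (leaves t)"
      using that(1) by (metis composable_free length_map)
    have "list_all2 (\<lambda>v u. length v = length (leaves u)) vss us"
      using that(2) unfolding list_all2_conv_all_nth
      by (metis composable_free length_map)
    then show "map length vss = map (length \<circ> leaves) us"
      by (simp add: list_all2_map_eqI)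
  qed
  note simps = op_set_def free_operad_def
  show ?thesis
    unfolding operad_def
  proof (intro conjI ballI allI impI, goal_cases)
    case (1 f) then show ?case using leaves_in by (simp add: simps) 
  next
    case (2 f) then show ?case using root_in[OF K] by (simp add: simps) 
  next
    case (3 c) then show ?case by (simp add: simps optrees.Leaf) 
  next
    case (4 f gs)
    then have "f \<in> optrees K" "gs \<in> lists (optrees K)" "map (tree_root K) gs = leaves f"
      by (simp_all add: composable_free)
    from graft_typed[OF this] show ?case by (simp add: simps)
  next
    case (5 f) then show ?case by (simp add: simps)
  next
    case (6 f) then show ?case by (simp add: simps graft_id)
  next
    case (7 f gs hss) then show ?case using assoc[of f gs hss] by (simp add: free_operad_def)
  qed
qed


subsection \<open>Quotients of operads\<close>

lemma operad_src: "operad P \<Longrightarrow> f \<in> Ops P \<Longrightarrow> src P f \<in> lists (Col P)"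
  and operad_tgt: "operad P \<Longrightarrow> f \<in> Ops P \<Longrightarrow> tgt P f \<in> Col P"
  and operad_id: "operad P \<Longrightarrow> c \<in> Col P \<Longrightarrow> idop P c \<in> op_set P [c] c"
  and operad_comp: "operad P \<Longrightarrow> composable P f gs \<Longrightarrow>
       ocomp P f gs \<in> op_set P (concat (map (src P) gs)) (tgt P f)"
  and operad_unit_left: "operad P \<Longrightarrow> f \<in> Ops P \<Longrightarrow> ocomp P (idop P (tgt P f)) [f] = f"
  and operad_unit_right: "operad P \<Longrightarrow> f \<in> Ops P \<Longrightarrow> ocomp P f (map (idop P) (src P f)) = f"
  and operad_assoc: "operad P \<Longrightarrow> composable P f gs \<Longrightarrow> list_all2 (composable P) gs hss \<Longrightarrow>
       ocomp P (ocomp P f gs) (concat hss) = ocomp P f (map2 (ocomp P) gs hss)"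
  unfolding operad_def by blast+

definition assignment where
  "assignment K P F h \<longleftrightarrow> (\<forall>c \<in> gCol K. F c \<in> Col P) \<and>
     (\<forall>g \<in> gens K. h g \<in> op_set P (map F (gsrc K g)) (F (gtgt K g)))"

lemma eval_typed:
  assumes P: "operad P" and a: "assignment K P F h"
  shows "t \<in> optrees K \<Longrightarrow> eval_tree P F h t \<in> op_set P (map F (leaves t)) (F (tree_root K t))"
proof (induction rule: optrees.induct)
  case (Leaf c)
  then show ?case using a operad_id[OF P] by (simp add: assignment_def)
next
  case (Node g ts)
  have h: "h g \<in> op_set P (map F (gsrc K g)) (F (gtgt K g))"
    using a Node.hyps(1) by (simp add: assignment_def)
  have e: "eval_tree P F h t \<in> op_set P (map F (leaves t)) (F (tree_root K t))" if "t \<in> set ts" for t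
    using Node.IH that by blast
  have "map (tgt P) (map (eval_tree P F h) ts) = map F (map (tree_root K) ts)"
    using e by (simp add: op_set_def)
  then have c: "composable P (h g) (map (eval_tree P F h) ts)"
    using h e Node.hyps(2) by (auto simp: composable_def op_set_def in_lists_conv_set)
  have "map (src P) (map (eval_tree P F h) ts) = map (map F) (map leaves ts)"
    using e by (simp add: op_set_def)
  then have "concat (map (src P) (map (eval_tree P F h) ts)) = map F (concat (map leaves ts))"
    by (simp only: map_concat)
  then show ?case using operad_comp[OF P c] h by (simp add: op_set_def)
qed

lemma eval_graft:
  assumes P: "operad P" and a: "assignment K P F h"
  shows "t \<in> optrees K \<Longrightarrow> us \<in> lists (optrees K) \<Longrightarrow> map (tree_root K) us = leaves t \<Longrightarrow>
    eval_tree P F h (graft t us) = ocomp P (eval_tree P F h t) (map (eval_tree P F h) us)"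
proof (induction t arbitrary: us rule: optrees.induct)
  case (Leaf c)
  then obtain u where u: "us = [u]" "u \<in> optrees K" "tree_root K u = c"
    by (auto simp: map_eq_Cons_conv)
  from operad_unit_left[OF P, of "eval_tree P F h u"] eval_typed[OF P a u(2)] u show ?case
    by (simp add: op_set_def)
next
  case (Node g ts)
  let ?e = "eval_tree P F h"
  from Node.prems(2) have "map (tree_root K) us = concat (map leaves ts)" by simp
  from map_eq_concatD[OF this] obtain uss where
    uss: "us = concat uss" "map (map (tree_root K)) uss = map leaves ts" by blast
  have len: "map length uss = map (length \<circ> leaves) ts"
    using arg_cong[OF uss(2), of "map length"] by (simp add: comp_def)
  have l: "length uss = length ts" using arg_cong[OF uss(2), of length] by simp
  have mem: "uss ! i \<in> lists (optrees K)" if "i < length ts" for i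
    using Node.prems(1) uss(1) l that by (force simp: in_set_conv_nth)
  have rt: "map (tree_root K) (uss ! i) = leaves (ts ! i)" if "i < length ts" for i
    using arg_cong[OF uss(2), of "\<lambda>x. x ! i"] l that by simp
  have tm: "ts ! i \<in> optrees K" if "i < length ts" for i
    using Node.IH that by simp
  have h: "h g \<in> op_set P (map F (gsrc K g)) (F (gtgt K g))"
    using a Node.hyps(1) by (simp add: assignment_def)
  have e: "?e t \<in> op_set P (map F (leaves t)) (F (tree_root K t))" if "t \<in> set ts" for t
    using Node.IH that eval_typed[OF P a] by blast
  have "map (tgt P) (map ?e ts) = map F (map (tree_root K) ts)"
    using e by (simp add: op_set_def)
  then have c: "composable P (h g) (map ?e ts)"
    using h e Node.hyps(2) by (auto simp: composable_def op_set_def in_lists_conv_set)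
  have c2: "list_all2 (composable P) (map ?e ts) (map (map ?e) uss)"
    unfolding list_all2_conv_all_nth
  proof (intro conjI allI impI)
    fix i assume "i < length (map ?e ts)"
    then have i: "i < length ts" by simp
    have "map (tgt P \<circ> ?e) (uss ! i) = map (F \<circ> tree_root K) (uss ! i)"
      using mem[OF i] eval_typed[OF P a] by (auto simp: op_set_def)
    also have "\<dots> = map F (leaves (ts ! i))" using rt[OF i] by (metis map_map)
    also have "\<dots> = src P (?e (ts ! i))" using eval_typed[OF P a tm[OF i]] by (simp add: op_set_def)
    finally show "composable P (map ?e ts ! i) (map (map ?e) uss ! i)"
      using i l mem[OF i] tm[OF i] eval_typed[OF P a] by (auto simp: composable_def op_set_def)
  qed (simp add: l)
  have "?e (graft (Node g ts) us) = ocomp P (h g) (map ?e (map2 graft ts uss))"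
    using graft_Node[OF len, of g] uss(1) by simp
  also have "map ?e (map2 graft ts uss) = map2 (ocomp P) (map ?e ts) (map (map ?e) uss)"
    using Node.IH mem rt l by (auto simp: list_eq_iff_nth_eq)
  also have "ocomp P (h g) \<dots> = ocomp P (ocomp P (h g) (map ?e ts)) (concat (map (map ?e) uss))"
    using operad_assoc[OF P c c2] by simp
  finally show ?case using uss(1) by (simp add: map_concat)
qed

lemma free_simps [simp]:
  "Col (free_operad K) = gCol K" "Ops (free_operad K) = optrees K" "src (free_operad K) = leaves"
  "tgt (free_operad K) = tree_root K" "idop (free_operad K) = Leaf" "ocomp (free_operad K) = graft"
  by (simp_all add: free_operad_def)

lemma operad_map_eval:
  assumes P: "operad P" and a: "assignment K P F h"
  shows "operad_map (free_operad K) P F (eval_tree P F h)"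
  unfolding operad_map_def
  using a eval_typed[OF P a] eval_graft[OF P a]
  by (auto simp: assignment_def composable_free)

lemma operad_map_cong:
  assumes P: "operad P" and m: "operad_map P Q F G"
    and "\<And>c. c \<in> Col P \<Longrightarrow> F' c = F c" "\<And>f. f \<in> Ops P \<Longrightarrow> G' f = G f"
  shows "operad_map P Q F' G'"
  unfolding operad_map_def
proof (intro conjI ballI allI impI, goal_cases)
  case (1 c) then show ?case using assms by (simp add: operad_map_def)
next
  case (2 f)
  have "map F' (src P f) = map F (src P f)" using operad_src[OF P 2] assms(3) by auto
  moreover have "G f \<in> op_set Q (map F (src P f)) (F (tgt P f))" using m 2 by (simp add: operad_map_def)
  ultimately show ?case using 2 assms(3,4) operad_tgt[OF P 2] by metis
next
  case (3 c) then show ?case using assms operad_id[OF P 3] by (simp add: operad_map_def op_set_def)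
next
  case (4 f gs)
  then have "f \<in> Ops P" "gs \<in> lists (Ops P)" by (auto simp: composable_def)
  moreover from this have "map G' gs = map G gs" using assms(4) by auto
  ultimately have "G' (ocomp P f gs) = G (ocomp P f gs)" "G' f = G f" "map G' gs = map G gs"
    using assms(4) operad_comp[OF P 4] by (auto simp: op_set_def)
  moreover have "G (ocomp P f gs) = ocomp Q (G f) (map G gs)" using 4 m by (simp add: operad_map_def)
  ultimately show ?case by metis
qed

lemma free_extension_Hom:
  assumes K: "coll_ok K" and P: "operad P" and a: "assignment K P F h"
  shows "free_extension K P F h \<in> operad_Hom (free_operad K) P"
  unfolding free_extension_def operad_Hom_def
  using operad_map_cong[OF operad_free_operad[OF K] operad_map_eval[OF P a]] by auto

lemma corolla_in: "coll_ok K \<Longrightarrow> g \<in> gens K \<Longrightarrow> corolla K g \<in> optrees K"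
  unfolding corolla_def coll_ok_def
  by (rule optrees.Node) (auto intro: optrees.Leaf simp: in_lists_conv_set comp_def)

lemma corolla_simps [simp]: "leaves (corolla K g) = gsrc K g" "tree_root K (corolla K g) = gtgt K g"
  by (simp_all add: corolla_def comp_def)

lemma operad_map_eq_eval:
  assumes K: "coll_ok K" and m: "operad_map (free_operad K) P F G"
  shows "t \<in> optrees K \<Longrightarrow> G t = eval_tree P F (\<lambda>g. G (corolla K g)) t"
proof (induction rule: optrees.induct)
  case (Leaf c)
  then show ?case using m by (simp add: operad_map_def)
next
  case (Node g ts)
  have l: "length ts = length (gsrc K g)" using Node.hyps(2) by (metis length_map)
  have "composable (free_operad K) (corolla K g) ts"
    using Node corolla_in[OF K] by (auto simp: composable_free in_lists_conv_set)
  then have "G (graft (corolla K g) ts) = ocomp P (G (corolla K g)) (map G ts)"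
    using m by (simp add: operad_map_def)
  moreover have "map G ts = map (eval_tree P F (\<lambda>g. G (corolla K g))) ts"
    using Node.IH by auto
  ultimately show ?case using graft_corolla[OF l] by simp
qed

lemma free_Hom_eqI:
  assumes K: "coll_ok K"
    and x: "x \<in> operad_Hom (free_operad K) P" and y: "y \<in> operad_Hom (free_operad K) P"
    and c: "\<And>c. c \<in> gCol K \<Longrightarrow> fst x c = fst y c"
    and g: "\<And>g. g \<in> gens K \<Longrightarrow> snd x (corolla K g) = snd y (corolla K g)"
  shows "x = y"
proof -
  have mx: "operad_map (free_operad K) P (fst x) (snd x)"
    and my: "operad_map (free_operad K) P (fst y) (snd y)"
    using x y by (auto simp: operad_Hom_def)
  have e: "eval_tree P (fst x) (\<lambda>g. snd x (corolla K g)) t =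
      eval_tree P (fst y) (\<lambda>g. snd y (corolla K g)) t" if "t \<in> optrees K" for t
    using that
  proof (induction rule: optrees.induct)
    case (Node a ts)
    then have "map (eval_tree P (fst x) (\<lambda>g. snd x (corolla K g))) ts =
      map (eval_tree P (fst y) (\<lambda>g. snd y (corolla K g))) ts" by auto
    then show ?case using g[OF Node.hyps(1)] unfolding eval_tree.simps by metis
  qed (use c in simp)
  have "fst x = fst y"
    by (rule extensionalityI[of _ "gCol K"]) (use x y c in \<open>auto simp: operad_Hom_def\<close>)
  moreover have "snd x = snd y"
    by (rule extensionalityI[of _ "optrees K"])
      (use x y e operad_map_eq_eval[OF K mx] operad_map_eq_eval[OF K my] in \<open>auto simp: operad_Hom_def\<close>)
  ultimately show ?thesis by (simp add: prod_eq_iff)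
qed

lemma eval_corolla:
  assumes P: "operad P" and a: "assignment K P F h" and g: "g \<in> gens K"
  shows "eval_tree P F h (corolla K g) = h g"
proof -
  have "h g \<in> op_set P (map F (gsrc K g)) (F (gtgt K g))" using a g by (simp add: assignment_def)
  then show ?thesis using operad_unit_right[OF P, of "h g"]
    by (simp add: corolla_def op_set_def comp_def)
qed

definition parallel where
  "parallel P R \<longleftrightarrow> (\<forall>(f, g) \<in> R. f \<in> Ops P \<and> g \<in> Ops P \<and> src P f = src P g \<and> tgt P f = tgt P g)"

lemma cong_parallel:
  assumes P: "operad P" and R: "parallel P R"
  shows "operad_cong P R f g \<Longrightarrow> f \<in> Ops P \<and> g \<in> Ops P \<and> src P f = src P g \<and> tgt P f = tgt P g"
proof (induction rule: operad_cong.induct)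
  case (base f g) then show ?case using R by (auto simp: parallel_def)
next
  case (ocomp f f' gs gs')
  have "list_all2 (\<lambda>x y. x \<in> Ops P \<and> y \<in> Ops P \<and> src P x = src P y \<and> tgt P x = tgt P y) gs gs'"
    using ocomp.IH(2) by (rule list_all2_mono) auto
  then have gs: "gs \<in> lists (Ops P)" "gs' \<in> lists (Ops P)" "map (src P) gs = map (src P) gs'"
      "map (tgt P) gs = map (tgt P) gs'"
    by (auto simp: list_all2_conv_all_nth in_set_conv_nth list_eq_iff_nth_eq in_lists_conv_set)
  then have "composable P f gs" "composable P f' gs'"
    using ocomp by (auto simp: composable_def)
  then show ?case using operad_comp[OF P] gs ocomp by (auto simp: op_set_def)
qed auto

lemma op_class_eq_iff:
  "f \<in> Ops P \<Longrightarrow> g \<in> Ops P \<Longrightarrow> op_class P R f = op_class P R g \<longleftrightarrow> operad_cong P R f g"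
  unfolding op_class_def
  by (auto intro: operad_cong.intros)

lemma op_class_eq: "operad_cong P R f g \<Longrightarrow> op_class P R f = op_class P R g"
  unfolding op_class_def by (auto intro: operad_cong.sym operad_cong.trans)

lemma rep_cong: "f \<in> Ops P \<Longrightarrow> operad_cong P R f (rep (op_class P R f))"
  unfolding rep_def by (rule someI2[of _ f]) (auto simp: op_class_def intro: operad_cong.refl)

lemma quot_simps [simp]:
  "Col (operad_quotient P R) = Col P" "Ops (operad_quotient P R) = op_class P R ` Ops P"
  "idop (operad_quotient P R) c = op_class P R (idop P c)"
  by (simp_all add: operad_quotient_def)

context
  fixes P :: "('c, 'o) operad" and R
  assumes P: "operad P" and R: "parallel P R"
begin

lemma quot_src: "f \<in> Ops P \<Longrightarrow> src (operad_quotient P R) (op_class P R f) = src P f"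
  and quot_tgt: "f \<in> Ops P \<Longrightarrow> tgt (operad_quotient P R) (op_class P R f) = tgt P f"
  using cong_parallel[OF P R rep_cong[of f P R]] by (simp_all add: operad_quotient_def)

lemma quot_comp:
  assumes "composable P f gs"
  shows "ocomp (operad_quotient P R) (op_class P R f) (map (op_class P R) gs) =
    op_class P R (ocomp P f gs)"
proof -
  have "operad_cong P R (ocomp P f gs) (ocomp P (rep (op_class P R f)) (map (rep \<circ> op_class P R) gs))"
    using assms by (intro operad_cong.ocomp)
      (auto simp: composable_def list_all2_conv_all_nth in_lists_conv_set intro!: rep_cong)
  from op_class_eq[OF this] show ?thesis by (simp add: operad_quotient_def)
qed

lemma quot_composableD:
  assumes "composable (operad_quotient P R) F Gs"
  obtains f gs where "F = op_class P R f" "Gs = map (op_class P R) gs" "composable P f gs"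
proof -
  from assms obtain f where f: "F = op_class P R f" "f \<in> Ops P" by (auto simp: composable_def)
  from assms have "Gs \<in> lists (op_class P R ` Ops P)" by (simp add: composable_def)
  then obtain gs where gs: "Gs = map (op_class P R) gs" "gs \<in> lists (Ops P)"
    by (auto simp: lists_image)
  have "map (tgt P) gs = map (tgt (operad_quotient P R)) Gs" using gs quot_tgt by auto
  then have "map (tgt P) gs = src P f" using assms f quot_src by (simp add: composable_def)
  then show thesis using that f gs by (auto simp: composable_def)
qed

lemma quot_map: "operad_map P (operad_quotient P R) (\<lambda>c. c) (op_class P R)"
  unfolding operad_map_def
  using quot_comp quot_src quot_tgt by (auto simp: op_set_def)

lemma operad_quotient: "operad (operad_quotient P R)"
  unfolding operad_def
proof (intro conjI ballI allI impI, goal_cases)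
  case (1 f) then show ?case using quot_src operad_src[OF P] by (auto simp: in_lists_conv_set)
next
  case (2 f) then show ?case using quot_tgt operad_tgt[OF P] by auto
next
  case (3 c) then show ?case using quot_src quot_tgt operad_id[OF P, of c] by (auto simp: op_set_def)
next
  case (4 F Gs)
  then obtain f gs where fg: "F = op_class P R f" "Gs = map (op_class P R) gs" "composable P f gs"
    by (rule quot_composableD)
  have qc: "ocomp (operad_quotient P R) F Gs = op_class P R (ocomp P f gs)"
    using quot_comp fg by simp
  have "map (src (operad_quotient P R)) Gs = map (src P) gs"
    using fg quot_src by (auto simp: composable_def)
  moreover have "f \<in> Ops P" using fg(3) by (simp add: composable_def)
  ultimately show ?case unfolding qc using fg(1) operad_comp[OF P fg(3)] quot_src quot_tgt
    by (simp add: op_set_def)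
next
  case (5 F)
  then obtain f where f: "F = op_class P R f" "f \<in> Ops P" by auto
  have "composable P (idop P (tgt P f)) [f]"
    using f operad_id[OF P operad_tgt[OF P f(2)]] by (simp add: composable_def op_set_def)
  from quot_comp[OF this] show ?case using f quot_tgt operad_unit_left[OF P] by simp
next
  case (6 F)
  then obtain f where f: "F = op_class P R f" "f \<in> Ops P" by auto
  have "composable P f (map (idop P) (src P f))"
    using f operad_id[OF P] operad_src[OF P f(2)]
    by (auto simp: composable_def op_set_def in_lists_conv_set intro!: map_idI)
  from quot_comp[OF this] show ?case using f quot_src operad_unit_right[OF P] by (simp add: comp_def quot_simps(3)[abs_def])
next
  case (7 F Gs Hss)
  then obtain f gs where fg: "F = op_class P R f" "Gs = map (op_class P R) gs" "composable P f gs"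
    by (meson quot_composableD)
  have gi: "gs ! i \<in> Ops P" if "i < length gs" for i using fg(3) that by (auto simp: composable_def)
  have "\<exists>hs. Hss ! i = map (op_class P R) hs \<and> composable P (gs ! i) hs" if "i < length gs" for i
  proof -
    have "composable (operad_quotient P R) (op_class P R (gs ! i)) (Hss ! i)"
      using 7 fg(2) that by (auto simp: list_all2_conv_all_nth)
    then have c: "Hss ! i \<in> lists (op_class P R ` Ops P)"
       "map (tgt (operad_quotient P R)) (Hss ! i) = src P (gs ! i)"
      using quot_src[OF gi[OF that]] by (auto simp: composable_def)
    then obtain hs where hs: "Hss ! i = map (op_class P R) hs" "hs \<in> lists (Ops P)"
      by (auto simp: lists_image)
    have "map (tgt P) hs = map (tgt (operad_quotient P R)) (Hss ! i)" using hs quot_tgt by auto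
    then have "map (tgt P) hs = src P (gs ! i)" using c(2) by metis
    then have "composable P (gs ! i) hs" using hs(2) gi[OF that] by (simp add: composable_def)
    then show ?thesis using hs by blast
  qed
  then obtain hf where hf: "\<And>i. i < length gs \<Longrightarrow> Hss ! i = map (op_class P R) (hf i) \<and> composable P (gs ! i) (hf i)"
    by metis
  define hss where "hss = map hf [0..<length gs]"
  have l: "length Hss = length gs" using 7 fg(2) by (auto simp: list_all2_conv_all_nth)
  have H: "Hss = map (map (op_class P R)) hss" using hf l by (intro nth_equalityI) (simp_all add: hss_def)
  have c: "list_all2 (composable P) gs hss" using hf by (auto simp: hss_def list_all2_conv_all_nth)
  have c1: "composable P (ocomp P f gs) (concat hss)"
  proof -
    have "map (map (tgt P)) hss = map (src P) gs"
      using c by (intro nth_equalityI) (simp_all add: list_all2_conv_all_nth composable_def)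
    then have "map (tgt P) (concat hss) = concat (map (src P) gs)" by (simp add: map_concat)
    moreover have "concat hss \<in> lists (Ops P)"
    proof -
      have "hs \<in> lists (Ops P)" if "hs \<in> set hss" for hs
      proof -
        from that obtain i where "i < length hss" "hs = hss ! i" by (metis in_set_conv_nth)
        then show ?thesis using c by (auto simp: list_all2_conv_all_nth composable_def)
      qed
      then show ?thesis by (fastforce simp: in_lists_conv_set)
    qed
    ultimately show ?thesis using operad_comp[OF P fg(3)] by (simp add: composable_def op_set_def)
  qed
  have lh: "length hss = length gs" using c by (simp add: list_all2_conv_all_nth)
  have oi: "ocomp P (gs ! i) (hss ! i) \<in> Ops P \<and> tgt P (ocomp P (gs ! i) (hss ! i)) = tgt P (gs ! i)"
    if "i < length gs" for i
  proof -
    have "composable P (gs ! i) (hss ! i)" using c that by (simp add: list_all2_conv_all_nth)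
    from operad_comp[OF P this] show ?thesis by (simp add: op_set_def)
  qed
  have c2: "composable P f (map2 (ocomp P) gs hss)"
  proof -
    have "map (tgt P) (map2 (ocomp P) gs hss) = map (tgt P) gs"
      using oi lh by (intro nth_equalityI) simp_all
    moreover have "map2 (ocomp P) gs hss \<in> lists (Ops P)"
      unfolding in_lists_conv_set
    proof
      fix x assume "x \<in> set (map2 (ocomp P) gs hss)"
      then obtain i where "i < length gs" "x = ocomp P (gs ! i) (hss ! i)"
        using lh by (auto simp: set_zip)
      then show "x \<in> Ops P" using oi by simp
    qed
    ultimately show ?thesis using fg(3) by (simp add: composable_def)
  qed
  have "ocomp (operad_quotient P R) (ocomp (operad_quotient P R) F Gs) (concat Hss) =
      op_class P R (ocomp P (ocomp P f gs) (concat hss))"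
    using quot_comp[OF fg(3)] quot_comp[OF c1] fg H by (simp add: map_concat)
  also have "\<dots> = op_class P R (ocomp P f (map2 (ocomp P) gs hss))"
    using operad_assoc[OF P fg(3) c] by simp
  also have "\<dots> = ocomp (operad_quotient P R) F (map (op_class P R) (map2 (ocomp P) gs hss))"
    using quot_comp[OF c2] fg by simp
  also have "map (op_class P R) (map2 (ocomp P) gs hss) = map2 (ocomp (operad_quotient P R)) Gs Hss"
  proof (rule nth_equalityI, goal_cases)
    case (2 i)
    then have i: "i < length gs" using lh by simp
    have "composable P (gs ! i) (hss ! i)" using c i by (simp add: list_all2_conv_all_nth)
    from quot_comp[OF this] show ?case using i lh fg H by simp
  qed (use lh fg H in simp)
  finally show ?case .
qed

lemma cong_descend:
  assumes Q: "operad_map P Q F G" and r: "\<And>f g. (f, g) \<in> R \<Longrightarrow> G f = G g"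
  shows "operad_cong P R f g \<Longrightarrow> G f = G g"
proof (induction rule: operad_cong.induct)
  case (ocomp f f' gs gs')
  have "list_all2 (\<lambda>x y. operad_cong P R x y \<and> G x = G y) gs gs'"
    using ocomp.IH(2) by (rule list_all2_mono) auto
  then have m: "map G gs = map G gs'" by (auto simp: list_all2_conv_all_nth list_eq_iff_nth_eq)
  have "list_all2 (\<lambda>x y. x \<in> Ops P \<and> y \<in> Ops P \<and> src P x = src P y \<and> tgt P x = tgt P y) gs gs'"
    using ocomp.IH(2) by (rule list_all2_mono) (use cong_parallel[OF P R] in auto)
  then have gs: "gs \<in> lists (Ops P)" "gs' \<in> lists (Ops P)" "map (tgt P) gs = map (tgt P) gs'"
    by (auto simp: list_all2_conv_all_nth in_set_conv_nth list_eq_iff_nth_eq in_lists_conv_set)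
  have "composable P f gs" "composable P f' gs'"
    using cong_parallel[OF P R ocomp.hyps(1)] gs ocomp.hyps(2) by (auto simp: composable_def)
  then show ?case using Q m ocomp by (simp add: operad_map_def)
qed (use r in auto)

end


subsection \<open>Chains\<close>

definition cnt :: "(nat \<Rightarrow> nat) \<Rightarrow> nat \<Rightarrow> nat \<Rightarrow> nat" where
  "cnt f A c = card {b. b < A \<and> f b < c}"

lemma cnt_iff:
  assumes m: "mono_on {..<A} f" and p: "p < A"
  shows "f p < c \<longleftrightarrow> p < cnt f A c"
proof
  assume "f p < c"
  then have "{..p} \<subseteq> {b. b < A \<and> f b < c}"
    using p m by (auto simp: mono_on_def intro: le_less_trans)
  from card_mono[OF _ this] show "p < cnt f A c" by (simp add: cnt_def)
next
  assume "p < cnt f A c"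
  show "f p < c"
  proof (rule ccontr)
    assume "\<not> f p < c"
    then have "{b. b < A \<and> f b < c} \<subseteq> {..<p}"
      using p m by (auto simp: mono_on_def) (metis le_trans lessThan_iff not_less)
    from card_mono[OF _ this] show False using \<open>p < cnt f A c\<close> by (simp add: cnt_def)
  qed
qed

lemma sorted_filter_upt [simp]: "sorted (filter P [a..<b::nat])"
  by (rule sorted_wrt_filter) simp

lemma cnt_le: "cnt f A c \<le> A"
  using card_mono[of "{..<A}" "{b. b < A \<and> f b < c}"] by (auto simp: cnt_def)

lemma filter_eq_cnt:
  assumes m: "mono_on {..<A} f"
  shows "filter (\<lambda>b. f b = c) [0..<A] = [cnt f A c..<cnt f A (Suc c)]"
proof (rule sorted_distinct_set_unique)
  show "set (filter (\<lambda>b. f b = c) [0..<A]) = set [cnt f A c..<cnt f A (Suc c)]"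
  proof (intro set_eqI)
    fix x
    have "x < A \<and> f x = c \<longleftrightarrow> x < A \<and> \<not> f x < c \<and> f x < Suc c" by auto
    also have "\<dots> \<longleftrightarrow> x < A \<and> \<not> x < cnt f A c \<and> x < cnt f A (Suc c)"
      using cnt_iff[OF m] by blast
    also have "\<dots> \<longleftrightarrow> cnt f A c \<le> x \<and> x < cnt f A (Suc c)"
      using cnt_le[of f A "Suc c"] by auto
    finally show "x \<in> set (filter (\<lambda>b. f b = c) [0..<A]) \<longleftrightarrow> x \<in> set [cnt f A c..<cnt f A (Suc c)]"
      by auto
  qed
qed auto

primrec block_index :: "nat list \<Rightarrow> nat \<Rightarrow> nat" where
  "block_index [] p = 0"
| "block_index (l # ls) p = (if p < l then 0 else Suc (block_index ls (p - l)))"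

lemma block_index_less: "c \<le> length ls \<Longrightarrow> block_index ls p < c \<longleftrightarrow> p < sum_list (take c ls)"
proof (induction ls arbitrary: p c)
  case (Cons l ls)
  then show ?case by (cases c) auto
qed simp

lemma block_index_mono: "p \<le> q \<Longrightarrow> block_index ls p \<le> block_index ls q"
  by (induction ls arbitrary: p q) auto

lemma sum_list_take_le: "sum_list (take c ls) \<le> sum_list (ls :: nat list)"
  by (metis append_take_drop_id le_add1 sum_list_append)

lemma cnt_block_index: "c \<le> length ls \<Longrightarrow> cnt (block_index ls) (sum_list ls) c = sum_list (take c ls)"
proof -
  assume "c \<le> length ls"
  then have "{b. b < sum_list ls \<and> block_index ls b < c} = {..<sum_list (take c ls)}"
    using block_index_less[OF \<open>c \<le> length ls\<close>] order.strict_trans2[OF _ sum_list_take_le[of c ls]] by blast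
  then show ?thesis by (simp add: cnt_def)
qed

lemma cnt_cong: "(\<And>b. b < A \<Longrightarrow> f b = g b) \<Longrightarrow> cnt f A c = cnt g A c"
  unfolding cnt_def by (rule arg_cong[of _ _ card]) auto

lemma lev_mk_chain [simp]: "i \<le> n \<Longrightarrow> lev (mk_chain n A f) i = A i"
  and lmap_mk_chain [simp]: "i \<le> j \<Longrightarrow> j \<le> n \<Longrightarrow> b < A i \<Longrightarrow> lmap (mk_chain n A f) i j b = f i j b"
  by (simp_all add: mk_chain_def)

lemma mk_chain_cong:
  "(\<And>i. i \<le> n \<Longrightarrow> A i = A' i) \<Longrightarrow>
   (\<And>i j b. i \<le> j \<Longrightarrow> j \<le> n \<Longrightarrow> b < A i \<Longrightarrow> f i j b = f' i j b) \<Longrightarrow>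
   mk_chain n A f = mk_chain n A' f'"
  unfolding mk_chain_def by (auto intro!: ext simp: restrict_def)

lemma mk_chain_idem: "mk_chain n (lev (mk_chain n A f)) (lmap (mk_chain n A f)) = mk_chain n A f"
  by (rule mk_chain_cong) auto

lemma mk_chain_in:
  assumes "\<And>i j b. i \<le> j \<Longrightarrow> j \<le> n \<Longrightarrow> b < A i \<Longrightarrow> f i j b < A j"
    and "\<And>i j b c. i \<le> j \<Longrightarrow> j \<le> n \<Longrightarrow> b \<le> c \<Longrightarrow> c < A i \<Longrightarrow> f i j b \<le> f i j c"
    and "\<And>i b. i \<le> n \<Longrightarrow> b < A i \<Longrightarrow> f i i b = b"
    and "\<And>i j l b. i \<le> j \<Longrightarrow> j \<le> l \<Longrightarrow> l \<le> n \<Longrightarrow> b < A i \<Longrightarrow> f i l b = f j l (f i j b)"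
  shows "mk_chain n A f \<in> chains n"
  unfolding chains_def mem_Collect_eq mk_chain_idem
proof (intro conjI allI impI, goal_cases)
  case 1 show ?case ..
next
  case (2 i j)
  then have "mono_on {..<A i} (restrict (f i j) {..<A i})"
    using assms(2)[of i j] by (auto simp: mono_on_def)
  then show ?case using 2 assms(1)[of i j] by (auto simp: mk_chain_def ord_maps_def)
next
  case (3 i x) then show ?case using assms(3) by simp
next
  case (4 i j l x)
  then show ?case using assms(4)[of i j l x] assms(1)[of i j x] by simp
qed

lemma chain_eqI:
  assumes "\<alpha> \<in> chains n" "\<beta> \<in> chains n"
    and "\<And>i. i \<le> n \<Longrightarrow> lev \<alpha> i = lev \<beta> i"
    and "\<And>i j b. i \<le> j \<Longrightarrow> j \<le> n \<Longrightarrow> b < lev \<alpha> i \<Longrightarrow> lmap \<alpha> i j b = lmap \<beta> i j b"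
  shows "\<alpha> = \<beta>"
proof -
  have "\<alpha> = mk_chain n (lev \<alpha>) (lmap \<alpha>)" "\<beta> = mk_chain n (lev \<beta>) (lmap \<beta>)"
    using assms by (auto simp: chains_def)
  moreover have "mk_chain n (lev \<alpha>) (lmap \<alpha>) = mk_chain n (lev \<beta>) (lmap \<beta>)"
    by (rule mk_chain_cong) (use assms in auto)
  ultimately show ?thesis by simp
qed

context
  fixes n \<alpha> assumes \<alpha>: "\<alpha> \<in> chains n"
begin

lemma chain_lt: "i \<le> j \<Longrightarrow> j \<le> n \<Longrightarrow> b < lev \<alpha> i \<Longrightarrow> lmap \<alpha> i j b < lev \<alpha> j"
proof -
  assume "i \<le> j" "j \<le> n" and b: "b < lev \<alpha> i"
  then have "lmap \<alpha> i j \<in> ord_maps (lev \<alpha> i) (lev \<alpha> j)" using \<alpha> unfolding chains_def by blast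
  then show ?thesis using b by (auto simp: ord_maps_def)
qed

lemma chain_mono: "i \<le> j \<Longrightarrow> j \<le> n \<Longrightarrow> mono_on {..<lev \<alpha> i} (lmap \<alpha> i j)"
  using \<alpha> unfolding chains_def ord_maps_def by blast

lemma chain_id: "i \<le> n \<Longrightarrow> b < lev \<alpha> i \<Longrightarrow> lmap \<alpha> i i b = b"
  using \<alpha> unfolding chains_def mem_Collect_eq by blast

lemma chain_comp: "i \<le> j \<Longrightarrow> j \<le> l \<Longrightarrow> l \<le> n \<Longrightarrow> b < lev \<alpha> i \<Longrightarrow>
    lmap \<alpha> j l (lmap \<alpha> i j b) = lmap \<alpha> i l b"
proof -
  assume "i \<le> j" "j \<le> l" "l \<le> n" "b < lev \<alpha> i"
  then have "lmap \<alpha> i l b = lmap \<alpha> j l (lmap \<alpha> i j b)"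
    using \<alpha> unfolding chains_def mem_Collect_eq by blast
  then show ?thesis by simp
qed

lemma fibre_eq: "i \<le> j \<Longrightarrow> j \<le> n \<Longrightarrow>
    fibre \<alpha> i j a = [cnt (lmap \<alpha> i j) (lev \<alpha> i) a..<cnt (lmap \<alpha> i j) (lev \<alpha> i) (Suc a)]"
  unfolding fibre_def by (rule filter_eq_cnt[OF chain_mono])

lemma fibre_id: "i \<le> n \<Longrightarrow> a < lev \<alpha> i \<Longrightarrow> fibre \<alpha> i i a = [a]"
  unfolding fibre_def
  by (rule sorted_distinct_set_unique) (auto simp: chain_id)

lemma set_fibre: "set (fibre \<alpha> i j a) = {b. b < lev \<alpha> i \<and> lmap \<alpha> i j b = a}"
  by (auto simp: fibre_def)

lemma offset_iff: "i \<le> n \<Longrightarrow> b < lev \<alpha> i \<Longrightarrow> lmap \<alpha> i n b < a \<longleftrightarrow> b < offset \<alpha> n a i"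
  using cnt_iff[OF chain_mono, of i n b a] by (simp add: offset_def cnt_def)

lemma offset_fibre: "i \<le> n \<Longrightarrow> fibre \<alpha> i n a = [offset \<alpha> n a i..<offset \<alpha> n a i + length (fibre \<alpha> i n a)]"
proof -
  assume i: "i \<le> n"
  have "cnt (lmap \<alpha> i n) (lev \<alpha> i) a \<le> cnt (lmap \<alpha> i n) (lev \<alpha> i) (Suc a)"
    unfolding cnt_def by (rule card_mono) auto
  then show ?thesis using fibre_eq[OF i order.refl, of a] by (simp add: offset_def cnt_def)
qed

lemma offset_mem: "i \<le> n \<Longrightarrow> b < length (fibre \<alpha> i n a) \<Longrightarrow>
    offset \<alpha> n a i + b < lev \<alpha> i \<and> lmap \<alpha> i n (offset \<alpha> n a i + b) = a"
proof -
  assume "i \<le> n" "b < length (fibre \<alpha> i n a)"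
  then have "offset \<alpha> n a i + b \<in> set (fibre \<alpha> i n a)" using offset_fibre[of i a]
    by (metis atLeastLessThan_iff le_add1 nat_add_left_cancel_less set_upt)
  then show ?thesis by (simp add: set_fibre)
qed

lemma offset_memD: "i \<le> n \<Longrightarrow> c < lev \<alpha> i \<Longrightarrow> lmap \<alpha> i n c = a \<Longrightarrow>
    offset \<alpha> n a i \<le> c \<and> c - offset \<alpha> n a i < length (fibre \<alpha> i n a)"
proof -
  assume "i \<le> n" "c < lev \<alpha> i" "lmap \<alpha> i n c = a"
  then have "c \<in> set (fibre \<alpha> i n a)" by (simp add: set_fibre)
  then have "c \<in> set [offset \<alpha> n a i..<offset \<alpha> n a i + length (fibre \<alpha> i n a)]"
    using offset_fibre[OF \<open>i \<le> n\<close>] by metis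
  then show ?thesis by auto
qed

lemma sub_lmap: 
  assumes "i \<le> j" "j \<le> n" "b < length (fibre \<alpha> i n a)"
  shows "lmap \<alpha> i j (offset \<alpha> n a i + b) < lev \<alpha> j"
    "lmap \<alpha> j n (lmap \<alpha> i j (offset \<alpha> n a i + b)) = a"
    "offset \<alpha> n a j \<le> lmap \<alpha> i j (offset \<alpha> n a i + b)"
    "lmap \<alpha> i j (offset \<alpha> n a i + b) - offset \<alpha> n a j < length (fibre \<alpha> j n a)"
proof -
  have i: "i \<le> n" using assms by simp
  note o = offset_mem[OF i assms(3)]
  show 1: "lmap \<alpha> i j (offset \<alpha> n a i + b) < lev \<alpha> j" using chain_lt assms o by blast
  show 2: "lmap \<alpha> j n (lmap \<alpha> i j (offset \<alpha> n a i + b)) = a"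
    using chain_comp[of i j n] assms o by simp
  show "offset \<alpha> n a j \<le> lmap \<alpha> i j (offset \<alpha> n a i + b)"
    "lmap \<alpha> i j (offset \<alpha> n a i + b) - offset \<alpha> n a j < length (fibre \<alpha> j n a)"
    using offset_memD[OF assms(2) 1 2] by auto
qed

lemma subchain_in: "subchain n \<alpha> a \<in> chains n"
  unfolding subchain_def
proof (rule mk_chain_in, goal_cases)
  case (1 i j b) from sub_lmap(4)[OF this] show ?case .
next
  case (2 i j b c)
  then have "offset \<alpha> n a i + c < lev \<alpha> i" using offset_mem[of i c a] by simp
  then have "lmap \<alpha> i j (offset \<alpha> n a i + b) \<le> lmap \<alpha> i j (offset \<alpha> n a i + c)"
    using chain_mono[OF 2(1,2)] 2(3) by (auto simp: mono_on_def)
  then show ?case by simp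
next
  case (3 i b) then show ?case using chain_id offset_mem by simp
next
  case (4 i j l b)
  then show ?case using sub_lmap(3)[of i j b a] chain_comp[of i j l] offset_mem[of i b a] by simp
qed

lemma fibre_sub:
  assumes "i \<le> j" "j \<le> n" "b < length (fibre \<alpha> j n a)"
  shows "map ((+) (offset \<alpha> n a i)) (fibre (subchain n \<alpha> a) i j b) = fibre \<alpha> i j (offset \<alpha> n a j + b)"
proof (rule sorted_distinct_set_unique)
  let ?o = "\<lambda>i. offset \<alpha> n a i"
  have i: "i \<le> n" using assms by simp
  have s: "set (fibre (subchain n \<alpha> a) i j b) =
      {c. c < length (fibre \<alpha> i n a) \<and> lmap \<alpha> i j (?o i + c) - ?o j = b}"
    using assms by (auto simp: fibre_def subchain_def)
  show "set (map ((+) (?o i)) (fibre (subchain n \<alpha> a) i j b)) = set (fibre \<alpha> i j (?o j + b))"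
  proof (intro equalityI subsetI)
    fix c assume "c \<in> set (map ((+) (?o i)) (fibre (subchain n \<alpha> a) i j b))"
    then obtain d where "c = ?o i + d" "d < length (fibre \<alpha> i n a)" "lmap \<alpha> i j (?o i + d) - ?o j = b"
      using s by auto
    then show "c \<in> set (fibre \<alpha> i j (?o j + b))"
      using sub_lmap(3)[OF assms(1,2)] offset_mem[OF i] by (auto simp: set_fibre)
  next
    fix c assume "c \<in> set (fibre \<alpha> i j (?o j + b))"
    then have c: "c < lev \<alpha> i" "lmap \<alpha> i j c = ?o j + b" by (auto simp: set_fibre)
    have "lmap \<alpha> i n c = a" using chain_comp[OF assms(1,2) order.refl c(1)] c(2) offset_mem[OF assms(2,3)] by simp
    note o = offset_memD[OF i c(1) this]
    then have "c - ?o i \<in> set (fibre (subchain n \<alpha> a) i j b)" using c unfolding s by simp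
    moreover have "c = ?o i + (c - ?o i)" using o by simp
    ultimately show "c \<in> set (map ((+) (?o i)) (fibre (subchain n \<alpha> a) i j b))"
      unfolding set_map by (rule image_eqI[rotated])
  qed
  show "sorted (map ((+) (?o i)) (fibre (subchain n \<alpha> a) i j b))"
    by (simp add: fibre_def sorted_wrt_map)
qed (auto simp: fibre_def distinct_map)

lemma pull_in:
  assumes "\<theta> \<in> simplex_maps k n"
  shows "pull_chain k \<theta> \<alpha> \<in> chains k"
proof -
  have m: "\<theta> i \<le> \<theta> j" "\<theta> j \<le> n" if "i \<le> j" "j \<le> k" for i j
    using assms that by (auto simp: simplex_maps_def mono_on_def)
  show ?thesis unfolding pull_chain_def
  proof (rule mk_chain_in, goal_cases)
    case (1 i j b) then show ?case using chain_lt[OF m(1,2)[OF 1(1,2)]] by simp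
  next
    case (2 i j b c) then show ?case using chain_mono[OF m(1,2)[OF 2(1,2)]] by (auto simp: mono_on_def)
  next
    case (3 i b) then show ?case using chain_id[OF m(2)[OF order.refl 3(1)]] by simp
  next
    case (4 i j l b) then show ?case
      using chain_comp[OF m(1)[OF 4(1)] m(1,2)[OF 4(2,3)]] by simp
  qed
qed

lemma lev_pull: "i \<le> k \<Longrightarrow> lev (pull_chain k \<theta> \<alpha>) i = lev \<alpha> (\<theta> i)"
  by (simp add: pull_chain_def)

lemma fibre_pull: "i \<le> j \<Longrightarrow> j \<le> k \<Longrightarrow> fibre (pull_chain k \<theta> \<alpha>) i j a = fibre \<alpha> (\<theta> i) (\<theta> j) a"
  unfolding fibre_def pull_chain_def by (auto intro: filter_cong)

lemma fibre_comp:
  assumes "i \<le> j" "j \<le> l" "l \<le> n"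
  shows "fibre \<alpha> i l a = concat (map (fibre \<alpha> i j) (fibre \<alpha> j l a))"
proof -
  have ap: "filter P xs @ filter Q xs = filter (\<lambda>x. P x \<or> Q x) xs"
    if "sorted xs" "\<And>x y. x \<in> set xs \<Longrightarrow> y \<in> set xs \<Longrightarrow> P x \<Longrightarrow> Q y \<Longrightarrow> x < y" for P Q and xs :: "nat list"
    using that
  proof (induction xs)
    case (Cons x xs)
    have IH: "filter P xs @ filter Q xs = filter (\<lambda>x. P x \<or> Q x) xs"
      using Cons.IH Cons.prems by auto
    show ?case
    proof (cases "Q x \<and> \<not> P x")
      case True
      then have "filter P xs = []" using Cons.prems by (fastforce simp: filter_empty_conv)
      then show ?thesis using True IH by simp
    next
      case False
      have "\<not> (P x \<and> Q x)" using Cons.prems(2)[of x x] by auto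
      then show ?thesis using False IH by auto
    qed
  qed simp
  have key: "concat (map (fibre \<alpha> i j) cs) = filter (\<lambda>b. lmap \<alpha> i j b \<in> set cs) [0..<lev \<alpha> i]"
    if "sorted_wrt (<) cs" for cs
    using that
  proof (induction cs)
    case (Cons c cs)
    have "x < y" if "x < lev \<alpha> i" "y < lev \<alpha> i" "lmap \<alpha> i j x = c" "lmap \<alpha> i j y \<in> set cs" for x y
    proof (rule ccontr)
      assume "\<not> x < y"
      then have "lmap \<alpha> i j y \<le> lmap \<alpha> i j x"
        using chain_mono[of i j] assms that by (auto simp: mono_on_def)
      then show False using that Cons.prems by auto
    qed
    then have "filter (\<lambda>b. lmap \<alpha> i j b = c) [0..<lev \<alpha> i] @
        filter (\<lambda>b. lmap \<alpha> i j b \<in> set cs) [0..<lev \<alpha> i] =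
        filter (\<lambda>b. lmap \<alpha> i j b = c \<or> lmap \<alpha> i j b \<in> set cs) [0..<lev \<alpha> i]"
      by (intro ap) auto
    then show ?case using Cons by (simp add: fibre_def)
  qed (simp add: fibre_def)
  have "sorted_wrt (<) (fibre \<alpha> j l a)" unfolding fibre_def
    by (rule sorted_wrt_filter) simp
  from key[OF this] have "concat (map (fibre \<alpha> i j) (fibre \<alpha> j l a)) =
     filter (\<lambda>b. lmap \<alpha> i j b \<in> set (fibre \<alpha> j l a)) [0..<lev \<alpha> i]" .
  also have "\<dots> = fibre \<alpha> i l a" unfolding fibre_def
    using assms chain_lt[of i j] chain_comp[of i j l] by (auto intro!: filter_cong)
  finally show ?thesis by simp
qed

end

lemma chain_eq_fibreI:
  assumes a: "\<alpha> \<in> chains n" and b: "\<beta> \<in> chains n"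
    and l: "\<And>i. i \<le> n \<Longrightarrow> lev \<alpha> i = lev \<beta> i"
    and f: "\<And>i j c. i \<le> j \<Longrightarrow> j \<le> n \<Longrightarrow> c < lev \<alpha> j \<Longrightarrow> length (fibre \<alpha> i j c) = length (fibre \<beta> i j c)"
  shows "\<alpha> = \<beta>"
proof (rule chain_eqI[OF a b l])
  fix i j p assume ij: "i \<le> j" "j \<le> n" and p: "p < lev \<alpha> i"
  have i: "i \<le> n" using ij by simp
  have cm: "cnt (lmap \<gamma> i j) A c \<le> cnt (lmap \<gamma> i j) A (Suc c)" for \<gamma> A c
    unfolding cnt_def by (rule card_mono) auto
  have c: "cnt (lmap \<alpha> i j) (lev \<alpha> i) c = cnt (lmap \<beta> i j) (lev \<beta> i) c" if "c \<le> lev \<alpha> j" for c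
    using that
  proof (induction c)
    case 0 show ?case by (simp add: cnt_def)
  next
    case (Suc c)
    then show ?case using f[OF ij, of c] fibre_eq[OF a ij, of c] fibre_eq[OF b ij, of c] 
      cm[of \<alpha> "lev \<alpha> i" c] cm[of \<beta> "lev \<beta> i" c] by simp
  qed
  have "lmap \<alpha> i j p < c \<longleftrightarrow> lmap \<beta> i j p < c" if "c \<le> lev \<alpha> j" for c
    using cnt_iff[OF chain_mono[OF a ij] p] cnt_iff[OF chain_mono[OF b ij]] p l[OF i] c[OF that] by simp
  moreover have "lmap \<alpha> i j p < lev \<alpha> j" "lmap \<beta> i j p < lev \<alpha> j"
    using chain_lt[OF a ij p] chain_lt[OF b ij] p l[OF i] l[OF ij(2)] by auto
  ultimately show "lmap \<alpha> i j p = lmap \<beta> i j p"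
    by (meson Suc_leI lessI less_or_eq_imp_le linorder_cases not_less_eq order.strict_trans)
qed


subsection \<open>Trees and restriction maps\<close>

lemma operad_hcomp_Hom:
  assumes P: "operad P" and F: "F \<in> operad_Hom P Q" and G: "G \<in> operad_Hom Q R"
  shows "operad_hcomp P G F \<in> operad_Hom P R"
proof -
  have f: "operad_map P Q (fst F) (snd F)" and g: "operad_map Q R (fst G) (snd G)"
    using F G by (auto simp: operad_Hom_def)
  have fo: "snd F h \<in> op_set Q (map (fst F) (src P h)) (fst F (tgt P h))" if "h \<in> Ops P" for h
    using f that by (simp add: operad_map_def)
  have go: "snd G h \<in> op_set R (map (fst G) (src Q h)) (fst G (tgt Q h))" if "h \<in> Ops Q" for h
    using g that by (simp add: operad_map_def)
  have "operad_map P R (fst G \<circ> fst F) (snd G \<circ> snd F)"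
    unfolding operad_map_def
  proof (intro conjI ballI allI impI, goal_cases)
    case (1 c) then show ?case using f g by (simp add: operad_map_def)
  next
    case (2 h) then show ?case using fo[OF 2] go[of "snd F h"] by (simp add: op_set_def)
  next
    case (3 c) then show ?case using f g by (simp add: operad_map_def)
  next
    case (4 h hs)
    have hs: "\<forall>x \<in> set hs. x \<in> Ops P" using 4 by (auto simp: composable_def)
    have "composable Q (snd F h) (map (snd F) hs)"
    proof -
      have "map (tgt Q) (map (snd F) hs) = map (fst F) (map (tgt P) hs)"
        using fo hs by (simp add: op_set_def)
      also have "map (tgt P) hs = src P h" using 4 by (simp add: composable_def)
      also have "map (fst F) (src P h) = src Q (snd F h)"
        using 4 fo by (simp add: composable_def op_set_def)
      finally show ?thesis unfolding composable_def
        using 4 fo hs by (auto simp: composable_def op_set_def in_lists_conv_set)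
    qed
    then have "snd G (ocomp Q (snd F h) (map (snd F) hs)) = ocomp R (snd G (snd F h)) (map (snd G) (map (snd F) hs))"
      using g by (simp add: operad_map_def)
    moreover have "snd F (ocomp P h hs) = ocomp Q (snd F h) (map (snd F) hs)"
      using f 4 by (simp add: operad_map_def)
    ultimately show ?case by simp
  qed
  then have "operad_map P R (compose (Col P) (fst G) (fst F)) (compose (Ops P) (snd G) (snd F))"
    by (rule operad_map_cong[OF P]) (auto simp: compose_def)
  then show ?thesis by (auto simp: operad_Hom_def operad_hcomp_def)
qed

lemma tree_coll_simps [simp]:
  "(i, a) \<in> gCol (tree_coll n \<alpha>) \<longleftrightarrow> i \<le> n \<and> a < lev \<alpha> i"
  "(i, a) \<in> gens (tree_coll n \<alpha>) \<longleftrightarrow> 1 \<le> i \<and> i \<le> n \<and> a < lev \<alpha> i"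
  "gsrc (tree_coll n \<alpha>) (i, a) = map (Pair (i - 1)) (fibre \<alpha> (i - 1) i a)"
  "gtgt (tree_coll n \<alpha>) p = p"
  by (auto simp: tree_coll_def)

lemma coll_ok_tree: "coll_ok (tree_coll n \<alpha>)"
  unfolding coll_ok_def by (auto simp: fibre_def in_lists_conv_set)

lemma operad_tree: "operad (tree_operad n \<alpha>)"
  unfolding tree_operad_def by (rule operad_free_operad[OF coll_ok_tree])

lemma level_op_typed:
  assumes \<alpha>: "\<alpha> \<in> chains n"
  shows "i + d \<le> n \<Longrightarrow> a < lev \<alpha> (i + d) \<Longrightarrow> level_op \<alpha> i d a \<in> optrees (tree_coll n \<alpha>) \<and>
    leaves (level_op \<alpha> i d a) = map (Pair i) (fibre \<alpha> i (i + d) a) \<and>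
    tree_root (tree_coll n \<alpha>) (level_op \<alpha> i d a) = (i + d, a)"
proof (induction d arbitrary: a)
  case 0
  then show ?case using fibre_id[OF \<alpha>] by (auto intro: optrees.Leaf)
next
  case (Suc d)
  let ?L = "fibre \<alpha> (i + d) (i + Suc d) a"
  have IH: "level_op \<alpha> i d b \<in> optrees (tree_coll n \<alpha>) \<and>
    leaves (level_op \<alpha> i d b) = map (Pair i) (fibre \<alpha> i (i + d) b) \<and>
    tree_root (tree_coll n \<alpha>) (level_op \<alpha> i d b) = (i + d, b)" if "b \<in> set ?L" for b
    using Suc.IH[of b] Suc.prems that by (simp add: fibre_def)
  have "level_op \<alpha> i (Suc d) a \<in> optrees (tree_coll n \<alpha>)"
    unfolding level_op.simps using IH Suc.prems
    by (intro optrees.Node) auto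
  moreover have "leaves (level_op \<alpha> i (Suc d) a) = map (Pair i) (fibre \<alpha> i (i + Suc d) a)"
  proof -
    have "leaves (level_op \<alpha> i (Suc d) a) = concat (map (\<lambda>b. leaves (level_op \<alpha> i d b)) ?L)"
      by (simp add: comp_def)
    also have "\<dots> = concat (map (\<lambda>b. map (Pair i) (fibre \<alpha> i (i + d) b)) ?L)"
      using IH by (intro arg_cong[of _ _ concat] map_cong) auto
    also have "\<dots> = map (Pair i) (concat (map (fibre \<alpha> i (i + d)) ?L))"
      by (simp add: map_concat comp_def)
    also have "concat (map (fibre \<alpha> i (i + d)) ?L) = fibre \<alpha> i (i + Suc d) a"
      using fibre_comp[OF \<alpha>, of i "i + d" "i + Suc d" a] Suc.prems by simp
    finally show ?thesis .
  qed
  ultimately show ?case by simp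
qed

lemma simplex_mapsD:
  assumes "\<theta> \<in> simplex_maps k n" "i \<le> j" "j \<le> k"
  shows "\<theta> i \<le> \<theta> j" "\<theta> j \<le> n" "\<theta> i \<le> n"
  using assms by (auto simp: simplex_maps_def mono_on_def PiE_iff)

lemma assignment_tree_map:
  assumes \<alpha>: "\<alpha> \<in> chains n" and \<theta>: "\<theta> \<in> simplex_maps k n"
  shows "assignment (tree_coll k (pull_chain k \<theta> \<alpha>)) (tree_operad n \<alpha>)
      (\<lambda>(i, b). (\<theta> i, b)) (\<lambda>(i, b). level_op \<alpha> (\<theta> (i - 1)) (\<theta> i - \<theta> (i - 1)) b)"
  unfolding assignment_def
proof (intro conjI ballI, goal_cases)
  case (1 c)
  then show ?case using simplex_mapsD[OF \<theta>] by (cases c) (auto simp: tree_operad_def lev_pull[OF \<alpha>])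
next
  case (2 g)
  then obtain i b where g: "g = (i, b)" "1 \<le> i" "i \<le> k" "b < lev \<alpha> (\<theta> i)"
    by (cases g) (auto simp: lev_pull[OF \<alpha>])
  then have "\<theta> (i - 1) \<le> \<theta> i" "\<theta> i \<le> n" using simplex_mapsD[OF \<theta>, of "i - 1" i] by auto
  then show ?case using level_op_typed[OF \<alpha>, of "\<theta> (i - 1)" "\<theta> i - \<theta> (i - 1)" b] g
     fibre_pull[OF \<alpha>, of "i - 1" i k \<theta> b]
    by (simp add: tree_operad_def op_set_def comp_def)
qed

lemma assignment_incl:
  assumes \<alpha>: "\<alpha> \<in> chains n"
  shows "assignment (tree_coll n (subchain n \<alpha> a)) (tree_operad n \<alpha>)
      (\<lambda>(i, b). (i, offset \<alpha> n a i + b))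
      (\<lambda>(i, b). corolla (tree_coll n \<alpha>) (i, offset \<alpha> n a i + b))"
  unfolding assignment_def
proof (intro conjI ballI, goal_cases)
  case (1 c)
  then show ?case using offset_mem[OF \<alpha>] by (cases c) (auto simp: tree_operad_def subchain_def)
next
  case (2 g)
  then obtain i b where g: "g = (i, b)" "1 \<le> i" "i \<le> n" "b < length (fibre \<alpha> i n a)"
    by (cases g) (auto simp: subchain_def)
  then have "(i, offset \<alpha> n a i + b) \<in> gens (tree_coll n \<alpha>)" using offset_mem[OF \<alpha>] by simp
  moreover have "map (Pair (i - 1)) (fibre \<alpha> (i - 1) i (offset \<alpha> n a i + b)) =
      map (\<lambda>c. (i - 1, offset \<alpha> n a (i - 1) + c)) (fibre (subchain n \<alpha> a) (i - 1) i b)"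
    using fibre_sub[OF \<alpha>, of "i - 1" i b a] g by (simp flip: fibre_sub[OF \<alpha>])
  ultimately show ?case using corolla_in[OF coll_ok_tree, of _ n \<alpha>] g
    by (simp add: tree_operad_def op_set_def comp_def)
qed

definition restr_map where
  "restr_map k n \<theta> \<alpha> a = operad_hcomp (tree_operad k (subchain k (pull_chain k \<theta> \<alpha>) a))
     (tree_map k n \<theta> \<alpha>) (subtree_incl k (pull_chain k \<theta> \<alpha>) a)"

context
  fixes \<alpha> \<beta> :: chain and k n a :: nat and \<theta> :: "nat \<Rightarrow> nat"
  assumes \<alpha>: "\<alpha> \<in> chains n" and \<theta>: "\<theta> \<in> simplex_maps k n"
  defines "\<beta> \<equiv> pull_chain k \<theta> \<alpha>"
begin

lemma pull_beta: "\<beta> \<in> chains k"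
  unfolding \<beta>_def by (rule pull_in[OF \<alpha> \<theta>])

lemma restr_Hom: "restr_map k n \<theta> \<alpha> a \<in> operad_Hom (tree_operad k (subchain k \<beta> a)) (tree_operad n \<alpha>)"
  unfolding restr_map_def \<beta>_def[symmetric]
proof (rule operad_hcomp_Hom[OF operad_tree])
  show "subtree_incl k \<beta> a \<in> operad_Hom (tree_operad k (subchain k \<beta> a)) (tree_operad k \<beta>)"
    unfolding subtree_incl_def tree_operad_def[of _ "subchain k \<beta> a"]
    by (rule free_extension_Hom[OF coll_ok_tree operad_tree assignment_incl[OF pull_beta]])
  show "tree_map k n \<theta> \<alpha> \<in> operad_Hom (tree_operad k \<beta>) (tree_operad n \<alpha>)"
    unfolding tree_map_def tree_operad_def[of k] \<beta>_def
    by (rule free_extension_Hom[OF coll_ok_tree operad_tree assignment_tree_map[OF \<alpha> \<theta>]])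
qed

lemma restr_col:
  assumes "i \<le> k" "b < length (fibre \<beta> i k a)"
  shows "fst (restr_map k n \<theta> \<alpha> a) (i, b) = (\<theta> i, offset \<beta> k a i + b)"
  unfolding restr_map_def \<beta>_def[symmetric] operad_hcomp_def subtree_incl_def tree_map_def free_extension_def
  using assms offset_mem[OF pull_beta assms]
  by (simp add: tree_operad_def compose_def \<beta>_def) (simp add: subchain_def)

lemma restr_gen:
  assumes "1 \<le> i" "i \<le> k" "b < length (fibre \<beta> i k a)"
  shows "snd (restr_map k n \<theta> \<alpha> a) (corolla (tree_coll k (subchain k \<beta> a)) (i, b)) =
    level_op \<alpha> (\<theta> (i - 1)) (\<theta> i - \<theta> (i - 1)) (offset \<beta> k a i + b)"
proof -
  have g: "(i, b) \<in> gens (tree_coll k (subchain k \<beta> a))" using assms by (simp add: subchain_def)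
  have g2: "(i, offset \<beta> k a i + b) \<in> gens (tree_coll k \<beta>)" using assms offset_mem[OF pull_beta] by simp
  have 1: "snd (subtree_incl k \<beta> a) (corolla (tree_coll k (subchain k \<beta> a)) (i, b)) =
      corolla (tree_coll k \<beta>) (i, offset \<beta> k a i + b)"
    unfolding subtree_incl_def free_extension_def
    using corolla_in[OF coll_ok_tree g] eval_corolla[OF operad_tree assignment_incl[OF pull_beta] g] by simp
  have 2: "snd (tree_map k n \<theta> \<alpha>) (corolla (tree_coll k \<beta>) (i, offset \<beta> k a i + b)) =
     level_op \<alpha> (\<theta> (i - 1)) (\<theta> i - \<theta> (i - 1)) (offset \<beta> k a i + b)"
    unfolding tree_map_def free_extension_def \<beta>_def[symmetric]
    using corolla_in[OF coll_ok_tree g2]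
      eval_corolla[OF operad_tree assignment_tree_map[OF \<alpha> \<theta>, folded \<beta>_def] g2] by simp
  show ?thesis unfolding restr_map_def \<beta>_def[symmetric] operad_hcomp_def
    using 1 2 corolla_in[OF coll_ok_tree g] by (simp add: compose_def tree_operad_def)
qed

end

lemma list_nerve_act:
  "lact (list_nerve P) k n \<theta> (\<alpha>, x) =
    map (\<lambda>a. (subchain k (pull_chain k \<theta> \<alpha>) a,
      operad_hcomp (tree_operad k (subchain k (pull_chain k \<theta> \<alpha>) a)) x (restr_map k n \<theta> \<alpha> a)))
      [0..<lev \<alpha> (\<theta> k)]"
  by (simp add: list_nerve_def restr_map_def Let_def)

lemma vertex_in: "i \<le> n \<Longrightarrow> vertex i \<in> simplex_maps 0 n"
  by (auto simp: vertex_def simplex_maps_def mono_on_def)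

lemma edge_in: "i \<le> j \<Longrightarrow> j \<le> n \<Longrightarrow> edge i j \<in> simplex_maps 1 n"
  by (auto simp: edge_def simplex_maps_def mono_on_def)

lemma offset_id: "\<alpha> \<in> chains n \<Longrightarrow> a < lev \<alpha> n \<Longrightarrow> offset \<alpha> n a n = a"
proof -
  assume "\<alpha> \<in> chains n" "a < lev \<alpha> n"
  then have "{b. b < lev \<alpha> n \<and> lmap \<alpha> n n b < a} = {..<a}" using chain_id[of \<alpha> n n] by auto
  then show ?thesis by (simp add: offset_def)
qed

lemma top_fibre: "\<alpha> \<in> chains n \<Longrightarrow> a < lev \<alpha> n \<Longrightarrow> length (fibre \<alpha> n n a) = 1"
  by (simp add: fibre_id)

text \<open>Values of the operators for vertices and edges in the list nerve.\<close>

lemma nerve_vertex: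
  assumes \<alpha>: "\<alpha> \<in> chains n" and i: "i \<le> n" "a < lev \<alpha> i"
  shows "fst (snd (lact (list_nerve P) 0 n (vertex i) (\<alpha>, x) ! a)) (0, 0) = fst x (i, a)"
proof -
  let ?b = "pull_chain 0 (vertex i) \<alpha>"
  note v = vertex_in[OF i(1)]
  have b: "?b \<in> chains 0" by (rule pull_in[OF \<alpha> v])
  have l: "lev ?b 0 = lev \<alpha> i" using lev_pull[OF \<alpha>, of 0 0] by (simp add: vertex_def)
  have f: "fibre ?b 0 0 a = [a]" using fibre_id[OF b] l i by simp
  have c: "fst (restr_map 0 n (vertex i) \<alpha> a) (0, 0) = (i, a)"
    using restr_col[OF \<alpha> v, of 0 0 a] f offset_id[OF b, of a] l i by (simp add: vertex_def)
  show ?thesis using i c f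
    by (simp add: list_nerve_act vertex_def[of i, THEN fun_cong, of 0] operad_hcomp_def compose_def
        tree_operad_def subchain_def)
qed

lemma nerve_edge:
  assumes \<alpha>: "\<alpha> \<in> chains n" and i: "i \<le> j" "j \<le> n" "a < lev \<alpha> j"
  shows "snd (snd (lact (list_nerve P) 1 n (edge i j) (\<alpha>, x) ! a))
     (corolla (tree_coll 1 (fst (lact (list_nerve P) 1 n (edge i j) (\<alpha>, x) ! a))) (1, 0)) =
      snd x (level_op \<alpha> i (j - i) a)"
    and "lev (fst (lact (list_nerve P) 1 n (edge i j) (\<alpha>, x) ! a)) 0 = length (fibre \<alpha> i j a)"
proof -
  let ?b = "pull_chain 1 (edge i j) \<alpha>"
  note v = edge_in[OF i(1,2)]
  have b: "?b \<in> chains 1" by (rule pull_in[OF \<alpha> v])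
  have l: "lev ?b 1 = lev \<alpha> j" using lev_pull[OF \<alpha>, of 1 1] by (simp add: edge_def)
  have f: "fibre ?b 1 1 a = [a]" using fibre_id[OF b] l i by simp
  have e: "edge i j 1 = j" "edge i j 0 = i" "edge i j (Suc 0) = j" by (simp_all add: edge_def)
  have c: "snd (restr_map 1 n (edge i j) \<alpha> a) (corolla (tree_coll 1 (subchain 1 ?b a)) (1, 0)) =
     level_op \<alpha> i (j - i) a"
    using restr_gen[OF \<alpha> v, of 1 0 a] f offset_id[OF b, of a] l i e by simp
  have g: "(1, 0) \<in> gens (tree_coll 1 (subchain 1 ?b a))" using f by (simp add: subchain_def)
  show "snd (snd (lact (list_nerve P) 1 n (edge i j) (\<alpha>, x) ! a))
     (corolla (tree_coll 1 (fst (lact (list_nerve P) 1 n (edge i j) (\<alpha>, x) ! a))) (1, 0)) =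
      snd x (level_op \<alpha> i (j - i) a)"
    using i c corolla_in[OF coll_ok_tree g]
    by (simp add: list_nerve_act e operad_hcomp_def compose_def tree_operad_def)
  show "lev (fst (lact (list_nerve P) 1 n (edge i j) (\<alpha>, x) ! a)) 0 = length (fibre \<alpha> i j a)"
    using i e fibre_pull[OF \<alpha>, of 0 1 1 "edge i j" a] by (simp add: list_nerve_act subchain_def)
qed


subsection \<open>The shape of a simplex\<close>

definition shape :: "'x slist \<Rightarrow> nat \<Rightarrow> 'x \<Rightarrow> chain" where
  "shape X n x = mk_chain n (\<lambda>i. length (lact X 0 n (vertex i) x))
     (\<lambda>i j. block_index (map (\<lambda>e. length (lact X 0 1 (vertex 0) e)) (lact X 1 n (edge i j) x)))"

definition tau1_unit ::
    "'x slist \<Rightarrow> nat \<Rightarrow> 'x \<Rightarrow>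
     chain \<times> (nat \<times> nat \<Rightarrow> 'x) \<times> ((nat \<times> nat, nat \<times> nat) optree \<Rightarrow> ('x, 'x) optree set)" where
  "tau1_unit X n x =
    (shape X n x,
     free_extension (tree_coll n (shape X n x)) (tau1 X)
       (\<lambda>(i, a). lact X 0 n (vertex i) x ! a)
       (\<lambda>(i, a). tau1_gen X (lact X 1 n (edge (i - 1) i) x ! a)))"

lemma nth_concat_block:
  assumes "a < length xss" "b < length (xss ! a)"
  shows "length (concat (take a xss)) + b < length (concat xss)"
    "concat xss ! (length (concat (take a xss)) + b) = xss ! a ! b"
proof -
  have "concat xss = concat (take a xss @ xss ! a # drop (Suc a) xss)"
    using id_take_nth_drop[OF assms(1)] by metis
  then have e: "concat xss = concat (take a xss) @ xss ! a @ concat (drop (Suc a) xss)" by simp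
  show "length (concat (take a xss)) + b < length (concat xss)"
    unfolding e using assms by simp
  show "concat xss ! (length (concat (take a xss)) + b) = xss ! a ! b"
    unfolding e using assms by (simp add: nth_append)
qed

lemma map_nth_concat:
  assumes "a < length xss"
  shows "map ((!) (concat xss)) [length (concat (take a xss))..<length (concat (take (Suc a) xss))] = xss ! a"
proof (rule nth_equalityI)
  show l: "length (map ((!) (concat xss)) [length (concat (take a xss))..<length (concat (take (Suc a) xss))]) =
      length (xss ! a)"
    using assms by (simp add: take_Suc_conv_app_nth)
  fix b assume "b < length (map ((!) (concat xss)) [length (concat (take a xss))..<length (concat (take (Suc a) xss))])"
  then show "map ((!) (concat xss)) [length (concat (take a xss))..<length (concat (take (Suc a) xss))] ! b = xss ! a ! b"
    using nth_concat_block(2)[OF assms] l by simp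
qed

lemma comp_vertex: "i \<le> k \<Longrightarrow> compose {..0} \<theta> (vertex i) = vertex (\<theta> i)"
  by (auto simp: compose_def vertex_def)

lemma comp_edge: "compose {..1} \<theta> (edge i j) = edge (\<theta> i) (\<theta> j)"
  by (auto simp: compose_def edge_def)

lemma edge_simps [simp]: "edge i j 0 = i" "edge i j 1 = j" "edge i j (Suc 0) = j"
  by (simp_all add: edge_def)

lemma vertex_simps [simp]: "vertex i 0 = i"
  by (simp add: vertex_def)

lemma eq_of_less_iff: "(p::nat) < m \<Longrightarrow> q < m \<Longrightarrow> (\<And>c. c \<le> m \<Longrightarrow> p < c \<longleftrightarrow> q < c) \<Longrightarrow> p = q"
  by (meson Suc_leI lessI less_or_eq_imp_le linorder_cases not_less_eq order.strict_trans)

locale oslist =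
  fixes X :: "'x slist"
  assumes X: "simplicial_list X" and op: "operadic X"
begin

abbreviation "V n i x \<equiv> lact X 0 n (vertex i) x"
abbreviation "E n i j x \<equiv> lact X 1 n (edge i j) x"

lemma act_in: "\<theta> \<in> simplex_maps k n \<Longrightarrow> x \<in> lsplx X n \<Longrightarrow> y \<in> set (lact X k n \<theta> x) \<Longrightarrow> y \<in> lsplx X k"
  using X unfolding simplicial_list_def in_lists_conv_set by blast

lemma act_id: "x \<in> lsplx X n \<Longrightarrow> lact X n n (\<lambda>i\<in>{..n}. i) x = [x]"
  using X unfolding simplicial_list_def by blast

lemma act_comp: "\<theta> \<in> simplex_maps k n \<Longrightarrow> \<eta> \<in> simplex_maps l k \<Longrightarrow> x \<in> lsplx X n \<Longrightarrow>
    concat (map (lact X l k \<eta>) (lact X k n \<theta> x)) = lact X l n (compose {..l} \<theta> \<eta>) x"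
  using X unfolding simplicial_list_def listing_comp_def by metis

lemma act_top:
  assumes "\<theta> \<in> simplex_maps k n" "\<theta> k = n" "x \<in> lsplx X n"
  shows "lact X k n \<theta> x = [hd (lact X k n \<theta> x)]" "hd (lact X k n \<theta> x) \<in> lsplx X k"
proof -
  have "length (lact X k n \<theta> x) = 1" using op assms unfolding operadic_def by blast
  then show 1: "lact X k n \<theta> x = [hd (lact X k n \<theta> x)]" by (cases "lact X k n \<theta> x") auto
  show "hd (lact X k n \<theta> x) \<in> lsplx X k" using act_in[OF assms(1,3)] 1
    by (metis list.set_intros(1))
qed

lemma V_comp: "\<theta> \<in> simplex_maps k n \<Longrightarrow> i \<le> k \<Longrightarrow> x \<in> lsplx X n \<Longrightarrow>
    concat (map (V k i) (lact X k n \<theta> x)) = V n (\<theta> i) x"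
  using act_comp[of \<theta> k n "vertex i" 0 x] vertex_in[of i k] comp_vertex[of i k \<theta>] by simp

lemma E_comp: "\<theta> \<in> simplex_maps k n \<Longrightarrow> i \<le> j \<Longrightarrow> j \<le> k \<Longrightarrow> x \<in> lsplx X n \<Longrightarrow>
    concat (map (E k i j) (lact X k n \<theta> x)) = E n (\<theta> i) (\<theta> j) x"
  using act_comp[of \<theta> k n "edge i j" 1 x] edge_in[of i j k] comp_edge[of \<theta> i j] by simp

lemma V_in: "i \<le> n \<Longrightarrow> x \<in> lsplx X n \<Longrightarrow> v \<in> set (V n i x) \<Longrightarrow> v \<in> lsplx X 0"
  using act_in[OF vertex_in] by blast

lemma E_in: "i \<le> j \<Longrightarrow> j \<le> n \<Longrightarrow> x \<in> lsplx X n \<Longrightarrow> e \<in> set (E n i j x) \<Longrightarrow> e \<in> lsplx X 1"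
  using act_in[OF edge_in] by blast

lemma V_top: "x \<in> lsplx X n \<Longrightarrow> V n n x = [hd (V n n x)]"
  and E_top: "i \<le> n \<Longrightarrow> x \<in> lsplx X n \<Longrightarrow> E n i n x = [hd (E n i n x)]"
  using act_top(1)[OF vertex_in] act_top(1)[OF edge_in] by simp_all

lemma V00: "v \<in> lsplx X 0 \<Longrightarrow> V 0 0 v = [v]"
proof -
  have "vertex 0 = (\<lambda>i\<in>{..0}. i)" by (auto simp: vertex_def)
  then show "v \<in> lsplx X 0 \<Longrightarrow> V 0 0 v = [v]" using act_id[of v 0] by simp
qed

lemma E101: "e \<in> lsplx X 1 \<Longrightarrow> E 1 0 1 e = [e]"
proof -
  have "edge 0 1 = (\<lambda>i\<in>{..1}. i)" by (auto simp: edge_def)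
  then show "e \<in> lsplx X 1 \<Longrightarrow> E 1 0 1 e = [e]" using act_id[of e 1] by simp
qed

lemma E_src: "i \<le> j \<Longrightarrow> j \<le> n \<Longrightarrow> x \<in> lsplx X n \<Longrightarrow> concat (map (V 1 0) (E n i j x)) = V n i x"
  using V_comp[OF edge_in, of i j n 0 x] by simp

lemma E_tgt: "i \<le> j \<Longrightarrow> j \<le> n \<Longrightarrow> x \<in> lsplx X n \<Longrightarrow> map (\<lambda>e. hd (V 1 1 e)) (E n i j x) = V n j x"
proof -
  assume a: "i \<le> j" "j \<le> n" "x \<in> lsplx X n"
  have "V n j x = concat (map (V 1 1) (E n i j x))"
    using V_comp[OF edge_in, of i j n 1 x] a by simp
  also have "map (V 1 1) (E n i j x) = map (\<lambda>e. [hd (V 1 1 e)]) (E n i j x)"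
    using V_top E_in[OF a] by (intro map_cong) auto
  also have "concat \<dots> = map (\<lambda>e. hd (V 1 1 e)) (E n i j x)" by (induction "E n i j x") auto
  finally show ?thesis by simp
qed

lemma length_E: "i \<le> j \<Longrightarrow> j \<le> n \<Longrightarrow> x \<in> lsplx X n \<Longrightarrow> length (E n i j x) = length (V n j x)"
  by (metis E_tgt length_map)

definition S where
  "S n i j x c = length (concat (map (V 1 0) (take c (E n i j x))))"

lemma S_eq: "S n i j x c = sum_list (take c (map (\<lambda>e. length (V 1 0 e)) (E n i j x)))"
  by (simp add: S_def length_concat take_map comp_def)

lemma length_concat_E:
  assumes "i \<le> j" "j \<le> k" "set ys \<subseteq> lsplx X k"
  shows "length (concat (map (E k i j) ys)) = length (concat (map (V k j) ys))"
    and "concat (map (V 1 0) (concat (map (E k i j) ys))) = concat (map (V k i) ys)"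
  using assms(3) by (induction ys) (use length_E[OF assms(1,2)] E_src[OF assms(1,2)] in auto)

lemma prefix:
  assumes "\<theta> \<in> simplex_maps k n" "x \<in> lsplx X n" "i \<le> j" "j \<le> k"
  shows "take (length (concat (map (V k j) (take c (lact X k n \<theta> x))))) (E n (\<theta> i) (\<theta> j) x) =
    concat (map (E k i j) (take c (lact X k n \<theta> x)))"
proof -
  let ?ys = "lact X k n \<theta> x"
  have s: "set (take c ?ys) \<subseteq> lsplx X k" using act_in[OF assms(1,2)] set_take_subset[of c ?ys] by auto
  have "E n (\<theta> i) (\<theta> j) x = concat (map (E k i j) (take c ?ys @ drop c ?ys))"
    using E_comp[OF assms(1,3,4,2)] by simp
  then have "E n (\<theta> i) (\<theta> j) x = concat (map (E k i j) (take c ?ys)) @ concat (map (E k i j) (drop c ?ys))"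
    by (simp del: append_take_drop_id)
  then show ?thesis using length_concat_E(1)[OF assms(3,4) s] by simp
qed

lemma S_prefix:
  assumes "\<theta> \<in> simplex_maps k n" "x \<in> lsplx X n" "i \<le> j" "j \<le> k"
  shows "S n (\<theta> i) (\<theta> j) x (length (concat (map (V k j) (take c (lact X k n \<theta> x))))) =
    length (concat (map (V k i) (take c (lact X k n \<theta> x))))"
proof -
  have s: "set (take c (lact X k n \<theta> x)) \<subseteq> lsplx X k"
    using act_in[OF assms(1,2)] set_take_subset[of c "lact X k n \<theta> x"] by auto
  show ?thesis unfolding S_def prefix[OF assms] length_concat_E(2)[OF assms(3,4) s] ..
qed

lemma length_concat_top:
  assumes "set ys \<subseteq> lsplx X k" shows "length (concat (map (V k k) ys)) = length ys"
  using assms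
proof (induction ys)
  case (Cons y ys)
  have "length (V k k y) = 1" using V_top[of y k] Cons.prems by (metis One_nat_def length_Cons list.size(3) insert_subset list.set(2))
  then show ?case using Cons by simp
qed simp

lemma length_act: "\<theta> \<in> simplex_maps k n \<Longrightarrow> x \<in> lsplx X n \<Longrightarrow> length (lact X k n \<theta> x) = length (V n (\<theta> k) x)"
  using V_comp[of \<theta> k n k x] length_concat_top[of "lact X k n \<theta> x" k] act_in[of \<theta> k n x] by (metis order.refl subsetI)

lemma S_prefix_top:
  assumes "\<theta> \<in> simplex_maps k n" "x \<in> lsplx X n" "i \<le> k" "c \<le> length (lact X k n \<theta> x)"
  shows "S n (\<theta> i) (\<theta> k) x c = length (concat (map (V k i) (take c (lact X k n \<theta> x))))"
proof -
  have s: "set (take c (lact X k n \<theta> x)) \<subseteq> lsplx X k"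
    using act_in[OF assms(1,2)] set_take_subset[of c "lact X k n \<theta> x"] by auto
  show ?thesis using S_prefix[OF assms(1-3) order.refl, of c] length_concat_top[OF s] assms(4) by simp
qed

definition tri :: "nat \<Rightarrow> nat \<Rightarrow> nat \<Rightarrow> nat \<Rightarrow> nat" where
  "tri i j l = (\<lambda>p\<in>{..2}. if p = 0 then i else if p = 1 then j else l)"

lemma tri_in: "i \<le> j \<Longrightarrow> j \<le> l \<Longrightarrow> l \<le> n \<Longrightarrow> tri i j l \<in> simplex_maps 2 n"
  by (auto simp: tri_def simplex_maps_def mono_on_def)

lemma tri_simps [simp]: "tri i j l 0 = i" "tri i j l 1 = j" "tri i j l (Suc 0) = j" "tri i j l 2 = l"
  by (simp_all add: tri_def)

lemma S_comp:
  assumes "i \<le> j" "j \<le> l" "l \<le> n" "x \<in> lsplx X n" "c \<le> length (V n l x)"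
  shows "S n i l x c = S n i j x (S n j l x c)"
proof -
  note t = tri_in[OF assms(1-3)]
  have c: "c \<le> length (lact X 2 n (tri i j l) x)"
    using length_act[OF t assms(4)] assms(5) by simp
  show ?thesis
    using S_prefix[OF t assms(4), of 0 1 c] S_prefix_top[OF t assms(4) _ c, of 0] S_prefix_top[OF t assms(4) _ c, of 1]
    by simp
qed

lemma deg:
  assumes v: "v \<in> lsplx X 0"
  defines "s \<equiv> hd (E 0 0 0 v)"
  shows "E 0 0 0 v = [s]" "s \<in> lsplx X 1" "V 1 0 s = [v]" "V 1 1 s = [v]"
proof -
  have e: "edge 0 0 \<in> simplex_maps 1 0" by (rule edge_in) auto
  show 1: "E 0 0 0 v = [s]" "s \<in> lsplx X 1"
    unfolding s_def using act_top[OF e _ v] by simp_all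
  show "V 1 0 s = [v]" using E_src[of 0 0 0 v] 1 v V00 by simp
  show "V 1 1 s = [v]" using V_comp[OF e, of 1 v] 1 v V00 by simp
qed

lemma E_ii:
  assumes "i \<le> n" "x \<in> lsplx X n"
  shows "E n i i x = map (\<lambda>v. hd (E 0 0 0 v)) (V n i x)"
proof -
  have e: "edge 0 0 \<in> simplex_maps 1 0" by (rule edge_in) auto
  have "compose {..1} (vertex i) (edge 0 0) = edge i i" by (auto simp: compose_def vertex_def edge_def)
  then have "E n i i x = concat (map (E 0 0 0) (V n i x))"
    using act_comp[OF vertex_in[OF assms(1)] e assms(2)] by simp
  also have "map (E 0 0 0) (V n i x) = map (\<lambda>v. [hd (E 0 0 0 v)]) (V n i x)"
    using deg(1) V_in[OF assms] by (intro map_cong) auto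
  also have "concat \<dots> = map (\<lambda>v. hd (E 0 0 0 v)) (V n i x)" by (induction "V n i x") auto
  finally show ?thesis .
qed

lemma S_id:
  assumes "i \<le> n" "x \<in> lsplx X n" "c \<le> length (V n i x)"
  shows "S n i i x c = c"
proof -
  have "map (V 1 0) (take c (E n i i x)) = map (\<lambda>v. [v]) (take c (V n i x))"
    unfolding E_ii[OF assms(1,2)] take_map
    using deg(3) V_in[OF assms(1,2)] by (auto dest: in_set_takeD)
  then show ?thesis using assms(3) by (simp add: S_def comp_def)
qed

lemma lev_shape: "i \<le> n \<Longrightarrow> lev (shape X n x) i = length (V n i x)"
  by (simp add: shape_def)

lemma lmap_shape_less:
  assumes "i \<le> j" "j \<le> n" "x \<in> lsplx X n" "c \<le> length (V n j x)"
  shows "block_index (map (\<lambda>e. length (V 1 0 e)) (E n i j x)) b < c \<longleftrightarrow> b < S n i j x c"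
  unfolding S_eq using assms(4) length_E[OF assms(1-3)] by (intro block_index_less) simp

lemma S_total: "i \<le> j \<Longrightarrow> j \<le> n \<Longrightarrow> x \<in> lsplx X n \<Longrightarrow> S n i j x (length (V n j x)) = length (V n i x)"
  unfolding S_def using length_E E_src by simp

lemma shape_in: assumes x: "x \<in> lsplx X n" shows "shape X n x \<in> chains n"
  unfolding shape_def
proof (rule mk_chain_in, goal_cases)
  case (1 i j b)
  then show ?case using lmap_shape_less[OF 1(1,2) x order.refl] S_total[OF 1(1,2) x] by simp
next
  case (2 i j b c) then show ?case by (simp add: block_index_mono)
next
  case (3 i b)
  have a: "block_index (map (\<lambda>e. length (V 1 0 e)) (E n i i x)) b < c \<longleftrightarrow> b < c" if "c \<le> length (V n i x)" for c
    using lmap_shape_less[OF order.refl 3(1) x that] S_id[OF 3(1) x that] by simp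
  show ?case by (rule eq_of_less_iff[of _ "length (V n i x)"]) (use a 3 in auto)
next
  case (4 i j l b)
  let ?f = "\<lambda>i j. block_index (map (\<lambda>e. length (V 1 0 e)) (E n i j x))"
  have il: "i \<le> l" "j \<le> n" using 4 by auto
  have S_le: "S n j l x c \<le> length (V n j x)" if "c \<le> length (V n l x)" for c
    using S_total[OF 4(2,3) x] that unfolding S_eq
    by (metis length_E[OF 4(2,3) x] length_map order.refl sum_list_take_le take_all)
  have a: "?f i l b < c \<longleftrightarrow> ?f j l (?f i j b) < c" if "c \<le> length (V n l x)" for c
    using lmap_shape_less[OF il(1) 4(3) x that] lmap_shape_less[OF 4(2,3) x that]
      lmap_shape_less[OF 4(1) il(2) x S_le[OF that]] S_comp[OF 4(1-3) x that] by simp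
  have lt: "?f i l b < length (V n l x)"
    using lmap_shape_less[OF il(1) 4(3) x order.refl] S_total[OF il(1) 4(3) x] 4(4) by simp
  show ?case by (rule eq_of_less_iff[OF lt]) (use a lt in auto)
qed

lemma shape_rooted: "x \<in> lsplx X n \<Longrightarrow> shape X n x \<in> rooted_chains n"
  unfolding rooted_chains_def using shape_in V_top[of x n] lev_shape[of n n x]
  by (metis (mono_tags, lifting) One_nat_def length_Cons list.size(3) mem_Collect_eq order.refl)

lemma cnt_shape:
  assumes "i \<le> j" "j \<le> n" "x \<in> lsplx X n" "c \<le> length (V n j x)"
  shows "cnt (lmap (shape X n x) i j) (lev (shape X n x) i) c = S n i j x c"
proof -
  have i: "i \<le> n" using assms by simp
  have "cnt (lmap (shape X n x) i j) (length (V n i x)) c =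
      cnt (block_index (map (\<lambda>e. length (V 1 0 e)) (E n i j x))) (length (V n i x)) c"
    by (rule cnt_cong) (use assms in \<open>simp add: shape_def\<close>)
  also have "\<dots> = S n i j x c"
  proof -
    have "length (V n i x) = sum_list (map (\<lambda>e. length (V 1 0 e)) (E n i j x))"
      using arg_cong[OF E_src[OF assms(1-3)], of length] by (simp add: length_concat comp_def)
    then show ?thesis unfolding S_eq using cnt_block_index[of c "map (\<lambda>e. length (V 1 0 e)) (E n i j x)"]
      assms length_E by simp
  qed
  finally show ?thesis using lev_shape[OF i] by simp
qed

lemma fibre_shape:
  assumes "i \<le> j" "j \<le> n" "x \<in> lsplx X n" "a < length (V n j x)"
  shows "fibre (shape X n x) i j a = [S n i j x a..<S n i j x (Suc a)]"
  using fibre_eq[OF shape_in[OF assms(3)] assms(1,2)] cnt_shape[OF assms(1-3), of a]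
    cnt_shape[OF assms(1-3), of "Suc a"] assms(4) by simp

lemma fibre_V:
  assumes "i \<le> j" "j \<le> n" "x \<in> lsplx X n" "a < length (V n j x)"
  shows "map ((!) (V n i x)) (fibre (shape X n x) i j a) = V 1 0 (E n i j x ! a)"
proof -
  have a: "a < length (map (V 1 0) (E n i j x))" using length_E[OF assms(1-3)] assms(4) by simp
  show ?thesis unfolding fibre_shape[OF assms] S_def
    using map_nth_concat[OF a] E_src[OF assms(1-3)] a by (simp add: take_map)
qed

lemma length_fibre_shape:
  assumes "i \<le> j" "j \<le> n" "x \<in> lsplx X n" "a < length (V n j x)"
  shows "length (fibre (shape X n x) i j a) = length (V 1 0 (E n i j x ! a))"
  using arg_cong[OF fibre_V[OF assms], of length] by simp

lemma V_block:
  assumes "\<theta> \<in> simplex_maps k n" "x \<in> lsplx X n" "a < length (lact X k n \<theta> x)" "i \<le> k"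
    "b < length (V k i (lact X k n \<theta> x ! a))"
  shows "V n (\<theta> i) x ! (S n (\<theta> i) (\<theta> k) x a + b) = V k i (lact X k n \<theta> x ! a) ! b"
proof -
  let ?ys = "lact X k n \<theta> x"
  have "S n (\<theta> i) (\<theta> k) x a = length (concat (take a (map (V k i) ?ys)))"
    using S_prefix_top[OF assms(1,2,4), of a] assms(3) by (simp add: take_map)
  then show ?thesis
    using nth_concat_block(2)[of a "map (V k i) ?ys" b] assms V_comp[OF assms(1,4,2)] by simp
qed

lemma E_block:
  assumes "\<theta> \<in> simplex_maps k n" "x \<in> lsplx X n" "a < length (lact X k n \<theta> x)" "i \<le> j" "j \<le> k"
    "b < length (V k j (lact X k n \<theta> x ! a))"
  shows "E n (\<theta> i) (\<theta> j) x ! (S n (\<theta> j) (\<theta> k) x a + b) = E k i j (lact X k n \<theta> x ! a) ! b"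
    "S n (\<theta> j) (\<theta> k) x a + b < length (V n (\<theta> j) x)"
proof -
  let ?ys = "lact X k n \<theta> x"
  have y: "?ys ! a \<in> lsplx X k" using act_in[OF assms(1,2)] assms(3) by simp
  have s: "set (take a ?ys) \<subseteq> lsplx X k"
    using act_in[OF assms(1,2)] set_take_subset[of a ?ys] by auto
  have S: "S n (\<theta> j) (\<theta> k) x a = length (concat (take a (map (E k i j) ?ys)))"
    using S_prefix_top[OF assms(1,2,5), of a] assms(3) length_concat_E(1)[OF assms(4,5) s] by (simp add: take_map)
  have b: "b < length (map (E k i j) ?ys ! a)" using length_E[OF assms(4,5) y] assms by simp
  show "E n (\<theta> i) (\<theta> j) x ! (S n (\<theta> j) (\<theta> k) x a + b) = E k i j (?ys ! a) ! b"
    using nth_concat_block(2)[OF _ b] assms E_comp[OF assms(1,4,5,2)] S by simp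
  have "S n (\<theta> j) (\<theta> k) x a + b < length (E n (\<theta> i) (\<theta> j) x)"
    using nth_concat_block(1)[OF _ b] assms E_comp[OF assms(1,4,5,2)] S by simp
  then show "S n (\<theta> j) (\<theta> k) x a + b < length (V n (\<theta> j) x)"
    using length_E[OF simplex_mapsD(1,2)[OF assms(1,4,5)] assms(2)] by simp
qed

context
  fixes \<theta> k n x a
  assumes \<theta>: "\<theta> \<in> simplex_maps k n" and x: "x \<in> lsplx X n" and a: "a < length (lact X k n \<theta> x)"
begin

lemma offset_shape:
  assumes i: "i \<le> k"
  shows "offset (pull_chain k \<theta> (shape X n x)) k a i = S n (\<theta> i) (\<theta> k) x a"
proof -
  let ?b = "pull_chain k \<theta> (shape X n x)"
  note t = simplex_mapsD[OF \<theta> i order.refl]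
  have l: "lev ?b i = lev (shape X n x) (\<theta> i)" using lev_pull[OF shape_in[OF x] i] .
  have "offset ?b k a i = cnt (lmap ?b i k) (lev ?b i) a" by (simp add: offset_def cnt_def)
  also have "\<dots> = cnt (lmap (shape X n x) (\<theta> i) (\<theta> k)) (lev ?b i) a"
    by (rule cnt_cong) (use i l in \<open>simp add: pull_chain_def\<close>)
  also have "\<dots> = S n (\<theta> i) (\<theta> k) x a"
    unfolding l using cnt_shape[OF t(1,2) x] a length_act[OF \<theta> x] by simp
  finally show ?thesis .
qed

lemma y_in: "lact X k n \<theta> x ! a \<in> lsplx X k"
  using act_in[OF \<theta> x] a by simp

lemma lev_sub:
  assumes i: "i \<le> k"
  shows "length (fibre (pull_chain k \<theta> (shape X n x)) i k a) = length (V k i (lact X k n \<theta> x ! a))"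
proof -
  note t = simplex_mapsD[OF \<theta> i order.refl]
  have "length (fibre (pull_chain k \<theta> (shape X n x)) i k a) = length (fibre (shape X n x) (\<theta> i) (\<theta> k) a)"
    using fibre_pull[OF shape_in[OF x] i order.refl] by simp
  also have "\<dots> = length (concat (map (V k i) (take (Suc a) (lact X k n \<theta> x)))) -
      length (concat (map (V k i) (take a (lact X k n \<theta> x))))"
    using fibre_shape[OF t(1,2) x] a length_act[OF \<theta> x] S_prefix_top[OF \<theta> x i] by simp
  also have "\<dots> = length (V k i (lact X k n \<theta> x ! a))"
    using a by (simp add: take_Suc_conv_app_nth)
  finally show ?thesis .
qed

lemma sub_shape: "subchain k (pull_chain k \<theta> (shape X n x)) a = shape X k (lact X k n \<theta> x ! a)"
proof (rule chain_eq_fibreI)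
  let ?b = "pull_chain k \<theta> (shape X n x)"
  let ?y = "lact X k n \<theta> x ! a"
  have b: "?b \<in> chains k" by (rule pull_in[OF shape_in[OF x] \<theta>])
  show "subchain k ?b a \<in> chains k" by (rule subchain_in[OF b])
  show "shape X k ?y \<in> chains k" by (rule shape_in[OF y_in])
  show l: "lev (subchain k ?b a) i = lev (shape X k ?y) i" if "i \<le> k" for i
    using lev_sub[OF that] lev_shape[OF that] that by (simp add: subchain_def)
  fix i j c assume ij: "i \<le> j" "j \<le> k" and "c < lev (subchain k ?b a) j"
  then have c: "c < length (fibre ?b j k a)" "c < length (V k j ?y)"
    using lev_sub[OF ij(2)] by (simp_all add: subchain_def)
  note t = simplex_mapsD[OF \<theta> ij]
  have "length (fibre (subchain k ?b a) i j c) = length (fibre ?b i j (offset ?b k a j + c))"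
    using fibre_sub[OF b ij c(1)] by (metis length_map)
  also have "\<dots> = length (fibre (shape X n x) (\<theta> i) (\<theta> j) (S n (\<theta> j) (\<theta> k) x a + c))"
    using fibre_pull[OF shape_in[OF x] ij] offset_shape[OF ij(2)] by simp
  also have "\<dots> = length (V 1 0 (E n (\<theta> i) (\<theta> j) x ! (S n (\<theta> j) (\<theta> k) x a + c)))"
    by (rule length_fibre_shape[OF t(1,2) x E_block(2)[OF \<theta> x a ij c(2)]])
  also have "\<dots> = length (V 1 0 (E k i j ?y ! c))"
    using E_block(1)[OF \<theta> x a ij c(2)] by simp
  also have "\<dots> = length (fibre (shape X k ?y) i j c)"
    using length_fibre_shape[OF ij y_in c(2)] by simp
  finally show "length (fibre (subchain k ?b a) i j c) = length (fibre (shape X k ?y) i j c)" .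
qed

end

end


subsection \<open>The unit\<close>

lemma quot_descend:
  assumes P: "operad P" and R: "parallel P R" and G: "operad_map P Q F G"
    and r: "\<And>f g. (f, g) \<in> R \<Longrightarrow> G f = G g"
  shows "f \<in> Ops P \<Longrightarrow> G (rep (op_class P R f)) = G f"
    and "operad_map (operad_quotient P R) Q F (\<lambda>C. G (rep C))"
proof -
  have e: "G (rep (op_class P R f)) = G f" if "f \<in> Ops P" for f
    using cong_descend[OF P R G r rep_cong[OF that]] by simp
  then show "f \<in> Ops P \<Longrightarrow> G (rep (op_class P R f)) = G f" .
  show "operad_map (operad_quotient P R) Q F (\<lambda>C. G (rep C))"
    unfolding operad_map_def
  proof (intro conjI ballI allI impI, goal_cases)
    case (1 c) then show ?case using G by (simp add: operad_map_def)
  next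
    case (2 C)
    then obtain f where "C = op_class P R f" "f \<in> Ops P" by auto
    then show ?case using G e quot_src[OF P R] quot_tgt[OF P R] by (simp add: operad_map_def)
  next
    case (3 c)
    then have c: "c \<in> Col P" by simp
    then have "idop P c \<in> Ops P" using operad_id[OF P] by (simp add: op_set_def)
    then show ?case using G e c by (simp add: operad_map_def)
  next
    case (4 C Ds)
    then obtain f gs where fg: "C = op_class P R f" "Ds = map (op_class P R) gs" "composable P f gs"
      by (rule quot_composableD[OF P R])
    have "f \<in> Ops P" "\<forall>g \<in> set gs. g \<in> Ops P" using fg(3) by (auto simp: composable_def)
    moreover have "ocomp P f gs \<in> Ops P" using operad_comp[OF P fg(3)] by (simp add: op_set_def)
    moreover have "G (ocomp P f gs) = ocomp Q (G f) (map G gs)" using G fg(3) by (simp add: operad_map_def)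
    moreover have "map (\<lambda>C. G (rep C)) Ds = map G gs" unfolding fg(2) using e \<open>\<forall>g \<in> set gs. g \<in> Ops P\<close> by simp
    ultimately show ?case using quot_comp[OF P R fg(3)] e fg(1,2) by metis
  qed
qed

lemma Hom_map: "x \<in> operad_Hom P Q \<Longrightarrow> operad_map P Q (fst x) (snd x)"
  by (auto simp: operad_Hom_def)

lemma level_op_step:
  assumes \<alpha>: "\<alpha> \<in> chains n" and m: "operad_map (tree_operad n \<alpha>) P F G"
    and i: "i + Suc d \<le> n" "a < lev \<alpha> (i + Suc d)"
  shows "G (level_op \<alpha> i (Suc d) a) =
    ocomp P (G (corolla (tree_coll n \<alpha>) (i + Suc d, a)))
      (map (\<lambda>b. G (level_op \<alpha> i d b)) (fibre \<alpha> (i + d) (i + Suc d) a))"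
proof -
  let ?L = "fibre \<alpha> (i + d) (i + Suc d) a"
  let ?c = "corolla (tree_coll n \<alpha>) (i + Suc d, a)"
  have s: "gsrc (tree_coll n \<alpha>) (i + Suc d, a) = map (Pair (i + d)) ?L" by simp
  have t: "level_op \<alpha> i d b \<in> optrees (tree_coll n \<alpha>) \<and> tree_root (tree_coll n \<alpha>) (level_op \<alpha> i d b) = (i + d, b)"
    if "b \<in> set ?L" for b
    using level_op_typed[OF \<alpha>, of i d b] that i by (simp add: fibre_def)
  have "composable (tree_operad n \<alpha>) ?c (map (level_op \<alpha> i d) ?L)"
    unfolding tree_operad_def composable_free
    using corolla_in[OF coll_ok_tree, of "(i + Suc d, a)" n \<alpha>] t i
    by (auto simp: in_lists_conv_set)
  then have "G (graft ?c (map (level_op \<alpha> i d) ?L)) = ocomp P (G ?c) (map G (map (level_op \<alpha> i d) ?L))"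
    using m by (simp add: operad_map_def tree_operad_def)
  moreover have "graft ?c (map (level_op \<alpha> i d) ?L) = level_op \<alpha> i (Suc d) a"
    by (subst graft_corolla) simp_all
  ultimately show ?thesis by (simp add: comp_def)
qed

lemma level_op_1: "i < n \<Longrightarrow> level_op \<alpha> i 1 a = corolla (tree_coll n \<alpha>) (Suc i, a)"
  by (simp add: corolla_def comp_def)

context oslist
begin

abbreviation "K \<equiv> tau1_coll X"

lemma K_simps: "gCol K = lsplx X 0" "gens K = lsplx X 1" "gsrc K e = V 1 0 e" "gtgt K e = hd (V 1 1 e)"
  by (simp_all add: tau1_coll_def)

lemma coll_ok_K: "coll_ok K"
  unfolding coll_ok_def K_simps
  using V_in[of 0 1] act_top(2)[OF vertex_in, of 1 1] by (auto simp: in_lists_conv_set)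

lemma edge_top:
  assumes s: "s \<in> lsplx X n" and i: "i \<le> n"
  shows "hd (E n i n s) \<in> lsplx X 1" "V 1 0 (hd (E n i n s)) = V n i s"
    "hd (V 1 1 (hd (E n i n s))) = hd (V n n s)"
proof -
  obtain e where e: "E n i n s = [e]" using E_top[OF i s] by blast
  show "hd (E n i n s) \<in> lsplx X 1" using E_in[OF i order.refl s, of e] unfolding e by simp
  show "V 1 0 (hd (E n i n s)) = V n i s" using E_src[OF i order.refl s] unfolding e by simp
  show "hd (V 1 1 (hd (E n i n s))) = hd (V n n s)"
    using arg_cong[OF E_tgt[OF i order.refl s], of hd] unfolding e by simp
qed

lemma edges2:
  assumes s: "s \<in> lsplx X 2"
  shows "hd (E 2 1 2 s) \<in> lsplx X 1" "hd (E 2 0 2 s) \<in> lsplx X 1"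
    "V 1 0 (hd (E 2 1 2 s)) = V 2 1 s" "V 1 0 (hd (E 2 0 2 s)) = V 2 0 s"
    "hd (V 1 1 (hd (E 2 1 2 s))) = hd (V 2 2 s)" "hd (V 1 1 (hd (E 2 0 2 s))) = hd (V 2 2 s)"
    "E 2 1 2 s = [hd (E 2 1 2 s)]" "E 2 0 2 s = [hd (E 2 0 2 s)]"
  using E_top[OF one_le_numeral s] E_top[OF zero_le s] edge_top[OF s one_le_numeral] edge_top[OF s zero_le]
  by blast+

lemma rel_cases:
  assumes "(f, g) \<in> tau1_rel X"
  obtains (deg) v where "v \<in> lsplx X 0" "f = corolla K (hd (E 0 0 0 v))" "g = Leaf v"
  | (tri) s where "s \<in> lsplx X 2" "f = Node (hd (E 2 1 2 s)) (map (corolla K) (E 2 0 1 s))"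
      "g = corolla K (hd (E 2 0 2 s))"
  using assms unfolding tau1_rel_def by auto

lemma comp_tri:
  assumes s: "s \<in> lsplx X 2"
  shows "composable (free_operad K) (corolla K (hd (E 2 1 2 s))) (map (corolla K) (E 2 0 1 s))"
    "graft (corolla K (hd (E 2 1 2 s))) (map (corolla K) (E 2 0 1 s)) =
      Node (hd (E 2 1 2 s)) (map (corolla K) (E 2 0 1 s))"
proof -
  have m: "map (\<lambda>e. hd (V 1 1 e)) (E 2 0 1 s) = V 2 1 s" using E_tgt[OF _ _ s] by simp
  have c: "corolla K e \<in> optrees K" if "e \<in> set (E 2 0 1 s)" for e
    using corolla_in[OF coll_ok_K] E_in[OF _ _ s, of 0 1] that by (simp add: K_simps)
  have r: "map (tree_root K) (map (corolla K) (E 2 0 1 s)) = V 2 1 s"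
    using m by (simp add: comp_def K_simps)
  show "composable (free_operad K) (corolla K (hd (E 2 1 2 s))) (map (corolla K) (E 2 0 1 s))"
    unfolding composable_free
    using c r corolla_in[OF coll_ok_K] edges2[OF s] by (auto simp: in_lists_conv_set K_simps)
  show "graft (corolla K (hd (E 2 1 2 s))) (map (corolla K) (E 2 0 1 s)) =
      Node (hd (E 2 1 2 s)) (map (corolla K) (E 2 0 1 s))"
    by (rule graft_corolla) (use arg_cong[OF r, of length] edges2[OF s] in \<open>simp add: K_simps\<close>)
qed

lemma par: "parallel (free_operad K) (tau1_rel X)"
  unfolding parallel_def
proof (intro ballI, clarify)
  fix f g assume "(f, g) \<in> tau1_rel X"
  then show "f \<in> Ops (free_operad K) \<and> g \<in> Ops (free_operad K) \<and>
      src (free_operad K) f = src (free_operad K) g \<and> tgt (free_operad K) f = tgt (free_operad K) g"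
  proof (cases rule: rel_cases)
    case (deg v)
    note d = oslist.deg[OF oslist_axioms deg(1)]
    show ?thesis using deg d corolla_in[OF coll_ok_K, of "hd (E 0 0 0 v)"]
      by (auto simp: K_simps intro: optrees.Leaf)
  next
    case (tri s)
    note c = comp_tri[OF tri(1)] and e = edges2[OF tri(1)]
    have 1: "f \<in> optrees K" "leaves f = concat (map leaves (map (corolla K) (E 2 0 1 s)))"
      using graft_typed[of "corolla K (hd (E 2 1 2 s))" K "map (corolla K) (E 2 0 1 s)"] c
      by (simp_all add: tri composable_free)
    have m: "map leaves (map (corolla K) (E 2 0 1 s)) = map (V 1 0) (E 2 0 1 s)" by (simp add: K_simps)
    have "leaves f = V 2 0 s" unfolding 1(2) m using E_src[OF _ _ tri(1), of 0 1] by simp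
    then show ?thesis using 1 e tri corolla_in[OF coll_ok_K] by (simp add: K_simps)
  qed
qed

lemma operad_tau1: "operad (tau1 X)"
  unfolding tau1_def by (rule operad_quotient[OF operad_free_operad[OF coll_ok_K] par])

lemma quotF: "operad_map (free_operad K) (tau1 X) (\<lambda>c. c) (op_class (free_operad K) (tau1_rel X))"
  unfolding tau1_def by (rule quot_map[OF operad_free_operad[OF coll_ok_K] par])

lemma Col_tau1: "Col (tau1 X) = lsplx X 0"
  by (simp add: tau1_def K_simps)

lemma gen_typed: "e \<in> lsplx X 1 \<Longrightarrow> tau1_gen X e \<in> op_set (tau1 X) (V 1 0 e) (hd (V 1 1 e))"
  using quotF corolla_in[OF coll_ok_K, of e] by (auto simp: operad_map_def tau1_gen_def K_simps)

lemma gen_deg: "v \<in> lsplx X 0 \<Longrightarrow> tau1_gen X (hd (E 0 0 0 v)) = idop (tau1 X) v"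
proof -
  assume v: "v \<in> lsplx X 0"
  then have "(corolla K (hd (E 0 0 0 v)), Leaf v) \<in> tau1_rel X" by (auto simp: tau1_rel_def)
  from op_class_eq[OF operad_cong.base, OF this] show ?thesis by (simp add: tau1_gen_def tau1_def)
qed

lemma gen_comp:
  assumes s: "s \<in> lsplx X 2"
  shows "ocomp (tau1 X) (tau1_gen X (hd (E 2 1 2 s))) (map (tau1_gen X) (E 2 0 1 s)) =
    tau1_gen X (hd (E 2 0 2 s))"
proof -
  let ?q = "op_class (free_operad K) (tau1_rel X)"
  have "?q (graft (corolla K (hd (E 2 1 2 s))) (map (corolla K) (E 2 0 1 s))) =
      ocomp (tau1 X) (?q (corolla K (hd (E 2 1 2 s)))) (map ?q (map (corolla K) (E 2 0 1 s)))"
    using quotF comp_tri(1)[OF s] by (simp add: operad_map_def)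
  moreover have "?q (Node (hd (E 2 1 2 s)) (map (corolla K) (E 2 0 1 s))) = ?q (corolla K (hd (E 2 0 2 s)))"
    by (rule op_class_eq[OF operad_cong.base]) (use s in \<open>auto simp: tau1_rel_def\<close>)
  moreover have "map (tau1_gen X) (E 2 0 1 s) = map ?q (map (corolla K) (E 2 0 1 s))"
    by (simp add: tau1_gen_def comp_def)
  ultimately show ?thesis using comp_tri(2)[OF s] unfolding tau1_gen_def by metis
qed

abbreviation "uF n x \<equiv> (\<lambda>(i, a). V n i x ! a)"
abbreviation "uh n x \<equiv> (\<lambda>(i, a). tau1_gen X (E n (i - 1) i x ! a))"

lemma E_nth:
  assumes "i \<le> j" "j \<le> n" "x \<in> lsplx X n" "a < length (V n j x)"
  shows "E n i j x ! a \<in> lsplx X 1" "hd (V 1 1 (E n i j x ! a)) = V n j x ! a"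
proof -
  have l: "a < length (E n i j x)" using length_E[OF assms(1-3)] assms(4) by simp
  then show "E n i j x ! a \<in> lsplx X 1" using E_in[OF assms(1-3)] by simp
  show "hd (V 1 1 (E n i j x ! a)) = V n j x ! a"
    using arg_cong[OF E_tgt[OF assms(1-3)], of "\<lambda>xs. xs ! a"] l by simp
qed

lemma unit_assignment:
  assumes x: "x \<in> lsplx X n"
  shows "assignment (tree_coll n (shape X n x)) (tau1 X) (uF n x) (uh n x)"
  unfolding assignment_def
proof (intro conjI ballI, goal_cases)
  case (1 c)
  then obtain i a where c: "c = (i, a)" "i \<le> n" "a < length (V n i x)"
    by (cases c) (auto simp: lev_shape)
  then show ?case using V_in[OF c(2) x] by (simp add: Col_tau1)
next
  case (2 g)
  then obtain i a where g: "g = (i, a)" "1 \<le> i" "i \<le> n" "a < length (V n i x)"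
    by (cases g) (auto simp: lev_shape)
  have i: "i - 1 \<le> i" by simp
  note e = E_nth[OF i g(3) x g(4)]
  have "map (uF n x) (gsrc (tree_coll n (shape X n x)) g) = V 1 0 (E n (i - 1) i x ! a)"
    using fibre_V[OF i g(3) x g(4)] g(1) by (simp add: comp_def)
  then show ?case using gen_typed[OF e(1)] e(2) g(1) by simp
qed

lemma unit_level_op:
  assumes x: "x \<in> lsplx X n"
  shows "i + d \<le> n \<Longrightarrow> a < length (V n (i + d) x) \<Longrightarrow>
    eval_tree (tau1 X) (uF n x) (uh n x) (level_op (shape X n x) i d a) = tau1_gen X (E n i (i + d) x ! a)"
proof (induction d arbitrary: a)
  case 0
  then show ?case using E_ii[of i n x] x V_in[of i n x] gen_deg by simp
next
  case (Suc d)
  let ?\<alpha> = "shape X n x"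
  let ?e = "eval_tree (tau1 X) (uF n x) (uh n x)"
  let ?t = "tri i (i + d) (i + Suc d)"
  let ?L = "fibre ?\<alpha> (i + d) (i + Suc d) a"
  have ij: "i \<le> i + d" "i + d \<le> i + Suc d" "i + d \<le> n" "i + Suc d \<le> n" using Suc.prems by auto
  note t = tri_in[OF ij(1,2,4)]
  have la: "a < length (lact X 2 n ?t x)" using length_act[OF t x] Suc.prems by simp
  let ?s = "lact X 2 n ?t x ! a"
  have s: "?s \<in> lsplx X 2" using act_in[OF t x] la by simp
  have ss: "length (V 2 2 ?s) = 1" using V_top[OF s] by (metis One_nat_def length_Cons list.size(3))
  have z: "S n (i + Suc d) (i + Suc d) x a = a"
    using S_id[OF ij(4) x] Suc.prems by simp
  have e12: "E n (i + d) (i + Suc d) x ! a = hd (E 2 1 2 ?s)"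
    using E_block(1)[OF t x la, of 1 2 0] ss z edges2(7)[OF s] by (metis One_nat_def tri_simps(2,4)
      add.right_neutral le_refl less_one nth_Cons_0 one_le_numeral)
  have e02: "E n i (i + Suc d) x ! a = hd (E 2 0 2 ?s)"
    using E_block(1)[OF t x la, of 0 2 0] ss z edges2(8)[OF s] by (metis One_nat_def tri_simps(1,4)
      add.right_neutral le_refl less_one nth_Cons_0 zero_le)
  have L: "?L = [S n (i + d) (i + Suc d) x a..<S n (i + d) (i + Suc d) x (Suc a)]"
    using fibre_shape[OF ij(2,4) x] Suc.prems by simp
  have len: "length ?L = length (V 2 1 ?s)"
    using length_fibre_shape[OF ij(2,4) x] Suc.prems e12 edges2(3)[OF s] by simp
  have IH: "map (\<lambda>b. ?e (level_op ?\<alpha> i d b)) ?L = map (tau1_gen X) (E 2 0 1 ?s)"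
  proof (rule nth_equalityI)
    show "length (map (\<lambda>b. ?e (level_op ?\<alpha> i d b)) ?L) = length (map (tau1_gen X) (E 2 0 1 ?s))"
      using len length_E[OF _ _ s, of 0 1] by simp
    fix b assume "b < length (map (\<lambda>b. ?e (level_op ?\<alpha> i d b)) ?L)"
    then have b: "b < length ?L" "b < length (V 2 1 ?s)" using len by simp_all
    have Lb: "?L ! b = S n (i + d) (i + Suc d) x a + b" using L b(1) by simp
    have bl: "E n i (i + d) x ! (S n (i + d) (i + Suc d) x a + b) = E 2 0 1 ?s ! b"
        "S n (i + d) (i + Suc d) x a + b < length (V n (i + d) x)"
      using E_block[OF t x la, of 0 1 b] b(2) by simp_all
    show "map (\<lambda>b. ?e (level_op ?\<alpha> i d b)) ?L ! b = map (tau1_gen X) (E 2 0 1 ?s) ! b"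
      using Suc.IH[OF ij(3) bl(2)] bl(1) b Lb length_E[OF _ _ s, of 0 1] by simp
  qed
  have "?e (level_op ?\<alpha> i (Suc d) a) = ocomp (tau1 X) (?e (corolla (tree_coll n ?\<alpha>) (i + Suc d, a)))
      (map (\<lambda>b. ?e (level_op ?\<alpha> i d b)) ?L)"
    by (rule level_op_step[OF shape_in[OF x], where F = "uF n x"])
      (use operad_map_eval[OF operad_tau1 unit_assignment[OF x]] Suc.prems lev_shape in
        \<open>simp_all add: tree_operad_def\<close>)
  also have "?e (corolla (tree_coll n ?\<alpha>) (i + Suc d, a)) = tau1_gen X (E n (i + d) (i + Suc d) x ! a)"
    using eval_corolla[OF operad_tau1 unit_assignment[OF x], of "(i + Suc d, a)"] Suc.prems lev_shape by simp
  finally show ?case using IH e12 e02 gen_comp[OF s] by simp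
qed

lemma unit_Hom: "x \<in> lsplx X n \<Longrightarrow>
    snd (tau1_unit X n x) \<in> operad_Hom (tree_operad n (shape X n x)) (tau1 X)"
  unfolding tau1_unit_def tree_operad_def
  using free_extension_Hom[OF coll_ok_tree operad_tau1 unit_assignment] by simp

lemma unit_col: "x \<in> lsplx X n \<Longrightarrow> i \<le> n \<Longrightarrow> a < length (V n i x) \<Longrightarrow>
    fst (snd (tau1_unit X n x)) (i, a) = V n i x ! a"
  by (simp add: tau1_unit_def free_extension_def lev_shape)

lemma unit_lop:
  assumes x: "x \<in> lsplx X n" and i: "i \<le> j" "j \<le> n" "a < length (V n j x)"
  shows "snd (snd (tau1_unit X n x)) (level_op (shape X n x) i (j - i) a) = tau1_gen X (E n i j x ! a)"
  using unit_level_op[OF x, of i "j - i" a] level_op_typed[OF shape_in[OF x], of i "j - i" a] i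
  by (simp add: tau1_unit_def free_extension_def lev_shape)

lemma unit_gen:
  assumes x: "x \<in> lsplx X n" and i: "1 \<le> i" "i \<le> n" "a < length (V n i x)"
  shows "snd (snd (tau1_unit X n x)) (corolla (tree_coll n (shape X n x)) (i, a)) = tau1_gen X (E n (i - 1) i x ! a)"
  using unit_lop[OF x, of "i - 1" i a] level_op_1[of "i - 1" n "shape X n x" a] i by simp

theorem unit_hom: "slist_hom X (list_nerve (tau1 X)) (tau1_unit X)"
  unfolding slist_hom_def
proof (intro conjI allI ballI)
  fix n x assume x: "x \<in> lsplx X n"
  then show "tau1_unit X n x \<in> lsplx (list_nerve (tau1 X)) n"
    using unit_Hom[OF x] shape_rooted[OF x] by (simp add: list_nerve_def tau1_unit_def)
next
  fix k n \<theta> x assume \<theta>: "\<theta> \<in> simplex_maps k n" and x: "x \<in> lsplx X n"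
  let ?\<alpha> = "shape X n x"
  define u where "u = snd (tau1_unit X n x)"
  let ?b = "pull_chain k \<theta> ?\<alpha>"
  have ux: "tau1_unit X n x = (?\<alpha>, u)" by (simp add: u_def tau1_unit_def)
  have lev: "lev ?\<alpha> (\<theta> k) = length (lact X k n \<theta> x)"
    using length_act[OF \<theta> x] lev_shape simplex_mapsD[OF \<theta> order.refl order.refl] by simp
  show "map (tau1_unit X k) (lact X k n \<theta> x) = lact (list_nerve (tau1 X)) k n \<theta> (tau1_unit X n x)"
    unfolding ux list_nerve_act
  proof (rule nth_equalityI)
    fix a assume "a < length (map (tau1_unit X k) (lact X k n \<theta> x))"
    then have a: "a < length (lact X k n \<theta> x)" by simp
    let ?y = "lact X k n \<theta> x ! a"
    note y = y_in[OF \<theta> x a] and sub = sub_shape[OF \<theta> x a]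
    note \<alpha> = shape_in[OF x]
    have "snd (tau1_unit X k ?y) = operad_hcomp (tree_operad k (shape X k ?y)) u (restr_map k n \<theta> ?\<alpha> a)"
    proof (rule free_Hom_eqI[OF coll_ok_tree])
      show "snd (tau1_unit X k ?y) \<in> operad_Hom (free_operad (tree_coll k (shape X k ?y))) (tau1 X)"
        using unit_Hom[OF y] by (simp add: tree_operad_def)
      have "operad_hcomp (tree_operad k (shape X k ?y)) u (restr_map k n \<theta> ?\<alpha> a) \<in>
          operad_Hom (tree_operad k (shape X k ?y)) (tau1 X)"
        by (rule operad_hcomp_Hom[OF operad_tree _ unit_Hom[OF x, folded u_def]])
          (use restr_Hom[OF \<alpha> \<theta>, of a] sub in simp)
      then show "operad_hcomp (tree_operad k (shape X k ?y)) u (restr_map k n \<theta> ?\<alpha> a) \<in>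
          operad_Hom (free_operad (tree_coll k (shape X k ?y))) (tau1 X)"
        by (simp add: tree_operad_def)
    next
      fix c assume "c \<in> gCol (tree_coll k (shape X k ?y))"
      then obtain i b where c: "c = (i, b)" "i \<le> k" "b < length (V k i ?y)"
        by (cases c) (auto simp: lev_shape)
      have "fst (restr_map k n \<theta> ?\<alpha> a) (i, b) = (\<theta> i, S n (\<theta> i) (\<theta> k) x a + b)"
        using restr_col[OF \<alpha> \<theta> c(2), of b a] lev_sub[OF \<theta> x a c(2)] c(3) offset_shape[OF \<theta> x a c(2)] by simp
      moreover have "S n (\<theta> i) (\<theta> k) x a + b < length (V n (\<theta> i) x)"
        using E_block(2)[OF \<theta> x a order.refl c(2,3)] .
      ultimately show "fst (snd (tau1_unit X k ?y)) c =
          fst (operad_hcomp (tree_operad k (shape X k ?y)) u (restr_map k n \<theta> ?\<alpha> a)) c"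
        using unit_col[OF y c(2,3)] V_block[OF \<theta> x a c(2,3)] c(1) c(2,3) lev_shape[OF c(2)]
          unit_col[OF x, folded u_def] simplex_mapsD[OF \<theta> order.refl c(2)]
        by (simp add: operad_hcomp_def compose_def tree_operad_def)
    next
      fix g assume g0: "g \<in> gens (tree_coll k (shape X k ?y))"
      then obtain i b where g: "g = (i, b)" "1 \<le> i" "i \<le> k" "b < length (V k i ?y)"
        by (cases g) (auto simp: lev_shape)
      have i: "i - 1 \<le> i" by simp
      note t = simplex_mapsD[OF \<theta> i g(3)]
      have "snd (restr_map k n \<theta> ?\<alpha> a) (corolla (tree_coll k (shape X k ?y)) (i, b)) =
         level_op ?\<alpha> (\<theta> (i - 1)) (\<theta> i - \<theta> (i - 1)) (S n (\<theta> i) (\<theta> k) x a + b)"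
        using restr_gen[OF \<alpha> \<theta> g(2,3), of b a] lev_sub[OF \<theta> x a g(3)] g(4) offset_shape[OF \<theta> x a g(3)] sub by simp
      moreover note bl = E_block[OF \<theta> x a i g(3,4)]
      ultimately show "snd (snd (tau1_unit X k ?y)) (corolla (tree_coll k (shape X k ?y)) g) =
          snd (operad_hcomp (tree_operad k (shape X k ?y)) u (restr_map k n \<theta> ?\<alpha> a))
            (corolla (tree_coll k (shape X k ?y)) g)"
        using unit_gen[OF y g(2-4)] unit_lop[OF x, folded u_def, OF t(1,2) bl(2)] g(1) corolla_in[OF coll_ok_tree g0]
        by (simp add: operad_hcomp_def compose_def tree_operad_def)
    qed
    then have "tau1_unit X k ?y = (shape X k ?y, operad_hcomp (tree_operad k (shape X k ?y)) u (restr_map k n \<theta> ?\<alpha> a))"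
      by (simp add: prod_eq_iff) (simp add: tau1_unit_def)
    then show "map (tau1_unit X k) (lact X k n \<theta> x) ! a =
      map (\<lambda>a. (subchain k ?b a, operad_hcomp (tree_operad k (subchain k ?b a)) u (restr_map k n \<theta> ?\<alpha> a)))
        [0..<lev ?\<alpha> (\<theta> k)] ! a"
      using a lev sub by simp
  qed (use lev in simp)
qed

end


subsection \<open>Universality\<close>

lemma (in oslist) V_top':
  assumes "x \<in> lsplx X n"
  shows "length (V n n x) = 1" "V n n x ! 0 = hd (V n n x)"
proof -
  obtain v where "V n n x = [v]" using V_top[OF assms] by blast
  then show "length (V n n x) = 1" "V n n x ! 0 = hd (V n n x)" by simp_all
qed

lemma (in oslist) E_top':
  assumes "x \<in> lsplx X n" "i \<le> n"
  shows "E n i n x ! 0 = hd (E n i n x)"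
proof -
  obtain v where "E n i n x = [v]" using E_top[OF assms(2,1)] by blast
  then show "E n i n x ! 0 = hd (E n i n x)" by simp
qed

locale nerve_hom = oslist X for X :: "'x slist" +
  fixes P :: "('c, 'o) operad" and f
  assumes P: "operad P" and f: "slist_hom X (list_nerve P) f"
begin

abbreviation "\<alpha> n x \<equiv> fst (f n x)"
abbreviation "\<phi> n x \<equiv> snd (f n x)"

definition col where "col x = fst (\<phi> 0 x) (0, 0)"
definition gen where "gen e = snd (\<phi> 1 e) (corolla (tree_coll 1 (\<alpha> 1 e)) (1, 0))"

lemma f_in: assumes x: "x \<in> lsplx X n"
  shows "\<alpha> n x \<in> rooted_chains n" "\<alpha> n x \<in> chains n" "\<phi> n x \<in> operad_Hom (tree_operad n (\<alpha> n x)) P"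
proof -
  have "f n x \<in> lsplx (list_nerve P) n" using f x by (simp add: slist_hom_def)
  then show "\<alpha> n x \<in> rooted_chains n" "\<alpha> n x \<in> chains n" "\<phi> n x \<in> operad_Hom (tree_operad n (\<alpha> n x)) P"
    by (auto simp: list_nerve_def rooted_chains_def)
qed

lemma f_act: "\<theta> \<in> simplex_maps k n \<Longrightarrow> x \<in> lsplx X n \<Longrightarrow>
    map (f k) (lact X k n \<theta> x) = lact (list_nerve P) k n \<theta> (\<alpha> n x, \<phi> n x)"
  using f by (simp add: slist_hom_def)

lemma lev_f: assumes x: "x \<in> lsplx X n" and i: "i \<le> n"
  shows "lev (\<alpha> n x) i = length (V n i x)"
  using arg_cong[OF f_act[OF vertex_in[OF i] x], of length] unfolding list_nerve_act by simp

lemma f_V: assumes x: "x \<in> lsplx X n" and i: "i \<le> n" "a < length (V n i x)"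
  shows "fst (\<phi> n x) (i, a) = col (V n i x ! a)"
proof -
  have "f 0 (V n i x ! a) = lact (list_nerve P) 0 n (vertex i) (\<alpha> n x, \<phi> n x) ! a"
    using arg_cong[OF f_act[OF vertex_in[OF i(1)] x], of "\<lambda>xs. xs ! a"] i(2) by simp
  then show ?thesis
    using nerve_vertex[OF f_in(2)[OF x] i(1), of a P "\<phi> n x"] lev_f[OF x i(1)] i(2) by (simp add: col_def)
qed

lemma f_E: assumes x: "x \<in> lsplx X n" and i: "i \<le> j" "j \<le> n" "a < length (V n j x)"
  shows "snd (\<phi> n x) (level_op (\<alpha> n x) i (j - i) a) = gen (E n i j x ! a)"
    "length (fibre (\<alpha> n x) i j a) = length (V 1 0 (E n i j x ! a))"
proof -
  let ?z = "E n i j x ! a"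
  have l: "a < length (E n i j x)" using length_E[OF i(1,2) x] i(3) by simp
  have e: "f 1 ?z = lact (list_nerve P) 1 n (edge i j) (\<alpha> n x, \<phi> n x) ! a"
    using arg_cong[OF f_act[OF edge_in[OF i(1,2)] x], of "\<lambda>xs. xs ! a"] l by simp
  have la: "a < lev (\<alpha> n x) j" using lev_f[OF x i(2)] i(3) by simp
  note nerve = nerve_edge[OF f_in(2)[OF x] i(1,2) la, of P "\<phi> n x", folded e]
  show "snd (\<phi> n x) (level_op (\<alpha> n x) i (j - i) a) = gen ?z"
    using nerve(1) by (simp add: gen_def)
  show "length (fibre (\<alpha> n x) i j a) = length (V 1 0 ?z)"
    using nerve(2) lev_f[OF E_nth(1)[OF i(1,2) x i(3)], of 0] by simp
qed

lemma f_shape: assumes x: "x \<in> lsplx X n" shows "\<alpha> n x = shape X n x"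
proof (rule chain_eq_fibreI[OF f_in(2)[OF x] shape_in[OF x]])
  show "lev (\<alpha> n x) i = lev (shape X n x) i" if "i \<le> n" for i
    using lev_f[OF x that] lev_shape[OF that] by simp
  fix i j c assume ij: "i \<le> j" "j \<le> n" and "c < lev (\<alpha> n x) j"
  then have c: "c < length (V n j x)" using lev_f[OF x] by simp
  show "length (fibre (\<alpha> n x) i j c) = length (fibre (shape X n x) i j c)"
    using f_E(2)[OF x ij c] length_fibre_shape[OF ij x c] by simp
qed

lemma f_gen: assumes x: "x \<in> lsplx X n" and i: "1 \<le> i" "i \<le> n" "a < length (V n i x)"
  shows "snd (\<phi> n x) (corolla (tree_coll n (\<alpha> n x)) (i, a)) = gen (E n (i - 1) i x ! a)"
  using f_E(1)[OF x, of "i - 1" i a] level_op_1[of "i - 1" n "\<alpha> n x" a] i by simp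

lemma asg: "assignment K P col gen"
  unfolding assignment_def
proof (intro conjI ballI, goal_cases)
  case (1 v)
  then have v: "v \<in> lsplx X 0" by (simp add: K_simps)
  have "lev (\<alpha> 0 v) 0 = 1" using f_in(1)[OF v] by (simp add: rooted_chains_def)
  then show ?case using Hom_map[OF f_in(3)[OF v]]
    by (simp add: operad_map_def tree_operad_def col_def)
next
  case (2 e)
  then have e: "e \<in> lsplx X 1" by (simp add: K_simps)
  let ?a = "\<alpha> 1 e"
  have l1: "lev ?a 1 = 1" using f_in(1)[OF e] by (simp add: rooted_chains_def)
  have v1: "length (V 1 1 e) = 1" using lev_f[OF e, of 1] l1 by simp
  have "(1, 0) \<in> gens (tree_coll 1 ?a)" using l1 by simp
  note c = corolla_in[OF coll_ok_tree this]
  have "snd (\<phi> 1 e) t \<in> op_set P (map (fst (\<phi> 1 e)) (leaves t)) (fst (\<phi> 1 e) (tree_root (tree_coll 1 ?a) t))"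
    if "t \<in> optrees (tree_coll 1 ?a)" for t
    using Hom_map[OF f_in(3)[OF e]] that by (simp add: operad_map_def tree_operad_def)
  from this[OF c] have
    "gen e \<in> op_set P (map (fst (\<phi> 1 e)) (map (Pair 0) (fibre ?a 0 1 0))) (fst (\<phi> 1 e) (1, 0))"
    by (simp add: gen_def)
  moreover have "map (fst (\<phi> 1 e)) (map (Pair 0) (fibre ?a 0 1 0)) = map col (V 1 0 e)"
  proof -
    have "map (fst (\<phi> 1 e)) (map (Pair 0) (fibre ?a 0 1 0)) = map (\<lambda>b. col (V 1 0 e ! b)) (fibre ?a 0 1 0)"
      using f_V[OF e, of 0] lev_f[OF e, of 0] by (auto simp: fibre_def)
    also have "\<dots> = map col (map ((!) (V 1 0 e)) (fibre (shape X 1 e) 0 1 0))"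
      using f_shape[OF e] by (simp add: comp_def)
    also have "map ((!) (V 1 0 e)) (fibre (shape X 1 e) 0 1 0) = V 1 0 e"
    proof -
      have "0 < length (V 1 1 e)" using v1 by simp
      from fibre_V[OF zero_le order.refl e this] show ?thesis using E101[OF e] by simp
    qed
    finally show ?thesis .
  qed
  moreover have "fst (\<phi> 1 e) (1, 0) = col (hd (V 1 1 e))"
  proof -
    have "0 < length (V 1 1 e)" using v1 by simp
    from f_V[OF e order.refl this] show ?thesis using V_top'(2)[OF e] by simp
  qed
  ultimately show ?case by (simp add: K_simps)
qed

lemma relations:
  assumes "(s, t) \<in> tau1_rel X"
  shows "eval_tree P col gen s = eval_tree P col gen t"
  using assms
proof (cases rule: rel_cases)
  case (deg v)
  note d = oslist.deg[OF oslist_axioms deg(1)]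
  have l: "lev (\<alpha> 0 v) 0 = 1" using f_in(1)[OF deg(1)] by (simp add: rooted_chains_def)
  have "gen (hd (E 0 0 0 v)) = snd (\<phi> 0 v) (Leaf (0, 0))"
    using f_E(1)[OF deg(1) order.refl order.refl, of 0] E_top'[OF deg(1) order.refl] V00[OF deg(1)] by simp
  also have "\<dots> = idop P (col v)"
    using Hom_map[OF f_in(3)[OF deg(1)]] l by (simp add: operad_map_def tree_operad_def col_def)
  finally show ?thesis using deg eval_corolla[OF P asg] d(2) by (simp add: K_simps)
next
  case (tri s)
  note s = tri(1) note e = edges2[OF s]
  let ?a = "\<alpha> 2 s" and ?p = "snd (\<phi> 2 s)"
  have l: "lev ?a 2 = 1" using f_in(1)[OF s] by (simp add: rooted_chains_def)
  have v2: "length (V 2 2 s) = 1" using lev_f[OF s, of 2] l by simp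
  have g12: "gen (hd (E 2 1 2 s)) = ?p (corolla (tree_coll 2 ?a) (2, 0))"
    using f_gen[OF s one_le_numeral order.refl, of 0] v2 E_top'[OF s one_le_numeral] by simp
  have g02: "gen (hd (E 2 0 2 s)) = ?p (level_op ?a 0 2 0)"
    using f_E(1)[OF s zero_le order.refl, of 0] v2 E_top'[OF s zero_le] by simp
  have fib: "fibre ?a 1 2 0 = [0..<length (V 2 1 s)]"
  proof -
    have "S 2 1 2 s 0 = 0" by (simp add: S_def)
    moreover have "S 2 1 2 s 1 = length (V 2 1 s)"
      using S_total[OF one_le_numeral order.refl s] v2 by simp
    ultimately show ?thesis using fibre_shape[OF one_le_numeral order.refl s, of 0] v2 f_shape[OF s] by simp
  qed
  have g01: "map (\<lambda>b. ?p (level_op ?a 0 1 b)) (fibre ?a 1 2 0) = map gen (E 2 0 1 s)"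
  proof (rule nth_equalityI)
    show "length (map (\<lambda>b. ?p (level_op ?a 0 1 b)) (fibre ?a 1 2 0)) = length (map gen (E 2 0 1 s))"
      using fib length_E[OF _ _ s, of 0 1] by simp
    fix b assume "b < length (map (\<lambda>b. ?p (level_op ?a 0 1 b)) (fibre ?a 1 2 0))"
    then have b: "b < length (V 2 1 s)" using fib by simp
    then show "map (\<lambda>b. ?p (level_op ?a 0 1 b)) (fibre ?a 1 2 0) ! b = map gen (E 2 0 1 s) ! b"
      using f_E(1)[OF s, of 0 1 b] fib length_E[OF _ _ s, of 0 1] by simp
  qed
  have "?p (level_op ?a 0 (Suc 1) 0) = ocomp P (?p (corolla (tree_coll 2 ?a) (0 + Suc 1, 0)))
      (map (\<lambda>b. ?p (level_op ?a 0 1 b)) (fibre ?a (0 + 1) (0 + Suc 1) 0))"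
    by (rule level_op_step[OF f_in(2)[OF s] Hom_map[OF f_in(3)[OF s]]]) (use l in \<open>simp_all add: numeral_2_eq_2\<close>)
  then have "?p (level_op ?a 0 2 0) = ocomp P (?p (corolla (tree_coll 2 ?a) (2, 0)))
      (map (\<lambda>b. ?p (level_op ?a 0 1 b)) (fibre ?a 1 2 0))"
    by (simp only: add_0 Suc_1)
  then have "gen (hd (E 2 0 2 s)) = ocomp P (gen (hd (E 2 1 2 s))) (map gen (E 2 0 1 s))"
    unfolding g02 g12 g01 .
  moreover have m: "map (eval_tree P col gen) (map (corolla K) (E 2 0 1 s)) = map gen (E 2 0 1 s)"
    using eval_corolla[OF P asg] E_in[OF _ _ s, of 0 1] by (auto simp: K_simps)
  moreover have "eval_tree P col gen (corolla K (hd (E 2 0 2 s))) = gen (hd (E 2 0 2 s))"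
    using eval_corolla[OF P asg] e(2) by (simp add: K_simps)
  ultimately show ?thesis unfolding tri(2,3) eval_tree.simps m by metis
qed

definition g where
  "g = (restrict col (Col (tau1 X)), \<lambda>F\<in>Ops (tau1 X). eval_tree P col gen (rep F))"

lemmas dsc = quot_descend[OF operad_free_operad[OF coll_ok_K] par
  operad_map_eval[OF P asg] relations, folded tau1_def]

lemma g_Hom: "g \<in> operad_Hom (tau1 X) P"
  using operad_map_cong[OF operad_tau1 dsc(2)] by (auto simp: g_def operad_Hom_def)

lemma g_col: "v \<in> lsplx X 0 \<Longrightarrow> fst g v = col v"
  by (simp add: g_def Col_tau1)

lemma g_gen: "e \<in> lsplx X 1 \<Longrightarrow> snd g (tau1_gen X e) = gen e"
proof -
  assume e: "e \<in> lsplx X 1"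
  then have c: "corolla K e \<in> optrees K" using corolla_in[OF coll_ok_K] by (simp add: K_simps)
  have "tau1_gen X e \<in> Ops (tau1 X)" using gen_typed[OF e] by (simp add: op_set_def)
  then show ?thesis using dsc(1)[of "corolla K e"] c eval_corolla[OF P asg, of e] e
    by (simp add: g_def tau1_gen_def K_simps)
qed

lemma g_unit:
  assumes x: "x \<in> lsplx X n"
  shows "list_nerve_map g n (tau1_unit X n x) = f n x"
proof -
  let ?a = "shape X n x"
  have "operad_hcomp (tree_operad n ?a) g (snd (tau1_unit X n x)) = \<phi> n x"
  proof (rule free_Hom_eqI[OF coll_ok_tree])
    show "operad_hcomp (tree_operad n ?a) g (snd (tau1_unit X n x)) \<in> operad_Hom (free_operad (tree_coll n ?a)) P"
      using operad_hcomp_Hom[OF operad_tree unit_Hom[OF x] g_Hom] by (simp add: tree_operad_def)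
    show "\<phi> n x \<in> operad_Hom (free_operad (tree_coll n ?a)) P"
      using f_in(3)[OF x] f_shape[OF x] by (simp add: tree_operad_def)
  next
    fix c assume "c \<in> gCol (tree_coll n ?a)"
    then obtain i a where c: "c = (i, a)" "i \<le> n" "a < length (V n i x)" "a < lev ?a i"
      by (cases c) (auto simp: lev_shape)
    then show "fst (operad_hcomp (tree_operad n ?a) g (snd (tau1_unit X n x))) c = fst (\<phi> n x) c"
      using unit_col[OF x c(2,3)] f_V[OF x c(2,3)] g_col V_in[OF c(2) x]
      by (simp add: operad_hcomp_def compose_def tree_operad_def)
  next
    fix p assume p: "p \<in> gens (tree_coll n ?a)"
    then obtain i a where c: "p = (i, a)" "1 \<le> i" "i \<le> n" "a < length (V n i x)"
      by (cases p) (auto simp: lev_shape)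
    have i: "i - 1 \<le> i" by simp
    show "snd (operad_hcomp (tree_operad n ?a) g (snd (tau1_unit X n x))) (corolla (tree_coll n ?a) p) =
        snd (\<phi> n x) (corolla (tree_coll n ?a) p)"
      using unit_gen[OF x c(2-4)] f_gen[OF x c(2-4)] f_shape[OF x] g_gen[OF E_nth(1)[OF i c(3) x c(4)]]
        corolla_in[OF coll_ok_tree p] c(1)
      by (simp add: operad_hcomp_def compose_def tree_operad_def)
  qed
  then show ?thesis using f_shape[OF x] by (simp add: list_nerve_map_def tau1_unit_def prod_eq_iff)
qed

lemma unique:
  assumes h: "h \<in> operad_Hom (tau1 X) P"
    and u: "\<And>n x. x \<in> lsplx X n \<Longrightarrow> f n x = list_nerve_map h n (tau1_unit X n x)"
  shows "h = g"
proof -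
  have sh: "\<phi> n x = operad_hcomp (tree_operad n (shape X n x)) h (snd (tau1_unit X n x))" if "x \<in> lsplx X n" for n x
    using u[OF that] by (simp add: list_nerve_map_def tau1_unit_def)
  have hc: "fst h v = col v" if v: "v \<in> lsplx X 0" for v
  proof -
    have "lev (shape X 0 v) 0 = 1" using V00[OF v] lev_shape by simp
    then show ?thesis using sh[OF v] unit_col[OF v, of 0 0] V00[OF v]
      by (simp add: col_def operad_hcomp_def compose_def tree_operad_def)
  qed
  have hg: "snd h (tau1_gen X e) = gen e" if e: "e \<in> lsplx X 1" for e
  proof -
    have v: "length (V 1 1 e) = 1" by (rule V_top'(1)[OF e])
    then have "(1, 0) \<in> gens (tree_coll 1 (shape X 1 e))" using lev_shape[of 1 1 e] by simp
    from corolla_in[OF coll_ok_tree this]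
    have "gen e = snd h (snd (snd (tau1_unit X 1 e)) (corolla (tree_coll 1 (shape X 1 e)) (1, 0)))"
      unfolding gen_def sh[OF e] f_shape[OF e] by (simp add: operad_hcomp_def compose_def tree_operad_def)
    moreover have "0 < length (V 1 1 e)" using v by simp
    note unit_gen[OF e order.refl order.refl this]
    ultimately show ?thesis using E101[OF e] by simp
  qed
  have ev: "snd k (op_class (free_operad K) (tau1_rel X) t) = eval_tree P col gen t"
    if k: "k \<in> operad_Hom (tau1 X) P" and kc: "\<And>v. v \<in> lsplx X 0 \<Longrightarrow> fst k v = col v"
      and kg: "\<And>e. e \<in> lsplx X 1 \<Longrightarrow> snd k (tau1_gen X e) = gen e" and t: "t \<in> optrees K" for k t
  proof -
    let ?q = "op_class (free_operad K) (tau1_rel X)"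
    let ?h = "operad_hcomp (free_operad K) k (\<lambda>c\<in>gCol K. c, restrict ?q (optrees K))"
    let ?f = "free_extension K P col gen"
    have q: "(\<lambda>c\<in>gCol K. c, restrict ?q (optrees K)) \<in> operad_Hom (free_operad K) (tau1 X)"
      using operad_map_cong[OF operad_free_operad[OF coll_ok_K] quotF] by (auto simp: operad_Hom_def)
    have "?h = ?f"
    proof (rule free_Hom_eqI[OF coll_ok_K])
      show "?h \<in> operad_Hom (free_operad K) P"
        by (rule operad_hcomp_Hom[OF operad_free_operad[OF coll_ok_K] q k])
      show "?f \<in> operad_Hom (free_operad K) P" by (rule free_extension_Hom[OF coll_ok_K P asg])
      show "fst ?h c = fst ?f c" if "c \<in> gCol K" for c
        using that kc by (simp add: operad_hcomp_def free_extension_def compose_def K_simps)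
      show "snd ?h (corolla K c) = snd ?f (corolla K c)" if c: "c \<in> gens K" for c
        using c corolla_in[OF coll_ok_K c] kg eval_corolla[OF P asg c]
        by (simp add: operad_hcomp_def free_extension_def compose_def K_simps tau1_gen_def)
    qed
    then have "snd ?h t = snd ?f t" by simp
    then show ?thesis using t by (simp add: operad_hcomp_def free_extension_def compose_def)
  qed
  have O: "Ops (tau1 X) = op_class (free_operad K) (tau1_rel X) ` optrees K" by (simp add: tau1_def)
  have "fst h = fst g"
    by (rule extensionalityI[of _ "Col (tau1 X)"]) (use h g_Hom hc g_col in \<open>auto simp: operad_Hom_def Col_tau1\<close>)
  moreover have "snd h = snd g"
    by (rule extensionalityI[of _ "Ops (tau1 X)"])
      (use h g_Hom ev[OF h hc hg] ev[OF g_Hom g_col g_gen] in \<open>auto simp: operad_Hom_def O\<close>)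
  ultimately show ?thesis by (simp add: prod_eq_iff)
qed

end

theorem tau1_universal:
  assumes "simplicial_list X" "operadic X" "operad P" "slist_hom X (list_nerve P) f"
  shows "\<exists>!g. g \<in> operad_Hom (tau1 X) P \<and>
    (\<forall>n. \<forall>x \<in> lsplx X n. f n x = list_nerve_map g n (tau1_unit X n x))"
proof -
  interpret nerve_hom X P f by unfold_locales (use assms in auto)
  show ?thesis
  proof (rule ex1I[of _ g])
    show "g \<in> operad_Hom (tau1 X) P \<and> (\<forall>n. \<forall>x \<in> lsplx X n. f n x = list_nerve_map g n (tau1_unit X n x))"
      using g_Hom g_unit by metis
  next
    fix h assume "h \<in> operad_Hom (tau1 X) P \<and> (\<forall>n. \<forall>x \<in> lsplx X n. f n x = list_nerve_map h n (tau1_unit X n x))"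
    then show "h = g" using unique[of h] by blast
  qed
qed

theorem operad_tau1: "simplicial_list X \<Longrightarrow> operadic X \<Longrightarrow> operad (tau1 X)"
  by (rule oslist.operad_tau1) unfold_locales

theorem tau1_unit_hom:
  "simplicial_list X \<Longrightarrow> operadic X \<Longrightarrow> slist_hom X (list_nerve (tau1 X)) (tau1_unit X)"
  by (rule oslist.unit_hom) unfold_locales

theorem tau1_map:
  assumes X: "simplicial_list X" "operadic X" and Y: "simplicial_list Y" "operadic Y"
    and h: "slist_hom X Y h"
  shows "tau1_map X Y h \<in> operad_Hom (tau1 X) (tau1 Y)"
    and "x \<in> lsplx X n \<Longrightarrow> tau1_unit Y n (h n x) = list_nerve_map (tau1_map X Y h) n (tau1_unit X n x)"
proof -
  interpret Y: oslist Y by unfold_locales fact+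
  let ?f = "\<lambda>n x. tau1_unit Y n (h n x)"
  have f: "slist_hom X (list_nerve (tau1 Y)) ?f"
    unfolding slist_hom_def
  proof (intro conjI allI ballI)
    fix n x assume "x \<in> lsplx X n"
    then show "?f n x \<in> lsplx (list_nerve (tau1 Y)) n"
      using h Y.unit_hom by (simp add: slist_hom_def)
  next
    fix k n \<theta> x assume t: "\<theta> \<in> simplex_maps k n" "x \<in> lsplx X n"
    have "map (?f k) (lact X k n \<theta> x) = map (tau1_unit Y k) (map (h k) (lact X k n \<theta> x))" by simp
    also have "\<dots> = map (tau1_unit Y k) (lact Y k n \<theta> (h n x))" using h t by (simp add: slist_hom_def)
    also have "\<dots> = lact (list_nerve (tau1 Y)) k n \<theta> (?f n x)"
      using h Y.unit_hom t by (simp add: slist_hom_def)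
    finally show "map (?f k) (lact X k n \<theta> x) = lact (list_nerve (tau1 Y)) k n \<theta> (?f n x)" .
  qed
  interpret nerve_hom X "tau1 Y" ?f by unfold_locales (use X f Y.operad_tau1 in auto)
  have c: "col v = h 0 v" if "v \<in> lsplx X 0" for v
  proof -
    have "h 0 v \<in> lsplx Y 0" using h that by (simp add: slist_hom_def)
    then show ?thesis unfolding col_def using Y.unit_col[of "h 0 v" 0 0 0] Y.V00 by simp
  qed
  have e: "gen e = tau1_gen Y (h 1 e)" if "e \<in> lsplx X 1" for e
  proof -
    have 1: "h 1 e \<in> lsplx Y 1" using h that by (simp add: slist_hom_def)
    have "0 < length (Y.V 1 1 (h 1 e))" using Y.V_top'(1)[OF 1] by simp
    note u = Y.unit_gen[OF 1 order.refl order.refl this]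
    have "fst (?f 1 e) = shape Y 1 (h 1 e)" by (simp add: tau1_unit_def)
    then show ?thesis unfolding gen_def using u Y.E101[OF 1] by simp
  qed
  have ev: "eval_tree (tau1 Y) (h 0) (\<lambda>e. tau1_gen Y (h 1 e)) t = eval_tree (tau1 Y) col gen t"
    if "t \<in> optrees K" for t
    using that
  proof (induction rule: optrees.induct)
    case (Node a ts)
    then have "map (eval_tree (tau1 Y) (h 0) (\<lambda>e. tau1_gen Y (h 1 e))) ts = map (eval_tree (tau1 Y) col gen) ts"
      by auto
    moreover have "gen a = tau1_gen Y (h 1 a)" using e Node.hyps(1) by (simp add: K_simps)
    ultimately show ?case unfolding eval_tree.simps by metis
  qed (simp add: c K_simps)
  have r: "rep F \<in> optrees K" if F: "F \<in> Ops (tau1 X)" for F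
  proof -
    from F obtain t where t: "F = op_class (free_operad K) (tau1_rel X) t" "t \<in> optrees K"
      by (auto simp: tau1_def)
    then have "operad_cong (free_operad K) (tau1_rel X) t (rep F)" using rep_cong[of t "free_operad K"] by simp
    from cong_parallel[OF operad_free_operad[OF coll_ok_K] par this] show ?thesis by simp
  qed
  have eq: "tau1_map X Y h = g"
    unfolding tau1_map_def g_def using c ev r by (auto simp: Col_tau1 intro!: restrict_ext)
  show "tau1_map X Y h \<in> operad_Hom (tau1 X) (tau1 Y)" unfolding eq by (rule g_Hom)
  show "x \<in> lsplx X n \<Longrightarrow> tau1_unit Y n (h n x) = list_nerve_map (tau1_map X Y h) n (tau1_unit X n x)"
    unfolding eq by (simp add: g_unit)
qed


subsection \<open>Thick trees\<close>

lemma tobj_mk [simp]: "i \<le> k \<Longrightarrow> tobj (mk_thick k t u) i = t i"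
  and tmor_mk [simp]: "i \<le> j \<Longrightarrow> j \<le> k \<Longrightarrow> tmor (mk_thick k t u) i j = u i j"
  by (simp_all add: mk_thick_def)

lemma mk_thick_cong:
  "(\<And>i. i \<le> k \<Longrightarrow> t i = t' i) \<Longrightarrow> (\<And>i j. i \<le> j \<Longrightarrow> j \<le> k \<Longrightarrow> u i j = u' i j) \<Longrightarrow>
    mk_thick k t u = mk_thick k t' u'"
  unfolding mk_thick_def by (auto intro!: ext simp: restrict_def)

lemma mk_thick_idem: "mk_thick k (tobj (mk_thick k t u)) (tmor (mk_thick k t u)) = mk_thick k t u"
  by (rule mk_thick_cong) auto

lemma thick_functorsD:
  assumes "\<theta> \<in> thick_functors n m k"
  shows "\<theta> = mk_thick k (tobj \<theta>) (tmor \<theta>)" "\<And>i. i \<le> k \<Longrightarrow> tobj \<theta> i \<le> n"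
    "\<And>i j. i \<le> j \<Longrightarrow> j \<le> k \<Longrightarrow> tmor \<theta> i j \<in> thick_mor m (tobj \<theta> i) (tobj \<theta> j)"
    "\<And>i. i \<le> k \<Longrightarrow> tmor \<theta> i i = (\<lambda>r. {tobj \<theta> i})"
    "\<And>i j l. i \<le> j \<Longrightarrow> j \<le> l \<Longrightarrow> l \<le> k \<Longrightarrow> tmor \<theta> i l = (\<lambda>r. tmor \<theta> j l r \<union> tmor \<theta> i j r)"
  using assms unfolding thick_functors_def by blast+

lemma tobj_mono:
  assumes "\<theta> \<in> thick_functors n m k" "i \<le> j" "j \<le> k"
  shows "tobj \<theta> i \<le> tobj \<theta> j"
proof -
  have "tobj \<theta> i \<in> tmor \<theta> i j 0" "tmor \<theta> i j 0 \<subseteq> {tobj \<theta> i..tobj \<theta> j}"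
    using thick_functorsD(3)[OF assms] by (auto simp: thick_mor_def)
  then show ?thesis by auto
qed

lemma thick_functorsI:
  assumes "\<And>i. i \<le> k \<Longrightarrow> t i \<le> n"
    "\<And>i j. i \<le> j \<Longrightarrow> j \<le> k \<Longrightarrow> u i j \<in> thick_mor m (t i) (t j)"
    "\<And>i. i \<le> k \<Longrightarrow> u i i = (\<lambda>r. {t i})"
    "\<And>i j l. i \<le> j \<Longrightarrow> j \<le> l \<Longrightarrow> l \<le> k \<Longrightarrow> u i l = (\<lambda>r. u j l r \<union> u i j r)"
  shows "mk_thick k t u \<in> thick_functors n m k"
  unfolding thick_functors_def mem_Collect_eq mk_thick_idem
proof (intro conjI allI impI, goal_cases)
  case (5 i j l)
  then have "i \<le> l" "j \<le> k" by auto
  then show ?case using 5 assms(4)[of i j l] by simp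
qed (use assms(1-3) in auto)

lemma thick_pre_in:
  assumes \<theta>: "\<theta> \<in> thick_functors n m k" and \<eta>: "\<eta> \<in> simplex_maps l k"
  shows "thick_pre l \<eta> \<theta> \<in> thick_functors n m l"
  unfolding thick_pre_def
proof (rule thick_functorsI, goal_cases)
  case (1 i) then show ?case using thick_functorsD(2)[OF \<theta>] simplex_mapsD[OF \<eta> order.refl 1] by simp
next
  case (2 i j) then show ?case using thick_functorsD(3)[OF \<theta>] simplex_mapsD[OF \<eta> 2] by simp
next
  case (3 i) then show ?case using thick_functorsD(4)[OF \<theta>] simplex_mapsD[OF \<eta> order.refl 3] by simp
next
  case (4 i j l)
  then have j: "j \<le> l" "l \<le> l" by auto
  show ?case
    by (rule thick_functorsD(5)[OF \<theta>])
      (use 4 simplex_mapsD[OF \<eta>, of i j] simplex_mapsD[OF \<eta>, of j l] in simp_all)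
qed

lemma thick_slist_simps:
  "(\<theta>, a) \<in> lsplx (thick_slist n \<alpha> m) k \<longleftrightarrow> \<theta> \<in> thick_functors n m k \<and> a < lev \<alpha> (tobj \<theta> k)"
  "lact (thick_slist n \<alpha> m) l k \<eta> (\<theta>, a) =
    map (\<lambda>b. (thick_pre l \<eta> \<theta>, b)) (fibre \<alpha> (tobj \<theta> (\<eta> l)) (tobj \<theta> k) a)"
  by (simp_all add: thick_slist_def)

theorem thick_slist:
  assumes \<alpha>: "\<alpha> \<in> chains n"
  shows "simplicial_list (thick_slist n \<alpha> m)" "operadic (thick_slist n \<alpha> m)"
proof -
  show "simplicial_list (thick_slist n \<alpha> m)"
    unfolding simplicial_list_def
  proof (intro conjI allI ballI)
    fix l k \<eta> x assume \<eta>: "\<eta> \<in> simplex_maps l k" and "x \<in> lsplx (thick_slist n \<alpha> m) k"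
    then obtain \<theta> a where x: "x = (\<theta>, a)" "\<theta> \<in> thick_functors n m k"
      by (cases x) (auto simp: thick_slist_simps)
    have "tobj (thick_pre l \<eta> \<theta>) l = tobj \<theta> (\<eta> l)" by (simp add: thick_pre_def)
    then show "lact (thick_slist n \<alpha> m) l k \<eta> x \<in> lists (lsplx (thick_slist n \<alpha> m) l)"
      using thick_pre_in[OF x(2) \<eta>] by (auto simp: x(1) thick_slist_simps in_lists_conv_set fibre_def)
  next
    fix k x assume "x \<in> lsplx (thick_slist n \<alpha> m) k"
    then obtain \<theta> a where x: "x = (\<theta>, a)" "\<theta> \<in> thick_functors n m k" "a < lev \<alpha> (tobj \<theta> k)"
      by (cases x) (auto simp: thick_slist_simps)
    have "thick_pre k (\<lambda>i\<in>{..k}. i) \<theta> = mk_thick k (tobj \<theta>) (tmor \<theta>)"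
      unfolding thick_pre_def by (rule mk_thick_cong) auto
    then have "thick_pre k (\<lambda>i\<in>{..k}. i) \<theta> = \<theta>" using thick_functorsD(1)[OF x(2)] by metis
    then show "lact (thick_slist n \<alpha> m) k k (\<lambda>i\<in>{..k}. i) x = [x]"
      using fibre_id[OF \<alpha> thick_functorsD(2)[OF x(2) order.refl] x(3)] by (simp add: x(1) thick_slist_simps)
  next
    fix p l k \<eta> \<zeta> x
    assume \<eta>: "\<eta> \<in> simplex_maps l k" and \<zeta>: "\<zeta> \<in> simplex_maps p l"
      and "x \<in> lsplx (thick_slist n \<alpha> m) k"
    then obtain \<theta> a where x: "x = (\<theta>, a)" "\<theta> \<in> thick_functors n m k"
      by (cases x) (auto simp: thick_slist_simps)
    have c: "compose {..p} \<eta> \<zeta> i = \<eta> (\<zeta> i)" if "i \<le> p" for i using that by (simp add: compose_def)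
    have pre: "thick_pre p (compose {..p} \<eta> \<zeta>) \<theta> = thick_pre p \<zeta> (thick_pre l \<eta> \<theta>)"
      unfolding thick_pre_def
      by (rule mk_thick_cong) (use c simplex_mapsD[OF \<zeta>] in simp_all)
    note z = simplex_mapsD[OF \<zeta> order.refl order.refl]
    note e = simplex_mapsD[OF \<eta> z(2) order.refl] simplex_mapsD(2)[OF \<eta> order.refl order.refl]
    have t: "tobj (thick_pre l \<eta> \<theta>) (\<zeta> p) = tobj \<theta> (\<eta> (\<zeta> p))" "tobj (thick_pre l \<eta> \<theta>) l = tobj \<theta> (\<eta> l)"
      using z by (simp_all add: thick_pre_def)
    have mc: "map f (concat (map g xs)) = concat (map (\<lambda>x. map f (g x)) xs)" for f :: "nat \<Rightarrow> thick \<times> nat" and g :: "nat \<Rightarrow> nat list" and xs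
      by (simp add: map_concat comp_def)
    have "concat (map (fibre \<alpha> (tobj \<theta> (\<eta> (\<zeta> p))) (tobj \<theta> (\<eta> l))) (fibre \<alpha> (tobj \<theta> (\<eta> l)) (tobj \<theta> k) a)) =
        fibre \<alpha> (tobj \<theta> (\<eta> (\<zeta> p))) (tobj \<theta> k) a"
      using fibre_comp[OF \<alpha> tobj_mono[OF x(2) e(1,2)] tobj_mono[OF x(2) e(4) order.refl]
          thick_functorsD(2)[OF x(2) order.refl]] by simp
    then show "lact (thick_slist n \<alpha> m) p k (compose {..p} \<eta> \<zeta>) x =
        listing_comp (lact (thick_slist n \<alpha> m) p l \<zeta>) (lact (thick_slist n \<alpha> m) l k \<eta>) x"
      unfolding x(1) listing_comp_def thick_slist_simps pre c[OF order.refl]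
      by (simp add: comp_def thick_slist_simps t flip: mc)
  qed
  show "operadic (thick_slist n \<alpha> m)"
    unfolding operadic_def
  proof (intro allI ballI impI)
    fix l k \<eta> x assume \<eta>: "\<eta> \<in> simplex_maps l k" "\<eta> l = k" and "x \<in> lsplx (thick_slist n \<alpha> m) k"
    then obtain \<theta> a where x: "x = (\<theta>, a)" "\<theta> \<in> thick_functors n m k" "a < lev \<alpha> (tobj \<theta> k)"
      by (cases x) (auto simp: thick_slist_simps)
    then show "length (lact (thick_slist n \<alpha> m) l k \<eta> x) = 1"
      using \<eta>(2) fibre_id[OF \<alpha> thick_functorsD(2)[OF x(2) order.refl] x(3)] by (simp add: thick_slist_simps)
  qed
qed


lemma thick_op_in:
  assumes \<theta>: "\<theta> \<in> thick_functors n m k" and \<psi>: "\<psi> \<in> simplex_maps m' m"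
  shows "thick_op k m' \<psi> \<theta> \<in> thick_functors n m' k"
  unfolding thick_op_def
proof (rule thick_functorsI, goal_cases)
  case (1 i) then show ?case using thick_functorsD(2)[OF \<theta>] by simp
next
  case (2 i j)
  note u = thick_functorsD(3)[OF \<theta> 2]
  have "tmor \<theta> i j (\<psi> (min r m')) \<subseteq> tmor \<theta> i j (\<psi> (min s m'))" if "r \<le> s" for r s
  proof -
    have "min r m' \<le> min s m'" using that by (simp add: min.coboundedI1)
    from simplex_mapsD(1)[OF \<psi> this] show ?thesis using u by (auto simp: thick_mor_def mono_def)
  qed
  then show ?case using u by (auto simp: thick_mor_def mono_def min_absorb2)
next
  case (3 i) then show ?case using thick_functorsD(4)[OF \<theta>] by simp
next
  case (4 i j l) then show ?case using thick_functorsD(5)[OF \<theta> 4] by simp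
qed

lemma thick_op_hom:
  assumes \<psi>: "\<psi> \<in> simplex_maps m' m"
  shows "slist_hom (thick_slist n \<alpha> m) (thick_slist n \<alpha> m') (\<lambda>k (\<theta>, a). (thick_op k m' \<psi> \<theta>, a))"
  unfolding slist_hom_def
proof (intro conjI allI ballI)
  fix k x assume "x \<in> lsplx (thick_slist n \<alpha> m) k"
  then show "(\<lambda>(\<theta>, a). (thick_op k m' \<psi> \<theta>, a)) x \<in> lsplx (thick_slist n \<alpha> m') k"
    using thick_op_in[OF _ \<psi>] by (cases x) (auto simp: thick_slist_simps thick_op_def)
next
  fix l k \<eta> x assume \<eta>: "\<eta> \<in> simplex_maps l k" and "x \<in> lsplx (thick_slist n \<alpha> m) k"
  then obtain \<theta> a where x: "x = (\<theta>, a)" "\<theta> \<in> thick_functors n m k"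
    by (cases x) (auto simp: thick_slist_simps)
  have "thick_op l m' \<psi> (thick_pre l \<eta> \<theta>) = thick_pre l \<eta> (thick_op k m' \<psi> \<theta>)"
    unfolding thick_op_def thick_pre_def
    by (rule mk_thick_cong) (use simplex_mapsD[OF \<eta>] in auto)
  moreover have "tobj (thick_op k m' \<psi> \<theta>) (\<eta> l) = tobj \<theta> (\<eta> l)" "tobj (thick_op k m' \<psi> \<theta>) k = tobj \<theta> k"
    using simplex_mapsD[OF \<eta> order.refl order.refl] by (simp_all add: thick_op_def)
  ultimately show "map (\<lambda>(\<theta>, a). (thick_op l m' \<psi> \<theta>, a)) (lact (thick_slist n \<alpha> m) l k \<eta> x) =
      lact (thick_slist n \<alpha> m') l k \<eta> ((\<lambda>(\<theta>, a). (thick_op k m' \<psi> \<theta>, a)) x)"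
    by (simp add: x(1) thick_slist_simps comp_def)
qed

lemma slist_hom_comp:
  assumes "slist_hom X Y f" "slist_hom Y Z g"
  shows "slist_hom X Z (\<lambda>n x. g n (f n x))"
  unfolding slist_hom_def
proof (intro conjI allI ballI)
  fix n x assume "x \<in> lsplx X n"
  then show "g n (f n x) \<in> lsplx Z n" using assms by (simp add: slist_hom_def)
next
  fix k n \<theta> x assume t: "\<theta> \<in> simplex_maps k n" "x \<in> lsplx X n"
  have "map (\<lambda>x. g k (f k x)) (lact X k n \<theta> x) = map (g k) (map (f k) (lact X k n \<theta> x))" by simp
  also have "\<dots> = map (g k) (lact Y k n \<theta> (f n x))" using assms(1) t by (simp add: slist_hom_def)
  also have "\<dots> = lact Z k n \<theta> (g n (f n x))" using assms t by (simp add: slist_hom_def)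
  finally show "map (\<lambda>x. g k (f k x)) (lact X k n \<theta> x) = lact Z k n \<theta> (g n (f n x))" .
qed

lemma tau1_map_unique:
  assumes X: "simplicial_list X" "operadic X" and Y: "simplicial_list Y" "operadic Y" and h: "slist_hom X Y h"
    and g: "g \<in> operad_Hom (tau1 X) (tau1 Y)"
      "\<And>n x. x \<in> lsplx X n \<Longrightarrow> tau1_unit Y n (h n x) = list_nerve_map g n (tau1_unit X n x)"
  shows "g = tau1_map X Y h"
proof -
  let ?P = "\<lambda>g. g \<in> operad_Hom (tau1 X) (tau1 Y) \<and>
    (\<forall>n. \<forall>x \<in> lsplx X n. tau1_unit Y n (h n x) = list_nerve_map g n (tau1_unit X n x))"
  have ex: "\<exists>!g. ?P g"
    by (rule tau1_universal[OF X operad_tau1[OF Y] slist_hom_comp[OF h tau1_unit_hom[OF Y]]])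
  have 1: "?P g" using g by blast
  have 2: "?P (tau1_map X Y h)" using tau1_map[OF X Y h] by blast
  show ?thesis using the1_equality[OF ex 1] the1_equality[OF ex 2] by simp
qed

lemma tau1_map_comp:
  assumes X: "simplicial_list X" "operadic X" and Y: "simplicial_list Y" "operadic Y"
    and Z: "simplicial_list Z" "operadic Z" and h: "slist_hom X Y h" and h': "slist_hom Y Z h'"
  shows "operad_hcomp (tau1 X) (tau1_map Y Z h') (tau1_map X Y h) = tau1_map X Z (\<lambda>n x. h' n (h n x))"
proof (rule tau1_map_unique[OF X Z slist_hom_comp[OF h h']])
  show "operad_hcomp (tau1 X) (tau1_map Y Z h') (tau1_map X Y h) \<in> operad_Hom (tau1 X) (tau1 Z)"
    by (rule operad_hcomp_Hom[OF operad_tau1[OF X] tau1_map(1)[OF X Y h] tau1_map(1)[OF Y Z h']])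
  fix n x assume x: "x \<in> lsplx X n"
  let ?g = "tau1_map X Y h" and ?g' = "tau1_map Y Z h'" and ?u = "snd (tau1_unit X n x)"
  let ?T = "tree_operad n (shape X n x)"
  have u: "?u \<in> operad_Hom ?T (tau1 X)" by (rule oslist.unit_Hom[OF _ x]) (unfold_locales, fact+)
  then have "fst ?u c \<in> Col (tau1 X)" if "c \<in> Col ?T" for c
    using Hom_map[OF u] that by (simp add: operad_map_def)
  moreover have "snd ?u t \<in> Ops (tau1 X)" if "t \<in> Ops ?T" for t
    using Hom_map[OF u] that by (simp add: operad_map_def op_set_def)
  ultimately have e: "operad_hcomp ?T (operad_hcomp (tau1 X) ?g' ?g) ?u = operad_hcomp ?T ?g' (operad_hcomp ?T ?g ?u)"
    by (auto simp: operad_hcomp_def compose_def intro!: restrict_ext)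
  have 1: "h n x \<in> lsplx Y n" using h x by (simp add: slist_hom_def)
  have f: "fst (tau1_unit X n x) = shape X n x" by (simp add: tau1_unit_def)
  have "tau1_unit Z n (h' n (h n x)) = list_nerve_map ?g' n (list_nerve_map ?g n (tau1_unit X n x))"
    using tau1_map(2)[OF Y Z h' 1] tau1_map(2)[OF X Y h x] by simp
  also have "\<dots> = list_nerve_map (operad_hcomp (tau1 X) ?g' ?g) n (tau1_unit X n x)"
    using e by (simp add: list_nerve_map_def split_beta f)
  finally show "tau1_unit Z n (h' n (h n x)) = list_nerve_map (operad_hcomp (tau1 X) ?g' ?g) n (tau1_unit X n x)" .
qed

lemma tau1_map_cong:
  assumes X: "simplicial_list X" "operadic X" and Y: "simplicial_list Y" "operadic Y" and h: "slist_hom X Y h"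
    and e: "\<And>n x. x \<in> lsplx X n \<Longrightarrow> h' n x = h n x"
  shows "tau1_map X Y h' = tau1_map X Y h"
proof -
  have "\<forall>x \<in> set (lact X k n \<theta> x). x \<in> lsplx X k" if "\<theta> \<in> simplex_maps k n" "x \<in> lsplx X n" for k n \<theta> x
    using X(1) that unfolding simplicial_list_def in_lists_conv_set by blast
  then have h': "slist_hom X Y h'"
    using h e unfolding slist_hom_def by (metis (no_types, lifting) map_cong)
  show ?thesis
    by (rule tau1_map_unique[OF X Y h tau1_map(1)[OF X Y h']])
      (use tau1_map(2)[OF X Y h'] e in metis)
qed

lemma tau1_map_id:
  assumes X: "simplicial_list X" "operadic X"
  shows "tau1_map X X (\<lambda>n x. x) = (\<lambda>c\<in>Col (tau1 X). c, \<lambda>f\<in>Ops (tau1 X). f)"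
proof (rule tau1_map_unique[OF X X, symmetric])
  show "slist_hom X X (\<lambda>n x. x)" by (simp add: slist_hom_def)
  have "operad_map (tau1 X) (tau1 X) (\<lambda>c. c) (\<lambda>f. f)"
    using operad_src[OF operad_tau1[OF X]] by (simp add: operad_map_def op_set_def)
  from operad_map_cong[OF operad_tau1[OF X] this]
  show i: "(\<lambda>c\<in>Col (tau1 X). c, \<lambda>f\<in>Ops (tau1 X). f) \<in> operad_Hom (tau1 X) (tau1 X)"
    by (auto simp: operad_Hom_def)
  fix n x assume x: "x \<in> lsplx X n"
  let ?u = "snd (tau1_unit X n x)"
  let ?T = "tree_operad n (shape X n x)"
  have u: "?u \<in> operad_Hom ?T (tau1 X)" by (rule oslist.unit_Hom[OF _ x]) (unfold_locales, fact+)
  have "fst ?u c \<in> Col (tau1 X)" if "c \<in> Col ?T" for c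
    using Hom_map[OF u] that by (simp add: operad_map_def)
  moreover have "snd ?u t \<in> Ops (tau1 X)" if "t \<in> Ops ?T" for t
    using Hom_map[OF u] that by (simp add: operad_map_def op_set_def)
  moreover have "fst ?u \<in> extensional (Col ?T)" "snd ?u \<in> extensional (Ops ?T)"
    using u by (auto simp: operad_Hom_def)
  ultimately have "operad_hcomp ?T (\<lambda>c\<in>Col (tau1 X). c, \<lambda>f\<in>Ops (tau1 X). f) ?u = ?u"
    by (auto simp: operad_hcomp_def compose_def prod_eq_iff extensional_def restrict_def fun_eq_iff)
  then show "tau1_unit X n x = list_nerve_map (\<lambda>c\<in>Col (tau1 X). c, \<lambda>f\<in>Ops (tau1 X). f) n (tau1_unit X n x)"
    by (simp add: list_nerve_map_def split_beta tau1_unit_def)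
qed

lemma thick_vertices:
  "\<theta> \<in> thick_functors n m 0 \<longleftrightarrow> \<theta> = mk_thick 0 (tobj \<theta>) (\<lambda>_ _ _. {tobj \<theta> 0}) \<and> tobj \<theta> 0 \<le> n"
proof
  assume \<theta>: "\<theta> \<in> thick_functors n m 0"
  have "\<theta> = mk_thick 0 (tobj \<theta>) (tmor \<theta>)" by (rule thick_functorsD(1)[OF \<theta>])
  also have "\<dots> = mk_thick 0 (tobj \<theta>) (\<lambda>_ _ _. {tobj \<theta> 0})"
    by (rule mk_thick_cong) (use thick_functorsD(4)[OF \<theta>] in auto)
  finally show "\<theta> = mk_thick 0 (tobj \<theta>) (\<lambda>_ _ _. {tobj \<theta> 0}) \<and> tobj \<theta> 0 \<le> n"
    using thick_functorsD(2)[OF \<theta>] by simp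
next
  assume a: "\<theta> = mk_thick 0 (tobj \<theta>) (\<lambda>_ _ _. {tobj \<theta> 0}) \<and> tobj \<theta> 0 \<le> n"
  have "mk_thick 0 (tobj \<theta>) (\<lambda>_ _ _. {tobj \<theta> 0}) \<in> thick_functors n m 0"
    by (rule thick_functorsI) (use a in \<open>auto simp: thick_mor_def mono_def\<close>)
  then show "\<theta> \<in> thick_functors n m 0" using a by metis
qed

lemma thick_op_vertex:
  assumes "\<theta> \<in> thick_functors n m 0" shows "thick_op 0 m' \<psi> \<theta> = \<theta>"
proof -
  have "thick_op 0 m' \<psi> \<theta> = mk_thick 0 (tobj \<theta>) (tmor \<theta>)"
    unfolding thick_op_def by (rule mk_thick_cong) (use thick_functorsD(4)[OF assms] in auto)
  then show ?thesis using thick_functorsD(1)[OF assms] by metis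
qed

theorem simplicial_operad_thick:
  assumes \<alpha>: "\<alpha> \<in> chains n"
  shows "simplicial_operad (thick_operad n \<alpha>)"
proof -
  let ?U = "thick_slist n \<alpha>"
  let ?h = "\<lambda>m' \<psi> (k::nat) (\<theta>, a). (thick_op k m' \<psi> \<theta>, a)"
  note U = thick_slist[OF \<alpha>]
  have Col: "Col (tau1 (?U m)) = lsplx (?U m) 0" for m
    by (simp add: tau1_def tau1_coll_def)
  have Hom: "tau1_map (?U m) (?U m') (?h m' \<psi>) \<in> operad_Hom (tau1 (?U m)) (tau1 (?U m'))"
    if "\<psi> \<in> simplex_maps m' m" for m m' \<psi>
    by (rule tau1_map(1)[OF U U thick_op_hom[OF that]])
  show ?thesis
    unfolding simplicial_operad_def thick_operad_def soperad.select_convs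
  proof (intro conjI allI ballI, goal_cases)
    case (1 m) show ?case by (rule operad_tau1[OF U])
  next
    case (2 m)
    show ?case unfolding Col
      by (auto simp: thick_slist_def thick_vertices[of _ n m] thick_vertices[of _ n 0])
  next
    case (3 k m \<psi>)
    have m: "operad_map (tau1 (?U m)) (tau1 (?U k)) (fst (tau1_map (?U m) (?U k) (?h k \<psi>)))
       (snd (tau1_map (?U m) (?U k) (?h k \<psi>)))"
      by (rule Hom_map[OF Hom[OF 3]])
    have "fst (tau1_map (?U m) (?U k) (?h k \<psi>)) c = c" if "c \<in> Col (tau1 (?U m))" for c
      using that thick_op_vertex unfolding tau1_map_def Col by (cases c) (auto simp: thick_slist_simps)
    then show ?case by (intro operad_map_cong[OF operad_tau1[OF U] m]) simp_all
  next
    case (4 m f)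
    have "thick_op k m (\<lambda>i\<in>{..m}. i) \<theta> = \<theta>" if \<theta>: "\<theta> \<in> thick_functors n m k" for k \<theta>
    proof -
      have "thick_op k m (\<lambda>i\<in>{..m}. i) \<theta> = mk_thick k (tobj \<theta>) (tmor \<theta>)"
        unfolding thick_op_def
      proof (rule mk_thick_cong)
        fix i j assume "i \<le> j" "j \<le> k"
        then have c: "tmor \<theta> i j r = tmor \<theta> i j m" if "r \<ge> m" for r
          using thick_functorsD(3)[OF \<theta>] that unfolding thick_mor_def by blast
        show "(\<lambda>r. tmor \<theta> i j ((\<lambda>i\<in>{..m}. i) (min r m))) = tmor \<theta> i j"
        proof
          fix r show "tmor \<theta> i j ((\<lambda>i\<in>{..m}. i) (min r m)) = tmor \<theta> i j r"
            by (cases "r \<le> m") (use c[of r] in simp_all)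
        qed
      qed simp
      then show ?thesis using thick_functorsD(1)[OF \<theta>] by metis
    qed
    then have "tau1_map (?U m) (?U m) (?h m (\<lambda>i\<in>{..m}. i)) = tau1_map (?U m) (?U m) (\<lambda>n x. x)"
      by (intro tau1_map_cong[OF U U]) (auto simp: slist_hom_def thick_slist_simps)
    then show ?case using tau1_map_id[OF U] 4 by simp
  next
    case (5 l k m \<theta> \<eta> f)
    have "?h l (compose {..l} \<theta> \<eta>) j x = ?h l \<eta> j (?h k \<theta> j x)" for j x
    proof -
      have "thick_op j l (compose {..l} \<theta> \<eta>) \<zeta> = thick_op j l \<eta> (thick_op j k \<theta> \<zeta>)" for \<zeta>
        unfolding thick_op_def
      proof (rule mk_thick_cong)
        have "\<eta> (min r l) \<le> k" for r using simplex_mapsD(2)[OF 5(2), of "min r l" "min r l"] by simp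
        then show "(\<lambda>r. tmor \<zeta> p q (compose {..l} \<theta> \<eta> (min r l))) = (\<lambda>r. tmor
          (mk_thick j (tobj \<zeta>) (\<lambda>i j r. tmor \<zeta> i j (\<theta> (min r k)))) p q (\<eta> (min r l)))"
          if "p \<le> q" "q \<le> j" for p q
          using that by (simp add: compose_def min_absorb1)
      qed simp
      then show ?thesis by (simp add: split_beta)
    qed
    then have e: "?h l (compose {..l} \<theta> \<eta>) = (\<lambda>j x. ?h l \<eta> j (?h k \<theta> j x))" by blast
    have "tau1_map (?U m) (?U l) (?h l (compose {..l} \<theta> \<eta>)) =
        operad_hcomp (tau1 (?U m)) (tau1_map (?U k) (?U l) (?h l \<eta>)) (tau1_map (?U m) (?U k) (?h k \<theta>))"
      unfolding e by (rule tau1_map_comp[OF U U U thick_op_hom[OF 5(1)] thick_op_hom[OF 5(2)], symmetric])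
    then show ?case using 5(3) by (simp add: operad_hcomp_def compose_def)
  qed
qed

end

theory Submission
  imports Defs
begin

text \<open>On generators, a morphism from the thick operad of a chain \<open>\<alpha>\<close> to \<open>Q\<close> is a family of colours together
  with operations indexed by simplices of the cubes of subsets of \<open>{i..j}\<close>, compatible with
  composition and with the simplicial operators. This description makes sense for chains that are not rooted, and a
  list of simplices of the coherent list nerve is then the same thing as one such family over the
  disjoint union of its chains. For an inner horn, everything is determined except the operations from
  level \<open>0\<close> to level \<open>n\<close>; these are prescribed on a cube without its interior and one face, and
  extend because the operation spaces are Kan complexes.\<close>

subsection \<open>Morphisms out of \<open>\<tau>\<^sub>1 X\<close>\<close>

text \<open>Even when the other faces of a horn are single trees, the face opposite to n ends at
  level n - 1 and is in general a list of trees. Unrooted families make every face one object, so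
  that cutting into trees becomes bookkeeping kept apart from the homotopical argument. The cube to
  be filled consists of the sets X with {0, n} \<subseteq> X \<subseteq> {..n}. If all members of a
  chain contain k, the value is a composite at level k; if all omit k, it comes from the k-th face
  of the horn. Only the face of sets omitting \<open>i\<close> and the interior remain free. In the
  matching, \<open>L \<union> {i}\<close> can be the largest member of its chain, so outer horns
  occur: already for n = 2 a single edge is filled starting from its last vertex. This is where Kan
  complexes, rather than quasi-categories, enter.\<close>

context oslist
begin

lemma gen_in: "e \<in> lsplx X 1 \<Longrightarrow> tau1_gen X e \<in> Ops (tau1 X)"
  using gen_typed by (auto simp: op_set_def)

lemma Ops_tau1: "Ops (tau1 X) = op_class (free_operad K) (tau1_rel X) ` optrees K"
  by (simp add: tau1_def)

text \<open>Precomposition with the quotient map reduces the claim to the free operad, where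
  \<open>operad_map_eq_eval\<close> shows that values on corollas determine everything. The
  restrictions make the maps extensional, as \<open>operad_hcomp_Hom\<close> requires.\<close>

lemma tau1_map_eval:
  assumes P: "operad P" and m: "operad_map (tau1 X) P F G" and t: "t \<in> optrees K"
  shows "G (op_class (free_operad K) (tau1_rel X) t) = eval_tree P F (\<lambda>e. G (tau1_gen X e)) t"
proof -
  let ?q = "op_class (free_operad K) (tau1_rel X)"
  have "operad_map (free_operad K) P F (G \<circ> ?q)"
  proof -
    have q: "(\<lambda>c\<in>gCol K. c, restrict ?q (optrees K)) \<in> operad_Hom (free_operad K) (tau1 X)"
      using operad_map_cong[OF operad_free_operad[OF coll_ok_K] quotF] by (auto simp: operad_Hom_def)
    have x: "(restrict F (Col (tau1 X)), restrict G (Ops (tau1 X))) \<in> operad_Hom (tau1 X) P"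
      using operad_map_cong[OF operad_tau1 m] by (auto simp: operad_Hom_def)
    show ?thesis
      by (rule operad_map_cong[OF operad_free_operad[OF coll_ok_K]
            Hom_map[OF operad_hcomp_Hom[OF operad_free_operad[OF coll_ok_K] q x]]])
        (auto simp: operad_hcomp_def compose_def K_simps Col_tau1 Ops_tau1)
  qed
  from operad_map_eq_eval[OF coll_ok_K this t] show ?thesis by (simp add: tau1_gen_def)
qed

lemma eval_cong:
  assumes "\<And>c. c \<in> gCol K \<Longrightarrow> F c = F' c" "\<And>e. e \<in> gens K \<Longrightarrow> h e = h' e"
  shows "t \<in> optrees K \<Longrightarrow> eval_tree P F h t = eval_tree P F' h' t"
proof (induction rule: optrees.induct)
  case (Node g ts)
  then have "map (eval_tree P F h) ts = map (eval_tree P F' h') ts" by simp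
  then show ?case using assms(2)[OF Node.hyps(1)] by (metis eval_tree.simps(2))
qed (simp add: assms)

lemma tau1_map_eqI:
  assumes P: "operad P" and m: "operad_map (tau1 X) P F G" "operad_map (tau1 X) P F' G'"
    and c: "\<And>v. v \<in> lsplx X 0 \<Longrightarrow> F v = F' v"
    and g: "\<And>e. e \<in> lsplx X 1 \<Longrightarrow> G (tau1_gen X e) = G' (tau1_gen X e)"
    and f: "f \<in> Ops (tau1 X)"
  shows "G f = G' f"
proof -
  obtain t where t: "f = op_class (free_operad K) (tau1_rel X) t" "t \<in> optrees K"
    using f by (auto simp: Ops_tau1)
  show ?thesis unfolding t(1) tau1_map_eval[OF P m(1) t(2)] tau1_map_eval[OF P m(2) t(2)]
    by (rule eval_cong[OF _ _ t(2)]) (use c g in \<open>auto simp: K_simps\<close>)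
qed

lemma tau1_Hom_eqI:
  assumes P: "operad P" and x: "x \<in> operad_Hom (tau1 X) P" "y \<in> operad_Hom (tau1 X) P"
    and c: "\<And>v. v \<in> lsplx X 0 \<Longrightarrow> fst x v = fst y v"
    and g: "\<And>e. e \<in> lsplx X 1 \<Longrightarrow> snd x (tau1_gen X e) = snd y (tau1_gen X e)"
  shows "x = y"
proof -
  have "fst x = fst y"
    by (rule extensionalityI[of _ "Col (tau1 X)"]) (use x c in \<open>auto simp: operad_Hom_def Col_tau1\<close>)
  moreover have "snd x = snd y"
    by (rule extensionalityI[of _ "Ops (tau1 X)"])
      (use x tau1_map_eqI[OF P Hom_map[OF x(1)] Hom_map[OF x(2)] c g] in \<open>auto simp: operad_Hom_def\<close>)
  ultimately show ?thesis by (simp add: prod_eq_iff)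
qed

text \<open>The presentation in directly usable form: one condition for each degenerate edge and one
  for each 2-simplex, without constructing a morphism into the list nerve.\<close>

lemma tau1_Hom_exists:
  assumes P: "operad P" and a: "assignment K P F h"
    and deg: "\<And>v. v \<in> lsplx X 0 \<Longrightarrow> h (hd (E 0 0 0 v)) = idop P (F v)"
    and tri: "\<And>s. s \<in> lsplx X 2 \<Longrightarrow>
      ocomp P (h (hd (E 2 1 2 s))) (map h (E 2 0 1 s)) = h (hd (E 2 0 2 s))"
  shows "\<exists>x \<in> operad_Hom (tau1 X) P. (\<forall>v \<in> lsplx X 0. fst x v = F v) \<and>
    (\<forall>e \<in> lsplx X 1. snd x (tau1_gen X e) = h e)"
proof -
  let ?G = "eval_tree P F h"
  have rel: "?G s = ?G t" if "(s, t) \<in> tau1_rel X" for s t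
    using that
  proof (cases rule: rel_cases)
    case (deg v)
    note d = oslist.deg[OF oslist_axioms deg(1)]
    show ?thesis using deg assms(3)[OF deg(1)] eval_corolla[OF P a] d(2) by (simp add: K_simps)
  next
    case (tri s)
    note e = edges2[OF tri(1)]
    have m: "map ?G (map (corolla K) (E 2 0 1 s)) = map h (E 2 0 1 s)"
      using eval_corolla[OF P a] E_in[OF _ _ tri(1), of 0 1] by (auto simp: K_simps)
    have "?G (corolla K (hd (E 2 0 2 s))) = h (hd (E 2 0 2 s))"
      using eval_corolla[OF P a] e(2) by (simp add: K_simps)
    then show ?thesis unfolding tri(2,3) eval_tree.simps m using assms(4)[OF tri(1)] by simp
  qed
  note dsc = quot_descend[OF operad_free_operad[OF coll_ok_K] par operad_map_eval[OF P a] rel, folded tau1_def]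
  let ?x = "(restrict F (Col (tau1 X)), \<lambda>C\<in>Ops (tau1 X). ?G (rep C))"
  have "?x \<in> operad_Hom (tau1 X) P"
    using operad_map_cong[OF operad_tau1 dsc(2)] by (auto simp: operad_Hom_def)
  moreover have "snd ?x (tau1_gen X e) = h e" if e: "e \<in> lsplx X 1" for e
  proof -
    have c: "corolla K e \<in> optrees K" using corolla_in[OF coll_ok_K] e by (simp add: K_simps)
    show ?thesis using dsc(1)[of "corolla K e"] c eval_corolla[OF P a, of e] e gen_in[OF e]
      by (simp add: tau1_gen_def K_simps)
  qed
  ultimately show ?thesis by (intro bexI[of _ ?x]) (auto simp: Col_tau1)
qed

end

text \<open>\<open>tau1_map\<close> is defined through representatives of classes. Naturality of the
  unit at the 1-simplex \<open>e\<close> gives its value on generators without touching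
  representatives, since the unit sends the only corolla of the shape of \<open>e\<close> to the
  generator \<open>e\<close>.\<close>

lemma tau1_map_gen:
  assumes X: "simplicial_list X" "operadic X" and Y: "simplicial_list Y" "operadic Y"
    and h: "slist_hom X Y h" and e: "e \<in> lsplx X 1"
  shows "snd (tau1_map X Y h) (tau1_gen X e) = tau1_gen Y (h 1 e)"
proof -
  interpret X: oslist X by unfold_locales fact+
  interpret Y: oslist Y by unfold_locales fact+
  have 1: "h 1 e \<in> lsplx Y 1" using h e by (simp add: slist_hom_def)
  have l: "0 < length (X.V 1 1 e)" "0 < length (Y.V 1 1 (h 1 e))" using X.V_top'(1)[OF e] Y.V_top'(1)[OF 1] by simp_all
  have u: "tau1_unit Y 1 (h 1 e) = list_nerve_map (tau1_map X Y h) 1 (tau1_unit X 1 e)"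
    by (rule tau1_map(2)[OF X Y h e])
  have s: "shape Y 1 (h 1 e) = shape X 1 e" using arg_cong[OF u, of fst] by (simp add: list_nerve_map_def tau1_unit_def)
  let ?c = "corolla (tree_coll 1 (shape X 1 e)) (1, 0)"
  have "(1, 0) \<in> gens (tree_coll 1 (shape X 1 e))" using X.lev_shape[of 1 1 e] l(1) by simp
  from corolla_in[OF coll_ok_tree this]
  have "snd (snd (tau1_unit Y 1 (h 1 e))) ?c = snd (tau1_map X Y h) (snd (snd (tau1_unit X 1 e)) ?c)"
    unfolding u by (simp add: list_nerve_map_def tau1_unit_def operad_hcomp_def compose_def tree_operad_def)
  then show ?thesis
    using X.unit_gen[OF e order.refl order.refl l(1)] Y.unit_gen[OF 1 order.refl order.refl l(2)] s
      X.E101[OF e] Y.E101[OF 1] by simp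
qed

subsection \<open>Box filling in Kan complexes\<close>

text \<open>As in \<^const>\<open>thick_mor\<close>, a chain of length \<open>m\<close> is extended to a sequence constant from \<open>m\<close> on.\<close>

definition complex_splx :: "nat \<Rightarrow> 'a::order set set \<Rightarrow> (nat \<Rightarrow> 'a) set" where
  "complex_splx m K = {U. mono U \<and> (\<forall>r\<ge>m. U r = U m) \<and> range U \<in> K}"

lemma complex_splxD:
  assumes "U \<in> complex_splx m K"
  shows "mono U" "\<And>r. r \<ge> m \<Longrightarrow> U r = U m" "range U \<in> K"
    "range U \<in> K' \<Longrightarrow> U \<in> complex_splx m K'"
  using assms unfolding complex_splx_def by blast+

text \<open>\<open>min r m'\<close> keeps the argument of \<psi> inside its domain and makes the
  result constant from \<open>m'\<close> on.\<close>

definition seq_op :: "nat \<Rightarrow> (nat \<Rightarrow> nat) \<Rightarrow> (nat \<Rightarrow> 'a) \<Rightarrow> nat \<Rightarrow> 'a" where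
  "seq_op m' \<psi> U = (\<lambda>r. U (\<psi> (min r m')))"

text \<open>\<open>K\<close> plays the role of an ordered simplicial complex, and the condition is
  that of a simplicial map out of the simplicial set it generates.\<close>

definition complex_hom :: "'a::order set set \<Rightarrow> 's sset \<Rightarrow> (nat \<Rightarrow> (nat \<Rightarrow> 'a) \<Rightarrow> 's) \<Rightarrow> bool" where
  "complex_hom K S f \<longleftrightarrow>
    (\<forall>m. \<forall>U \<in> complex_splx m K. f m U \<in> splx S m \<and>
      (\<forall>m'. \<forall>\<psi> \<in> simplex_maps m' m. f m' (seq_op m' \<psi> U) = sact S m' m \<psi> (f m U)))"

definition subset_closed :: "'a set set \<Rightarrow> bool" where
  "subset_closed K \<longleftrightarrow> (\<forall>C \<in> K. \<forall>B. B \<subseteq> C \<and> B \<noteq> {} \<longrightarrow> B \<in> K)"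

lemma simplex_mapsI:
  "(\<And>i. i \<le> k \<Longrightarrow> \<theta> i \<le> n) \<Longrightarrow> (\<And>i j. i \<le> j \<Longrightarrow> j \<le> k \<Longrightarrow> \<theta> i \<le> \<theta> j) \<Longrightarrow>
    (\<And>i. \<not> i \<le> k \<Longrightarrow> \<theta> i = undefined) \<Longrightarrow> \<theta> \<in> simplex_maps k n"
  by (auto simp: simplex_maps_def mono_on_def extensional_def PiE_def)

lemma simplex_maps_ext: "\<theta> \<in> simplex_maps k n \<Longrightarrow> \<not> i \<le> k \<Longrightarrow> \<theta> i = undefined"
  by (auto simp: simplex_maps_def PiE_def extensional_def)

lemma simplex_maps_comp:
  assumes "\<theta> \<in> simplex_maps k n" "\<eta> \<in> simplex_maps l k"
  shows "compose {..l} \<theta> \<eta> \<in> simplex_maps l n"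
proof (rule simplex_mapsI)
  fix i j assume ij: "i \<le> j" "j \<le> l"
  note e = simplex_mapsD[OF assms(2) ij]
  show "compose {..l} \<theta> \<eta> i \<le> compose {..l} \<theta> \<eta> j"
    using simplex_mapsD(1)[OF assms(1) e(1,2)] ij by (simp add: compose_def)
next
  fix i assume i: "i \<le> l"
  note e = simplex_mapsD[OF assms(2) order.refl i]
  show "compose {..l} \<theta> \<eta> i \<le> n" using simplex_mapsD(2)[OF assms(1) order.refl e(2)] i by (simp add: compose_def)
qed (simp add: compose_def)

lemma simplex_maps_eqI:
  assumes "\<theta> \<in> simplex_maps k n" "\<eta> \<in> simplex_maps k n" "\<And>i. i \<le> k \<Longrightarrow> \<theta> i = \<eta> i"
  shows "\<theta> = \<eta>"
proof
  fix i show "\<theta> i = \<eta> i"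
    using assms(3) simplex_maps_ext[OF assms(1)] simplex_maps_ext[OF assms(2)] by (cases "i \<le> k") auto
qed

text \<open>Identifies the vertices of one simplex of a complex with an initial segment of the
  naturals, so that increasing sequences in \<open>C\<close> become operators into a standard
  simplex.\<close>

lemma chain_enum:
  fixes C :: "'a::order set"
  assumes "finite C" "\<And>x y. x \<in> C \<Longrightarrow> y \<in> C \<Longrightarrow> x \<le> y \<or> y \<le> x"
  shows "\<exists>e. bij_betw e {..<card C} C \<and> strict_mono_on {..<card C} e"
  using assms
proof (induction "card C" arbitrary: C)
  case 0 then show ?case by (auto simp: strict_mono_on_def bij_betw_def)
next
  case (Suc d)
  then have "C \<noteq> {}" by auto
  with Suc.prems obtain t where t: "t \<in> C" "\<And>x. x \<in> C \<Longrightarrow> t \<le> x \<Longrightarrow> t = x"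
    using finite_has_maximal[of C] by metis
  then have top: "x < t" if "x \<in> C - {t}" for x using that Suc.prems(2)[of x t] by (force simp: less_le)
  have d: "card (C - {t}) = d" using Suc.hyps(2) t(1) Suc.prems(1) by simp
  obtain e where e: "bij_betw e {..<d} (C - {t})" "strict_mono_on {..<d} e"
    using Suc.hyps(1)[of "C - {t}"] Suc.prems d by auto
  let ?e = "e(d := t)"
  have "bij_betw ?e {..<d} (C - {t})" using e(1) by (subst bij_betw_cong[of _ _ e]) auto
  then have "bij_betw ?e ({..<d} \<union> {d}) ((C - {t}) \<union> {t})"
    by (rule bij_betw_combine) (auto simp: bij_betw_def)
  moreover have "{..<d} \<union> {d} = {..<Suc d}" "(C - {t}) \<union> {t} = C" using t(1) by auto
  moreover have "strict_mono_on {..<Suc d} ?e"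
  proof (rule strict_mono_onI)
    fix r s assume rs: "r \<in> {..<Suc d}" "s \<in> {..<Suc d}" "r < s"
    then have "e r \<in> C - {t}" using e(1) by (auto simp: bij_betw_def)
    with rs top[of "e r"] e(2) show "?e r < ?e s" by (auto simp: strict_mono_on_def less_Suc_eq)
  qed
  ultimately show ?case using Suc.hyps(2) by (metis)
qed

text \<open>The members of \<open>K\<close> inside \<open>C\<close> form exactly the horn of
  \<open>C\<close> at \<open>x\<close>: all facets containing \<open>x\<close> are present, the
  facet opposite to \<open>x\<close> and \<open>C\<close> itself are not. Adding these two is
  therefore one horn filling.\<close>

lemma complex_step:
  fixes C :: "'a::order set"
  assumes S: "simplicial_set S" "\<And>n i. 1 \<le> n \<Longrightarrow> i \<le> n \<Longrightarrow> fills_horn S n i"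
    and K: "subset_closed K" and f: "complex_hom K S f"
    and C: "finite C" "\<And>x y. x \<in> C \<Longrightarrow> y \<in> C \<Longrightarrow> x \<le> y \<or> y \<le> x"
    and x: "x \<in> C" "C - {x} \<noteq> {}" "C \<notin> K" "C - {x} \<notin> K"
    and faces: "\<And>y. y \<in> C \<Longrightarrow> y \<noteq> x \<Longrightarrow> C - {y} \<in> K"
  shows "\<exists>g. complex_hom (K \<union> {C, C - {x}}) S g \<and> (\<forall>m. \<forall>U \<in> complex_splx m K. g m U = f m U)"
proof -
  obtain e where e: "bij_betw e {..<card C} C" "strict_mono_on {..<card C} e"
    using chain_enum[OF C] by blast
  have "card (C - {x}) \<noteq> 0" using x(2) C(1) by simp
  then have c2: "card C \<ge> 2" using x(1) C(1) by (simp add: card_Diff_singleton)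
  define d where "d = card C - 1"
  have d: "1 \<le> d" "{..<card C} = {..d}" using c2 by (auto simp: d_def)
  note e = e[unfolded d(2)]
  have ele: "e r \<le> e s \<longleftrightarrow> r \<le> s" if "r \<le> d" "s \<le> d" for r s
    using strict_mono_on_less_eq[OF e(2)] that by simp
  have einj: "e r = e s \<longleftrightarrow> r = s" if "r \<le> d" "s \<le> d" for r s
    using e(1) that by (auto simp: bij_betw_def inj_on_def)
  have eC: "e ` {..d} = C" using e(1) by (simp add: bij_betw_def)
  obtain p where p: "p \<le> d" "e p = x" using x(1) eC by auto
  define \<iota> where "\<iota> = inv_into {..d} e"
  have \<iota>: "\<iota> z \<le> d" "e (\<iota> z) = z" if "z \<in> C" for z
    using that eC inv_into_into[of z e "{..d}"] f_inv_into_f[of z e "{..d}"] by (auto simp: \<iota>_def)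
  \<comment> \<open>\<open>T\<close> reads an operator into the standard simplex as a sequence in
    \<open>C\<close>; \<open>R\<close> below is its inverse.\<close>
  define T where "T k \<theta> = (\<lambda>r. e (\<theta> (min r k)))" for k and \<theta> :: "nat \<Rightarrow> nat"
  have Trange: "range (T k \<theta>) = e ` \<theta> ` {..k}" for k \<theta>
    unfolding T_def by (force simp: image_iff min_def)
  have T: "T k \<theta> \<in> complex_splx k K'" if "\<theta> \<in> simplex_maps k d" "e ` \<theta> ` {..k} \<in> K'" for k \<theta> K'
  proof -
    have "e (\<theta> (min r k)) \<le> e (\<theta> (min s k))" if "r \<le> s" for r s
    proof -
      have "min r k \<le> min s k" "min s k \<le> k" using that by auto
      then show ?thesis using simplex_mapsD[OF \<open>\<theta> \<in> simplex_maps k d\<close>, of "min r k" "min s k"] ele by simp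
    qed
    then show ?thesis using that(2) Trange[of k \<theta>] by (simp add: complex_splx_def mono_def) (simp add: T_def)
  qed
  have horn_K: "e ` \<theta> ` {..k} \<in> K" if \<theta>: "\<theta> \<in> splx (horn d p) k" for k \<theta>
  proof -
    have t: "\<theta> \<in> simplex_maps k d" "insert p (\<theta> ` {..k}) \<noteq> {..d}" using \<theta> by (auto simp: horn_def)
    have im: "\<theta> ` {..k} \<subseteq> {..d}" using simplex_mapsD(2)[OF t(1) order.refl] by auto
    then obtain q where q: "q \<le> d" "q \<notin> \<theta> ` {..k}" "q \<noteq> p" using t(2) p(1) by auto
    have "e q \<noteq> x" "e q \<in> C" using q p einj eC by auto
    then have "C - {e q} \<in> K" by (rule faces[rotated])
    moreover have "e ` \<theta> ` {..k} \<subseteq> C - {e q}" using im q eC einj by blast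
    moreover have "e ` \<theta> ` {..k} \<noteq> {}" by simp
    ultimately show ?thesis using K unfolding subset_closed_def by blast
  qed
  have T_seq: "T l (compose {..l} \<theta> \<eta>) = seq_op l \<eta> (T k \<theta>)" if "\<eta> \<in> simplex_maps l k" for l k \<eta> \<theta>
  proof
    fix r
    have "\<eta> (min r l) \<le> k" using simplex_mapsD(2)[OF that order.refl, of "min r l"] by simp
    then show "T l (compose {..l} \<theta> \<eta>) r = seq_op l \<eta> (T k \<theta>) r"
      by (simp add: T_def seq_op_def compose_def min_absorb1)
  qed
  define h where "h k \<theta> = f k (T k \<theta>)" for k \<theta>
  have "sset_hom (horn d p) S h"
    unfolding sset_hom_def
  proof (intro conjI allI ballI)
    fix k \<theta> assume \<theta>: "\<theta> \<in> splx (horn d p) k"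
    then have "\<theta> \<in> simplex_maps k d" by (simp add: horn_def)
    then show "h k \<theta> \<in> splx S k" using f T horn_K[OF \<theta>] by (simp add: complex_hom_def h_def)
  next
    fix l k \<eta> \<theta> assume \<eta>: "\<eta> \<in> simplex_maps l k" and \<theta>: "\<theta> \<in> splx (horn d p) k"
    then have "\<theta> \<in> simplex_maps k d" by (simp add: horn_def)
    then show "h l (sact (horn d p) l k \<eta> \<theta>) = sact S l k \<eta> (h k \<theta>)"
      using f T horn_K[OF \<theta>] T_seq[OF \<eta>] \<eta> by (simp add: complex_hom_def h_def horn_def)
  qed
  with S(2)[OF d(1) p(1)] obtain g where g: "sset_hom (std_simplex d) S g"
    and gh: "\<And>k \<theta>. \<theta> \<in> splx (horn d p) k \<Longrightarrow> g k \<theta> = h k \<theta>"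
    unfolding fills_horn_def by blast
  define R where "R m U = (\<lambda>r\<in>{..m}. \<iota> (U r))" for m and U :: "nat \<Rightarrow> 'a"
  have R: "R m U \<in> simplex_maps m d" "T m (R m U) = U"
    if U: "mono U" "\<And>r. r \<ge> m \<Longrightarrow> U r = U m" "range U \<subseteq> C" for m U
  proof -
    have UC: "U r \<in> C" for r using U(3) by auto
    show "R m U \<in> simplex_maps m d"
    proof (rule simplex_mapsI)
      show "R m U i \<le> R m U j" if "i \<le> j" "j \<le> m" for i j
      proof -
        have "e (\<iota> (U i)) \<le> e (\<iota> (U j))" using U(1) that \<iota>(2)[OF UC] by (simp add: monoD)
        then show ?thesis using that ele \<iota>(1)[OF UC] by (simp add: R_def)
      qed
    qed (use \<iota>(1)[OF UC] in \<open>auto simp: R_def\<close>)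
    show "T m (R m U) = U"
    proof
      show "T m (R m U) r = U r" for r
        using \<iota>(2)[OF UC] U(2)[of r] by (cases "r \<le> m") (auto simp: T_def R_def min_def)
    qed
  qed
  define F where "F m U = (if range U \<in> K then f m U else g m (R m U))" for m U
  let ?K = "K \<union> {C, C - {x}}"
  have "complex_hom ?K S F"
    unfolding complex_hom_def
  proof (intro allI ballI conjI)
    fix m U assume U: "U \<in> complex_splx m ?K"
    show "F m U \<in> splx S m"
    proof (cases "range U \<in> K")
      case True
      then have "U \<in> complex_splx m K" by (rule complex_splxD(4)[OF U])
      then show ?thesis using f True by (simp add: complex_hom_def F_def)
    next
      case False
      then have "range U \<subseteq> C" using complex_splxD(3)[OF U] by auto
      then have "R m U \<in> simplex_maps m d" using R(1)[of U m] complex_splxD(1,2)[OF U] by blast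
      then show ?thesis using g False by (simp add: F_def sset_hom_def std_simplex_def)
    qed
    fix m' \<psi> assume \<psi>: "\<psi> \<in> simplex_maps m' m"
    show "F m' (seq_op m' \<psi> U) = sact S m' m \<psi> (F m U)"
    proof (cases "range U \<in> K")
      case True
      then have "U \<in> complex_splx m K" by (rule complex_splxD(4)[OF U])
      moreover have "range (seq_op m' \<psi> U) \<in> K"
      proof -
        have "range (seq_op m' \<psi> U) \<subseteq> range U" "range (seq_op m' \<psi> U) \<noteq> {}" by (auto simp: seq_op_def)
        then show ?thesis using True K unfolding subset_closed_def by blast
      qed
      ultimately show ?thesis using f True \<psi> by (simp add: complex_hom_def F_def)
    next
      case False
      then have rU: "range U = C \<or> range U = C - {x}" using complex_splxD(3)[OF U] by blast
      then have UC: "range U \<subseteq> C" by auto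
      have RU: "R m U \<in> simplex_maps m d" "T m (R m U) = U"
        using R[of U m] complex_splxD(1,2)[OF U] UC by blast+
      let ?\<theta> = "compose {..m'} (R m U) \<psi>"
      have \<theta>: "?\<theta> \<in> simplex_maps m' d" by (rule simplex_maps_comp[OF RU(1) \<psi>])
      have g\<theta>: "g m' ?\<theta> = sact S m' m \<psi> (g m (R m U))"
        using g \<psi> RU(1) by (simp add: sset_hom_def std_simplex_def)
      have U': "seq_op m' \<psi> U = T m' ?\<theta>" using T_seq[OF \<psi>, of "R m U"] RU(2) by simp
      have "F m' (seq_op m' \<psi> U) = g m' ?\<theta>"
      proof (cases "range (seq_op m' \<psi> U) \<in> K")
        case True
        \<comment> \<open>The restricted sequence may drop into \<open>K\<close> although
          \<open>U\<close> is outside it. It then does not cover \<open>C - {x}\<close>, so its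
          index sequence lies in the horn, where \<open>g\<close> has the given values.\<close>
        have "insert p (?\<theta> ` {..m'}) \<noteq> {..d}"
        proof
          assume a: "insert p (?\<theta> ` {..m'}) = {..d}"
          have "C - {x} \<subseteq> range (seq_op m' \<psi> U)"
          proof
            fix z assume z: "z \<in> C - {x}"
            then obtain q where q: "q \<le> d" "z = e q" using eC by auto
            then have "q \<noteq> p" using z p by auto
            then have "q \<in> ?\<theta> ` {..m'}" using a q(1) by blast
            then show "z \<in> range (seq_op m' \<psi> U)" unfolding U' Trange using q(2) by blast
          qed
          then have "C - {x} \<in> K" using True K x(2) unfolding subset_closed_def by blast
          then show False using x(4) by blast
        qed
        then have "?\<theta> \<in> splx (horn d p) m'" using \<theta> by (simp add: horn_def)
        from gh[OF this] show ?thesis using True U' by (simp add: F_def h_def)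
      next
        case F: False
        have "R m' (seq_op m' \<psi> U) = ?\<theta>"
        proof
          fix r
          have "\<psi> (min r m') \<le> m" using simplex_mapsD(2)[OF \<psi> order.refl, of "min r m'"] by simp
          then show "R m' (seq_op m' \<psi> U) r = ?\<theta> r"
            by (auto simp: R_def seq_op_def compose_def min_absorb1)
        qed
        then show ?thesis using F by (simp add: F_def)
      qed
      then show ?thesis using g\<theta> False by (simp add: F_def)
    qed
  qed
  moreover have "F m U = f m U" if "U \<in> complex_splx m K" for m U
    using complex_splxD(3)[OF that] by (simp add: F_def)
  ultimately show ?thesis by blast
qed


lemma finite_chain_Union:
  assumes "finite C" "C \<noteq> {}" "\<And>x y. x \<in> C \<Longrightarrow> y \<in> C \<Longrightarrow> x \<subseteq> y \<or> y \<subseteq> x"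
  shows "\<Union>C \<in> C"
  using assms
proof (induction rule: finite_ne_induct)
  case (insert x F)
  then have "\<Union>F \<in> F" by blast
  with insert.prems[of x "\<Union>F"] show ?case by (auto simp: sup.absorb1 sup.absorb2)
qed simp

text \<open>The cube of all \<open>X\<close> with \<open>B \<subseteq> X \<subseteq> A\<close>; \<open>box\<close> omits its interior and the face \<open>i \<notin> X\<close>.\<close>

definition cube :: "'a set \<Rightarrow> 'a set \<Rightarrow> 'a set set set" where
  "cube B A = {C. finite C \<and> C \<noteq> {} \<and> (\<forall>X \<in> C. B \<subseteq> X \<and> X \<subseteq> A) \<and> (\<forall>X \<in> C. \<forall>Y \<in> C. X \<subseteq> Y \<or> Y \<subseteq> X)}"

definition box :: "'a set \<Rightarrow> 'a set \<Rightarrow> 'a \<Rightarrow> 'a set set set" where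
  "box B A i = {C \<in> cube B A. (\<exists>k \<in> A - B. \<forall>X \<in> C. k \<in> X) \<or> (\<exists>k \<in> A - B - {i}. \<forall>X \<in> C. k \<notin> X)}"

lemma cube_subset:
  assumes C: "C \<in> cube B A" and D: "D \<subseteq> C" "D \<noteq> {}"
  shows "D \<in> cube B A"
proof -
  have "finite D" using C D(1) by (auto simp: cube_def intro: finite_subset)
  moreover have "B \<subseteq> X \<and> X \<subseteq> A" "Y \<in> D \<Longrightarrow> X \<subseteq> Y \<or> Y \<subseteq> X" if "X \<in> D" for X Y
    using C subsetD[OF D(1) that] subsetD[OF D(1), of Y] by (simp_all add: cube_def)
  ultimately show ?thesis using D(2) by (simp add: cube_def)
qed

lemma subset_closed_box: "subset_closed (box B A i)"
proof -
  have "D \<in> box B A i" if C: "C \<in> box B A i" and D: "D \<subseteq> C" "D \<noteq> {}" for C D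
  proof -
    have "D \<in> cube B A" using C D cube_subset[of C B A D] by (simp add: box_def)
    then show ?thesis using C D(1) unfolding box_def by blast
  qed
  then show ?thesis unfolding subset_closed_def by blast
qed

text \<open>The chains outside the box are matched in pairs by inserting or deleting \<open>L \<union> {i}\<close>, where \<open>L\<close> is
  the largest member that does not contain \<open>i\<close>. Each pair is one horn filling; the pairs are added in
  the order of dimension, then of the number of members without \<open>i\<close>.\<close>

theorem box_filling:
  fixes A B :: "'a set"
  assumes S: "simplicial_set S" "\<And>n i. 1 \<le> n \<Longrightarrow> i \<le> n \<Longrightarrow> fills_horn S n i"
    and A: "finite A" and i: "i \<in> A - B" and f: "complex_hom (box B A i) S f"
  shows "\<exists>g. complex_hom (cube B A) S g \<and> (\<forall>m. \<forall>U \<in> complex_splx m (box B A i). g m U = f m U)"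
proof -
  define L where "L C = \<Union>{X \<in> C. i \<notin> X}" for C
  define y where "y C = insert i (L C)" for C
  let ?All = "cube B A" and ?Box = "box B A i"
  have finAll: "finite ?All"
    by (rule finite_subset[of _ "Pow (Pow A)"]) (use A in \<open>auto simp: cube_def\<close>)
  have L_in: "L C \<in> C" "i \<notin> L C" if C: "C \<in> ?All" "C \<notin> ?Box" for C
  proof -
    have "C \<noteq> {}" "finite C" "\<forall>X \<in> C. \<forall>Y \<in> C. X \<subseteq> Y \<or> Y \<subseteq> X" using C(1) by (auto simp: cube_def)
    \<comment> \<open>Otherwise \<open>C\<close> lies in the face where every member contains
      \<open>i\<close>, which is part of the box.\<close>
    moreover have "\<exists>X \<in> C. i \<notin> X" using C i unfolding box_def by blast
    ultimately have "\<Union>{X \<in> C. i \<notin> X} \<in> {X \<in> C. i \<notin> X}" by (intro finite_chain_Union) auto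
    then show "L C \<in> C" "i \<notin> L C" by (auto simp: L_def)
  qed
  have L_max: "X \<subseteq> L C" if "X \<in> C" "i \<notin> X" for X C using that by (auto simp: L_def)
  have y_ge: "y C \<subseteq> X" if C: "C \<in> ?All" "C \<notin> ?Box" and X: "X \<in> C" "i \<in> X" for C X
  proof -
    have "X \<subseteq> L C \<or> L C \<subseteq> X" using C(1) L_in(1)[OF C] X(1) unfolding cube_def by blast
    then show ?thesis using X(2) L_in(2)[OF C] by (auto simp: y_def)
  qed
  have y_same: "L (insert (y C) C) = L C" "L (C - {y C}) = L C" "y (insert (y C) C) = y C" "y (C - {y C}) = y C" for C
    by (auto simp: L_def y_def)
  have mate_All: "insert (y C) C \<in> ?All" if C: "C \<in> ?All" "C \<notin> ?Box" for C
  proof -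
    have "y C \<subseteq> X \<or> X \<subseteq> y C" if "X \<in> C" for X
      using y_ge[OF C that] L_max[OF that] by (auto simp: y_def)
    moreover have "B \<subseteq> y C \<and> y C \<subseteq> A" using L_in(1)[OF C] C(1) i by (auto simp: cube_def y_def)
    ultimately show ?thesis using C(1) by (auto simp: cube_def)
  qed
  \<comment> \<open>\<open>K\<close> consists of the box and of complete pairs: together with
    closure under subsets, the last clause yields both partners as soon as one is present.\<close>
  define Inv where "Inv K \<longleftrightarrow> subset_closed K \<and> ?Box \<subseteq> K \<and> K \<subseteq> ?All \<and>
    (\<forall>C \<in> K - ?Box. insert (y C) C \<in> K)" for K
  have "\<exists>g. complex_hom ?All S g \<and> (\<forall>m. \<forall>U \<in> complex_splx m K. g m U = f m U)"
    if "Inv K" "complex_hom K S f" for K f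
    using that
  proof (induction "card (?All - K)" arbitrary: K f rule: less_induct)
    case less
    have K: "subset_closed K" "?Box \<subseteq> K" "K \<subseteq> ?All" "\<And>C. C \<in> K \<Longrightarrow> C \<notin> ?Box \<Longrightarrow> insert (y C) C \<in> K"
      using less.prems(1) by (auto simp: Inv_def)
    have down: "D \<in> K" if "C \<in> K" "D \<subseteq> C" "D \<noteq> {}" for C D
      using K(1) that unfolding subset_closed_def by blast
    \<comment> \<open>The larger partners of the pairs still missing.\<close>
    define H where "H = {C \<in> ?All - K. y C \<in> C}"
    show ?case
    proof (cases "H = {}")
      case True
      have "C \<in> K" if C: "C \<in> ?All" for C
      proof (rule ccontr)
        assume n: "C \<notin> K"
        then have b: "C \<notin> ?Box" using K(2) by blast
        have "C \<noteq> {}" using C by (simp add: cube_def)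
        then have "insert (y C) C \<notin> K" using n down by blast
        then have "insert (y C) C \<in> H" using mate_All[OF C b] y_same(3)[of C] by (simp add: H_def)
        then show False using True by blast
      qed
      then have "K = ?All" using K(3) by blast
      then show ?thesis using less.prems(2) by blast
    next
      case False
      \<comment> \<open>A lexicographic order as one number: the second summand is at most
        \<open>card C\<close>, which is less than the gap 2 \<open>card C\<close> + 1 between
        consecutive squares.\<close>
      define rk where "rk C = (card C)\<^sup>2 + card {X \<in> C. i \<notin> X}" for C :: "'a set set"
      obtain C where C: "C \<in> H" "\<And>D. D \<in> H \<Longrightarrow> rk C \<le> rk D"
        using ex_has_least_nat[of "\<lambda>C. C \<in> H" _ rk] False by blast
      have CA: "C \<in> ?All" "C \<notin> K" "y C \<in> C" using C(1) by (auto simp: H_def)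
      have CB: "C \<notin> ?Box" using CA(2) K(2) by blast
      have fin: "finite C" and chain: "\<And>x y. x \<in> C \<Longrightarrow> y \<in> C \<Longrightarrow> x \<subseteq> y \<or> y \<subseteq> x"
        using CA(1) by (auto simp: cube_def)
      have less_rk: "D \<in> K" if D: "D \<in> ?All" "y D \<in> D" "rk D < rk C" for D
        using C(2)[of D] D by (force simp: H_def)
      have small: "rk D < rk C" if "card D < card C" "finite D" for D
      proof -
        have "card {X \<in> D. i \<notin> X} \<le> card D" by (rule card_mono) (use that in auto)
        then have "rk D < (Suc (card D))\<^sup>2" by (simp add: rk_def power2_eq_square)
        also have "\<dots> \<le> (card C)\<^sup>2" using that(1) by (simp add: power_mono)
        finally show ?thesis by (simp add: rk_def)
      qed
      let ?x = "y C"
      have LC: "L C \<in> C" "i \<notin> L C" by (rule L_in[OF CA(1) CB])+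
      have Lx: "L C \<in> C - {?x}" using LC by (auto simp: y_def)
      \<comment> \<open>\<open>y C\<close> differs from \<open>L C\<close> only by \<open>i\<close>.
        So an element common to all other members lies in \<open>L C\<close> and hence in
        \<open>y C\<close>, and an element other than \<open>i\<close> that all of them omit is
        omitted by \<open>y C\<close> too.\<close>
      have lowB: "C - {?x} \<notin> ?Box"
      proof
        assume "C - {?x} \<in> ?Box"
        then consider k where "k \<in> A - B" "\<forall>X \<in> C - {?x}. k \<in> X"
          | k where "k \<in> A - B - {i}" "\<forall>X \<in> C - {?x}. k \<notin> X" unfolding box_def by blast
        then show False
        proof cases
          case 1
          then have "\<forall>X \<in> C. k \<in> X" using Lx by (auto simp: y_def)
          then show False using CA(1) CB 1(1) unfolding box_def by blast
        next
          case 2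
          then have "\<forall>X \<in> C. k \<notin> X" using Lx by (auto simp: y_def)
          then show False using CA(1) CB 2(1) unfolding box_def by blast
        qed
      qed
      have lowK: "C - {?x} \<notin> K"
        using K(4)[OF _ lowB] y_same(4)[of C] CA(2,3) by (auto simp: insert_absorb)
      \<comment> \<open>Such a facet is in the box or belongs to a pair of smaller rank. Deleting
        \<open>z \<noteq> L C\<close> lowers the cardinality and leaves \<open>y\<close> unchanged.
        Deleting \<open>L C\<close> changes \<open>y\<close>, but the larger partner of the facet
        has no more members than \<open>C\<close>, and fewer of them omit \<open>i\<close>.\<close>
      have faces: "C - {z} \<in> K" if z: "z \<in> C" "z \<noteq> ?x" for z
      proof (cases "C - {z} \<in> ?Box")
        case False
        have zA: "C - {z} \<in> ?All"
          by (rule cube_subset[OF CA(1)]) (use CA(3) z in auto)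
        have cz: "card (C - {z}) < card C" using z(1) fin by (rule card_Diff1_less[rotated])
        show ?thesis
        proof (cases "z = L C")
          case zL: False
          have "L (C - {z}) = L C"
          proof
            show "L C \<subseteq> L (C - {z})" by (rule L_max) (use LC zL in auto)
          qed (auto simp: L_def)
          then have "y (C - {z}) \<in> C - {z}" using CA(3) z by (simp add: y_def)
          then show ?thesis using less_rk[OF zA] small[OF cz] fin by blast
        next
          case zL: True
          let ?D = "insert (y (C - {z})) (C - {z})"
          have Lz: "L (C - {z}) \<in> C - {z}" "i \<notin> L (C - {z})" by (rule L_in[OF zA False])+
          have "?D \<in> ?All" by (rule mate_All[OF zA False])
          moreover have "y ?D \<in> ?D" using y_same(3)[of "C - {z}"] by simp
          moreover have "rk ?D < rk C"
          proof -
            have "card ?D \<le> card C" using cz fin by (simp add: card_insert_if)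
            moreover have "card {X \<in> ?D. i \<notin> X} < card {X \<in> C. i \<notin> X}"
            proof (rule psubset_card_mono)
              show "{X \<in> ?D. i \<notin> X} \<subset> {X \<in> C. i \<notin> X}" using zL LC by (auto simp: y_def)
            qed (use fin in auto)
            ultimately show ?thesis unfolding rk_def by (intro add_le_less_mono power_mono) simp_all
          qed
          ultimately have "?D \<in> K" by (rule less_rk)
          then show ?thesis by (rule down) (use Lz in auto)
        qed
      qed (use K(2) in auto)
      obtain g where g: "complex_hom (K \<union> {C, C - {?x}}) S g" "\<And>m U. U \<in> complex_splx m K \<Longrightarrow> g m U = f m U"
        using complex_step[OF S K(1) less.prems(2) fin chain CA(3) _ CA(2) lowK faces] Lx by blast
      let ?K = "K \<union> {C, C - {?x}}"
      have lowA: "C - {?x} \<in> ?All"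
        by (rule cube_subset[OF CA(1)]) (use Lx in auto)
      have sub: "D \<in> ?K" if D: "D \<subseteq> C" "D \<noteq> {}" for D
      proof (cases "D = C \<or> D = C - {?x}")
        case False
        then obtain z where "z \<in> C" "z \<notin> D" "z \<noteq> ?x" using D(1) by blast
        then show ?thesis using down[OF faces[of z], of D] D by blast
      qed auto
      have "subset_closed ?K"
        unfolding subset_closed_def
      proof (intro ballI allI impI)
        fix E D assume E: "E \<in> ?K" and D: "D \<subseteq> E \<and> D \<noteq> {}"
        show "D \<in> ?K"
        proof (cases "E \<in> K")
          case True then show ?thesis using down D by blast
        next
          case False then show ?thesis using E D by (intro sub) auto
        qed
      qed
      moreover have "insert (y D) D \<in> ?K" if "D \<in> ?K" "D \<notin> ?Box" for D
      proof (cases "D \<in> K")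
        case True then show ?thesis using K(4) that(2) by blast
      next
        case False
        then have "insert (y D) D = C" using that(1) y_same(4)[of C] CA(3) by auto
        then show ?thesis by simp
      qed
      moreover have "?Box \<subseteq> ?K" "?K \<subseteq> ?All" using K(2,3) CA(1) lowA by auto
      ultimately have inv: "Inv ?K" unfolding Inv_def by - (intro conjI ballI, (elim DiffE | assumption | blast)+)
      have "card (?All - ?K) < card (?All - K)"
      proof (rule psubset_card_mono)
        have "C \<in> ?All - K" "C \<notin> ?All - ?K" using CA by simp_all
        then show "?All - ?K \<subset> ?All - K" by blast
      qed (simp add: finAll)
      from less.hyps[OF this inv g(1)] obtain h where h: "complex_hom ?All S h"
        "\<And>m U. U \<in> complex_splx m ?K \<Longrightarrow> h m U = g m U" by blast
      have "h m U = f m U" if U: "U \<in> complex_splx m K" for m U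
      proof -
        have "U \<in> complex_splx m ?K" using complex_splxD(3)[OF U] by (intro complex_splxD(4)[OF U]) blast
        then show ?thesis using h(2) g(2)[OF U] by simp
      qed
      then show ?thesis using h(1) by blast
    qed
  qed
  moreover have "Inv ?Box" using subset_closed_box[of B A i] by (auto simp: Inv_def box_def)
  ultimately show ?thesis using f by blast
qed

subsection \<open>Coherent data\<close>

text \<open>The presentation of \<open>tau1\<close> sees only simplices of dimension at most two.
  Their normal forms are fixed here; in \<open>ttri\<close> the edge from 0 to 2 has to be the union
  because union is the composition.\<close>

definition tvertex :: "nat \<Rightarrow> thick" where
  "tvertex i = mk_thick 0 (\<lambda>_. i) (\<lambda>_ _ _. {i})"

definition tedge :: "nat \<Rightarrow> nat \<Rightarrow> (nat \<Rightarrow> nat set) \<Rightarrow> thick" where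
  "tedge i j U = mk_thick 1 (\<lambda>p. if p = 0 then i else j)
     (\<lambda>p q. if p = q then (\<lambda>_. {if p = 0 then i else j}) else U)"

definition ttri :: "nat \<Rightarrow> nat \<Rightarrow> nat \<Rightarrow> (nat \<Rightarrow> nat set) \<Rightarrow> (nat \<Rightarrow> nat set) \<Rightarrow> thick" where
  "ttri i j l U V = mk_thick 2 (\<lambda>p. if p = 0 then i else if p = 1 then j else l)
     (\<lambda>p q. if p = q then (\<lambda>_. {if p = 0 then i else if p = 1 then j else l})
        else if q = 1 then U else if p = 1 then V else (\<lambda>r. V r \<union> U r))"

lemma thick_morD:
  assumes "U \<in> thick_mor m i j"
  shows "i \<le> j" "i \<in> U r" "j \<in> U r" "U r \<subseteq> {i..j}" "mono U" "r \<ge> m \<Longrightarrow> U r = U m" "U r \<subseteq> U m"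
proof -
  have 1: "\<And>r. i \<in> U r \<and> j \<in> U r \<and> U r \<subseteq> {i..j}" and 2: "mono U" and 3: "\<And>r. r \<ge> m \<Longrightarrow> U r = U m"
    using assms unfolding thick_mor_def by blast+
  show "i \<in> U r" "j \<in> U r" "U r \<subseteq> {i..j}" "mono U" using 1 2 by auto
  show "i \<le> j" using 1[of 0] by auto
  show "r \<ge> m \<Longrightarrow> U r = U m" by (rule 3)
  show "U r \<subseteq> U m" using monoD[OF 2, of r m] 3[of r] by (cases "r \<le> m") auto
qed

lemma thick_mor_diag: "U \<in> thick_mor m i i \<longleftrightarrow> U = (\<lambda>_. {i})"
proof
  assume "U \<in> thick_mor m i i"
  then have "U r = {i}" for r using thick_morD(2,4)[of U m i i r] by auto
  then show "U = (\<lambda>_. {i})" by blast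
qed (auto simp: thick_mor_def mono_def)

lemma thick_mor_union:
  assumes "U \<in> thick_mor m i j" "V \<in> thick_mor m j l"
  shows "(\<lambda>r. V r \<union> U r) \<in> thick_mor m i l"
proof -
  note U = thick_morD[OF assms(1)] and V = thick_morD[OF assms(2)]
  have "V r \<union> U r \<subseteq> {i..l}" for r using U(1) U(4)[of r] V(1) V(4)[of r] by force
  moreover have "mono (\<lambda>r. V r \<union> U r)"
    unfolding mono_def using monoD[OF U(5)] monoD[OF V(5)] by blast
  moreover have "V r \<union> U r = V m \<union> U m" if "r \<ge> m" for r using U(6)[OF that] V(6)[OF that] by simp
  ultimately show ?thesis using U(2) V(3) unfolding thick_mor_def by blast
qed

lemma thick_mor_seq_op:
  assumes U: "U \<in> thick_mor m i j" and \<psi>: "\<psi> \<in> simplex_maps m' m"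
  shows "seq_op m' \<psi> U \<in> thick_mor m' i j"
proof -
  note u = thick_morD[OF U]
  have "\<psi> (min r m') \<le> \<psi> (min s m')" if "r \<le> s" for r s
    using simplex_mapsD(1)[OF \<psi>, of "min r m'" "min s m'"] that by (simp add: min.coboundedI1)
  then have "mono (seq_op m' \<psi> U)" using monoD[OF u(5)] by (simp add: mono_def seq_op_def)
  moreover have "seq_op m' \<psi> U r = seq_op m' \<psi> U m'" if "r \<ge> m'" for r
    using that by (simp add: seq_op_def min_absorb2)
  moreover have "i \<in> seq_op m' \<psi> U r \<and> j \<in> seq_op m' \<psi> U r \<and> seq_op m' \<psi> U r \<subseteq> {i..j}" for r
    using u(2-4) by (simp add: seq_op_def)
  ultimately show ?thesis unfolding thick_mor_def by blast
qed

lemma thick_vertex_iff: "\<theta> \<in> thick_functors n m 0 \<longleftrightarrow> (\<exists>i\<le>n. \<theta> = tvertex i)"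
proof
  assume "\<theta> \<in> thick_functors n m 0"
  then have \<theta>: "\<theta> = mk_thick 0 (tobj \<theta>) (\<lambda>_ _ _. {tobj \<theta> 0})" "tobj \<theta> 0 \<le> n" using thick_vertices by blast+
  have "mk_thick 0 (tobj \<theta>) (\<lambda>_ _ _. {tobj \<theta> 0}) = tvertex (tobj \<theta> 0)"
    unfolding tvertex_def by (rule mk_thick_cong) auto
  then show "\<exists>i\<le>n. \<theta> = tvertex i" using \<theta> by metis
next
  assume "\<exists>i\<le>n. \<theta> = tvertex i"
  then show "\<theta> \<in> thick_functors n m 0" unfolding tvertex_def
    by (auto intro!: thick_functorsI simp: thick_mor_diag)
qed

lemma tobj_thick [simp]: "tobj (tvertex i) 0 = i" "tobj (tedge i j U) 0 = i" "tobj (tedge i j U) 1 = j"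
    "tobj (tedge i j U) (Suc 0) = j"
    "tobj (ttri i j l U V) 0 = i" "tobj (ttri i j l U V) 1 = j" "tobj (ttri i j l U V) (Suc 0) = j"
    "tobj (ttri i j l U V) 2 = l"
  by (simp_all add: tvertex_def tedge_def ttri_def)

lemma tmor_tedge [simp]: "tmor (tedge i j U) 0 1 = U" "tmor (tedge i j U) 0 (Suc 0) = U"
  by (simp_all add: tedge_def)

lemma tedge_in: "j \<le> n \<Longrightarrow> U \<in> thick_mor m i j \<Longrightarrow> tedge i j U \<in> thick_functors n m 1"
  unfolding tedge_def
proof (rule thick_functorsI, goal_cases)
  case (1 p) then show ?case using thick_morD(1)[OF 1(2)] by auto
next
  case (2 p q)
  then consider "p = q" "p \<le> 1" | "p = 0" "q = 1" by linarith
  then show ?case using 2 by cases (auto simp: thick_mor_diag)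
next
  case (4 p q r)
  note u = thick_morD[OF 4(2)]
  from 4 consider "p = q" "q = r" | "p = 0" "q = 0" "r = 1" | "p = 0" "q = 1" "r = 1" by linarith
  then show ?case using u(2,3) by cases (auto simp: fun_eq_iff)
qed auto

lemma le1_cases: "(p::nat) \<le> q \<Longrightarrow> q \<le> 1 \<Longrightarrow> (p = q \<Longrightarrow> p = 0 \<or> p = 1 \<Longrightarrow> P) \<Longrightarrow> (p = 0 \<Longrightarrow> q = 1 \<Longrightarrow> P) \<Longrightarrow> P"
  by (cases p; cases q) auto

lemma le2_cases: "(p::nat) \<le> q \<Longrightarrow> q \<le> 2 \<Longrightarrow> (p = q \<Longrightarrow> p = 0 \<or> p = 1 \<or> p = 2 \<Longrightarrow> P) \<Longrightarrow>
    (p = 0 \<Longrightarrow> q = 1 \<Longrightarrow> P) \<Longrightarrow> (p = 1 \<Longrightarrow> q = 2 \<Longrightarrow> P) \<Longrightarrow> (p = 0 \<Longrightarrow> q = 2 \<Longrightarrow> P) \<Longrightarrow> P"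
  by (cases "p = q"; cases "q = 1"; cases "p = 0") linarith+

lemma thick_edge_iff:
  "\<theta> \<in> thick_functors n m 1 \<longleftrightarrow> (\<exists>i j U. j \<le> n \<and> U \<in> thick_mor m i j \<and> \<theta> = tedge i j U)"
proof
  assume \<theta>: "\<theta> \<in> thick_functors n m 1"
  note t = thick_functorsD[OF \<theta>]
  have "mk_thick 1 (tobj \<theta>) (tmor \<theta>) = tedge (tobj \<theta> 0) (tobj \<theta> 1) (tmor \<theta> 0 1)"
    unfolding tedge_def
  proof (rule mk_thick_cong)
    show "tobj \<theta> p = (if p = 0 then tobj \<theta> 0 else tobj \<theta> 1)" if "p \<le> 1" for p using that by (cases p) auto
    show "tmor \<theta> p q = (if p = q then \<lambda>_. {if p = 0 then tobj \<theta> 0 else tobj \<theta> 1} else tmor \<theta> 0 1)"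
      if "p \<le> q" "q \<le> 1" for p q
      using that by (rule le1_cases) (use t(4)[of p] in auto)
  qed
  then have "\<theta> = tedge (tobj \<theta> 0) (tobj \<theta> 1) (tmor \<theta> 0 1)" using t(1) by simp
  moreover have "tmor \<theta> 0 1 \<in> thick_mor m (tobj \<theta> 0) (tobj \<theta> 1)" "tobj \<theta> 1 \<le> n" using t(2,3) by simp_all
  ultimately show "\<exists>i j U. j \<le> n \<and> U \<in> thick_mor m i j \<and> \<theta> = tedge i j U" by blast
qed (auto intro: tedge_in[simplified])

lemma ttri_in:
  assumes "l \<le> n" and U: "U \<in> thick_mor m i j" and V: "V \<in> thick_mor m j l"
  shows "ttri i j l U V \<in> thick_functors n m 2"
  unfolding ttri_def
proof (rule thick_functorsI, goal_cases)
  case (1 p) then show ?case using assms(1) thick_morD(1)[OF U] thick_morD(1)[OF V] by auto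
next
  case (2 p q)
  then show ?case by (rule le2_cases) (use U V thick_mor_union[OF U V] in \<open>auto simp: thick_mor_diag\<close>)
next
  case (4 p q r)
  note u = thick_morD[OF U] and v = thick_morD[OF V]
  from 4(2,3) have qr: "q \<le> r" "r \<le> 2" by auto
  from 4(1) have "p \<le> q" "q \<le> 2" using 4 by auto
  then show ?case
    by (rule le2_cases; use qr in \<open>rule le2_cases\<close>) (use u(2,3) v(2,3) in \<open>auto simp: fun_eq_iff\<close>)
qed auto

lemma thick_tri_iff:
  "\<theta> \<in> thick_functors n m 2 \<longleftrightarrow>
    (\<exists>i j l U V. l \<le> n \<and> U \<in> thick_mor m i j \<and> V \<in> thick_mor m j l \<and> \<theta> = ttri i j l U V)"
proof
  assume \<theta>: "\<theta> \<in> thick_functors n m 2"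
  note t = thick_functorsD[OF \<theta>]
  have "mk_thick 2 (tobj \<theta>) (tmor \<theta>) = ttri (tobj \<theta> 0) (tobj \<theta> 1) (tobj \<theta> 2) (tmor \<theta> 0 1) (tmor \<theta> 1 2)"
    unfolding ttri_def
  proof (rule mk_thick_cong, goal_cases)
    case (1 p) then have "p = 0 \<or> p = 1 \<or> p = 2" by linarith
    then show ?case by auto
  next
    case (2 p q)
    then show ?case
      by (rule le2_cases) (use t(4)[of p] t(5)[of 0 1 2] in auto)
  qed
  then have "\<theta> = ttri (tobj \<theta> 0) (tobj \<theta> 1) (tobj \<theta> 2) (tmor \<theta> 0 1) (tmor \<theta> 1 2)" using t(1) by simp
  moreover have "tmor \<theta> 0 1 \<in> thick_mor m (tobj \<theta> 0) (tobj \<theta> 1)" "tmor \<theta> 1 2 \<in> thick_mor m (tobj \<theta> 1) (tobj \<theta> 2)"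
    "tobj \<theta> 2 \<le> n" using t(2,3) by simp_all
  ultimately show "\<exists>i j l U V. l \<le> n \<and> U \<in> thick_mor m i j \<and> V \<in> thick_mor m j l \<and> \<theta> = ttri i j l U V" by blast
qed (auto intro: ttri_in)

lemma thick_pre_vertex: "thick_pre 0 (vertex p) \<theta> = mk_thick 0 (\<lambda>_. tobj \<theta> p) (\<lambda>_ _. tmor \<theta> p p)"
  unfolding thick_pre_def by (rule mk_thick_cong) (auto simp: vertex_def)

lemma thick_pre_vertices:
  "thick_pre 0 (vertex 0) (tedge i j U) = tvertex i"
  "thick_pre 0 (vertex 1) (tedge i j U) = tvertex j"
  unfolding thick_pre_vertex by (auto simp: tedge_def tvertex_def intro!: mk_thick_cong)

lemma thick_pre_edges:
  "thick_pre 1 (edge 0 0) (tvertex i) = tedge i i (\<lambda>_. {i})"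
  "thick_pre 1 (edge 0 1) (ttri i j l U V) = tedge i j U"
  "thick_pre 1 (edge 1 2) (ttri i j l U V) = tedge j l V"
  "thick_pre 1 (edge 0 2) (ttri i j l U V) = tedge i l (\<lambda>r. V r \<union> U r)"
  unfolding thick_pre_def tedge_def ttri_def tvertex_def
  by (rule mk_thick_cong; auto simp: edge_def fun_eq_iff elim!: le1_cases)+

lemma thick_op_edge: "thick_op 1 m' \<psi> (tedge i j U) = tedge i j (seq_op m' \<psi> U)"
  unfolding thick_op_def tedge_def seq_op_def by (rule mk_thick_cong) (auto elim!: le1_cases)

lemma thick_push_vertex: "thick_push 0 \<phi> (tvertex i) = tvertex (\<phi> i)"
  unfolding thick_push_def tvertex_def by (rule mk_thick_cong) auto

lemma thick_push_edge: "thick_push 1 \<phi> (tedge i j U) = tedge (\<phi> i) (\<phi> j) (\<lambda>r. \<phi> ` U r)"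
  unfolding thick_push_def tedge_def by (rule mk_thick_cong) (auto simp: fun_eq_iff elim!: le1_cases)

text \<open>Morphisms \<open>\<V>\<^sub>\<alpha> \<rightarrow> \<Q>\<close> in terms of generators: \<open>cop d m i j U b\<close> is the image of the \<open>m\<close>-simplex
  \<open>U\<close> of the mapping space from \<open>i\<close> to \<open>j\<close>, at \<open>b\<close> in level \<open>j\<close>. Here \<open>\<alpha>\<close> need not be rooted.
  As for chains, irrelevant components are fixed by \<open>mk_cdata\<close>.\<close>

record ('c, 'o) cdata =
  cch :: chain
  ccol :: "nat \<Rightarrow> nat \<Rightarrow> 'c"
  cop :: "nat \<Rightarrow> nat \<Rightarrow> nat \<Rightarrow> (nat \<Rightarrow> nat set) \<Rightarrow> nat \<Rightarrow> 'o"

definition mk_cdata ::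
    "nat \<Rightarrow> chain \<Rightarrow> (nat \<Rightarrow> nat \<Rightarrow> 'c) \<Rightarrow> (nat \<Rightarrow> nat \<Rightarrow> nat \<Rightarrow> (nat \<Rightarrow> nat set) \<Rightarrow> nat \<Rightarrow> 'o) \<Rightarrow> ('c, 'o) cdata"
  where
  "mk_cdata n \<alpha> F G = \<lparr>cch = \<alpha>,
     ccol = (\<lambda>i a. if i \<le> n \<and> a < lev \<alpha> i then F i a else undefined),
     cop = (\<lambda>m i j U b. if U \<in> thick_mor m i j \<and> j \<le> n \<and> b < lev \<alpha> j then G m i j U b else undefined)\<rparr>"

lemma mk_cdata_simps [simp]:
  "cch (mk_cdata n \<alpha> F G) = \<alpha>"
  "i \<le> n \<Longrightarrow> a < lev \<alpha> i \<Longrightarrow> ccol (mk_cdata n \<alpha> F G) i a = F i a"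
  "U \<in> thick_mor m i j \<Longrightarrow> j \<le> n \<Longrightarrow> b < lev \<alpha> j \<Longrightarrow> cop (mk_cdata n \<alpha> F G) m i j U b = G m i j U b"
  by (simp_all add: mk_cdata_def)

lemma mk_cdata_cong:
  assumes "\<alpha> = \<alpha>'" "\<And>i a. i \<le> n \<Longrightarrow> a < lev \<alpha> i \<Longrightarrow> F i a = F' i a"
    "\<And>m i j U b. U \<in> thick_mor m i j \<Longrightarrow> i \<le> j \<Longrightarrow> j \<le> n \<Longrightarrow> b < lev \<alpha> j \<Longrightarrow> G m i j U b = G' m i j U b"
  shows "mk_cdata n \<alpha> F G = mk_cdata n \<alpha>' F' G'"
proof -
  have "(if U \<in> thick_mor m i j \<and> j \<le> n \<and> b < lev \<alpha> j then G m i j U b else undefined) =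
      (if U \<in> thick_mor m i j \<and> j \<le> n \<and> b < lev \<alpha>' j then G' m i j U b else undefined)" for m i j U b
    using assms(1) assms(3)[of U m i j b] thick_morD(1)[of U m i j] by auto
  then show ?thesis using assms(1,2) by (auto simp: mk_cdata_def fun_eq_iff)
qed

text \<open>The unit and composition clauses are the relations of \<open>tau1\<close> for degenerate
  edges and for 2-simplices; the last clause is compatibility with the simplicial operators in
  \<open>m\<close>. The normal form makes equality of data the same as equality of their relevant
  values.\<close>

definition coherent :: "('c, 'o) soperad \<Rightarrow> nat \<Rightarrow> ('c, 'o) cdata \<Rightarrow> bool" where
  "coherent Q n d \<longleftrightarrow> cch d \<in> chains n \<and> d = mk_cdata n (cch d) (ccol d) (cop d) \<and>
    (\<forall>i a. i \<le> n \<longrightarrow> a < lev (cch d) i \<longrightarrow> ccol d i a \<in> Col (lvl Q 0)) \<and>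
    (\<forall>m i j U b. U \<in> thick_mor m i j \<longrightarrow> j \<le> n \<longrightarrow> b < lev (cch d) j \<longrightarrow>
       cop d m i j U b \<in> op_set (lvl Q m) (map (ccol d i) (fibre (cch d) i j b)) (ccol d j b)) \<and>
    (\<forall>m i a. i \<le> n \<longrightarrow> a < lev (cch d) i \<longrightarrow> cop d m i i (\<lambda>_. {i}) a = idop (lvl Q m) (ccol d i a)) \<and>
    (\<forall>m i j l U V c. U \<in> thick_mor m i j \<longrightarrow> V \<in> thick_mor m j l \<longrightarrow> l \<le> n \<longrightarrow> c < lev (cch d) l \<longrightarrow>
       cop d m i l (\<lambda>r. V r \<union> U r) c =
       ocomp (lvl Q m) (cop d m j l V c) (map (cop d m i j U) (fibre (cch d) j l c))) \<and>
    (\<forall>m m' \<psi> i j U b. \<psi> \<in> simplex_maps m' m \<longrightarrow> U \<in> thick_mor m i j \<longrightarrow> j \<le> n \<longrightarrow> b < lev (cch d) j \<longrightarrow>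
       cop d m' i j (seq_op m' \<psi> U) b = oact Q m' m \<psi> (cop d m i j U b))"

lemma coherentD:
  assumes "coherent Q n d"
  shows "cch d \<in> chains n" "d = mk_cdata n (cch d) (ccol d) (cop d)"
    "\<And>i a. i \<le> n \<Longrightarrow> a < lev (cch d) i \<Longrightarrow> ccol d i a \<in> Col (lvl Q 0)"
    "\<And>m i j U b. U \<in> thick_mor m i j \<Longrightarrow> j \<le> n \<Longrightarrow> b < lev (cch d) j \<Longrightarrow>
       cop d m i j U b \<in> op_set (lvl Q m) (map (ccol d i) (fibre (cch d) i j b)) (ccol d j b)"
    "\<And>m i a. i \<le> n \<Longrightarrow> a < lev (cch d) i \<Longrightarrow> cop d m i i (\<lambda>_. {i}) a = idop (lvl Q m) (ccol d i a)"
    "\<And>m i j l U V c. U \<in> thick_mor m i j \<Longrightarrow> V \<in> thick_mor m j l \<Longrightarrow> l \<le> n \<Longrightarrow> c < lev (cch d) l \<Longrightarrow>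
       cop d m i l (\<lambda>r. V r \<union> U r) c =
       ocomp (lvl Q m) (cop d m j l V c) (map (cop d m i j U) (fibre (cch d) j l c))"
    "\<And>m m' \<psi> i j U b. \<psi> \<in> simplex_maps m' m \<Longrightarrow> U \<in> thick_mor m i j \<Longrightarrow> j \<le> n \<Longrightarrow> b < lev (cch d) j \<Longrightarrow>
       cop d m' i j (seq_op m' \<psi> U) b = oact Q m' m \<psi> (cop d m i j U b)"
proof -
  note c = assms[unfolded coherent_def]
  show "cch d \<in> chains n" by (rule c[THEN conjunct1])
  show "d = mk_cdata n (cch d) (ccol d) (cop d)" by (rule c[THEN conjunct2, THEN conjunct1])
qed (insert assms[unfolded coherent_def, THEN conjunct2, THEN conjunct2], simp_all)

text \<open>The extra assumption \<open>i \<le> j\<close> costs nothing, since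
  \<open>thick_mor m i j\<close> is empty otherwise.\<close>

lemma coherentI:
  assumes \<alpha>: "\<alpha> \<in> chains n"
    and col: "\<And>i a. i \<le> n \<Longrightarrow> a < lev \<alpha> i \<Longrightarrow> F i a \<in> Col (lvl Q 0)"
    and op: "\<And>m i j U b. U \<in> thick_mor m i j \<Longrightarrow> i \<le> j \<Longrightarrow> j \<le> n \<Longrightarrow> b < lev \<alpha> j \<Longrightarrow>
       G m i j U b \<in> op_set (lvl Q m) (map (F i) (fibre \<alpha> i j b)) (F j b)"
    and id: "\<And>m i a. i \<le> n \<Longrightarrow> a < lev \<alpha> i \<Longrightarrow> G m i i (\<lambda>_. {i}) a = idop (lvl Q m) (F i a)"
    and comp: "\<And>m i j l U V c. U \<in> thick_mor m i j \<Longrightarrow> V \<in> thick_mor m j l \<Longrightarrow> i \<le> j \<Longrightarrow> j \<le> l \<Longrightarrow> l \<le> n \<Longrightarrow>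
       c < lev \<alpha> l \<Longrightarrow>
       G m i l (\<lambda>r. V r \<union> U r) c = ocomp (lvl Q m) (G m j l V c) (map (G m i j U) (fibre \<alpha> j l c))"
    and nat: "\<And>m m' \<psi> i j U b. \<psi> \<in> simplex_maps m' m \<Longrightarrow> U \<in> thick_mor m i j \<Longrightarrow> i \<le> j \<Longrightarrow> j \<le> n \<Longrightarrow>
       b < lev \<alpha> j \<Longrightarrow> G m' i j (seq_op m' \<psi> U) b = oact Q m' m \<psi> (G m i j U b)"
  shows "coherent Q n (mk_cdata n \<alpha> F G)"
proof -
  let ?d = "mk_cdata n \<alpha> F G"
  have fl: "b < lev \<alpha> i" if "b \<in> set (fibre \<alpha> i j a)" for b i j a
    using that by (simp add: set_fibre[OF \<alpha>])
  show ?thesis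
    unfolding coherent_def mk_cdata_simps(1)
  proof (intro conjI allI impI, goal_cases)
    case 1 show ?case by (rule \<alpha>)
  next
    case 2 show ?case by (rule mk_cdata_cong) simp_all
  next
    case (3 i a) then show ?case by (simp add: col)
  next
    case (4 m i j U b)
    note ij = thick_morD(1)[OF 4(1)]
    have e: "map (ccol ?d i) (fibre \<alpha> i j b) = map (F i) (fibre \<alpha> i j b)"
      using fl ij 4(2) by simp
    show ?case unfolding e using op[OF 4(1) ij 4(2,3)] 4 by simp
  next
    case (5 m i a) then show ?case by (simp add: id thick_mor_diag)
  next
    case (6 m i j l U V c)
    note le = thick_morD(1)[OF 6(1)] thick_morD(1)[OF 6(2)]
    have e: "map (cop ?d m i j U) (fibre \<alpha> j l c) = map (G m i j U) (fibre \<alpha> j l c)"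
      using fl le 6 by simp
    show ?case unfolding e using comp[OF 6(1,2) le 6(3,4)] 6 thick_mor_union[OF 6(1,2)] by simp
  next
    case (7 m m' \<psi> i j U b)
    then show ?case using nat[OF 7(1,2) thick_morD(1)[OF 7(2)] 7(3,4)] thick_mor_seq_op[OF 7(2,1)] by simp
  qed
qed

lemma operad_map_ocomp:
  "operad_map P P' F G \<Longrightarrow> composable P f gs \<Longrightarrow> G (ocomp P f gs) = ocomp P' (G f) (map G gs)"
  by (simp add: operad_map_def)

lemma operad_map_composable:
  assumes m: "operad_map P P' F G" and c: "composable P f gs"
  shows "composable P' (G f) (map G gs)"
proof -
  have G: "G h \<in> op_set P' (map F (src P h)) (F (tgt P h))" if "h \<in> Ops P" for h
    using m that by (simp add: operad_map_def)
  have gs: "h \<in> Ops P" if "h \<in> set gs" for h using c that by (auto simp: composable_def in_lists_conv_set)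
  have "map (tgt P') (map G gs) = map F (map (tgt P) gs)" using G gs by (auto simp: op_set_def)
  also have "\<dots> = src P' (G f)" using c G[of f] by (simp add: composable_def op_set_def)
  finally show ?thesis using c G gs by (auto simp: composable_def op_set_def in_lists_conv_set)
qed

lemma operad_map_compose:
  assumes m: "operad_map P P' F G" and m': "operad_map P' P'' F' G'"
  shows "operad_map P P'' (\<lambda>c. F' (F c)) (\<lambda>f. G' (G f))"
  unfolding operad_map_def
proof (intro conjI ballI allI impI)
  fix f assume f: "f \<in> Ops P"
  then have "G f \<in> op_set P' (map F (src P f)) (F (tgt P f))" using m by (simp add: operad_map_def)
  moreover have "\<forall>h \<in> Ops P'. G' h \<in> op_set P'' (map F' (src P' h)) (F' (tgt P' h))"
    using m' by (simp add: operad_map_def)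
  ultimately show "G' (G f) \<in> op_set P'' (map (\<lambda>c. F' (F c)) (src P f)) (F' (F (tgt P f)))"
    by (auto simp: op_set_def comp_def)
next
  fix f gs assume "composable P f gs"
  then show "G' (G (ocomp P f gs)) = ocomp P'' (G' (G f)) (map (\<lambda>f. G' (G f)) gs)"
    using operad_map_ocomp[OF m] operad_map_ocomp[OF m' operad_map_composable[OF m]] by (simp add: comp_def)
qed (use m m' in \<open>auto simp: operad_map_def\<close>)

locale soperad =
  fixes Q :: "('c, 'o) soperad"
  assumes Q: "simplicial_operad Q"
begin

lemma opQ: "operad (lvl Q m)" and ColQ: "Col (lvl Q m) = Col (lvl Q 0)"
  and actQ: "\<psi> \<in> simplex_maps m' m \<Longrightarrow> operad_map (lvl Q m) (lvl Q m') (\<lambda>c. c) (oact Q m' m \<psi>)"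
  using Q unfolding simplicial_operad_def by blast+

lemma actQ_comp: "\<psi> \<in> simplex_maps m' m \<Longrightarrow> composable (lvl Q m) f gs \<Longrightarrow>
    oact Q m' m \<psi> (ocomp (lvl Q m) f gs) = ocomp (lvl Q m') (oact Q m' m \<psi> f) (map (oact Q m' m \<psi>) gs)"
  using actQ[of \<psi> m' m] by (auto simp: operad_map_def)

end

section \<open>Morphisms out of thick operads as coherent data\<close>

definition cdata_of ::
    "nat \<Rightarrow> chain \<times> (thick \<times> nat \<Rightarrow> 'c) \<times> (nat \<Rightarrow> thick_ops \<Rightarrow> 'o) \<Rightarrow> ('c, 'o) cdata" where
  "cdata_of n = (\<lambda>(\<alpha>, x). mk_cdata n \<alpha> (\<lambda>i a. fst x (tvertex i, a))
     (\<lambda>m i j U b. snd x m (tau1_gen (thick_slist n \<alpha> m) (tedge i j U, b))))"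

lemma soperad_HomD:
  assumes "x \<in> soperad_Hom P Q"
  shows "(fst x, snd x m) \<in> operad_Hom (lvl P m) (lvl Q m)"
    "operad_map (lvl P m) (lvl Q m) (fst x) (snd x m)"
    "\<psi> \<in> simplex_maps k m \<Longrightarrow> f \<in> Ops (lvl P m) \<Longrightarrow> snd x k (oact P k m \<psi> f) = oact Q k m \<psi> (snd x m f)"
proof -
  show 1: "(fst x, snd x m) \<in> operad_Hom (lvl P m) (lvl Q m)"
    and "\<psi> \<in> simplex_maps k m \<Longrightarrow> f \<in> Ops (lvl P m) \<Longrightarrow> snd x k (oact P k m \<psi> f) = oact Q k m \<psi> (snd x m f)"
    using assms by (auto simp: soperad_Hom_def split_beta)
  show "operad_map (lvl P m) (lvl Q m) (fst x) (snd x m)" using Hom_map[OF 1] by simp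
qed

lemma lvl_thick [simp]: "lvl (thick_operad n \<alpha>) m = tau1 (thick_slist n \<alpha> m)"
  by (simp add: thick_operad_def)

context
  fixes n \<alpha> assumes \<alpha>: "\<alpha> \<in> chains n"
begin

lemma oslist_thick: "oslist (thick_slist n \<alpha> m)"
  by unfold_locales (rule thick_slist[OF \<alpha>])+

lemma thick0: "v \<in> lsplx (thick_slist n \<alpha> m) 0 \<longleftrightarrow> (\<exists>i a. i \<le> n \<and> a < lev \<alpha> i \<and> v = (tvertex i, a))"
  by (cases v) (auto simp: thick_slist_simps thick_vertex_iff)

lemma thick1: "e \<in> lsplx (thick_slist n \<alpha> m) 1 \<longleftrightarrow>
    (\<exists>i j U b. j \<le> n \<and> U \<in> thick_mor m i j \<and> b < lev \<alpha> j \<and> e = (tedge i j U, b))"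
  by (cases e) (force simp: thick_slist_simps thick_edge_iff simp del: One_nat_def)

lemma thick2: "s \<in> lsplx (thick_slist n \<alpha> m) 2 \<longleftrightarrow>
    (\<exists>i j l U V c. l \<le> n \<and> U \<in> thick_mor m i j \<and> V \<in> thick_mor m j l \<and> c < lev \<alpha> l \<and> s = (ttri i j l U V, c))"
  by (cases s) (force simp: thick_slist_simps thick_tri_iff)

lemma thick_src: "lact (thick_slist n \<alpha> m) 0 1 (vertex 0) (tedge i j U, b) = map (Pair (tvertex i)) (fibre \<alpha> i j b)"
  using thick_pre_vertices(1)[of i j U] by (simp add: thick_slist_simps)

lemma thick_tgt: "j \<le> n \<Longrightarrow> b < lev \<alpha> j \<Longrightarrow> lact (thick_slist n \<alpha> m) 0 1 (vertex 1) (tedge i j U, b) = [(tvertex j, b)]"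
  using thick_pre_vertices(2)[of i j U] by (simp add: thick_slist_simps fibre_id[OF \<alpha>])

lemma thick_deg: "i \<le> n \<Longrightarrow> a < lev \<alpha> i \<Longrightarrow>
    lact (thick_slist n \<alpha> m) 1 0 (edge 0 0) (tvertex i, a) = [(tedge i i (\<lambda>_. {i}), a)]"
  using thick_pre_edges(1)[of i] by (simp add: thick_slist_simps fibre_id[OF \<alpha>])

lemma thick_faces: 
  "l \<le> n \<Longrightarrow> c < lev \<alpha> l \<Longrightarrow> lact (thick_slist n \<alpha> m) 1 2 (edge 1 2) (ttri i j l U V, c) = [(tedge j l V, c)]"
  "l \<le> n \<Longrightarrow> c < lev \<alpha> l \<Longrightarrow> lact (thick_slist n \<alpha> m) 1 2 (edge 0 2) (ttri i j l U V, c) = [(tedge i l (\<lambda>r. V r \<union> U r), c)]"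
  "lact (thick_slist n \<alpha> m) 1 2 (edge 0 1) (ttri i j l U V, c) = map (Pair (tedge i j U)) (fibre \<alpha> j l c)"
  using thick_pre_edges(2-4)[of i j l U V] by (simp_all add: thick_slist_simps fibre_id[OF \<alpha>])

lemma thick_gen_in: "U \<in> thick_mor m i j \<Longrightarrow> j \<le> n \<Longrightarrow> b < lev \<alpha> j \<Longrightarrow>
    tau1_gen (thick_slist n \<alpha> m) (tedge i j U, b) \<in> Ops (tau1 (thick_slist n \<alpha> m))"
  using oslist.gen_in[OF oslist_thick, of "(tedge i j U, b)" m] thick1 by blast

lemma thick_oact_gen:
  assumes "U \<in> thick_mor m i j" "j \<le> n" "b < lev \<alpha> j" "\<psi> \<in> simplex_maps m' m"
  shows "oact (thick_operad n \<alpha>) m' m \<psi> (tau1_gen (thick_slist n \<alpha> m) (tedge i j U, b)) =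
    tau1_gen (thick_slist n \<alpha> m') (tedge i j (seq_op m' \<psi> U), b)"
proof -
  have e: "(tedge i j U, b) \<in> lsplx (thick_slist n \<alpha> m) 1" using assms thick1 by blast
  show ?thesis
    using tau1_map_gen[OF thick_slist[OF \<alpha>] thick_slist[OF \<alpha>] thick_op_hom[OF assms(4)] e] thick_op_edge[of m' \<psi> i j U]
    by (simp add: thick_operad_def)
qed

text \<open>Every clause is the image under \<open>x\<close> of a typing or a relation that holds
  between the generators of the thick operad.\<close>

lemma coherent_cdata_of:
  assumes Q: "simplicial_operad Q" and x: "x \<in> soperad_Hom (thick_operad n \<alpha>) Q"
  shows "coherent Q n (cdata_of n (\<alpha>, x))"
proof -
  interpret soperad Q by unfold_locales (rule Q)
  note hm = soperad_HomD(2)[OF x, unfolded lvl_thick]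
  let ?X = "thick_slist n \<alpha>"
  show ?thesis
    unfolding cdata_of_def prod.case
  proof (rule coherentI[OF \<alpha>], goal_cases)
    case (1 i a)
    then have "(tvertex i, a) \<in> Col (tau1 (?X 0))" using thick0 oslist.Col_tau1[OF oslist_thick] by blast
    then show ?case using hm[of 0] by (simp add: operad_map_def)
  next
    case (2 m i j U b)
    then have e: "(tedge i j U, b) \<in> lsplx (?X m) 1" using thick1 by blast
    have "tau1_gen (?X m) (tedge i j U, b) \<in> op_set (tau1 (?X m)) (map (Pair (tvertex i)) (fibre \<alpha> i j b)) (tvertex j, b)"
      using oslist.gen_typed[OF oslist_thick e] thick_src[of m i j U b] thick_tgt[OF 2(3,4), of m i U] by simp
    then show ?case using hm[of m] by (auto simp: operad_map_def op_set_def comp_def)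
  next
    case (3 m i a)
    then have v: "(tvertex i, a) \<in> lsplx (?X m) 0" using thick0 by blast
    have "tau1_gen (?X m) (tedge i i (\<lambda>_. {i}), a) = idop (tau1 (?X m)) (tvertex i, a)"
      using oslist.gen_deg[OF oslist_thick v] thick_deg[OF 3, of m] by simp
    then show ?case using hm[of m] v oslist.Col_tau1[OF oslist_thick] by (simp add: operad_map_def)
  next
    case (4 m i j l U V c)
    then have s: "(ttri i j l U V, c) \<in> lsplx (?X m) 2" using thick2 by blast
    have co: "composable (tau1 (?X m)) (tau1_gen (?X m) (tedge j l V, c))
        (map (tau1_gen (?X m)) (map (Pair (tedge i j U)) (fibre \<alpha> j l c)))"
    proof -
      have jn: "j \<le> n" using 4 by simp
      have "(tedge j l V, c) \<in> lsplx (?X m) 1" using 4 thick1 by blast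
      note g = oslist.gen_typed[OF oslist_thick this]
      have "tau1_gen (?X m) (tedge i j U, b) \<in> op_set (tau1 (?X m)) (map (Pair (tvertex i)) (fibre \<alpha> i j b)) (tvertex j, b)"
        if "b \<in> set (fibre \<alpha> j l c)" for b
      proof -
        have b: "b < lev \<alpha> j" using that by (simp add: set_fibre[OF \<alpha>])
        then have e: "(tedge i j U, b) \<in> lsplx (?X m) 1" using 4 jn thick1 by blast
        show ?thesis using oslist.gen_typed[OF oslist_thick e] thick_src[of m i j U b] thick_tgt[OF jn b, of m i U] by simp
      qed
      then show ?thesis using g thick_src[of m j l V c] by (auto simp: composable_def op_set_def)
    qed
    have "ocomp (tau1 (?X m)) (tau1_gen (?X m) (tedge j l V, c))
        (map (tau1_gen (?X m)) (map (Pair (tedge i j U)) (fibre \<alpha> j l c))) = tau1_gen (?X m) (tedge i l (\<lambda>r. V r \<union> U r), c)"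
      using oslist.gen_comp[OF oslist_thick s] thick_faces(1,2)[OF 4(5,6), of m i j U V] thick_faces(3)[of m i j l U V c] by simp
    then show ?case using operad_map_ocomp[OF hm co] by (simp add: comp_def)
  next
    case (5 m m' \<psi> i j U b)
    show ?case
      using soperad_HomD(3)[OF x 5(1), unfolded lvl_thick, OF thick_gen_in[OF 5(2,4,5)]]
      unfolding thick_oact_gen[OF 5(2,4,5,1)] .
  qed
qed

lemma cdata_of_inj:
  assumes Q: "simplicial_operad Q"
    and x: "x \<in> soperad_Hom (thick_operad n \<alpha>) Q" and y: "y \<in> soperad_Hom (thick_operad n \<alpha>) Q"
    and eq: "cdata_of n (\<alpha>, x) = cdata_of n (\<alpha>, y)"
  shows "x = y"
proof -
  interpret soperad Q by unfold_locales (rule Q)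
  have "(fst x, snd x m) = (fst y, snd y m)" for m
  proof (rule oslist.tau1_Hom_eqI[OF oslist_thick opQ])
    show "(fst x, snd x m) \<in> operad_Hom (tau1 (thick_slist n \<alpha> m)) (lvl Q m)" using soperad_HomD(1)[OF x] by simp
    show "(fst y, snd y m) \<in> operad_Hom (tau1 (thick_slist n \<alpha> m)) (lvl Q m)" using soperad_HomD(1)[OF y] by simp
    show "fst (fst x, snd x m) v = fst (fst y, snd y m) v" if "v \<in> lsplx (thick_slist n \<alpha> m) 0" for v
    proof -
      obtain i a where v: "i \<le> n" "a < lev \<alpha> i" "v = (tvertex i, a)" using \<open>v \<in> _\<close> thick0 by blast
      show ?thesis using arg_cong[OF eq, of "\<lambda>d. ccol d i a"] v by (simp add: cdata_of_def)
    qed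
    show "snd (fst x, snd x m) (tau1_gen (thick_slist n \<alpha> m) e) = snd (fst y, snd y m) (tau1_gen (thick_slist n \<alpha> m) e)"
      if "e \<in> lsplx (thick_slist n \<alpha> m) 1" for e
    proof -
      obtain i j U b where e: "j \<le> n" "U \<in> thick_mor m i j" "b < lev \<alpha> j" "e = (tedge i j U, b)"
        using \<open>e \<in> _\<close> thick1 by blast
      show ?thesis using arg_cong[OF eq, of "\<lambda>d. cop d m i j U b"] e by (simp add: cdata_of_def)
    qed
  qed
  then show ?thesis by (simp add: prod_eq_iff fun_eq_iff)
qed

text \<open>The levels are built independently from the presentation of \<open>tau1\<close>. It
  remains to match the colour maps and to prove naturality in \<open>m\<close>; the latter is an
  equality of two operad maps out of \<open>tau1\<close>, to be compared on vertices and edges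
  only.\<close>

lemma cdata_of_surj:
  assumes Q: "simplicial_operad Q" and d: "coherent Q n d" "cch d = \<alpha>"
  shows "\<exists>x \<in> soperad_Hom (thick_operad n \<alpha>) Q. cdata_of n (\<alpha>, x) = d"
proof -
  interpret soperad Q by unfold_locales (rule Q)
  note c = coherentD[OF d(1), unfolded d(2)]
  let ?X = "thick_slist n \<alpha>"
  \<comment> \<open>The indices are read off the thick functor, so that the assignments apply to
    arbitrary vertices and edges.\<close>
  define F where "F v = ccol d (tobj (fst v) 0) (snd v)" for v :: "thick \<times> nat"
  define h where "h m e = cop d m (tobj (fst e) 0) (tobj (fst e) 1) (tmor (fst e) 0 1) (snd e)" for m and e :: "thick \<times> nat"
  have F: "F (tvertex i, a) = ccol d i a" for i a by (simp add: F_def)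
  have h: "h m (tedge i j U, b) = cop d m i j U b" for m i j U b by (simp add: h_def)
  have fl: "b < lev \<alpha> i" if "b \<in> set (fibre \<alpha> i j a)" for b i j a
    using that by (simp add: set_fibre[OF \<alpha>])
  have "\<exists>x \<in> operad_Hom (tau1 (?X m)) (lvl Q m). (\<forall>v \<in> lsplx (?X m) 0. fst x v = F v) \<and>
    (\<forall>e \<in> lsplx (?X m) 1. snd x (tau1_gen (?X m) e) = h m e)" for m
  proof (rule oslist.tau1_Hom_exists[OF oslist_thick opQ])
    show "assignment (tau1_coll (?X m)) (lvl Q m) F (h m)"
      unfolding assignment_def
    proof (intro conjI ballI)
      fix v assume "v \<in> gCol (tau1_coll (?X m))"
      then obtain i a where "i \<le> n" "a < lev \<alpha> i" "v = (tvertex i, a)"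
        using thick0 oslist.K_simps(1)[OF oslist_thick] by blast
      then show "F v \<in> Col (lvl Q m)" using c(3) ColQ[of m] by (simp add: F)
    next
      fix e assume "e \<in> gens (tau1_coll (?X m))"
      then obtain i j U b where e: "j \<le> n" "U \<in> thick_mor m i j" "b < lev \<alpha> j" "e = (tedge i j U, b)"
        using thick1 oslist.K_simps(2)[OF oslist_thick] by blast
      show "h m e \<in> op_set (lvl Q m) (map F (gsrc (tau1_coll (?X m)) e)) (F (gtgt (tau1_coll (?X m)) e))"
        using c(4)[OF e(2,1,3)] thick_src[of m i j U b] thick_tgt[OF e(1,3), of m i U] e(4)
        by (simp add: oslist.K_simps[OF oslist_thick] F h comp_def)
    qed
  next
    fix v assume "v \<in> lsplx (?X m) 0"
    then obtain i a where v: "i \<le> n" "a < lev \<alpha> i" "v = (tvertex i, a)" using thick0 by blast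
    show "h m (hd (lact (?X m) 1 0 (edge 0 0) v)) = idop (lvl Q m) (F v)"
      using c(5)[OF v(1,2)] thick_deg[OF v(1,2), of m] v(3) by (simp add: F h)
  next
    fix s assume "s \<in> lsplx (?X m) 2"
    then obtain i j l U V b where s: "l \<le> n" "U \<in> thick_mor m i j" "V \<in> thick_mor m j l" "b < lev \<alpha> l"
      "s = (ttri i j l U V, b)" using thick2 by blast
    show "ocomp (lvl Q m) (h m (hd (lact (?X m) 1 2 (edge 1 2) s))) (map (h m) (lact (?X m) 1 2 (edge 0 1) s)) =
        h m (hd (lact (?X m) 1 2 (edge 0 2) s))"
      using c(6)[OF s(2,3,1,4)] thick_faces(1,2)[OF s(1,4), of m i j U V] thick_faces(3)[of m i j l U V b] s(5)
      by (simp add: h comp_def)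
  qed
  then obtain g where g: "\<And>m. g m \<in> operad_Hom (tau1 (?X m)) (lvl Q m)"
    and gF: "\<And>m v. v \<in> lsplx (?X m) 0 \<Longrightarrow> fst (g m) v = F v"
    and gh: "\<And>m e. e \<in> lsplx (?X m) 1 \<Longrightarrow> snd (g m) (tau1_gen (?X m) e) = h m e" by metis
  \<comment> \<open>The vertices of the thick simplicial lists are the same for every
    \<open>m\<close>, so the separately chosen colour maps coincide as extensional
    functions.\<close>
  have fst_g: "fst (g m) = fst (g 0)" for m
  proof (rule extensionalityI)
    have C: "Col (tau1 (?X m)) = Col (tau1 (?X 0))" for m
      using thick0 oslist.Col_tau1[OF oslist_thick] by blast
    show "fst (g m) \<in> extensional (Col (tau1 (?X 0)))" "fst (g 0) \<in> extensional (Col (tau1 (?X 0)))"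
      using g[of m, unfolded operad_Hom_def] g[of 0, unfolded operad_Hom_def] unfolding C[of m] by auto
    fix v assume "v \<in> Col (tau1 (?X 0))"
    then have "v \<in> lsplx (?X m) 0" "v \<in> lsplx (?X 0) 0" using C oslist.Col_tau1[OF oslist_thick] by auto
    then show "fst (g m) v = fst (g 0) v" using gF by metis
  qed
  let ?x = "(fst (g 0), \<lambda>m. snd (g m))"
  have gm: "operad_map (tau1 (?X m)) (lvl Q m) (fst (g m)) (snd (g m))" for m by (rule Hom_map[OF g])
  have "?x \<in> soperad_Hom (thick_operad n \<alpha>) Q"
    unfolding soperad_Hom_def mem_Collect_eq prod.case
  proof (intro conjI allI ballI)
    show "(fst (g 0), snd (g m)) \<in> operad_Hom (lvl (thick_operad n \<alpha>) m) (lvl Q m)" for m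
      using g[of m] fst_g[of m] by (metis lvl_thick prod.collapse)
  next
    fix k m \<psi> f assume \<psi>: "\<psi> \<in> simplex_maps k m" and f: "f \<in> Ops (lvl (thick_operad n \<alpha>) m)"
    let ?t = "oact (thick_operad n \<alpha>) k m \<psi>"
    have t: "operad_map (tau1 (?X m)) (tau1 (?X k)) (\<lambda>c. c) ?t"
      using simplicial_operad_thick[OF \<alpha>] \<psi> unfolding simplicial_operad_def by simp
    have "operad_map (tau1 (?X m)) (lvl Q k) (\<lambda>c. fst (g k) c) (\<lambda>f. snd (g k) (?t f))"
      by (rule operad_map_compose[OF t gm])
    moreover have "operad_map (tau1 (?X m)) (lvl Q k) (\<lambda>c. fst (g m) c) (\<lambda>f. oact Q k m \<psi> (snd (g m) f))"
      by (rule operad_map_compose[OF gm actQ[OF \<psi>]])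
    ultimately show "snd (g k) (?t f) = oact Q k m \<psi> (snd (g m) f)"
    proof (rule oslist.tau1_map_eqI[OF oslist_thick opQ])
      show "fst (g k) v = fst (g m) v" for v by (simp add: fst_g[of k] fst_g[of m])
      fix e assume e: "e \<in> lsplx (?X m) 1"
      then obtain i j U b where ij: "j \<le> n" "U \<in> thick_mor m i j" "b < lev \<alpha> j" "e = (tedge i j U, b)"
        using thick1 by blast
      have "(tedge i j (seq_op k \<psi> U), b) \<in> lsplx (?X k) 1" using ij thick_mor_seq_op[OF ij(2) \<psi>] thick1 by blast
      then show "snd (g k) (?t (tau1_gen (?X m) e)) = oact Q k m \<psi> (snd (g m) (tau1_gen (?X m) e))"
        using thick_oact_gen[OF ij(2,1,3) \<psi>] gh[OF e] gh ij(4) c(7)[OF \<psi> ij(2,1,3)] by (simp add: h)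
    next
      show "f \<in> Ops (tau1 (?X m))" using f by simp
    qed
  qed
  moreover have "cdata_of n (\<alpha>, ?x) = d"
  proof -
    have "cdata_of n (\<alpha>, ?x) = mk_cdata n \<alpha> (ccol d) (cop d)"
      unfolding cdata_of_def prod.case
    proof (rule mk_cdata_cong, goal_cases)
      case (2 i a)
      then have "(tvertex i, a) \<in> lsplx (?X 0) 0" using thick0 by blast
      then show ?case using gF F by simp
    next
      case (3 m i j U b)
      then have "(tedge i j U, b) \<in> lsplx (?X m) 1" using thick1 by blast
      then show ?case using gh h by simp
    qed simp
    then show ?thesis using c(2) by simp
  qed
  ultimately show ?thesis by blast
qed

end

subsection \<open>Simplicial operators on coherent data\<close>

text \<open>In the nerve an operator restricts a simplex and cuts the result into rooted trees at
  the same time. The two are separated: restriction alone is strictly functorial on unrooted data,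
  and \<open>cparts\<close> does the cutting.\<close>

definition cpull :: "nat \<Rightarrow> (nat \<Rightarrow> nat) \<Rightarrow> ('c, 'o) cdata \<Rightarrow> ('c, 'o) cdata" where
  "cpull k \<phi> d = mk_cdata k (pull_chain k \<phi> (cch d)) (\<lambda>i a. ccol d (\<phi> i) a)
     (\<lambda>m i j U b. cop d m (\<phi> i) (\<phi> j) (\<lambda>r. \<phi> ` U r) b)"

definition cpart :: "nat \<Rightarrow> nat \<Rightarrow> ('c, 'o) cdata \<Rightarrow> ('c, 'o) cdata" where
  "cpart n a d = mk_cdata n (subchain n (cch d) a) (\<lambda>i b. ccol d i (offset (cch d) n a i + b))
     (\<lambda>m i j U b. cop d m i j U (offset (cch d) n a j + b))"

definition cparts :: "nat \<Rightarrow> ('c, 'o) cdata \<Rightarrow> ('c, 'o) cdata list" where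
  "cparts n d = map (\<lambda>a. cpart n a d) [0..<lev (cch d) n]"

lemma thick_mor_image:
  assumes U: "U \<in> thick_mor m i j" and j: "j \<le> k" and \<phi>: "\<phi> \<in> simplex_maps k n"
  shows "(\<lambda>r. \<phi> ` U r) \<in> thick_mor m (\<phi> i) (\<phi> j)"
proof -
  note u = thick_morD[OF U]
  have "\<phi> x \<in> {\<phi> i..\<phi> j}" if "x \<in> U r" for x r
  proof -
    have x: "i \<le> x" "x \<le> j" using u(4)[of r] that by auto
    then show ?thesis using simplex_mapsD(1)[OF \<phi> x(1)] simplex_mapsD(1)[OF \<phi> x(2) j] j by simp
  qed
  moreover have "mono (\<lambda>r. \<phi> ` U r)" using monoD[OF u(5)] by (simp add: mono_def image_mono)
  moreover have "\<phi> ` U r = \<phi> ` U m" if "r \<ge> m" for r using u(6)[OF that] by simp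
  ultimately show ?thesis using u(2,3) unfolding thick_mor_def by blast
qed

lemma seq_op_image: "seq_op m' \<psi> (\<lambda>r. \<phi> ` U r) = (\<lambda>r. \<phi> ` seq_op m' \<psi> U r)"
  by (simp add: seq_op_def)

lemma thick_push_in:
  assumes \<theta>: "\<theta> \<in> thick_functors k m l" and \<phi>: "\<phi> \<in> simplex_maps k n"
  shows "thick_push l \<phi> \<theta> \<in> thick_functors n m l"
  unfolding thick_push_def
proof (rule thick_functorsI, goal_cases)
  case (1 i) then show ?case using simplex_mapsD(2)[OF \<phi> order.refl] thick_functorsD(2)[OF \<theta>] by simp
next
  case (2 i j) then show ?case
    using thick_mor_image[OF thick_functorsD(3)[OF \<theta> 2] thick_functorsD(2)[OF \<theta>] \<phi>] by simp
next
  case (3 i) then show ?case using thick_functorsD(4)[OF \<theta>] by simp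
next
  case (4 i j l) then show ?case using thick_functorsD(5)[OF \<theta> 4] by (simp add: image_Un)
qed

lemma soperad_hcomp_Hom:
  assumes P: "simplicial_operad P" and y: "y \<in> soperad_Hom P P'" and x: "x \<in> soperad_Hom P' Q"
  shows "soperad_hcomp P x y \<in> soperad_Hom P Q"
proof -
  interpret P: soperad P by unfold_locales (rule P)
  note hy = soperad_HomD[OF y] and hx = soperad_HomD[OF x]
  show ?thesis
    unfolding soperad_Hom_def soperad_hcomp_def mem_Collect_eq prod.case
  proof (intro conjI allI ballI)
    fix m
    have "operad_hcomp (lvl P m) (fst x, snd x m) (fst y, snd y m) \<in> operad_Hom (lvl P m) (lvl Q m)"
      by (rule operad_hcomp_Hom[OF P.opQ hy(1) hx(1)])
    then show "(compose (Col (lvl P 0)) (fst x) (fst y), compose (Ops (lvl P m)) (snd x m) (snd y m))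
        \<in> operad_Hom (lvl P m) (lvl Q m)"
      by (simp add: operad_hcomp_def P.ColQ[of m])
  next
    fix k m \<psi> f assume \<psi>: "\<psi> \<in> simplex_maps k m" and f: "f \<in> Ops (lvl P m)"
    have "oact P k m \<psi> f \<in> Ops (lvl P k)" using P.actQ[OF \<psi>] f by (auto simp: operad_map_def op_set_def)
    moreover have "snd y m f \<in> Ops (lvl P' m)" using hy(2)[of m] f by (auto simp: operad_map_def op_set_def)
    ultimately show "compose (Ops (lvl P k)) (snd x k) (snd y k) (oact P k m \<psi> f) =
        oact Q k m \<psi> (compose (Ops (lvl P m)) (snd x m) (snd y m) f)"
      using hy(3)[OF \<psi> f] hx(3)[OF \<psi>] f by (simp add: compose_def)
  qed
qed

context
  fixes n k a :: nat and \<alpha> \<phi>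
  assumes \<alpha>: "\<alpha> \<in> chains n" and \<phi>: "\<phi> \<in> simplex_maps k n"
begin

abbreviation "pc \<equiv> pull_chain k \<phi> \<alpha>"
abbreviation "sc \<equiv> subchain k pc a"
abbreviation "push \<equiv> (\<lambda>j (\<theta>, b). (thick_push j \<phi> \<theta>, offset pc k a (tobj \<theta> j) + b))"

lemma pc: "pc \<in> chains k" by (rule pull_in[OF \<alpha> \<phi>])
lemma sc: "sc \<in> chains k" by (rule subchain_in[OF pc])

lemma lev_sc: "i \<le> k \<Longrightarrow> lev sc i = length (fibre pc i k a)"
  by (simp add: subchain_def)

lemma sc_offset: "i \<le> k \<Longrightarrow> b < lev sc i \<Longrightarrow> offset pc k a i + b < lev \<alpha> (\<phi> i)"
  using offset_mem[OF pc, of i b a] lev_pull[OF \<alpha>, of i k \<phi>] lev_sc by auto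

text \<open>The offset moves an element of \<open>sc\<close> to its place in \<alpha>. By
  \<open>fibre_sub\<close> this shift carries fibres to fibres in order, which is compatibility with
  the list-valued operators.\<close>

lemma thick_push_hom: "slist_hom (thick_slist k sc m) (thick_slist n \<alpha> m) push"
  unfolding slist_hom_def
proof (intro conjI allI ballI)
  fix l x assume "x \<in> lsplx (thick_slist k sc m) l"
  then obtain \<theta> b where x: "x = (\<theta>, b)" "\<theta> \<in> thick_functors k m l" "b < lev sc (tobj \<theta> l)"
    by (cases x) (auto simp: thick_slist_simps)
  have "tobj \<theta> l \<le> k" using thick_functorsD(2)[OF x(2)] by simp
  then show "push l x \<in> lsplx (thick_slist n \<alpha> m) l"
    using thick_push_in[OF x(2) \<phi>] sc_offset x by (simp add: thick_slist_simps) (simp add: thick_push_def)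
next
  fix j l \<eta> x assume \<eta>: "\<eta> \<in> simplex_maps j l" and "x \<in> lsplx (thick_slist k sc m) l"
  then obtain \<theta> b where x: "x = (\<theta>, b)" "\<theta> \<in> thick_functors k m l" "b < lev sc (tobj \<theta> l)"
    by (cases x) (auto simp: thick_slist_simps)
  let ?p = "tobj \<theta> (\<eta> j)" and ?q = "tobj \<theta> l"
  have \<eta>j: "\<eta> j \<le> l" using simplex_mapsD(2)[OF \<eta> order.refl order.refl] .
  have pq: "?p \<le> ?q" "?q \<le> k" using tobj_mono[OF x(2) \<eta>j] thick_functorsD(2)[OF x(2)] by auto
  have "thick_push j \<phi> (thick_pre j \<eta> \<theta>) = thick_pre j \<eta> (thick_push l \<phi> \<theta>)"
    unfolding thick_push_def thick_pre_def
    by (rule mk_thick_cong) (use simplex_mapsD[OF \<eta>] in auto)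
  moreover have "tobj (thick_push l \<phi> \<theta>) (\<eta> j) = \<phi> ?p" "tobj (thick_push l \<phi> \<theta>) l = \<phi> ?q"
    "tobj (thick_pre j \<eta> \<theta>) j = ?p"
    using \<eta>j by (simp_all add: thick_push_def thick_pre_def)
  moreover have "fibre \<alpha> (\<phi> ?p) (\<phi> ?q) (offset pc k a ?q + b) = map ((+) (offset pc k a ?p)) (fibre sc ?p ?q b)"
  proof -
    have "b < length (fibre pc ?q k a)" using x(3) lev_sc[OF pq(2)] by simp
    from fibre_sub[OF pc pq this] show ?thesis using fibre_pull[OF \<alpha> pq] by simp
  qed
  ultimately show "map (push j) (lact (thick_slist k sc m) j l \<eta> x) = lact (thick_slist n \<alpha> m) j l \<eta> (push l x)"
    by (simp add: x(1) thick_slist_simps comp_def)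
qed

lemma thick_operad_map_simps:
  "v \<in> Col (tau1 (thick_slist k sc 0)) \<Longrightarrow> fst (thick_operad_map k n \<phi> \<alpha> a) v = push 0 v"
  "snd (thick_operad_map k n \<phi> \<alpha> a) m = snd (tau1_map (thick_slist k sc m) (thick_slist n \<alpha> m) push)"
  by (simp_all add: thick_operad_map_def Let_def tau1_map_def)

lemma thick_operad_map_gen:
  assumes "U \<in> thick_mor m i j" "j \<le> k" "b < lev sc j"
  shows "snd (thick_operad_map k n \<phi> \<alpha> a) m (tau1_gen (thick_slist k sc m) (tedge i j U, b)) =
    tau1_gen (thick_slist n \<alpha> m) (tedge (\<phi> i) (\<phi> j) (\<lambda>r. \<phi> ` U r), offset pc k a j + b)"
proof -
  have e: "(tedge i j U, b) \<in> lsplx (thick_slist k sc m) 1" using assms thick1[OF sc] by blast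
  show ?thesis
    using tau1_map_gen[OF thick_slist[OF sc] thick_slist[OF \<alpha>] thick_push_hom e] thick_push_edge[of \<phi> i j U]
    by (simp add: thick_operad_map_simps(2))
qed

lemma thick_operad_map_Hom:
  "thick_operad_map k n \<phi> \<alpha> a \<in> soperad_Hom (thick_operad k sc) (thick_operad n \<alpha>)"
proof -
  let ?X = "thick_slist k sc" and ?Y = "thick_slist n \<alpha>"
  let ?t = "thick_operad_map k n \<phi> \<alpha> a"
  have C: "Col (tau1 (?X m)) = Col (tau1 (?X 0))" for m
    using thick0[OF sc] oslist.Col_tau1[OF oslist_thick[OF sc]] by blast
  have H: "tau1_map (?X m) (?Y m) push \<in> operad_Hom (tau1 (?X m)) (tau1 (?Y m))" for m
    by (rule tau1_map(1)[OF thick_slist[OF sc] thick_slist[OF \<alpha>] thick_push_hom])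
  have fst_t: "fst ?t = fst (tau1_map (?X m) (?Y m) push)" for m
    by (simp add: thick_operad_map_def Let_def tau1_map_def C[of m])
  have t: "(fst ?t, snd ?t m) \<in> operad_Hom (tau1 (?X m)) (tau1 (?Y m))" for m
    using H[of m] by (simp add: fst_t[of m] thick_operad_map_simps(2))
  have tm: "operad_map (tau1 (?X m)) (tau1 (?Y m)) (fst ?t) (snd ?t m)" for m using Hom_map[OF t] by simp
  have "(fst ?t, snd ?t) \<in> soperad_Hom (thick_operad k sc) (thick_operad n \<alpha>)"
    unfolding soperad_Hom_def mem_Collect_eq prod.case
  proof (intro conjI allI ballI)
    fix m' m \<psi> f assume \<psi>: "\<psi> \<in> simplex_maps m' m" and f: "f \<in> Ops (lvl (thick_operad k sc) m)"
    have aX: "operad_map (tau1 (?X m)) (tau1 (?X m')) (\<lambda>c. c) (oact (thick_operad k sc) m' m \<psi>)"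
      and aY: "operad_map (tau1 (?Y m)) (tau1 (?Y m')) (\<lambda>c. c) (oact (thick_operad n \<alpha>) m' m \<psi>)"
      using simplicial_operad_thick[OF sc] simplicial_operad_thick[OF \<alpha>] \<psi> unfolding simplicial_operad_def by simp_all
    show "snd ?t m' (oact (thick_operad k sc) m' m \<psi> f) = oact (thick_operad n \<alpha>) m' m \<psi> (snd ?t m f)"
    proof (rule oslist.tau1_map_eqI[OF oslist_thick[OF sc] operad_tau1[OF thick_slist[OF \<alpha>]]
          operad_map_compose[OF aX tm] operad_map_compose[OF tm aY]])
      show "f \<in> Ops (tau1 (?X m))" using f by simp
    next
      fix e assume "e \<in> lsplx (?X m) 1"
      then obtain i j U b where e: "j \<le> k" "U \<in> thick_mor m i j" "b < lev sc j" "e = (tedge i j U, b)"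
        using thick1[OF sc] by blast
      have \<phi>j: "\<phi> j \<le> n" using simplex_mapsD(2)[OF \<phi> order.refl e(1)] .
      show "snd ?t m' (oact (thick_operad k sc) m' m \<psi> (tau1_gen (?X m) e)) =
          oact (thick_operad n \<alpha>) m' m \<psi> (snd ?t m (tau1_gen (?X m) e))"
        unfolding e(4) thick_oact_gen[OF sc e(2,1,3) \<psi>] thick_operad_map_gen[OF e(2,1,3)]
          thick_operad_map_gen[OF thick_mor_seq_op[OF e(2) \<psi>] e(1,3)]
          thick_oact_gen[OF \<alpha> thick_mor_image[OF e(2,1) \<phi>] \<phi>j sc_offset[OF e(1,3)] \<psi>] seq_op_image ..
    qed simp
  qed (use t in simp)
  then show ?thesis by simp
qed

text \<open>Compared on vertices and edges: composition with the thick operad map replaces an edge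
  \<open>U\<close> by its image under \<phi> and shifts positions by the offset, just as
  \<open>cpull\<close> followed by \<open>cpart\<close> does.\<close>

lemma cdata_of_act:
  assumes Q: "simplicial_operad Q" and x: "x \<in> soperad_Hom (thick_operad n \<alpha>) Q"
  shows "soperad_hcomp (thick_operad k sc) x (thick_operad_map k n \<phi> \<alpha> a) \<in> soperad_Hom (thick_operad k sc) Q"
    and "cdata_of k (sc, soperad_hcomp (thick_operad k sc) x (thick_operad_map k n \<phi> \<alpha> a)) =
      cpart k a (cpull k \<phi> (cdata_of n (\<alpha>, x)))"
proof -
  show "soperad_hcomp (thick_operad k sc) x (thick_operad_map k n \<phi> \<alpha> a) \<in> soperad_Hom (thick_operad k sc) Q"
    by (rule soperad_hcomp_Hom[OF simplicial_operad_thick[OF sc] thick_operad_map_Hom x])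
  show "cdata_of k (sc, soperad_hcomp (thick_operad k sc) x (thick_operad_map k n \<phi> \<alpha> a)) =
      cpart k a (cpull k \<phi> (cdata_of n (\<alpha>, x)))"
    unfolding cdata_of_def cpart_def cpull_def prod.case mk_cdata_simps(1)
  proof (rule mk_cdata_cong[OF HOL.refl], goal_cases)
    case (1 i b)
    have v: "(tvertex i, b) \<in> Col (tau1 (thick_slist k sc 0))"
      using thick0[OF sc] oslist.Col_tau1[OF oslist_thick[OF sc]] 1 by blast
    have "\<phi> i \<le> n" using simplex_mapsD(2)[OF \<phi> order.refl 1(1)] .
    then show ?case using v 1 sc_offset[OF 1] lev_pull[OF \<alpha> 1(1), of \<phi>]
      by (simp add: soperad_hcomp_def compose_def thick_operad_map_simps(1) thick_push_vertex)
  next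
    case (2 m i j U b)
    have "\<phi> j \<le> n" using simplex_mapsD(2)[OF \<phi> order.refl 2(3)] .
    then show ?case
      using thick_gen_in[OF sc 2(1,3,4)] 2 sc_offset[OF 2(3,4)] lev_pull[OF \<alpha> 2(3), of \<phi>]
        thick_operad_map_gen[OF 2(1,3,4)] thick_mor_image[OF 2(1,3) \<phi>]
      by (simp add: soperad_hcomp_def compose_def)
  qed
qed

end

text \<open>Direct images under \<phi> preserve endpoints, inclusions and unions, so each clause
  restricts.\<close>

lemma coherent_cpull:
  assumes d: "coherent Q n d" and \<phi>: "\<phi> \<in> simplex_maps k n"
  shows "coherent Q k (cpull k \<phi> d)"
  unfolding cpull_def
proof (rule coherentI)
  note c = coherentD[OF d]
  note le = simplex_mapsD(2)[OF \<phi> order.refl]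
  let ?\<alpha> = "cch d"
  have lev: "lev (pull_chain k \<phi> ?\<alpha>) i = lev ?\<alpha> (\<phi> i)" if "i \<le> k" for i by (rule lev_pull[OF c(1) that])
  show "pull_chain k \<phi> ?\<alpha> \<in> chains k" by (rule pull_in[OF c(1) \<phi>])
  show "ccol d (\<phi> i) a \<in> Col (lvl Q 0)" if "i \<le> k" "a < lev (pull_chain k \<phi> ?\<alpha>) i" for i a
    using c(3)[OF le] that lev by simp
  show "cop d m (\<phi> i) (\<phi> j) (\<lambda>r. \<phi> ` U r) b
      \<in> op_set (lvl Q m) (map (ccol d (\<phi> i)) (fibre (pull_chain k \<phi> ?\<alpha>) i j b)) (ccol d (\<phi> j) b)"
    if "U \<in> thick_mor m i j" "i \<le> j" "j \<le> k" "b < lev (pull_chain k \<phi> ?\<alpha>) j" for m i j U b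
    using c(4)[OF thick_mor_image[OF that(1,3) \<phi>] le[OF that(3)]] that lev fibre_pull[OF c(1) that(2,3)] by simp
  show "cop d m (\<phi> i) (\<phi> i) (\<lambda>r. \<phi> ` {i}) a = idop (lvl Q m) (ccol d (\<phi> i) a)"
    if "i \<le> k" "a < lev (pull_chain k \<phi> ?\<alpha>) i" for m i a
    using c(5)[OF le] that lev by simp
  show "cop d m (\<phi> i) (\<phi> l) (\<lambda>r. \<phi> ` (V r \<union> U r)) b = ocomp (lvl Q m) (cop d m (\<phi> j) (\<phi> l) (\<lambda>r. \<phi> ` V r) b)
      (map (cop d m (\<phi> i) (\<phi> j) (\<lambda>r. \<phi> ` U r)) (fibre (pull_chain k \<phi> ?\<alpha>) j l b))"
    if "U \<in> thick_mor m i j" "V \<in> thick_mor m j l" "i \<le> j" "j \<le> l" "l \<le> k" "b < lev (pull_chain k \<phi> ?\<alpha>) l"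
    for m i j l U V b
    using c(6)[OF thick_mor_image[OF that(1) order.trans[OF that(4,5)] \<phi>] thick_mor_image[OF that(2,5) \<phi>] le[OF that(5)]]
      that lev fibre_pull[OF c(1) that(4,5)] by (simp add: image_Un)
  show "cop d m' (\<phi> i) (\<phi> j) (\<lambda>r. \<phi> ` seq_op m' \<psi> U r) b = oact Q m' m \<psi> (cop d m (\<phi> i) (\<phi> j) (\<lambda>r. \<phi> ` U r) b)"
    if "\<psi> \<in> simplex_maps m' m" "U \<in> thick_mor m i j" "i \<le> j" "j \<le> k" "b < lev (pull_chain k \<phi> ?\<alpha>) j" for m m' \<psi> i j U b
    using c(7)[OF that(1) thick_mor_image[OF that(2,4) \<phi>] le[OF that(4)]] that lev by (simp add: seq_op_image)
qed

lemma pull_chain_comp: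
  assumes "\<eta> \<in> simplex_maps l k"
  shows "pull_chain l \<eta> (pull_chain k \<phi> \<alpha>) = pull_chain l (compose {..l} \<phi> \<eta>) \<alpha>"
  unfolding pull_chain_def by (rule mk_chain_cong) (use simplex_mapsD[OF assms] in \<open>auto simp: compose_def\<close>)

lemma pull_chain_id: "\<alpha> \<in> chains n \<Longrightarrow> pull_chain n (\<lambda>i\<in>{..n}. i) \<alpha> = \<alpha>"
proof -
  assume \<alpha>: "\<alpha> \<in> chains n"
  then have "\<alpha> = mk_chain n (lev \<alpha>) (lmap \<alpha>)" by (simp add: chains_def)
  moreover have "pull_chain n (\<lambda>i\<in>{..n}. i) \<alpha> = mk_chain n (lev \<alpha>) (lmap \<alpha>)"
    unfolding pull_chain_def by (rule mk_chain_cong) auto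
  ultimately show ?thesis by simp
qed

lemma cpull_comp:
  assumes d: "cch d \<in> chains n" and \<phi>: "\<phi> \<in> simplex_maps k n" and \<eta>: "\<eta> \<in> simplex_maps l k"
  shows "cpull l (compose {..l} \<phi> \<eta>) d = cpull l \<eta> (cpull k \<phi> d)"
  unfolding cpull_def mk_cdata_simps(1) pull_chain_comp[OF \<eta>]
proof (rule mk_cdata_cong[OF HOL.refl], goal_cases)
  let ?p = "pull_chain k \<phi> (cch d)"
  have lev: "lev (pull_chain l (compose {..l} \<phi> \<eta>) (cch d)) i = lev ?p (\<eta> i)" if "i \<le> l" for i
    using that simplex_mapsD(2)[OF \<eta> order.refl that] by (simp add: pull_chain_def compose_def)
  {
    case (1 i a)
    then show ?case using lev[OF 1(1)] simplex_mapsD(2)[OF \<eta> order.refl 1(1)] by (simp add: compose_def)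
  next
    case (2 m i j U b)
    \<comment> \<open>The extensional composite agrees with \<phi> after \<eta> only on
      \<open>{..l}\<close>.\<close>
    have "U r \<subseteq> {..l}" for r using thick_morD(4)[OF 2(1), of r] 2(3) by auto
    then have "compose {..l} \<phi> \<eta> ` U r = \<phi> ` \<eta> ` U r" for r by (force simp: compose_def image_iff)
    then show ?case using 2 lev[OF 2(3)] simplex_mapsD(2)[OF \<eta> order.refl 2(3)] thick_mor_image[OF 2(1,3) \<eta>]
      by (simp add: compose_def)
  }
qed

lemma cpull_id:
  assumes d: "coherent Q n d" shows "cpull n (\<lambda>i\<in>{..n}. i) d = d"
proof -
  have "cpull n (\<lambda>i\<in>{..n}. i) d = mk_cdata n (cch d) (ccol d) (cop d)"
    unfolding cpull_def pull_chain_id[OF coherentD(1)[OF d]]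
  proof (rule mk_cdata_cong[OF HOL.refl], goal_cases)
    case (2 m i j U b)
    have "U r \<subseteq> {..n}" for r using thick_morD(4)[OF 2(1), of r] 2(3) by auto
    then have "(\<lambda>i\<in>{..n}. i) ` U r = U r" for r by (force simp: image_iff)
    then show ?case using 2 by simp
  qed simp
  then show ?thesis using coherentD(2)[OF d] by simp
qed

text \<open>A model of the lists of simplices of the nerve that contains no lists; the isomorphism
  is given by \<open>total_bij\<close> and \<open>total_hom\<close>.\<close>

definition coherent_sset :: "('c, 'o) soperad \<Rightarrow> ('c, 'o) cdata sset" where
  "coherent_sset Q = \<lparr>splx = (\<lambda>n. {d. coherent Q n d}), sact = (\<lambda>k n \<phi>. cpull k \<phi>)\<rparr>"

subsection \<open>Decomposition into rooted data\<close>

text \<open>A window selects the elements \<open>s\<^sub>i \<le> c < s\<^sub>i + l\<^sub>i\<close> of each level; it has to be a union of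
  fibres over the top level.\<close>

definition window :: "nat \<Rightarrow> chain \<Rightarrow> (nat \<Rightarrow> nat) \<Rightarrow> (nat \<Rightarrow> nat) \<Rightarrow> bool" where
  "window n \<alpha> s l \<longleftrightarrow> (\<forall>i\<le>n. s i + l i \<le> lev \<alpha> i) \<and>
    (\<forall>i j c. i \<le> j \<longrightarrow> j \<le> n \<longrightarrow> c < lev \<alpha> i \<longrightarrow>
      (s i \<le> c \<and> c < s i + l i \<longleftrightarrow> s j \<le> lmap \<alpha> i j c \<and> lmap \<alpha> i j c < s j + l j))"

text \<open>For a window the truncated subtraction is exact, because the level maps keep elements
  inside it (\<open>window_lmap\<close>).\<close>

definition wchain :: "nat \<Rightarrow> (nat \<Rightarrow> nat) \<Rightarrow> (nat \<Rightarrow> nat) \<Rightarrow> chain \<Rightarrow> chain" where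
  "wchain n s l \<alpha> = mk_chain n l (\<lambda>i j b. lmap \<alpha> i j (s i + b) - s j)"

definition wdata :: "nat \<Rightarrow> (nat \<Rightarrow> nat) \<Rightarrow> (nat \<Rightarrow> nat) \<Rightarrow> ('c, 'o) cdata \<Rightarrow> ('c, 'o) cdata" where
  "wdata n s l d = mk_cdata n (wchain n s l (cch d)) (\<lambda>i b. ccol d i (s i + b)) (\<lambda>m i j U b. cop d m i j U (s j + b))"

context
  fixes n \<alpha> s l assumes \<alpha>: "\<alpha> \<in> chains n" and w: "window n \<alpha> s l"
begin

lemma window_lev: "i \<le> n \<Longrightarrow> b < l i \<Longrightarrow> s i + b < lev \<alpha> i"
  using w unfolding window_def by (meson add_less_cancel_left order_less_le_trans)

lemma window_iff: "i \<le> j \<Longrightarrow> j \<le> n \<Longrightarrow> c < lev \<alpha> i \<Longrightarrow>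
    (s i \<le> c \<and> c < s i + l i) = (s j \<le> lmap \<alpha> i j c \<and> lmap \<alpha> i j c < s j + l j)"
  using w unfolding window_def by blast

lemma window_lmap:
  assumes "i \<le> j" "j \<le> n" "b < l i"
  shows "s j \<le> lmap \<alpha> i j (s i + b)" "lmap \<alpha> i j (s i + b) - s j < l j"
  using window_iff[OF assms(1,2) window_lev[of i b]] assms by auto

lemma wchain_in: "wchain n s l \<alpha> \<in> chains n"
  unfolding wchain_def
proof (rule mk_chain_in)
  fix i j b assume ij: "i \<le> j" "j \<le> n" and b: "b < l i"
  show "lmap \<alpha> i j (s i + b) - s j < l j" by (rule window_lmap(2)[OF ij b])
next
  fix i j b c assume ij: "i \<le> j" "j \<le> n" and bc: "b \<le> c" "c < l i"
  have "lmap \<alpha> i j (s i + b) \<le> lmap \<alpha> i j (s i + c)"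
    using chain_mono[OF \<alpha> ij] window_lev[of i c] window_lev[of i b] ij bc by (auto simp: mono_on_def)
  then show "lmap \<alpha> i j (s i + b) - s j \<le> lmap \<alpha> i j (s i + c) - s j" by simp
next
  fix i b assume "i \<le> n" "b < l i"
  then show "lmap \<alpha> i i (s i + b) - s i = b" using chain_id[OF \<alpha>, of i "s i + b"] window_lev[of i b] by simp
next
  fix i j k b assume ij: "i \<le> j" "j \<le> k" "k \<le> n" and b: "b < l i"
  have "s j \<le> lmap \<alpha> i j (s i + b)" using window_lmap(1)[of i j b] ij b by simp
  then show "lmap \<alpha> i k (s i + b) - s k = lmap \<alpha> j k (s j + (lmap \<alpha> i j (s i + b) - s j)) - s k"
    using chain_comp[OF \<alpha> ij] window_lev[of i b] ij b by simp
qed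

lemma lev_wchain [simp]: "i \<le> n \<Longrightarrow> lev (wchain n s l \<alpha>) i = l i"
  by (simp add: wchain_def)

lemma set_fibre_wchain:
  assumes "i \<le> j" "j \<le> n"
  shows "b' \<in> set (fibre (wchain n s l \<alpha>) i j b) \<longleftrightarrow> b' < l i \<and> lmap \<alpha> i j (s i + b') - s j = b"
  unfolding set_fibre[OF wchain_in] using assms by (auto simp: wchain_def)

text \<open>An element lies in the window as soon as its image does, so fibres over the window are
  not cut off, and the shift preserves their order.\<close>

lemma fibre_wchain:
  assumes ij: "i \<le> j" "j \<le> n" and b: "b < l j"
  shows "fibre \<alpha> i j (s j + b) = map ((+) (s i)) (fibre (wchain n s l \<alpha>) i j b)"
proof (rule sorted_distinct_set_unique)
  show "sorted (fibre \<alpha> i j (s j + b))" "distinct (fibre \<alpha> i j (s j + b))" by (simp_all add: fibre_def)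
  have "sorted (fibre (wchain n s l \<alpha>) i j b)" "distinct (fibre (wchain n s l \<alpha>) i j b)"
    by (simp_all add: fibre_def)
  then show "sorted (map ((+) (s i)) (fibre (wchain n s l \<alpha>) i j b))"
    "distinct (map ((+) (s i)) (fibre (wchain n s l \<alpha>) i j b))"
    by (simp_all add: sorted_map distinct_map)
  show "set (fibre \<alpha> i j (s j + b)) = set (map ((+) (s i)) (fibre (wchain n s l \<alpha>) i j b))"
  proof (intro equalityI subsetI)
    fix c assume "c \<in> set (fibre \<alpha> i j (s j + b))"
    then have c: "c < lev \<alpha> i" "lmap \<alpha> i j c = s j + b" by (simp_all add: set_fibre[OF \<alpha>])
    then have "s i \<le> c" "c < s i + l i" using window_iff[OF ij c(1)] b by auto
    then obtain b' where b': "c = s i + b'" "b' < l i" by (metis add_less_cancel_left le_Suc_ex)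
    then have "b' \<in> set (fibre (wchain n s l \<alpha>) i j b)" using c by (simp add: set_fibre_wchain[OF ij])
    then show "c \<in> set (map ((+) (s i)) (fibre (wchain n s l \<alpha>) i j b))" using b'(1) by auto
  next
    fix c assume "c \<in> set (map ((+) (s i)) (fibre (wchain n s l \<alpha>) i j b))"
    then obtain b' where b': "c = s i + b'" "b' < l i" "lmap \<alpha> i j (s i + b') - s j = b"
      by (auto simp: set_fibre_wchain[OF ij])
    then show "c \<in> set (fibre \<alpha> i j (s j + b))"
      using window_lmap(1)[OF ij b'(2)] window_lev[of i b'] ij by (simp add: set_fibre[OF \<alpha>])
  qed
qed

end

lemma coherent_wdata:
  assumes d: "coherent Q n d" and w: "window n (cch d) s l"
  shows "coherent Q n (wdata n s l d)"
proof -
  note c = coherentD[OF d]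
  note lev = lev_wchain[OF c(1) w] and lt = window_lev[OF c(1) w] and fib = fibre_wchain[OF c(1) w]
  show ?thesis
    unfolding wdata_def
  proof (rule coherentI[OF wchain_in[OF c(1) w]], goal_cases)
    case (1 i a) then show ?case using c(3)[OF _ lt] lev by simp
  next
    case (2 m i j U b)
    then have b: "b < l j" using lev by simp
    show ?case using c(4)[OF 2(1,3) lt[OF 2(3) b]] unfolding fib[OF 2(2,3) b] by (simp add: comp_def)
  next
    case (3 m i a) then show ?case using c(5)[OF _ lt] lev by simp
  next
    case (4 m i j k U V b)
    then have b: "b < l k" using lev by simp
    show ?case using c(6)[OF 4(1,2,5) lt[OF 4(5) b]] unfolding fib[OF 4(4,5) b] by (simp add: comp_def)
  next
    case (5 m m' \<psi> i j U b) then show ?case using c(7)[OF 5(1,2,4) lt] lev by simp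
  qed
qed

lemma subchain_wchain: "subchain n \<alpha> a = wchain n (offset \<alpha> n a) (\<lambda>i. length (fibre \<alpha> i n a)) \<alpha>"
  by (simp add: subchain_def wchain_def)

lemma cpart_wdata: "cpart n a d = wdata n (offset (cch d) n a) (\<lambda>i. length (fibre (cch d) i n a)) d"
  by (simp add: cpart_def wdata_def subchain_wchain)

text \<open>An element belongs to this window precisely when it lies over \<open>a\<close> in the
  top level, a condition that the level maps preserve and reflect.\<close>

lemma window_part:
  assumes \<alpha>: "\<alpha> \<in> chains n"
  shows "window n \<alpha> (offset \<alpha> n a) (\<lambda>i. length (fibre \<alpha> i n a))"
proof -
  have iff: "offset \<alpha> n a i \<le> c \<and> c < offset \<alpha> n a i + length (fibre \<alpha> i n a) \<longleftrightarrow> lmap \<alpha> i n c = a"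
    if "i \<le> n" "c < lev \<alpha> i" for i c
    using offset_mem[OF \<alpha> that(1), of "c - offset \<alpha> n a i" a] offset_memD[OF \<alpha> that, of a] by auto
  have le: "offset \<alpha> n a i + length (fibre \<alpha> i n a) \<le> lev \<alpha> i" if "i \<le> n" for i
  proof (cases "length (fibre \<alpha> i n a)")
    case 0
    have "offset \<alpha> n a i \<le> card {..<lev \<alpha> i}" unfolding offset_def by (rule card_mono) auto
    then show ?thesis using 0 by simp
  next
    case (Suc q) then show ?thesis using offset_mem[OF \<alpha> that, of q a] by simp
  qed
  show ?thesis
    unfolding window_def
  proof (intro conjI allI impI, goal_cases)
    case (1 i) then show ?case by (rule le)
  next
    case (2 i j c)
    have "lmap \<alpha> i j c < lev \<alpha> j" by (rule chain_lt[OF \<alpha> 2])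
    then show ?case using iff[of i c] iff[of j "lmap \<alpha> i j c"] chain_comp[OF \<alpha> 2(1,2) order.refl 2(3)] 2 by simp
  qed
qed

lemma coherent_cpart: "coherent Q n d \<Longrightarrow> coherent Q n (cpart n a d)"
  unfolding cpart_wdata by (intro coherent_wdata window_part coherentD(1))

lemma rooted_cpart:
  assumes "coherent Q n d" "a < lev (cch d) n"
  shows "lev (cch (cpart n a d)) n = 1"
  using top_fibre[OF coherentD(1)[OF assms(1)] assms(2)] by (simp add: cpart_def subchain_def)

definition chain_sum :: "nat \<Rightarrow> chain \<Rightarrow> chain \<Rightarrow> chain" where
  "chain_sum n \<alpha> \<beta> = mk_chain n (\<lambda>i. lev \<alpha> i + lev \<beta> i)
     (\<lambda>i j b. if b < lev \<alpha> i then lmap \<alpha> i j b else lev \<alpha> j + lmap \<beta> i j (b - lev \<alpha> i))"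

text \<open>The counterpart of concatenating lists of rooted data, by \<open>cparts_csum\<close>.
  The second summand comes last in every level because the sources of operations are
  ordered.\<close>

definition csum :: "nat \<Rightarrow> ('c, 'o) cdata \<Rightarrow> ('c, 'o) cdata \<Rightarrow> ('c, 'o) cdata" where
  "csum n x y = mk_cdata n (chain_sum n (cch x) (cch y))
     (\<lambda>i a. if a < lev (cch x) i then ccol x i a else ccol y i (a - lev (cch x) i))
     (\<lambda>m i j U b. if b < lev (cch x) j then cop x m i j U b else cop y m i j U (b - lev (cch x) j))"

definition cempty :: "nat \<Rightarrow> ('c, 'o) cdata" where
  "cempty n = mk_cdata n (mk_chain n (\<lambda>_. 0) (\<lambda>_ _ _. 0)) (\<lambda>_ _. undefined) (\<lambda>_ _ _ _ _. undefined)"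

definition csum_list :: "nat \<Rightarrow> ('c, 'o) cdata list \<Rightarrow> ('c, 'o) cdata" where
  "csum_list n ds = foldr (csum n) ds (cempty n)"

lemma csum_list_simps [simp]: "csum_list n [] = cempty n" "csum_list n (d # ds) = csum n d (csum_list n ds)"
  by (simp_all add: csum_list_def)

lemma lev_chain_sum [simp]: "i \<le> n \<Longrightarrow> lev (chain_sum n \<alpha> \<beta>) i = lev \<alpha> i + lev \<beta> i"
  by (simp add: chain_sum_def)

context
  fixes n \<alpha> \<beta> assumes \<alpha>: "\<alpha> \<in> chains n" and \<beta>: "\<beta> \<in> chains n"
begin

lemma lmap_chain_sum:
  assumes "i \<le> j" "j \<le> n"
  shows "b < lev \<alpha> i \<Longrightarrow> lmap (chain_sum n \<alpha> \<beta>) i j b = lmap \<alpha> i j b"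
    and "c < lev \<beta> i \<Longrightarrow> lmap (chain_sum n \<alpha> \<beta>) i j (lev \<alpha> i + c) = lev \<alpha> j + lmap \<beta> i j c"
  using assms by (simp_all add: chain_sum_def)

lemma chain_sum_in: "chain_sum n \<alpha> \<beta> \<in> chains n"
  unfolding chain_sum_def
proof (rule mk_chain_in, goal_cases)
  case (1 i j b)
  then show ?case using chain_lt[OF \<alpha> 1(1,2), of b] chain_lt[OF \<beta> 1(1,2), of "b - lev \<alpha> i"] by auto
next
  case (2 i j b c)
  note m = chain_mono[OF \<alpha> 2(1,2)] chain_mono[OF \<beta> 2(1,2)]
  show ?case
    using 2 chain_lt[OF \<alpha> 2(1,2), of b] mono_onD[OF m(1), of b c] mono_onD[OF m(2), of "b - lev \<alpha> i" "c - lev \<alpha> i"]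
    by auto
next
  case (3 i b) then show ?case using chain_id[OF \<alpha> 3(1)] chain_id[OF \<beta> 3(1), of "b - lev \<alpha> i"] by auto
next
  case (4 i j l b)
  have "i \<le> l" "j \<le> n" using 4 by auto
  then show ?case
    using 4 chain_lt[OF \<alpha> 4(1), of b] chain_comp[OF \<alpha> 4(1-3), of b] chain_comp[OF \<beta> 4(1-3), of "b - lev \<alpha> i"] by auto
qed

text \<open>The level maps of the sum respect the two blocks, so a fibre stays within one of
  them.\<close>

lemma fibre_chain_sum:
  assumes ij: "i \<le> j" "j \<le> n"
  shows "a < lev \<alpha> j \<Longrightarrow> fibre (chain_sum n \<alpha> \<beta>) i j a = fibre \<alpha> i j a"
    and "fibre (chain_sum n \<alpha> \<beta>) i j (lev \<alpha> j + c) = map ((+) (lev \<alpha> i)) (fibre \<beta> i j c)"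
proof -
  have s: "[0..<lev (chain_sum n \<alpha> \<beta>) i] = [0..<lev \<alpha> i] @ map ((+) (lev \<alpha> i)) [0..<lev \<beta> i]"
    using ij by (intro nth_equalityI) (auto simp: nth_append)
  have f: "fibre (chain_sum n \<alpha> \<beta>) i j x = filter (\<lambda>b. lmap \<alpha> i j b = x) [0..<lev \<alpha> i] @
      map ((+) (lev \<alpha> i)) (filter (\<lambda>b. lev \<alpha> j + lmap \<beta> i j b = x) [0..<lev \<beta> i])" for x
    unfolding fibre_def s filter_append filter_map comp_def
    by (intro arg_cong2[of _ _ _ _ "(@)"] arg_cong[of _ _ "map ((+) (lev \<alpha> i))"] filter_cong)
      (auto simp: lmap_chain_sum[OF ij])
  show "a < lev \<alpha> j \<Longrightarrow> fibre (chain_sum n \<alpha> \<beta>) i j a = fibre \<alpha> i j a"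
    unfolding f by (simp add: fibre_def filter_empty_conv)
  have "filter (\<lambda>b. lmap \<alpha> i j b = lev \<alpha> j + c) [0..<lev \<alpha> i] = []"
    using chain_lt[OF \<alpha> ij] by (force simp: filter_empty_conv)
  then show "fibre (chain_sum n \<alpha> \<beta>) i j (lev \<alpha> j + c) = map ((+) (lev \<alpha> i)) (fibre \<beta> i j c)"
    unfolding f by (simp add: fibre_def)
qed

lemma offset_chain_sum:
  assumes i: "i \<le> n"
  shows "a < lev \<alpha> n \<Longrightarrow> offset (chain_sum n \<alpha> \<beta>) n a i = offset \<alpha> n a i"
    and "offset (chain_sum n \<alpha> \<beta>) n (lev \<alpha> n + c) i = lev \<alpha> i + offset \<beta> n c i"
proof -
  note l = lmap_chain_sum[OF i order.refl]
  have s: "{b. b < lev (chain_sum n \<alpha> \<beta>) i \<and> lmap (chain_sum n \<alpha> \<beta>) i n b < x} =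
      {b. b < lev \<alpha> i \<and> lmap \<alpha> i n b < x} \<union> (+) (lev \<alpha> i) ` {b. b < lev \<beta> i \<and> lev \<alpha> n + lmap \<beta> i n b < x}" for x
  proof (intro equalityI subsetI)
    fix b assume b: "b \<in> {b. b < lev (chain_sum n \<alpha> \<beta>) i \<and> lmap (chain_sum n \<alpha> \<beta>) i n b < x}"
    show "b \<in> {b. b < lev \<alpha> i \<and> lmap \<alpha> i n b < x} \<union> (+) (lev \<alpha> i) ` {b. b < lev \<beta> i \<and> lev \<alpha> n + lmap \<beta> i n b < x}"
    proof (cases "b < lev \<alpha> i")
      case True then show ?thesis using b l(1)[OF True] by simp
    next
      case False
      then obtain c where c: "b = lev \<alpha> i + c" using le_Suc_ex not_less by blast
      then have "c < lev \<beta> i" using b i by simp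
      then show ?thesis using b l(2) c by auto
    qed
  qed (use i l in auto)
  show "a < lev \<alpha> n \<Longrightarrow> offset (chain_sum n \<alpha> \<beta>) n a i = offset \<alpha> n a i"
    unfolding offset_def s by (rule arg_cong[of _ _ card]) auto
  have 1: "{b. b < lev \<alpha> i \<and> lmap \<alpha> i n b < lev \<alpha> n + c} = {..<lev \<alpha> i}"
    using chain_lt[OF \<alpha> i order.refl] by (auto simp: trans_less_add1)
  show "offset (chain_sum n \<alpha> \<beta>) n (lev \<alpha> n + c) i = lev \<alpha> i + offset \<beta> n c i"
    unfolding offset_def s 1 by (subst card_Un_disjoint) (auto simp: card_image)
qed

lemma subchain_chain_sum:
  shows "a < lev \<alpha> n \<Longrightarrow> subchain n (chain_sum n \<alpha> \<beta>) a = subchain n \<alpha> a"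
    and "subchain n (chain_sum n \<alpha> \<beta>) (lev \<alpha> n + c) = subchain n \<beta> c"
proof -
  show "subchain n (chain_sum n \<alpha> \<beta>) a = subchain n \<alpha> a" if a: "a < lev \<alpha> n"
    unfolding subchain_def
  proof (rule mk_chain_cong, goal_cases)
    case (1 i) then show ?case using fibre_chain_sum(1)[OF 1 order.refl a] by simp
  next
    case (2 i j b)
    then have "i \<le> n" by simp
    moreover have "offset \<alpha> n a i + b < lev \<alpha> i"
      using offset_mem[OF \<alpha> \<open>i \<le> n\<close>] 2(3) fibre_chain_sum(1)[OF \<open>i \<le> n\<close> order.refl a] by simp
    ultimately show ?case using offset_chain_sum(1)[OF _ a] 2 lmap_chain_sum(1)[OF 2(1,2)] by simp
  qed
  show "subchain n (chain_sum n \<alpha> \<beta>) (lev \<alpha> n + c) = subchain n \<beta> c"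
    unfolding subchain_def
  proof (rule mk_chain_cong, goal_cases)
    case (1 i) then show ?case using fibre_chain_sum(2)[OF 1 order.refl] by simp
  next
    case (2 i j b)
    then have "i \<le> n" by simp
    moreover have "offset \<beta> n c i + b < lev \<beta> i"
      using offset_mem[OF \<beta> \<open>i \<le> n\<close>] 2(3) fibre_chain_sum(2)[OF \<open>i \<le> n\<close> order.refl] by simp
    ultimately show ?case using offset_chain_sum(2) 2 lmap_chain_sum(2)[OF 2(1,2)] by (simp add: add.assoc)
  qed
qed

end

lemma pull_chain_sum:
  assumes \<phi>: "\<phi> \<in> simplex_maps k n"
  shows "pull_chain k \<phi> (chain_sum n \<alpha> \<beta>) = chain_sum k (pull_chain k \<phi> \<alpha>) (pull_chain k \<phi> \<beta>)"
  unfolding pull_chain_def chain_sum_def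
  by (rule mk_chain_cong) (use simplex_mapsD[OF \<phi>] in auto)

lemma less_add_cases:
  fixes b A B :: nat
  assumes "b < A + B" obtains "b < A" | c where "b = A + c" "c < B"
  using assms by (metis add_less_cancel_left le_Suc_ex not_less)

lemma cpull_csum:
  assumes \<phi>: "\<phi> \<in> simplex_maps k n" and x: "cch x \<in> chains n" and y: "cch y \<in> chains n"
  shows "cpull k \<phi> (csum n x y) = csum k (cpull k \<phi> x) (cpull k \<phi> y)"
  unfolding cpull_def csum_def mk_cdata_simps(1)
proof (rule mk_cdata_cong[OF pull_chain_sum[OF \<phi>]], goal_cases)
  have lx: "lev (pull_chain k \<phi> (cch x)) i = lev (cch x) (\<phi> i)" and ly: "lev (pull_chain k \<phi> (cch y)) i = lev (cch y) (\<phi> i)"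
    if "i \<le> k" for i using lev_pull[OF x that] lev_pull[OF y that] .
  {
    case (1 i a)
    have "\<phi> i \<le> n" using simplex_mapsD(2)[OF \<phi> order.refl 1(1)] .
    then show ?case using 1 lx ly by (auto simp: pull_chain_sum[OF \<phi>])
  next
    case (2 m i j U b)
    have "\<phi> j \<le> n" using simplex_mapsD(2)[OF \<phi> order.refl 2(3)] .
    then show ?case using 2 lx ly thick_mor_image[OF 2(1,3) \<phi>] by (auto simp: pull_chain_sum[OF \<phi>])
  }
qed

lemma coherent_csum:
  assumes x: "coherent Q n x" and y: "coherent Q n y"
  shows "coherent Q n (csum n x y)"
proof -
  note cx = coherentD[OF x] and cy = coherentD[OF y]
  let ?A = "lev (cch x)" and ?\<gamma> = "chain_sum n (cch x) (cch y)"
  have fx: "b < ?A i" if "b \<in> set (fibre (cch x) i j a)" for b i j a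
    using that by (simp add: set_fibre[OF cx(1)])
  note fib = fibre_chain_sum[OF cx(1) cy(1)]
  show ?thesis
    unfolding csum_def
  proof (rule coherentI[OF chain_sum_in[OF cx(1) cy(1)]], goal_cases)
    case (1 i a) then show ?case using cx(3)[OF 1(1)] cy(3)[OF 1(1), of "a - ?A i"] by auto
  next
    case (2 m i j U b)
    from 2(4) have "b < ?A j + lev (cch y) j" using 2(3) by simp
    then show ?case
    proof (cases rule: less_add_cases)
      case 1
      have e: "map (\<lambda>a. if a < ?A i then ccol x i a else ccol y i (a - ?A i)) (fibre (cch x) i j b) =
          map (ccol x i) (fibre (cch x) i j b)" using fx by simp
      show ?thesis using cx(4)[OF 2(1,3) 1] 1 unfolding fib(1)[OF 2(2,3) 1] e by simp
    next
      case (2 c)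
      then show ?thesis using cy(4)[OF \<open>U \<in> thick_mor m i j\<close> \<open>j \<le> n\<close> 2(2)]
        unfolding 2(1) fib(2)[OF \<open>i \<le> j\<close> \<open>j \<le> n\<close>] by (simp add: comp_def)
    qed
  next
    case (3 m i a)
    then show ?case using cx(5)[OF 3(1), of a m] cy(5)[OF 3(1), of "a - ?A i" m] by auto
  next
    case (4 m i j l U V b)
    from 4(6) have "b < ?A l + lev (cch y) l" using 4(5) by simp
    then show ?case
    proof (cases rule: less_add_cases)
      case 1
      have e: "map (\<lambda>b. if b < ?A j then cop x m i j U b else cop y m i j U (b - ?A j)) (fibre (cch x) j l b) =
          map (cop x m i j U) (fibre (cch x) j l b)" using fx by simp
      show ?thesis using cx(6)[OF 4(1,2,5) 1] 1 unfolding fib(1)[OF 4(4,5) 1] e by simp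
    next
      case (2 c)
      then show ?thesis using cy(6)[OF 4(1,2,5) 2(2)] unfolding 2(1) fib(2)[OF 4(4,5)] by (simp add: comp_def)
    qed
  next
    case (5 m m' \<psi> i j U b)
    then show ?case using cx(7)[OF 5(1,2,4), of b] cy(7)[OF 5(1,2,4), of "b - ?A j"] by auto
  qed
qed

lemma cch_csum [simp]: "cch (csum n x y) = chain_sum n (cch x) (cch y)"
  by (simp add: csum_def)

lemma lev_subchain: "i \<le> n \<Longrightarrow> lev (subchain n \<alpha> a) i = length (fibre \<alpha> i n a)"
  by (simp add: subchain_def)

lemma cpart_csum:
  assumes x: "cch x \<in> chains n" and y: "cch y \<in> chains n"
  shows "a < lev (cch x) n \<Longrightarrow> cpart n a (csum n x y) = cpart n a x"
    and "cpart n (lev (cch x) n + c) (csum n x y) = cpart n c y"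
proof -
  note sub = subchain_chain_sum[OF x y] and off = offset_chain_sum[OF x y]
  show "cpart n a (csum n x y) = cpart n a x" if a: "a < lev (cch x) n"
    unfolding cpart_def cch_csum
  proof (rule mk_cdata_cong[OF sub(1)[OF a]], goal_cases)
    case (1 i b)
    then have "b < length (fibre (cch x) i n a)" by (simp add: sub(1)[OF a] lev_subchain)
    from offset_mem[OF x 1(1) this] show ?case using off(1)[OF 1(1) a] 1 by (simp add: csum_def)
  next
    case (2 m i j U b)
    then have "b < length (fibre (cch x) j n a)" by (simp add: sub(1)[OF a] lev_subchain)
    from offset_mem[OF x 2(3) this] show ?case using off(1)[OF 2(3) a] 2 by (simp add: csum_def)
  qed
  show "cpart n (lev (cch x) n + c) (csum n x y) = cpart n c y"
    unfolding cpart_def cch_csum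
  proof (rule mk_cdata_cong[OF sub(2)], goal_cases)
    case (1 i b)
    then have "b < length (fibre (cch y) i n c)" by (simp add: sub(2) lev_subchain)
    from offset_mem[OF y 1(1) this] show ?case using off(2)[OF 1(1)] 1 by (simp add: csum_def add.assoc)
  next
    case (2 m i j U b)
    then have "b < length (fibre (cch y) j n c)" by (simp add: sub(2) lev_subchain)
    from offset_mem[OF y 2(3) this] show ?case using off(2)[OF 2(3)] 2 by (simp add: csum_def add.assoc)
  qed
qed

lemma cparts_csum:
  assumes x: "cch x \<in> chains n" and y: "cch y \<in> chains n"
  shows "cparts n (csum n x y) = cparts n x @ cparts n y"
proof (rule nth_equalityI)
  show "length (cparts n (csum n x y)) = length (cparts n x @ cparts n y)" by (simp add: cparts_def)
  fix a assume "a < length (cparts n (csum n x y))"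
  then have "a < lev (cch x) n + lev (cch y) n" by (simp add: cparts_def)
  then show "cparts n (csum n x y) ! a = (cparts n x @ cparts n y) ! a"
    by (cases rule: less_add_cases) (simp_all add: cparts_def nth_append cpart_csum[OF x y])
qed

lemma coherent_cempty: "coherent Q n (cempty n)"
proof -
  have "mk_chain n (\<lambda>_. 0) (\<lambda>_ _ _. 0) \<in> chains n" by (rule mk_chain_in) auto
  then show ?thesis unfolding cempty_def by (rule coherentI) auto
qed

text \<open>Every level maps to the top one, so an empty top level leaves no elements anywhere and
  the normal form fixes the rest. This settles the base cases of \<open>cpull_csum_list\<close> and
  \<open>rooted_decomposition\<close>.\<close>

lemma cempty_unique:
  assumes d: "coherent Q n d" and l: "lev (cch d) n = 0"
  shows "d = cempty n"
proof -
  note c = coherentD[OF d]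
  have z: "lev (cch d) i = 0" if "i \<le> n" for i
    using chain_lt[OF c(1) that order.refl, of 0] l by auto
  have "cch d = mk_chain n (lev (cch d)) (lmap (cch d))" using c(1) by (simp add: chains_def)
  also have "\<dots> = mk_chain n (\<lambda>_. 0) (\<lambda>_ _ _. 0)" by (rule mk_chain_cong) (use z in auto)
  finally have e: "cch d = mk_chain n (\<lambda>_. 0) (\<lambda>_ _ _. 0)" .
  have "mk_cdata n (cch d) (ccol d) (cop d) = cempty n"
    unfolding cempty_def by (rule mk_cdata_cong[OF e]) (use z in auto)
  then show ?thesis using c(2) by simp
qed

text \<open>All elements lie over the single root, so every offset is 0 and every fibre over it is a
  full level.\<close>

lemma cparts_rooted:
  assumes d: "coherent Q n d" and l: "lev (cch d) n = 1"
  shows "cparts n d = [d]"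
proof -
  note c = coherentD[OF d]
  have off: "offset (cch d) n 0 i = 0" for i by (simp add: offset_def)
  have fib: "fibre (cch d) i n 0 = [0..<lev (cch d) i]" if "i \<le> n" for i
    unfolding fibre_def filter_id_conv using chain_lt[OF c(1) that order.refl] l by auto
  have "cch d = mk_chain n (lev (cch d)) (lmap (cch d))" using c(1) by (simp add: chains_def)
  also have "\<dots> = subchain n (cch d) 0" unfolding subchain_def by (rule mk_chain_cong) (simp_all add: off fib)
  finally have s: "subchain n (cch d) 0 = cch d" by simp
  have "cpart n 0 d = mk_cdata n (cch d) (ccol d) (cop d)"
    unfolding cpart_def by (simp add: s off)
  then show ?thesis using c(2) l by (simp add: cparts_def)
qed

text \<open>The elements over the first root form an initial segment of every level, since the level
  maps are monotone. The remaining ones form a window as well, because the complement of a union of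
  fibres is again one.\<close>

lemma csum_split:
  assumes d: "coherent Q n d" and l: "lev (cch d) n = Suc r"
  shows "\<exists>e. coherent Q n e \<and> lev (cch e) n = r \<and> d = csum n (cpart n 0 d) e"
proof -
  note c = coherentD[OF d]
  let ?\<alpha> = "cch d"
  define s where "s i = length (fibre ?\<alpha> i n 0)" for i
  define t where "t i = lev ?\<alpha> i - s i" for i
  have off: "offset ?\<alpha> n 0 i = 0" for i by (simp add: offset_def)
  have off': "offset ?\<alpha> n 0 = (\<lambda>_. 0)" using off by blast
  have w0: "window n ?\<alpha> (\<lambda>_. 0) s" using window_part[OF c(1), of 0] by (simp only: off' s_def[abs_def])
  have s_le: "s i \<le> lev ?\<alpha> i" if "i \<le> n" for i using w0 that by (simp add: window_def)
  have s_iff: "b < s i \<longleftrightarrow> lmap ?\<alpha> i j b < s j" if "i \<le> j" "j \<le> n" "b < lev ?\<alpha> i" for i j b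
    using w0 that by (simp add: window_def)
  have w: "window n ?\<alpha> s t"
    unfolding window_def
  proof (intro conjI allI impI, goal_cases)
    case (1 i) then show ?case using s_le by (simp add: t_def)
  next
    case (2 i j b)
    have "i \<le> n" using 2 by simp
    then show ?case
      using s_iff[OF 2] chain_lt[OF c(1) 2] s_le[OF \<open>i \<le> n\<close>] s_le[OF 2(2)] 2 unfolding t_def by auto
  qed
  let ?e = "wdata n s t d"
  have p0: "cpart n 0 d = wdata n (\<lambda>_. 0) s d"
    using cpart_wdata[of n 0 d] by (simp only: off' s_def[abs_def])
  have e: "coherent Q n ?e" by (rule coherent_wdata[OF d w])
  have "s n = 1" using top_fibre[OF c(1)] l by (simp add: s_def)
  then have r: "lev (cch ?e) n = r" using lev_wchain[OF c(1) w order.refl] l by (simp add: wdata_def t_def)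
  have ch: "?\<alpha> = chain_sum n (wchain n (\<lambda>_. 0) s ?\<alpha>) (wchain n s t ?\<alpha>)"
  proof -
    have "?\<alpha> = mk_chain n (lev ?\<alpha>) (lmap ?\<alpha>)" using c(1) by (simp add: chains_def)
    also have "\<dots> = chain_sum n (wchain n (\<lambda>_. 0) s ?\<alpha>) (wchain n s t ?\<alpha>)"
      unfolding chain_sum_def
    proof (rule mk_chain_cong, goal_cases)
      case (1 i) then show ?case using s_le by (simp add: wchain_def t_def)
    next
      case (2 i j b)
      have "i \<le> n" using 2 by simp
      then show ?case using 2 s_le[of i] s_le[of j] s_iff[OF 2] by (auto simp: wchain_def t_def)
    qed
    finally show ?thesis .
  qed
  have "mk_cdata n ?\<alpha> (ccol d) (cop d) = csum n (cpart n 0 d) ?e"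
    unfolding csum_def p0
  proof (rule mk_cdata_cong, goal_cases)
    case 1 show ?case using ch by (simp add: wdata_def)
  next
    case (2 i a) then show ?case using s_le by (auto simp: wdata_def wchain_def t_def)
  next
    case (3 m i j U b) then show ?case using s_le by (auto simp: wdata_def wchain_def t_def)
  qed
  then show ?thesis using e r c(2) by auto
qed

definition rooted_coherent :: "('c, 'o) soperad \<Rightarrow> nat \<Rightarrow> ('c, 'o) cdata set" where
  "rooted_coherent Q n = {d. coherent Q n d \<and> lev (cch d) n = 1}"

lemma coherent_csum_list: "(\<And>d. d \<in> set ds \<Longrightarrow> coherent Q n d) \<Longrightarrow> coherent Q n (csum_list n ds)"
  by (induction ds) (auto intro: coherent_cempty coherent_csum)

lemma cparts_csum_list:
  "(\<And>d. d \<in> set ds \<Longrightarrow> coherent Q n d) \<Longrightarrow> cparts n (csum_list n ds) = concat (map (cparts n) ds)"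
proof (induction ds)
  case Nil show ?case by (simp add: cparts_def cempty_def)
next
  case (Cons d ds)
  have "cch d \<in> chains n" "cch (csum_list n ds) \<in> chains n"
    using Cons.prems coherentD(1) coherent_csum_list[of ds Q n] by auto
  then show ?case using Cons by (simp add: cparts_csum)
qed

lemma cparts_csum_list_rooted:
  assumes "ds \<in> lists (rooted_coherent Q n)" shows "cparts n (csum_list n ds) = ds"
proof -
  have m: "map (cparts n) ds = map (\<lambda>d. [d]) ds"
    using assms cparts_rooted by (auto simp: rooted_coherent_def in_lists_conv_set)
  have "cparts n (csum_list n ds) = concat (map (cparts n) ds)"
    by (rule cparts_csum_list) (use assms in \<open>auto simp: rooted_coherent_def in_lists_conv_set\<close>)
  then show ?thesis unfolding m by simp
qed

lemma cpull_csum_list: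
  assumes \<phi>: "\<phi> \<in> simplex_maps k n"
  shows "(\<And>d. d \<in> set ds \<Longrightarrow> coherent Q n d) \<Longrightarrow> cpull k \<phi> (csum_list n ds) = csum_list k (map (cpull k \<phi>) ds)"
proof (induction ds)
  case Nil
  have "coherent Q k (cpull k \<phi> (cempty n))" by (rule coherent_cpull[OF coherent_cempty \<phi>])
  moreover have "lev (cch (cpull k \<phi> (cempty n))) k = 0"
    using simplex_mapsD(2)[OF \<phi> order.refl order.refl] by (simp add: cpull_def pull_chain_def cempty_def)
  ultimately show ?case using cempty_unique by auto
next
  case (Cons d ds)
  have "cch d \<in> chains n" "cch (csum_list n ds) \<in> chains n"
    using Cons.prems coherentD(1) coherent_csum_list[of ds Q n] by auto
  then show ?case using Cons by (simp add: cpull_csum[OF \<phi>])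
qed

lemma rooted_decomposition:
  "coherent Q n d \<Longrightarrow> \<exists>ds \<in> lists (rooted_coherent Q n). d = csum_list n ds"
proof (induction "lev (cch d) n" arbitrary: d)
  case 0 then show ?case using cempty_unique by (intro bexI[of _ "[]"]) auto
next
  case (Suc r)
  from csum_split[OF Suc.prems Suc.hyps(2)[symmetric]] obtain e where
    e: "coherent Q n e" "lev (cch e) n = r" "d = csum n (cpart n 0 d) e" by blast
  from Suc.hyps(1)[OF e(2)[symmetric] e(1)] obtain ds where
    ds: "ds \<in> lists (rooted_coherent Q n)" "e = csum_list n ds" by blast
  have "cpart n 0 d \<in> rooted_coherent Q n"
    using coherent_cpart[OF Suc.prems] rooted_cpart[OF Suc.prems, of 0] Suc.hyps(2) by (simp add: rooted_coherent_def)
  then show ?case using ds e(3) by (intro bexI[of _ "cpart n 0 d # ds"]) auto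
qed

text \<open>\<open>cparts\<close> recovers any list of rooted data from its sum, so the existence of
  a decomposition already makes the two operations mutually inverse.\<close>

lemma csum_list_cparts:
  assumes "coherent Q n d"
  shows "csum_list n (cparts n d) = d" "cparts n d \<in> lists (rooted_coherent Q n)"
  using rooted_decomposition[OF assms] cparts_csum_list_rooted[of _ Q n] by metis+

text \<open>Restricting and cutting may be done piece by piece. In the nerve this becomes the
  composition law of listings.\<close>

lemma cparts_cpull:
  assumes d: "coherent Q n d" and \<phi>: "\<phi> \<in> simplex_maps k n"
  shows "cparts k (cpull k \<phi> d) = concat (map (\<lambda>e. cparts k (cpull k \<phi> e)) (cparts n d))"
proof -
  have r: "coherent Q n e" if "e \<in> set (cparts n d)" for e
    using csum_list_cparts(2)[OF d] that by (auto simp: rooted_coherent_def in_lists_conv_set)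
  have "cpull k \<phi> d = csum_list k (map (cpull k \<phi>) (cparts n d))"
    using cpull_csum_list[OF \<phi>, of "cparts n d" Q] r csum_list_cparts(1)[OF d] by simp
  then show ?thesis using cparts_csum_list[of "map (cpull k \<phi>) (cparts n d)" Q k] coherent_cpull[OF r \<phi>]
    by (auto simp: comp_def)
qed

section \<open>Lists of simplices of the nerve as coherent data\<close>

context soperad
begin

abbreviation "N \<equiv> coherent_list_nerve Q"

lemma nerve_splx: "(\<alpha>, x) \<in> lsplx N n \<longleftrightarrow> \<alpha> \<in> rooted_chains n \<and> x \<in> soperad_Hom (thick_operad n \<alpha>) Q"
  by (simp add: coherent_list_nerve_def)

lemma rooted_chainsD: "\<alpha> \<in> rooted_chains n \<Longrightarrow> \<alpha> \<in> chains n" "\<alpha> \<in> rooted_chains n \<Longrightarrow> lev \<alpha> n = 1"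
  by (simp_all add: rooted_chains_def)

lemma cch_cdata_of [simp]: "cch (cdata_of n (\<alpha>, x)) = \<alpha>"
  by (simp add: cdata_of_def)

lemma nerve_cdata: "y \<in> lsplx N n \<Longrightarrow> cdata_of n y \<in> rooted_coherent Q n"
  using coherent_cdata_of[OF _ Q] rooted_chainsD by (cases y) (auto simp: nerve_splx rooted_coherent_def)

lemma nerve_inj: "inj_on (cdata_of n) (lsplx N n)"
proof (rule inj_onI)
  fix y y' assume y: "y \<in> lsplx N n" "y' \<in> lsplx N n" and eq: "cdata_of n y = cdata_of n y'"
  obtain \<alpha> x \<beta> x' where s: "y = (\<alpha>, x)" "y' = (\<beta>, x')" by (cases y; cases y')
  then have "\<alpha> = \<beta>" using arg_cong[OF eq, of cch] by simp
  then show "y = y'" using y eq cdata_of_inj[OF rooted_chainsD(1) Q, of \<alpha> n x x'] by (simp add: s nerve_splx)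
qed

lemma nerve_surj:
  assumes d: "d \<in> rooted_coherent Q n"
  shows "\<exists>y \<in> lsplx N n. cdata_of n y = d"
proof -
  have "coherent Q n d" "cch d \<in> rooted_chains n"
    using d coherentD(1)[of Q n d] by (auto simp: rooted_coherent_def rooted_chains_def)
  then show ?thesis using cdata_of_surj[OF coherentD(1) Q, of Q n d d] nerve_splx by blast
qed

lemma nerve_act:
  assumes \<phi>: "\<phi> \<in> simplex_maps k n" and y: "y \<in> lsplx N n"
  shows "lact N k n \<phi> y \<in> lists (lsplx N k)"
    and "map (cdata_of k) (lact N k n \<phi> y) = cparts k (cpull k \<phi> (cdata_of n y))"
proof -
  obtain \<alpha> x where yx: "y = (\<alpha>, x)" by (cases y)
  have \<alpha>: "\<alpha> \<in> chains n" and x: "x \<in> soperad_Hom (thick_operad n \<alpha>) Q"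
    using y rooted_chainsD(1) by (simp_all add: yx nerve_splx)
  have l: "lev (pull_chain k \<phi> \<alpha>) k = lev \<alpha> (\<phi> k)" by (rule lev_pull[OF \<alpha> order.refl])
  note a = cdata_of_act[OF \<alpha> \<phi> Q x]
  have "subchain k (pull_chain k \<phi> \<alpha>) a \<in> rooted_chains k" if "a < lev \<alpha> (\<phi> k)" for a
    using subchain_in[OF pull_in[OF \<alpha> \<phi>]] top_fibre[OF pull_in[OF \<alpha> \<phi>], of a] l that lev_subchain[of k k]
    by (simp add: rooted_chains_def)
  then show "lact N k n \<phi> y \<in> lists (lsplx N k)"
    using a(1) by (auto simp: in_lists_conv_set yx coherent_list_nerve_def Let_def)
  show "map (cdata_of k) (lact N k n \<phi> y) = cparts k (cpull k \<phi> (cdata_of n y))"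
    using a(2) l by (simp add: yx coherent_list_nerve_def Let_def cparts_def cpull_def comp_def)
qed

text \<open>Equations between lists of simplices are thereby checked on data, where the operators
  are \<open>cpull\<close> and \<open>cparts\<close> instead of composites with morphisms of thick
  operads.\<close>

lemma nerve_list_eqI:
  assumes "xs \<in> lists (lsplx N k)" "ys \<in> lists (lsplx N k)" "map (cdata_of k) xs = map (cdata_of k) ys"
  shows "xs = ys"
proof -
  have "set xs \<union> set ys \<subseteq> lsplx N k" using assms(1,2) by (auto simp: in_lists_conv_set)
  then show ?thesis using assms(3) inj_on_map_eq_map inj_on_subset[OF nerve_inj] by blast
qed

lemma concat_lists: "(\<And>x. x \<in> set xs \<Longrightarrow> f x \<in> lists A) \<Longrightarrow> concat (map f xs) \<in> lists A"
  by (induction xs) auto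

lemma nerve_act_comp:
  assumes \<phi>: "\<phi> \<in> simplex_maps k n" and \<eta>: "\<eta> \<in> simplex_maps l k" and y: "y \<in> lsplx N n"
  shows "lact N l n (compose {..l} \<phi> \<eta>) y = listing_comp (lact N l k \<eta>) (lact N k n \<phi>) y"
proof (rule nerve_list_eqI)
  show "lact N l n (compose {..l} \<phi> \<eta>) y \<in> lists (lsplx N l)"
    by (rule nerve_act(1)[OF simplex_maps_comp[OF \<phi> \<eta>] y])
  have z: "z \<in> lsplx N k" if "z \<in> set (lact N k n \<phi> y)" for z
    using nerve_act(1)[OF \<phi> y] that by (auto simp: in_lists_conv_set)
  then show "listing_comp (lact N l k \<eta>) (lact N k n \<phi>) y \<in> lists (lsplx N l)"
    unfolding listing_comp_def by (intro concat_lists nerve_act(1)[OF \<eta>])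
  let ?d = "cdata_of n y"
  have d: "coherent Q n ?d" using nerve_cdata[OF y] by (simp add: rooted_coherent_def)
  have "map (cdata_of l) (listing_comp (lact N l k \<eta>) (lact N k n \<phi>) y) =
      concat (map (\<lambda>z. map (cdata_of l) (lact N l k \<eta> z)) (lact N k n \<phi> y))"
    by (simp add: listing_comp_def map_concat comp_def)
  also have "\<dots> = concat (map (\<lambda>z. cparts l (cpull l \<eta> (cdata_of k z))) (lact N k n \<phi> y))"
    using nerve_act(2)[OF \<eta> z] by (intro arg_cong[of _ _ concat] map_cong) auto
  also have "\<dots> = concat (map (\<lambda>e. cparts l (cpull l \<eta> e)) (map (cdata_of k) (lact N k n \<phi> y)))"
    by (simp add: comp_def)
  also have "\<dots> = cparts l (cpull l \<eta> (cpull k \<phi> ?d))"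
    using cparts_cpull[OF coherent_cpull[OF d \<phi>] \<eta>] nerve_act(2)[OF \<phi> y] by simp
  finally show "map (cdata_of l) (lact N l n (compose {..l} \<phi> \<eta>) y) =
      map (cdata_of l) (listing_comp (lact N l k \<eta>) (lact N k n \<phi>) y)"
    using nerve_act(2)[OF simplex_maps_comp[OF \<phi> \<eta>] y] cpull_comp[OF coherentD(1)[OF d] \<phi> \<eta>] by simp
qed

lemma nerve_act_id:
  assumes y: "y \<in> lsplx N n"
  shows "lact N n n (\<lambda>i\<in>{..n}. i) y = [y]"
proof (rule nerve_list_eqI)
  have i: "(\<lambda>i\<in>{..n}. i) \<in> simplex_maps n n" by (rule simplex_mapsI) auto
  show "lact N n n (\<lambda>i\<in>{..n}. i) y \<in> lists (lsplx N n)" by (rule nerve_act(1)[OF i y])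
  have d: "coherent Q n (cdata_of n y)" "lev (cch (cdata_of n y)) n = 1"
    using nerve_cdata[OF y] by (simp_all add: rooted_coherent_def)
  show "map (cdata_of n) (lact N n n (\<lambda>i\<in>{..n}. i) y) = map (cdata_of n) [y]"
    using nerve_act(2)[OF i y] cpull_id[OF d(1)] cparts_rooted[OF d] by simp
qed (use y in simp)

lemma simplicial_list_nerve: "simplicial_list N"
  unfolding simplicial_list_def using nerve_act(1) nerve_act_id nerve_act_comp by blast

lemma operadic_nerve: "operadic N"
  unfolding operadic_def
proof (intro allI ballI impI)
  fix k n \<theta> y assume "\<theta> \<in> simplex_maps k n" "\<theta> k = n" "y \<in> lsplx N n"
  then show "length (lact N k n \<theta> y) = 1"
    using rooted_chainsD(2) by (cases y) (auto simp: coherent_list_nerve_def)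
qed

definition total :: "nat \<Rightarrow> (chain \<times> (thick \<times> nat \<Rightarrow> 'c) \<times> (nat \<Rightarrow> thick_ops \<Rightarrow> 'o)) list \<Rightarrow> ('c, 'o) cdata" where
  "total n ys = csum_list n (map (cdata_of n) ys)"

lemma total_cdata: "ys \<in> lists (lsplx N n) \<Longrightarrow> map (cdata_of n) ys \<in> lists (rooted_coherent Q n)"
  using nerve_cdata by (auto simp: in_lists_conv_set)

text \<open>Two bijections are combined: simplices of the nerve with rooted data, and lists of
  rooted data with arbitrary data.\<close>

lemma total_bij: "bij_betw (total n) (lists (lsplx N n)) {d. coherent Q n d}"
proof (rule bij_betwI')
  fix xs ys assume xs: "xs \<in> lists (lsplx N n)" and ys: "ys \<in> lists (lsplx N n)"
  show "total n xs = total n ys \<longleftrightarrow> xs = ys"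
    using cparts_csum_list_rooted[OF total_cdata[OF xs]] cparts_csum_list_rooted[OF total_cdata[OF ys]]
      nerve_list_eqI[OF xs ys] unfolding total_def by metis
next
  fix xs assume "xs \<in> lists (lsplx N n)"
  from total_cdata[OF this] show "total n xs \<in> {d. coherent Q n d}"
    using coherent_csum_list[of "map (cdata_of n) xs" Q n]
    unfolding total_def in_lists_conv_set rooted_coherent_def by blast
next
  fix d assume "d \<in> {d. coherent Q n d}"
  then have d: "csum_list n (cparts n d) = d" "cparts n d \<in> lists (rooted_coherent Q n)"
    using csum_list_cparts[of Q n d] by blast+
  have "\<forall>e \<in> rooted_coherent Q n. \<exists>y. y \<in> lsplx N n \<and> cdata_of n y = e" using nerve_surj by blast
  from bchoice[OF this] obtain g where
    g: "\<forall>e \<in> rooted_coherent Q n. g e \<in> lsplx N n \<and> cdata_of n (g e) = e" ..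
  have "map (cdata_of n) (map g (cparts n d)) = cparts n d"
    unfolding map_map by (rule map_idI) (use g d(2) in \<open>auto simp: in_lists_conv_set\<close>)
  moreover have "map g (cparts n d) \<in> lists (lsplx N n)" using g d(2) by (auto simp: in_lists_conv_set)
  ultimately show "\<exists>xs \<in> lists (lsplx N n). d = total n xs"
    using d(1) by (intro bexI[of _ "map g (cparts n d)"]) (simp_all only: total_def)
qed

text \<open>By \<open>cparts_cpull\<close> both sides have the same rooted parts, and
  \<open>csum_list\<close> recovers a datum from its parts.\<close>

lemma total_hom: "sset_hom (list_sset N) (coherent_sset Q) total"
  unfolding sset_hom_def
proof (intro conjI allI ballI)
  fix n xs assume "xs \<in> splx (list_sset N) n"
  then show "total n xs \<in> splx (coherent_sset Q) n"
    using total_bij[of n] by (auto simp: list_sset_def coherent_sset_def bij_betw_def)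
next
  fix k n \<phi> xs assume \<phi>: "\<phi> \<in> simplex_maps k n" and "xs \<in> splx (list_sset N) n"
  then have xs: "xs \<in> lists (lsplx N n)" by (simp add: list_sset_def)
  let ?ds = "map (cdata_of n) xs"
  have y: "y \<in> lsplx N n" if "y \<in> set xs" for y using xs that by (auto simp: in_lists_conv_set)
  have d: "coherent Q n e" if "e \<in> set ?ds" for e
    using total_cdata[OF xs] that by (auto simp: in_lists_conv_set rooted_coherent_def)
  let ?t = "csum_list n ?ds"
  have t: "coherent Q n ?t" by (rule coherent_csum_list[OF d])
  have "map (cdata_of k) (concat (map (lact N k n \<phi>) xs)) = concat (map (\<lambda>y. cparts k (cpull k \<phi> (cdata_of n y))) xs)"
    unfolding map_concat map_map comp_def
    by (intro arg_cong[of _ _ concat] map_cong HOL.refl nerve_act(2)[OF \<phi> y])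
  also have "\<dots> = concat (map (\<lambda>e. cparts k (cpull k \<phi> e)) ?ds)" by (simp add: comp_def)
  also have "\<dots> = cparts k (cpull k \<phi> ?t)"
    using cparts_cpull[OF t \<phi>] cparts_csum_list_rooted[OF total_cdata[OF xs]] by simp
  finally show "total k (sact (list_sset N) k n \<phi> xs) = sact (coherent_sset Q) k n \<phi> (total n xs)"
    using csum_list_cparts(1)[OF coherent_cpull[OF t \<phi>]] by (simp add: total_def list_sset_def coherent_sset_def)
qed

end

lemma simplicial_set_list_sset:
  assumes X: "simplicial_list X" shows "simplicial_set (list_sset X)"
proof -
  have 1: "lact X k n \<theta> x \<in> lists (lsplx X k)" if "\<theta> \<in> simplex_maps k n" "x \<in> lsplx X n" for k n \<theta> x
    using X that unfolding simplicial_list_def by blast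
  have 2: "lact X n n (\<lambda>i\<in>{..n}. i) x = [x]" if "x \<in> lsplx X n" for n x
    using X that unfolding simplicial_list_def by blast
  have 3: "lact X l n (compose {..l} \<theta> \<eta>) x = concat (map (lact X l k \<eta>) (lact X k n \<theta> x))"
    if "\<theta> \<in> simplex_maps k n" "\<eta> \<in> simplex_maps l k" "x \<in> lsplx X n" for l k n \<theta> \<eta> x
    using X that unfolding simplicial_list_def listing_comp_def by blast
  show ?thesis
    unfolding simplicial_set_def list_sset_def sset.select_convs
  proof (intro conjI allI ballI)
    fix k n \<theta> xs assume t: "\<theta> \<in> simplex_maps k n" and xs: "xs \<in> lists (lsplx X n)"
    have "lact X k n \<theta> x \<in> lists (lsplx X k)" if "x \<in> set xs" for x
      using 1[OF t] xs that by (auto simp: in_lists_conv_set)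
    then show "concat (map (lact X k n \<theta>) xs) \<in> lists (lsplx X k)" by (induction xs) auto
  next
    fix n xs assume "xs \<in> lists (lsplx X n)"
    then have "map (lact X n n (\<lambda>i\<in>{..n}. i)) xs = map (\<lambda>x. [x]) xs"
      by (intro map_cong HOL.refl 2) (simp add: in_lists_conv_set)
    then show "concat (map (lact X n n (\<lambda>i\<in>{..n}. i)) xs) = xs" by (simp only: concat_map_singleton list.map_ident)
  next
    fix l k n \<theta> \<eta> xs assume t: "\<theta> \<in> simplex_maps k n" "\<eta> \<in> simplex_maps l k" and xs: "xs \<in> lists (lsplx X n)"
    then show "concat (map (lact X l n (compose {..l} \<theta> \<eta>)) xs) =
        concat (map (lact X l k \<eta>) (concat (map (lact X k n \<theta>) xs)))"
      by (induction xs) (auto simp: 3[OF t])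
  qed
qed

lemma fills_horn_iso:
  assumes S: "simplicial_set S" and h: "sset_hom S T h" and b: "\<And>n. bij_betw (h n) (splx S n) (splx T n)"
    and T: "fills_horn T n i"
  shows "fills_horn S n i"
  unfolding fills_horn_def
proof (intro allI impI)
  fix f assume f: "sset_hom (horn n i) S f"
  have "sset_hom (horn n i) T (\<lambda>k \<theta>. h k (f k \<theta>))"
    using f h unfolding sset_hom_def by simp
  then obtain g where g: "sset_hom (std_simplex n) T g"
    "\<And>k \<theta>. \<theta> \<in> splx (horn n i) k \<Longrightarrow> g k \<theta> = h k (f k \<theta>)"
    using T unfolding fills_horn_def by blast
  define u where "u k = inv_into (splx S k) (h k)" for k
  have u: "u k y \<in> splx S k" "h k (u k y) = y" if "y \<in> splx T k" for k y
    using b[of k] that inv_into_into[of y "h k" "splx S k"] f_inv_into_f[of y "h k" "splx S k"]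
    by (auto simp: u_def bij_betw_def)
  have uh: "u k (h k x) = x" if "x \<in> splx S k" for k x
    using b[of k] that by (simp add: u_def bij_betw_def)
  have inj: "x = y" if "h k x = h k y" "x \<in> splx S k" "y \<in> splx S k" for k x y using uh that by metis
  have "sset_hom (std_simplex n) S (\<lambda>k \<theta>. u k (g k \<theta>))"
    unfolding sset_hom_def
  proof (intro conjI allI ballI)
    fix k \<theta> assume "\<theta> \<in> splx (std_simplex n) k"
    then show "u k (g k \<theta>) \<in> splx S k" using g(1) u by (simp add: sset_hom_def)
  next
    fix l k \<eta> \<theta> assume \<eta>: "\<eta> \<in> simplex_maps l k" and \<theta>: "\<theta> \<in> splx (std_simplex n) k"
    have gT: "g k \<theta> \<in> splx T k" using g(1) \<theta> by (simp add: sset_hom_def)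
    have gn: "g l (sact (std_simplex n) l k \<eta> \<theta>) = sact T l k \<eta> (g k \<theta>)"
      using g(1) \<theta> \<eta> by (simp add: sset_hom_def)
    have a: "sact S l k \<eta> (u k (g k \<theta>)) \<in> splx S l" using S \<eta> u(1)[OF gT] by (simp add: simplicial_set_def)
    have hn: "h l (sact S l k \<eta> (u k (g k \<theta>))) = sact T l k \<eta> (g k \<theta>)"
      using h \<eta> u[OF gT] by (simp add: sset_hom_def)
    show "u l (g l (sact (std_simplex n) l k \<eta> \<theta>)) = sact S l k \<eta> (u k (g k \<theta>))"
      unfolding gn hn[symmetric] by (rule uh[OF a])
  qed
  moreover have "u k (g k \<theta>) = f k \<theta>" if "\<theta> \<in> splx (horn n i) k" for k \<theta>
    using g(2)[OF that] uh f that by (simp add: sset_hom_def)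
  ultimately show "\<exists>g. sset_hom (std_simplex n) S g \<and> (\<forall>k. \<forall>\<theta>\<in>splx (horn n i) k. g k \<theta> = f k \<theta>)"
    by (intro exI[of _ "\<lambda>k \<theta>. u k (g k \<theta>)"]) blast
qed

subsection \<open>Inner horns of coherent data\<close>

text \<open>Equality on the face spanned by \<open>B\<close>, without reindexing it: both arguments
  keep the indices \<open>{..n}\<close>. A chain \<open>U\<close> lies in the face when its largest
  member \<open>U m\<close> does.\<close>

definition agree :: "nat \<Rightarrow> nat set \<Rightarrow> ('c, 'o) cdata \<Rightarrow> ('c, 'o) cdata \<Rightarrow> bool" where
  "agree n B d e \<longleftrightarrow>
    (\<forall>p \<in> B. lev (cch d) p = lev (cch e) p) \<and>
    (\<forall>p \<in> B. \<forall>q \<in> B. \<forall>a. p \<le> q \<longrightarrow> a < lev (cch d) p \<longrightarrow> lmap (cch d) p q a = lmap (cch e) p q a) \<and>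
    (\<forall>p \<in> B. \<forall>a. a < lev (cch d) p \<longrightarrow> ccol d p a = ccol e p a) \<and>
    (\<forall>m p q U b. U \<in> thick_mor m p q \<longrightarrow> q \<le> n \<longrightarrow> U m \<subseteq> B \<longrightarrow> b < lev (cch d) q \<longrightarrow>
       cop d m p q U b = cop e m p q U b)"

lemma agreeD:
  assumes "agree n B d e"
  shows "p \<in> B \<Longrightarrow> lev (cch d) p = lev (cch e) p"
    "p \<in> B \<Longrightarrow> q \<in> B \<Longrightarrow> p \<le> q \<Longrightarrow> a < lev (cch d) p \<Longrightarrow> lmap (cch d) p q a = lmap (cch e) p q a"
    "p \<in> B \<Longrightarrow> a < lev (cch d) p \<Longrightarrow> ccol d p a = ccol e p a"
    "U \<in> thick_mor m p q \<Longrightarrow> q \<le> n \<Longrightarrow> U m \<subseteq> B \<Longrightarrow> b < lev (cch d) q \<Longrightarrow> cop d m p q U b = cop e m p q U b"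
  using assms unfolding agree_def by simp_all

lemma agree_sym: "agree n B d e \<Longrightarrow> agree n B e d"
  unfolding agree_def
  \<comment> \<open>The bound on \<open>b\<close> transfers because the endpoint \<open>q\<close>
    belongs to \<open>U m\<close> and so to \<open>B\<close>.\<close>
  by (elim conjE, intro conjI ballI allI impI; simp) (metis subsetD thick_morD(3))

lemma agree_trans: "agree n B d e \<Longrightarrow> agree n B e f \<Longrightarrow> agree n B d f"
  unfolding agree_def
  by (elim conjE, intro conjI ballI allI impI; simp) (metis subsetD thick_morD(3))

lemma agree_cpull:
  assumes a: "agree n B d e" and \<theta>: "\<theta> \<in> simplex_maps k n" "\<theta> ` {..k} \<subseteq> B"
    and d: "cch d \<in> chains n" and e: "cch e \<in> chains n"
  shows "cpull k \<theta> d = cpull k \<theta> e"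
  unfolding cpull_def
proof (rule mk_cdata_cong, goal_cases)
  have B: "\<theta> p \<in> B" if "p \<le> k" for p using \<theta>(2) that by auto
  have l: "lev (pull_chain k \<theta> (cch d)) p = lev (cch d) (\<theta> p)" if "p \<le> k" for p by (rule lev_pull[OF d that])
  {
    case 1
    show ?case unfolding pull_chain_def
      by (rule mk_chain_cong) (use agreeD(1)[OF a B] agreeD(2)[OF a B B] simplex_mapsD(1)[OF \<theta>(1)] in auto)
  next
    case (2 p b) then show ?case using agreeD(3)[OF a B] l by simp
  next
    case (3 m p q U b)
    have "\<theta> ` U m \<subseteq> B" using \<theta>(2) thick_morD(4)[OF 3(1), of m] 3(3) by fastforce
    then show ?case
      using agreeD(4)[OF a thick_mor_image[OF 3(1,3) \<theta>(1)] simplex_mapsD(2)[OF \<theta>(1) order.refl 3(3)]] 3 l by simp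
  }
qed

text \<open>Applied to a retraction onto \<open>B\<close>: two data with the same restriction along
  it then agree on \<open>B\<close>. In this way the compatibility of faces is extracted from a
  horn.\<close>

lemma agree_fixed:
  assumes \<theta>: "\<theta> \<in> simplex_maps n n" "\<And>p. p \<in> B \<Longrightarrow> \<theta> p = p" and B: "B \<subseteq> {..n}" and e: "cch e \<in> chains n"
  shows "agree n B (cpull n \<theta> e) e"
proof -
  have l: "lev (pull_chain n \<theta> (cch e)) p = lev (cch e) p" if "p \<in> B" for p
    using lev_pull[OF e, of p n \<theta>] that \<theta>(2) B by auto
  show ?thesis
    unfolding agree_def
  proof (intro conjI ballI allI impI, goal_cases)
    case (1 p) then show ?case using l by (simp add: cpull_def)
  next
    case (2 p q a) then show ?case using l \<theta>(2) B by (auto simp: cpull_def pull_chain_def)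
  next
    case (3 p a) then show ?case using l \<theta>(2) B by (auto simp: cpull_def)
  next
    case (4 m p q U b)
    note u = thick_morD[OF 4(1)]
    have pq: "p \<in> B" "q \<in> B" using 4(3) u(2,3) by auto
    have "\<theta> x = x" if "x \<in> U r" for x r using 4(3) u(7)[of r] that \<theta>(2) by blast
    then have "\<theta> ` U r = U r" for r by simp
    then show ?case using 4 pq \<theta>(2) by (simp add: cpull_def)
  qed
qed

text \<open>A monotone retraction of \<open>[n]\<close> onto \<open>B\<close>: it turns a face of a horn into an \<open>n\<close>-simplex that
  carries the same indices.\<close>

definition retract :: "nat \<Rightarrow> nat set \<Rightarrow> nat \<Rightarrow> nat" where
  "retract n B = (\<lambda>p\<in>{..n}. if \<exists>b\<in>B. b \<le> p then Max {b \<in> B. b \<le> p} else Min B)"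

lemma retract:
  assumes B: "B \<subseteq> {..n}" "B \<noteq> {}"
  shows "retract n B \<in> simplex_maps n n" "p \<in> B \<Longrightarrow> retract n B p = p" "retract n B ` {..n} \<subseteq> B"
proof -
  have fin: "finite B" using B(1) finite_subset by blast
  have in_B: "retract n B p \<in> B" if "p \<le> n" for p
  proof (cases "\<exists>b\<in>B. b \<le> p")
    case True
    then have "Max {b \<in> B. b \<le> p} \<in> {b \<in> B. b \<le> p}" using fin by (intro Max_in) auto
    then show ?thesis using True that by (simp add: retract_def)
  qed (use that fin B(2) in \<open>simp add: retract_def\<close>)
  then show "retract n B ` {..n} \<subseteq> B" by auto
  show "retract n B p = p" if "p \<in> B"
  proof -
    have "Max {b \<in> B. b \<le> p} = p" using that fin by (intro Max_eqI) auto
    then show ?thesis using that B(1) by (auto simp: retract_def)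
  qed
  show "retract n B \<in> simplex_maps n n"
  proof (rule simplex_mapsI)
    show "retract n B p \<le> n" if "p \<le> n" for p using in_B[OF that] B(1) by auto
    show "retract n B p = undefined" if "\<not> p \<le> n" for p using that by (simp add: retract_def)
    fix p q assume pq: "p \<le> q" "q \<le> n"
    show "retract n B p \<le> retract n B q"
    proof (cases "\<exists>b\<in>B. b \<le> p")
      case True
      then have "Max {b \<in> B. b \<le> p} \<le> Max {b \<in> B. b \<le> q}" using fin pq by (intro Max_mono) auto
      then show ?thesis using True pq by (auto simp: retract_def intro: order.trans)
    next
      case False
      then have "retract n B p = Min B" using pq by (simp add: retract_def)
      then show ?thesis using in_B[OF pq(2)] fin by simp
    qed
  qed
qed

text \<open>\<open>x k\<close> is an n-simplex standing for the k-th face; only its part over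
  \<open>{..n} - {k}\<close> carries information. \<open>agr\<close> is the compatibility of two
  faces where they meet.\<close>

locale inner_horn = soperad Q for Q :: "('c, 'o) soperad" +
  fixes n i :: nat and x :: "nat \<Rightarrow> ('c, 'o) cdata"
  assumes kan: "\<And>as b. as \<in> lists (Col (lvl Q 0)) \<Longrightarrow> b \<in> Col (lvl Q 0) \<Longrightarrow> kan_complex (op_space Q as b)"
    and i: "0 < i" "i < n"
    and coh: "\<And>k. k \<le> n \<Longrightarrow> k \<noteq> i \<Longrightarrow> coherent Q n (x k)"
    and agr: "\<And>k l. k \<le> n \<Longrightarrow> k \<noteq> i \<Longrightarrow> l \<le> n \<Longrightarrow> l \<noteq> i \<Longrightarrow> agree n ({..n} - {k, l}) (x k) (x l)"
begin

text \<open>\<open>ix p\<close> is a face that contains \<open>p\<close>, and all \<open>q \<ge> p\<close> unless \<open>p = 0\<close> and \<open>q = n\<close>.\<close>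

definition "ix p = (if p = 0 then n else (0::nat))"
definition "A p = lev (cch (x (ix p))) p"
text \<open>No face of the horn is certain to contain both 0 and n: for n = 2 only the missing one
  does. The map from level 0 to level n is therefore composed through \<open>i\<close>, using the
  faces \<open>n\<close> and 0.\<close>

definition "f p q a = (if p = 0 \<and> q = n then lmap (cch (x 0)) i n (lmap (cch (x n)) 0 i a) else lmap (cch (x (ix p))) p q a)"
definition "\<alpha> = mk_chain n A f"
definition "F p a = ccol (x (ix p)) p a"
definition "G m p q U b = cop (x (ix p)) m p q U b"

lemma ix: "ix p \<le> n" "ix p \<noteq> i" "ix p \<noteq> p"
  using i by (auto simp: ix_def)

lemma ix_ge: "p \<le> q \<Longrightarrow> \<not> (p = 0 \<and> q = n) \<Longrightarrow> ix p \<noteq> q"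
  by (auto simp: ix_def)

lemma lev_x: "p \<le> n \<Longrightarrow> k \<le> n \<Longrightarrow> k \<noteq> i \<Longrightarrow> k \<noteq> p \<Longrightarrow> lev (cch (x k)) p = A p"
  using agreeD(1)[OF agr[of k "ix p"], of p] ix[of p] by (simp add: A_def)

lemma col_x: "p \<le> n \<Longrightarrow> k \<le> n \<Longrightarrow> k \<noteq> i \<Longrightarrow> k \<noteq> p \<Longrightarrow> a < A p \<Longrightarrow> ccol (x k) p a = F p a"
  using agreeD(3)[OF agr[of k "ix p"], of p a] lev_x[of p k] ix[of p] by (simp add: F_def)

lemma lmap_x':
  assumes "p \<le> q" "q \<le> n" "k \<le> n" "k \<noteq> i" "k \<noteq> p" "k \<noteq> q" "a < A p" "\<not> (p = 0 \<and> q = n)"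
  shows "lmap (cch (x k)) p q a = f p q a"
  using agreeD(2)[OF agr[of k "ix p"], of p q a] lev_x[of p k] ix[of p] ix_ge[of p q] assms by (auto simp: f_def)

lemma x_chain: "k \<le> n \<Longrightarrow> k \<noteq> i \<Longrightarrow> cch (x k) \<in> chains n"
  by (rule coherentD(1)[OF coh])

lemma f_lt': "p \<le> q \<Longrightarrow> q \<le> n \<Longrightarrow> a < A p \<Longrightarrow> \<not> (p = 0 \<and> q = n) \<Longrightarrow> f p q a < A q"
  using chain_lt[OF x_chain[OF ix(1,2)], of p q a p] lmap_x'[of p q "ix p" a] lev_x[of p "ix p"] lev_x[of q "ix p"]
    ix[of p] ix_ge[of p q] by simp

lemma f_mono': "p \<le> q \<Longrightarrow> q \<le> n \<Longrightarrow> a \<le> b \<Longrightarrow> b < A p \<Longrightarrow> \<not> (p = 0 \<and> q = n) \<Longrightarrow> f p q a \<le> f p q b"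
  using mono_onD[OF chain_mono[OF x_chain[OF ix(1,2)], of p q p], of a b] lmap_x'[of p q "ix p"] lev_x[of p "ix p"]
    ix[of p] ix_ge[of p q] by simp

text \<open>The face \<open>ix p\<close> contains all three levels, so functoriality is inherited
  from it.\<close>

lemma f_comp':
  assumes "p \<le> q" "q \<le> r" "r \<le> n" "a < A p" "\<not> (p = 0 \<and> r = n)"
  shows "f p r a = f q r (f p q a)"
proof -
  let ?k = "ix p"
  have k: "?k \<noteq> p" "?k \<noteq> q" "?k \<noteq> r" using ix(3) ix_ge assms by (auto simp: ix_def)
  have n: "\<not> (p = 0 \<and> q = n)" "\<not> (q = 0 \<and> r = n)" using assms by auto
  show ?thesis
    using chain_comp[OF x_chain[OF ix(1,2)], of p q r a p] lmap_x'[of p q ?k a] lmap_x'[of p r ?k a]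
      lmap_x'[of q r ?k "f p q a"] f_lt'[of p q a] lev_x[of p ?k] ix[of p] k n assms by simp
qed

lemma f_0n: "a < A 0 \<Longrightarrow> f 0 n a = f i n (f 0 i a)"
  using lmap_x'[of 0 i n a] lmap_x'[of i n 0 "f 0 i a"] f_lt'[of 0 i a] i by (simp add: f_def)

lemma f_lt: "p \<le> q \<Longrightarrow> q \<le> n \<Longrightarrow> a < A p \<Longrightarrow> f p q a < A q"
proof (cases "p = 0 \<and> q = n")
  case True
  assume "p \<le> q" "q \<le> n" "a < A p"
  then show ?thesis using True f_0n[of a] f_lt'[of 0 i a] f_lt'[of i n "f 0 i a"] i by simp
qed (rule f_lt')

text \<open>From 0 to n, both sides are rewritten to pass through \<open>i\<close>. An intermediate
  level q below \<open>i\<close> is then handled by the triangles 0, q, \<open>i\<close> and q,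
  \<open>i\<close>, n; one above \<open>i\<close> by 0, \<open>i\<close>, q and \<open>i\<close>, q,
  n.\<close>

lemma f_comp:
  assumes "p \<le> q" "q \<le> r" "r \<le> n" "a < A p"
  shows "f p r a = f q r (f p q a)"
proof (cases "p = 0 \<and> r = n")
  case True
  have id: "f p p a = a" if "p \<le> n" "a < A p" for p a
    using chain_id[OF x_chain[OF ix(1,2)], of p a p] lev_x[of p "ix p"] ix[of p] i that by (auto simp: f_def)
  consider "q = 0" | "q = n" | "0 < q" "q \<le> i" | "i \<le> q" "q < n" using assms True by linarith
  then show ?thesis
  proof cases
    case 1 then show ?thesis using True id[of 0 a] assms by simp
  next
    case 2 then show ?thesis using True id[of n "f 0 n a"] f_lt[of 0 n a] assms by simp
  next
    case 3
    then show ?thesis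
      using True f_0n[of a] f_comp'[of 0 q i a] f_comp'[of q i n "f 0 q a"] f_lt'[of 0 q a] i assms by simp
  next
    case 4
    then show ?thesis
      using True f_0n[of a] f_comp'[of 0 i q a] f_comp'[of i q n "f 0 i a"] f_lt'[of 0 i a] i assms by simp
  qed
qed (use f_comp' assms in blast)

text \<open>The new case is the map from 0 to n: a face opposite to some \<open>k\<close> other than
  0, \<open>i\<close> and n contains \<open>i\<close>, so its own map factors through
  \<open>i\<close> too.\<close>

lemma lmap_x:
  assumes "p \<le> q" "q \<le> n" "k \<le> n" "k \<noteq> i" "k \<noteq> p" "k \<noteq> q" "a < A p"
  shows "lmap (cch (x k)) p q a = f p q a"
proof (cases "p = 0 \<and> q = n")
  case True
  have "lmap (cch (x k)) 0 i a = f 0 i a" using lmap_x'[of 0 i k a] i assms True by simp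
  moreover have "lmap (cch (x k)) i n (f 0 i a) = f i n (f 0 i a)"
    using lmap_x'[of i n k "f 0 i a"] f_lt'[of 0 i a] i assms True by simp
  moreover have "lmap (cch (x k)) 0 n a = lmap (cch (x k)) i n (lmap (cch (x k)) 0 i a)"
    using chain_comp[OF x_chain, of k 0 i n a] lev_x[of 0 k] i assms True by simp
  ultimately show ?thesis using f_0n[of a] assms(7) True by simp
qed (use lmap_x' assms in blast)

lemma alpha: "\<alpha> \<in> chains n"
  unfolding \<alpha>_def
proof (rule mk_chain_in, goal_cases)
  case (1 p q a) then show ?case by (rule f_lt)
next
  case (2 p q a b)
  show ?case
  proof (cases "p = 0 \<and> q = n")
    case True
    then show ?thesis
      using 2 f_0n[of a] f_0n[of b] f_mono'[of 0 i a b] f_mono'[of i n "f 0 i a" "f 0 i b"] f_lt'[of 0 i b] i by simp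
  qed (use f_mono' 2 in blast)
next
  case (3 p a)
  then show ?case using chain_id[OF x_chain[OF ix(1,2)], of p a p] lev_x[of p "ix p"] ix[of p] i by (auto simp: f_def)
next
  case (4 p q r a) then show ?case by (rule f_comp)
qed

lemma lev_alpha [simp]: "p \<le> n \<Longrightarrow> lev \<alpha> p = A p"
  by (simp add: \<alpha>_def)

lemma fibre_x:
  assumes "p \<le> q" "q \<le> n" "k \<le> n" "k \<noteq> i" "k \<noteq> p" "k \<noteq> q"
  shows "fibre (cch (x k)) p q b = fibre \<alpha> p q b"
proof -
  have "lev (cch (x k)) p = lev \<alpha> p" using lev_x[of p k] assms by simp
  moreover have "lmap (cch (x k)) p q c = lmap \<alpha> p q c" if "c < A p" for c
    using lmap_x[OF assms that] that assms by (simp add: \<alpha>_def)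
  ultimately show ?thesis unfolding fibre_def using assms by (intro filter_cong) auto
qed

lemma fibre_A: "p \<le> n \<Longrightarrow> a \<in> set (fibre \<alpha> p q b) \<Longrightarrow> a < A p"
  by (simp add: set_fibre[OF alpha])

lemma map_col_x:
  assumes "p \<le> q" "q \<le> n" "k \<le> n" "k \<noteq> i" "k \<noteq> p" "k \<noteq> q"
  shows "map (ccol (x k) p) (fibre (cch (x k)) p q b) = map (F p) (fibre \<alpha> p q b)"
  unfolding fibre_x[OF assms] using fibre_A[of p _ q b] col_x[of p k] assms by simp

lemma avoid:
  assumes "U \<in> thick_mor m p q" "k \<notin> U m"
  shows "k \<noteq> p" "k \<noteq> q"
  using thick_morD(2,3)[OF assms(1), of m] assms(2) by auto

lemma cop_typed:
  assumes U: "U \<in> thick_mor m p q" "q \<le> n" "b < A q" and k: "k \<le> n" "k \<noteq> i" "k \<notin> U m"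
  shows "cop (x k) m p q U b \<in> op_set (lvl Q m) (map (F p) (fibre \<alpha> p q b)) (F q b)"
proof -
  note pq = thick_morD(1)[OF U(1)] and av = avoid[OF U(1) k(3)]
  show ?thesis
    using coherentD(4)[OF coh[OF k(1,2)] U(1,2), of b] lev_x[OF U(2) k(1,2) av(2)] U(3)
      map_col_x[OF pq U(2) k(1,2) av] col_x[OF U(2) k(1,2) av(2) U(3)] by simp
qed

lemma cop_nat:
  assumes U: "U \<in> thick_mor m p q" "q \<le> n" "b < A q" and k: "k \<le> n" "k \<noteq> i" "k \<notin> U m" and \<psi>: "\<psi> \<in> simplex_maps m' m"
  shows "cop (x k) m' p q (seq_op m' \<psi> U) b = oact Q m' m \<psi> (cop (x k) m p q U b)"
  using coherentD(7)[OF coh[OF k(1,2)] \<psi> U(1,2), of b] lev_x[OF U(2) k(1,2) avoid(2)[OF U(1) k(3)]] U(3) by simp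

lemma cop_comp:
  assumes U: "U \<in> thick_mor m p q" and V: "V \<in> thick_mor m q r" "r \<le> n" "b < A r"
    and k: "k \<le> n" "k \<noteq> i" "k \<notin> V m \<union> U m"
  shows "cop (x k) m p r (\<lambda>s. V s \<union> U s) b =
    ocomp (lvl Q m) (cop (x k) m q r V b) (map (cop (x k) m p q U) (fibre \<alpha> q r b))"
proof -
  have av: "k \<noteq> q" "k \<noteq> r" using avoid[OF V(1)] k(3) by auto
  show ?thesis
    using coherentD(6)[OF coh[OF k(1,2)] U V(1,2), of b] lev_x[OF V(2) k(1,2) av(2)] V(3)
      fibre_x[OF thick_morD(1)[OF V(1)] V(2) k(1,2) av] by simp
qed

lemma cop_agree:
  assumes U: "U \<in> thick_mor m p q" "q \<le> n" "b < A q" and k: "k \<le> n" "k \<noteq> i" "k \<notin> U m"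
    and l: "l \<le> n" "l \<noteq> i" "l \<notin> U m"
  shows "cop (x k) m p q U b = cop (x l) m p q U b"
proof -
  have "U m \<subseteq> {..n} - {k, l}" using thick_morD(4)[OF U(1), of m] U(2) k(3) l(3) by auto
  from agreeD(4)[OF agr[OF k(1,2) l(1,2)] U(1,2) this] show ?thesis
    using lev_x[OF U(2) k(1,2) avoid(2)[OF U(1) k(3)]] U(3) by simp
qed

lemma ix_avoid: "U \<in> thick_mor m p q \<Longrightarrow> q \<le> n \<Longrightarrow> \<not> (p = 0 \<and> q = n) \<Longrightarrow> ix p \<notin> U m"
  using thick_morD(4)[of U m p q m] thick_morD(1)[of U m p q] by (auto simp: ix_def)

lemma G_eq:
  assumes U: "U \<in> thick_mor m p q" "q \<le> n" "b < A q" "\<not> (p = 0 \<and> q = n)" and k: "k \<le> n" "k \<noteq> i" "k \<notin> U m"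
  shows "cop (x k) m p q U b = G m p q U b"
  unfolding G_def by (rule cop_agree[OF U(1-3) k ix(1,2) ix_avoid[OF U(1,2,4)]])

lemma G_typed:
  assumes U: "U \<in> thick_mor m p q" "q \<le> n" "b < A q" "\<not> (p = 0 \<and> q = n)"
  shows "G m p q U b \<in> op_set (lvl Q m) (map (F p) (fibre \<alpha> p q b)) (F q b)"
  unfolding G_def by (rule cop_typed[OF U(1-3) ix(1,2) ix_avoid[OF U(1,2,4)]])

lemma G_nat:
  assumes U: "U \<in> thick_mor m p q" "q \<le> n" "b < A q" "\<not> (p = 0 \<and> q = n)" and \<psi>: "\<psi> \<in> simplex_maps m' m"
  shows "G m' p q (seq_op m' \<psi> U) b = oact Q m' m \<psi> (G m p q U b)"
  unfolding G_def by (rule cop_nat[OF U(1-3) ix(1,2) ix_avoid[OF U(1,2,4)] \<psi>])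

text \<open>Unless the composite runs from 0 to n, the face \<open>ix p\<close> contains both chains
  and the law is inherited from it.\<close>

lemma G_comp:
  assumes U: "U \<in> thick_mor m p q" and V: "V \<in> thick_mor m q r" "r \<le> n" "b < A r" and n: "\<not> (p = 0 \<and> r = n)"
  shows "G m p r (\<lambda>s. V s \<union> U s) b = ocomp (lvl Q m) (G m q r V b) (map (G m p q U) (fibre \<alpha> q r b))"
proof -
  let ?k = "ix p"
  note pq = thick_morD(1)[OF U] and qr = thick_morD(1)[OF V(1)]
  have UV: "(\<lambda>s. V s \<union> U s) \<in> thick_mor m p r" by (rule thick_mor_union[OF U V(1)])
  have k: "?k \<notin> V m \<union> U m" using ix_avoid[OF UV V(2) n] .
  have 1: "map (G m p q U) (fibre \<alpha> q r b) = map (cop (x ?k) m p q U) (fibre \<alpha> q r b)" by (simp add: G_def[abs_def])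
  have 2: "G m q r V b = cop (x ?k) m q r V b"
    by (rule G_eq[symmetric, OF V]) (use n pq qr V(2) k ix in auto)
  show ?thesis unfolding 1 2 using cop_comp[OF U V ix(1,2) k] by (simp only: G_def[of m p r])
qed

text \<open>Values on \<open>0 \<rightarrow> n\<close>: a chain \<open>U\<close> in the box misses some \<open>k \<noteq> i\<close> and then lies in a face of the
  horn, or passes through some \<open>k\<close> with \<open>0 < k < n\<close> and is then decomposable.\<close>

definition through :: "nat \<Rightarrow> nat \<Rightarrow> (nat \<Rightarrow> nat set) \<Rightarrow> nat \<Rightarrow> 'o" where
  "through k m U b = ocomp (lvl Q m) (G m k n (\<lambda>r. U r \<inter> {k..n}) b)
     (map (G m 0 k (\<lambda>r. U r \<inter> {0..k})) (fibre \<alpha> k n b))"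

text \<open>\<open>k \<notin> U m\<close> says that no member contains \<open>k\<close>, and
  \<open>k \<in> U 0\<close> that all do. That neither the chosen \<open>k\<close> nor the
  preference for the first alternative matters is shown by \<open>box_val_face\<close> and
  \<open>box_val_through\<close>.\<close>

definition box_val :: "nat \<Rightarrow> nat \<Rightarrow> (nat \<Rightarrow> nat set) \<Rightarrow> 'o" where
  "box_val b m U = (if \<exists>k\<le>n. k \<noteq> i \<and> k \<notin> U m then cop (x (SOME k. k \<le> n \<and> k \<noteq> i \<and> k \<notin> U m)) m 0 n U b
     else through (SOME k. 0 < k \<and> k < n \<and> k \<in> U 0) m U b)"

lemma box_val_face:
  assumes U: "U \<in> thick_mor m 0 n" and b: "b < A n" and k: "k \<le> n" "k \<noteq> i" "k \<notin> U m"
  shows "box_val b m U = cop (x k) m 0 n U b"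
proof -
  define l where "l = (SOME k. k \<le> n \<and> k \<noteq> i \<and> k \<notin> U m)"
  have l: "l \<le> n \<and> l \<noteq> i \<and> l \<notin> U m" unfolding l_def by (rule someI[of _ k]) (use k in simp)
  have ex: "\<exists>k\<le>n. k \<noteq> i \<and> k \<notin> U m" using k by blast
  have "box_val b m U = cop (x l) m 0 n U b" using ex by (simp add: box_val_def l_def)
  then show ?thesis using cop_agree[OF U order.refl b, of l k] l k by simp
qed

text \<open>Membership in the smallest set \<open>U 0\<close> puts \<open>k\<close> into every
  member, so the whole chain factors through \<open>k\<close>.\<close>

lemma split_mor:
  assumes U: "U \<in> thick_mor m p q" and k: "k \<in> U 0"
  shows "(\<lambda>r. U r \<inter> {p..k}) \<in> thick_mor m p k" "(\<lambda>r. U r \<inter> {k..q}) \<in> thick_mor m k q"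
    "(\<lambda>r. (U r \<inter> {k..q}) \<union> (U r \<inter> {p..k})) = U"
proof -
  note u = thick_morD[OF U]
  have kU: "k \<in> U r" for r using monoD[OF u(5), of 0 r] k by auto
  have pk: "p \<le> k" "k \<le> q" using u(4)[of 0] k by auto
  have m: "mono (\<lambda>r. U r \<inter> S)" for S using monoD[OF u(5)] by (auto simp: mono_def)
  have c: "U r \<inter> S = U m \<inter> S" if "r \<ge> m" for r S using u(6)[OF that] by simp
  have 1: "p \<in> U r \<inter> {p..k} \<and> k \<in> U r \<inter> {p..k} \<and> U r \<inter> {p..k} \<subseteq> {p..k}"
    "k \<in> U r \<inter> {k..q} \<and> q \<in> U r \<inter> {k..q} \<and> U r \<inter> {k..q} \<subseteq> {k..q}" for r
    using u(2,3) kU pk by auto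
  show "(\<lambda>r. U r \<inter> {p..k}) \<in> thick_mor m p k" "(\<lambda>r. U r \<inter> {k..q}) \<in> thick_mor m k q"
    unfolding thick_mor_def using 1 m c by blast+
  show "(\<lambda>r. (U r \<inter> {k..q}) \<union> (U r \<inter> {p..k})) = U"
  proof
    fix r show "(U r \<inter> {k..q}) \<union> (U r \<inter> {p..k}) = U r" using u(4)[of r] by auto
  qed
qed

lemma G_composable:
  assumes U: "U \<in> thick_mor m p k" and V: "V \<in> thick_mor m k q" "q \<le> n" "b < A q" and k: "0 < k" "k < n"
  shows "composable (lvl Q m) (G m k q V b) (map (G m p k U) (fibre \<alpha> k q b))"
    "concat (map (src (lvl Q m)) (map (G m p k U) (fibre \<alpha> k q b))) = map (F p) (fibre \<alpha> p q b)"
proof -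
  note pk = thick_morD(1)[OF U] and kq = thick_morD(1)[OF V(1)]
  have V': "G m k q V b \<in> op_set (lvl Q m) (map (F k) (fibre \<alpha> k q b)) (F q b)"
    by (rule G_typed[OF V]) (use k in simp)
  have U': "G m p k U a \<in> op_set (lvl Q m) (map (F p) (fibre \<alpha> p k a)) (F k a)" if "a \<in> set (fibre \<alpha> k q b)" for a
    by (rule G_typed[OF U]) (use k fibre_A[OF _ that] in simp_all)
  show "composable (lvl Q m) (G m k q V b) (map (G m p k U) (fibre \<alpha> k q b))"
    using U' V' by (auto simp: composable_def op_set_def)
  have e: "map (src (lvl Q m)) (map (G m p k U) (fibre \<alpha> k q b)) = map (\<lambda>a. map (F p) (fibre \<alpha> p k a)) (fibre \<alpha> k q b)"
    using U' by (simp add: op_set_def)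
  show "concat (map (src (lvl Q m)) (map (G m p k U) (fibre \<alpha> k q b))) = map (F p) (fibre \<alpha> p q b)"
    unfolding e using fibre_comp[OF alpha pk kq V(2), of b] by (simp add: map_concat comp_def)
qed

text \<open>Cutting at both \<open>k\<close> and \<open>l\<close> turns each side into a threefold
  composite; the two bracketings agree by associativity in the operad.\<close>

lemma through_unique':
  assumes U: "U \<in> thick_mor m 0 n" and b: "b < A n" and k: "0 < k" "k < l" "l < n" "k \<in> U 0" "l \<in> U 0"
  shows "through k m U b = through l m U b"
proof -
  let ?W = "\<lambda>r. U r \<inter> {l..n}" and ?V = "\<lambda>r. U r \<inter> {k..l}" and ?T = "\<lambda>r. U r \<inter> {0..k}"
  note sk = split_mor[OF U k(4)] and sl = split_mor[OF U k(5)]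
  have V: "?V \<in> thick_mor m k l"
  proof -
    have "(\<lambda>r. (U r \<inter> {k..n}) \<inter> {k..l}) \<in> thick_mor m k l" using split_mor(1)[OF sk(2), of l] k by simp
    moreover have "(\<lambda>r. (U r \<inter> {k..n}) \<inter> {k..l}) = ?V" using k by (auto simp: fun_eq_iff)
    ultimately show ?thesis by simp
  qed
  have e1: "(\<lambda>r. U r \<inter> {k..n}) = (\<lambda>r. ?W r \<union> ?V r)" and e2: "(\<lambda>r. U r \<inter> {0..l}) = (\<lambda>r. ?V r \<union> ?T r)"
    using k by (auto simp: fun_eq_iff)
  have fl: "a < A l" if "a \<in> set (fibre \<alpha> l n b)" for a using fibre_A[OF _ that] k by simp
  let ?gs = "map (G m k l ?V) (fibre \<alpha> l n b)"
  let ?hss = "map (\<lambda>a. map (G m 0 k ?T) (fibre \<alpha> k l a)) (fibre \<alpha> l n b)"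
  have c1: "composable (lvl Q m) (G m l n ?W b) ?gs"
    by (rule G_composable(1)[OF V sl(2) order.refl b]) (use k in simp_all)
  have c2: "list_all2 (composable (lvl Q m)) ?gs ?hss"
    unfolding list.rel_map
  proof (rule list.rel_refl_strong)
    fix a assume "a \<in> set (fibre \<alpha> l n b)"
    then show "composable (lvl Q m) (G m k l ?V a) (map (G m 0 k ?T) (fibre \<alpha> k l a))"
      by (intro G_composable(1)[OF sk(1) V]) (use k fl in simp_all)
  qed
  have "through k m U b = ocomp (lvl Q m) (ocomp (lvl Q m) (G m l n ?W b) ?gs) (map (G m 0 k ?T) (fibre \<alpha> k n b))"
    unfolding through_def e1 by (subst G_comp[OF V sl(2) order.refl b]) (use k in simp_all)
  also have "map (G m 0 k ?T) (fibre \<alpha> k n b) = concat ?hss"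
    using fibre_comp[OF alpha, of k l n b] k by (simp add: map_concat comp_def)
  also have "ocomp (lvl Q m) (ocomp (lvl Q m) (G m l n ?W b) ?gs) (concat ?hss) =
      ocomp (lvl Q m) (G m l n ?W b) (map2 (ocomp (lvl Q m)) ?gs ?hss)"
    by (rule operad_assoc[OF opQ c1 c2])
  also have "map2 (ocomp (lvl Q m)) ?gs ?hss = map (G m 0 l (\<lambda>r. U r \<inter> {0..l})) (fibre \<alpha> l n b)"
  proof (rule nth_equalityI)
    fix r assume "r < length (map2 (ocomp (lvl Q m)) ?gs ?hss)"
    then have r: "r < length (fibre \<alpha> l n b)" by simp
    then have "fibre \<alpha> l n b ! r < A l" by (intro fl) simp
    then show "map2 (ocomp (lvl Q m)) ?gs ?hss ! r = map (G m 0 l (\<lambda>r. U r \<inter> {0..l})) (fibre \<alpha> l n b) ! r"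
      using r G_comp[OF sk(1) V, of "fibre \<alpha> l n b ! r"] k unfolding e2 by simp
  qed simp
  finally show ?thesis by (simp add: through_def)
qed

text \<open>If \<open>U\<close> also misses some \<open>l \<noteq> i\<close>, the composition law
  inside the face \<open>l\<close> gives the factorisation at \<open>k\<close>. Otherwise the
  definition factors at some level, and \<open>through_unique'\<close> moves it to
  \<open>k\<close>.\<close>

lemma box_val_through:
  assumes U: "U \<in> thick_mor m 0 n" and b: "b < A n" and k: "0 < k" "k < n" "k \<in> U 0"
  shows "box_val b m U = through k m U b"
proof (cases "\<exists>l\<le>n. l \<noteq> i \<and> l \<notin> U m")
  case True
  then obtain l where l: "l \<le> n" "l \<noteq> i" "l \<notin> U m" by blast
  note s = split_mor[OF U k(3)]
  have "box_val b m U = cop (x l) m 0 n U b" by (rule box_val_face[OF U b l])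
  also have "\<dots> = ocomp (lvl Q m) (cop (x l) m k n (\<lambda>r. U r \<inter> {k..n}) b)
      (map (cop (x l) m 0 k (\<lambda>r. U r \<inter> {0..k})) (fibre \<alpha> k n b))"
    using cop_comp[OF s(1,2) order.refl b l(1,2)] l(3) s(3) by simp
  also have "map (cop (x l) m 0 k (\<lambda>r. U r \<inter> {0..k})) (fibre \<alpha> k n b) = map (G m 0 k (\<lambda>r. U r \<inter> {0..k})) (fibre \<alpha> k n b)"
    using G_eq[OF s(1) _ _ _ l(1,2)] l(3) k fibre_A[of k _ n b] by simp
  also have "cop (x l) m k n (\<lambda>r. U r \<inter> {k..n}) b = G m k n (\<lambda>r. U r \<inter> {k..n}) b"
    using G_eq[OF s(2) order.refl b _ l(1,2)] l(3) k by simp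
  finally show ?thesis by (simp add: through_def)
next
  case False
  define l where "l = (SOME k. 0 < k \<and> k < n \<and> k \<in> U 0)"
  have l: "0 < l \<and> l < n \<and> l \<in> U 0" unfolding l_def by (rule someI[of _ k]) (use k in simp)
  have "box_val b m U = through l m U b" unfolding box_val_def l_def using False by (simp only: if_False)
  moreover consider "k < l" | "k = l" | "l < k" by linarith
  then have "through l m U b = through k m U b"
  proof cases
    case 1 then show ?thesis using through_unique'[OF U b, of k l] l k by simp
  next
    case 3 then show ?thesis using through_unique'[OF U b, of l k] l k by simp
  qed simp
  ultimately show ?thesis by simp
qed

text \<open>The members of an increasing chain all contain \<open>k\<close> iff the first one does,
  and all omit \<open>k\<close> iff the last one does. The endpoints are never omitted, which is why
  the second alternative can let \<open>k\<close> range over all of \<open>{..n}\<close> except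
  \<open>i\<close>.\<close>

lemma in_box:
  "U \<in> complex_splx m (cube {0, n} {..n}) \<longleftrightarrow> U \<in> thick_mor m 0 n"
  "U \<in> complex_splx m (box {0, n} {..n} i) \<longleftrightarrow> U \<in> thick_mor m 0 n \<and>
     ((\<exists>k. 0 < k \<and> k < n \<and> k \<in> U 0) \<or> (\<exists>k\<le>n. k \<noteq> i \<and> k \<notin> U m))"
proof -
  have sub: "{0, n} \<subseteq> X \<and> X \<subseteq> {..n} \<longleftrightarrow> 0 \<in> X \<and> n \<in> X \<and> X \<subseteq> {0..n}" for X by auto
  show c: "U \<in> complex_splx m (cube {0, n} {..n}) \<longleftrightarrow> U \<in> thick_mor m 0 n"
  proof
    assume U: "U \<in> complex_splx m (cube {0, n} {..n})"
    note u = complex_splxD(1-3)[OF U]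
    have "\<forall>r. 0 \<in> U r \<and> n \<in> U r \<and> U r \<subseteq> {0..n}" using u(3) sub by (simp add: cube_def)
    then show "U \<in> thick_mor m 0 n" unfolding thick_mor_def using u(1,2) by blast
  next
    assume U: "U \<in> thick_mor m 0 n"
    note u = thick_morD[OF U]
    have "range U \<subseteq> U ` {..m}"
    proof
      fix X assume "X \<in> range U"
      then obtain r where "X = U r" by blast
      then show "X \<in> U ` {..m}" using u(6)[of r] by (cases "r \<le> m") auto
    qed
    then have "finite (range U)" by (rule finite_subset) simp
    moreover have "U r \<subseteq> U s \<or> U s \<subseteq> U r" for r s using monoD[OF u(5), of r s] monoD[OF u(5), of s r] by linarith
    moreover have "{0, n} \<subseteq> U r \<and> U r \<subseteq> {..n}" for r using u(2-4)[of r] by auto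
    ultimately have "range U \<in> cube {0, n} {..n}" by (simp add: cube_def)
    then show "U \<in> complex_splx m (cube {0, n} {..n})" unfolding complex_splx_def using u(5,6) by blast
  qed
  have "U \<in> complex_splx m (box {0, n} {..n} i) \<longleftrightarrow> U \<in> complex_splx m (cube {0, n} {..n}) \<and>
      ((\<exists>k \<in> {..n} - {0, n}. \<forall>r. k \<in> U r) \<or> (\<exists>k \<in> {..n} - {0, n} - {i}. \<forall>r. k \<notin> U r))"
    unfolding complex_splx_def box_def
    by (simp only: mem_Collect_eq ball_simps ball_UNIV conj_assoc)
  also have "\<dots> \<longleftrightarrow> U \<in> thick_mor m 0 n \<and>
     ((\<exists>k. 0 < k \<and> k < n \<and> k \<in> U 0) \<or> (\<exists>k\<le>n. k \<noteq> i \<and> k \<notin> U m))"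
    unfolding c
  proof (intro conj_cong HOL.refl)
    assume U: "U \<in> thick_mor m 0 n"
    note u = thick_morD[OF U]
    have 0: "(\<forall>r. k \<in> U r) \<longleftrightarrow> k \<in> U 0" for k using monoD[OF u(5), of 0] by blast
    have m: "(\<forall>r. k \<notin> U r) \<longleftrightarrow> k \<notin> U m" for k using u(7) by blast
    have in_m: "0 \<in> U m" "n \<in> U m" using u(2,3) by blast+
    have "k \<in> {..n} - {0, n} \<longleftrightarrow> 0 < k \<and> k < n" for k by auto
    then have "(\<exists>k \<in> {..n} - {0, n}. k \<in> U 0) \<longleftrightarrow> (\<exists>k. 0 < k \<and> k < n \<and> k \<in> U 0)"
      by (simp only: Bex_def conj_assoc)
    moreover have "(\<exists>k \<in> {..n} - {0, n} - {i}. k \<notin> U m) \<longleftrightarrow> (\<exists>k\<le>n. k \<noteq> i \<and> k \<notin> U m)"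
    proof
      assume "\<exists>k\<le>n. k \<noteq> i \<and> k \<notin> U m"
      then obtain k where k: "k \<le> n" "k \<noteq> i" "k \<notin> U m" by blast
      then have "k \<noteq> 0" "k \<noteq> n" using in_m by metis+
      then show "\<exists>k \<in> {..n} - {0, n} - {i}. k \<notin> U m" using k by (intro bexI[of _ k]) auto
    qed auto
    ultimately show "((\<exists>k \<in> {..n} - {0, n}. \<forall>r. k \<in> U r) \<or> (\<exists>k \<in> {..n} - {0, n} - {i}. \<forall>r. k \<notin> U r)) \<longleftrightarrow>
     ((\<exists>k. 0 < k \<and> k < n \<and> k \<in> U 0) \<or> (\<exists>k\<le>n. k \<noteq> i \<and> k \<notin> U m))"
      by (simp only: 0 m)
  qed
  finally show "U \<in> complex_splx m (box {0, n} {..n} i) \<longleftrightarrow> U \<in> thick_mor m 0 n \<and>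
     ((\<exists>k. 0 < k \<and> k < n \<and> k \<in> U 0) \<or> (\<exists>k\<le>n. k \<noteq> i \<and> k \<notin> U m))" .
qed


text \<open>A simplicial operator repeats or drops members of \<open>U\<close>, so a
  \<open>k\<close> contained in all members, or in none, stays so. The same \<open>k\<close> thus
  computes both sides of the naturality equation.\<close>

lemma box_val_hom:
  assumes b: "b < A n"
  shows "complex_hom (box {0, n} {..n} i) (op_space Q (map (F 0) (fibre \<alpha> 0 n b)) (F n b)) (box_val b)"
  unfolding complex_hom_def
proof (intro allI ballI conjI)
  fix m U assume "U \<in> complex_splx m (box {0, n} {..n} i)"
  then have U: "U \<in> thick_mor m 0 n" and bx: "(\<exists>k. 0 < k \<and> k < n \<and> k \<in> U 0) \<or> (\<exists>k\<le>n. k \<noteq> i \<and> k \<notin> U m)"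
    by (simp_all add: in_box)
  note u = thick_morD[OF U]
  show "box_val b m U \<in> splx (op_space Q (map (F 0) (fibre \<alpha> 0 n b)) (F n b)) m"
    using bx
  proof (elim disjE exE conjE)
    fix k assume k: "0 < k" "k < n" "k \<in> U 0"
    note s = split_mor[OF U k(3)] note c = G_composable[OF s(1,2) order.refl b k(1,2)]
    have "G m k n (\<lambda>r. U r \<inter> {k..n}) b \<in> op_set (lvl Q m) (map (F k) (fibre \<alpha> k n b)) (F n b)"
      by (rule G_typed[OF s(2) order.refl b]) (use k in simp)
    then have "through k m U b \<in> op_set (lvl Q m) (map (F 0) (fibre \<alpha> 0 n b)) (F n b)"
      using operad_comp[OF opQ c(1)] unfolding c(2) through_def by (simp add: op_set_def)
    then show ?thesis using box_val_through[OF U b k] by (simp add: op_space_def)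
  next
    fix k assume k: "k \<le> n" "k \<noteq> i" "k \<notin> U m"
    show ?thesis using cop_typed[OF U order.refl b k] box_val_face[OF U b k] by (simp add: op_space_def)
  qed
  fix m' \<psi> assume \<psi>: "\<psi> \<in> simplex_maps m' m"
  let ?U = "seq_op m' \<psi> U"
  have U': "?U \<in> thick_mor m' 0 n" by (rule thick_mor_seq_op[OF U \<psi>])
  have "box_val b m' ?U = oact Q m' m \<psi> (box_val b m U)"
    using bx
  proof (elim disjE exE conjE)
    fix k assume k: "0 < k" "k < n" "k \<in> U 0"
    note s = split_mor[OF U k(3)] note c = G_composable[OF s(1,2) order.refl b k(1,2)]
    have k': "k \<in> ?U 0" using monoD[OF u(5), of 0 "\<psi> 0"] k(3) by (auto simp: seq_op_def)
    have e: "(\<lambda>r. ?U r \<inter> S) = seq_op m' \<psi> (\<lambda>r. U r \<inter> S)" for S by (simp add: seq_op_def)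
    have g: "map (G m' 0 k (seq_op m' \<psi> (\<lambda>r. U r \<inter> {0..k}))) (fibre \<alpha> k n b) =
        map (oact Q m' m \<psi>) (map (G m 0 k (\<lambda>r. U r \<inter> {0..k})) (fibre \<alpha> k n b))"
      using G_nat[OF s(1) _ _ _ \<psi>] fibre_A[of k _ n b] k by simp
    have "through k m' ?U b = oact Q m' m \<psi> (through k m U b)"
      unfolding through_def e g actQ_comp[OF \<psi> c(1)] using G_nat[OF s(2) order.refl b _ \<psi>] k by simp
    then show ?thesis using box_val_through[OF U b k] box_val_through[OF U' b k(1,2) k'] by simp
  next
    fix k assume k: "k \<le> n" "k \<noteq> i" "k \<notin> U m"
    then have k': "k \<notin> ?U m'" using u(7) by (auto simp: seq_op_def)
    show ?thesis
      using cop_nat[OF U order.refl b k \<psi>] box_val_face[OF U b k] box_val_face[OF U' b k(1,2) k'] by simp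
  qed
  then show "box_val b m' ?U = sact (op_space Q (map (F 0) (fibre \<alpha> 0 n b)) (F n b)) m' m \<psi> (box_val b m U)"
    by (simp add: op_space_def)
qed

lemma F_col: "p \<le> n \<Longrightarrow> a < A p \<Longrightarrow> F p a \<in> Col (lvl Q 0)"
  using coherentD(3)[OF coh[OF ix(1,2)], of p a p] lev_x[of p "ix p"] ix[of p] by (simp add: F_def)

text \<open>Operations at different \<open>b\<close> lie in different operation spaces, so there is
  one box to fill for each \<open>b\<close> in the top level.\<close>

lemma fill_exists:
  "\<exists>g. \<forall>b < A n. complex_hom (cube {0, n} {..n}) (op_space Q (map (F 0) (fibre \<alpha> 0 n b)) (F n b)) (g b) \<and>
     (\<forall>m. \<forall>U \<in> complex_splx m (box {0, n} {..n} i). g b m U = box_val b m U)"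
proof -
  have "\<exists>g. complex_hom (cube {0, n} {..n}) (op_space Q (map (F 0) (fibre \<alpha> 0 n b)) (F n b)) g \<and>
     (\<forall>m. \<forall>U \<in> complex_splx m (box {0, n} {..n} i). g m U = box_val b m U)" if b: "b < A n" for b
  proof (rule box_filling)
    have "map (F 0) (fibre \<alpha> 0 n b) \<in> lists (Col (lvl Q 0))"
      using F_col[of 0] fibre_A[of 0 _ n b] by (auto simp: in_lists_conv_set)
    then have "kan_complex (op_space Q (map (F 0) (fibre \<alpha> 0 n b)) (F n b))" using kan F_col[OF order.refl b] by blast
    then show "simplicial_set (op_space Q (map (F 0) (fibre \<alpha> 0 n b)) (F n b))"
      "\<And>k j. 1 \<le> k \<Longrightarrow> j \<le> k \<Longrightarrow> fills_horn (op_space Q (map (F 0) (fibre \<alpha> 0 n b)) (F n b)) k j"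
      by (simp_all add: kan_complex_def)
  qed (use i box_val_hom[OF b] in auto)
  then show ?thesis by metis
qed

definition "fill = (SOME g. \<forall>b < A n.
   complex_hom (cube {0, n} {..n}) (op_space Q (map (F 0) (fibre \<alpha> 0 n b)) (F n b)) (g b) \<and>
   (\<forall>m. \<forall>U \<in> complex_splx m (box {0, n} {..n} i). g b m U = box_val b m U))"

lemma fill:
  assumes U: "U \<in> thick_mor m 0 n" and b: "b < A n"
  shows "fill b m U \<in> op_set (lvl Q m) (map (F 0) (fibre \<alpha> 0 n b)) (F n b)"
    "\<psi> \<in> simplex_maps m' m \<Longrightarrow> fill b m' (seq_op m' \<psi> U) = oact Q m' m \<psi> (fill b m U)"
    "k \<le> n \<Longrightarrow> k \<noteq> i \<Longrightarrow> k \<notin> U m \<Longrightarrow> fill b m U = cop (x k) m 0 n U b"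
    "0 < k \<Longrightarrow> k < n \<Longrightarrow> k \<in> U 0 \<Longrightarrow> fill b m U = through k m U b"
proof -
  have h: "complex_hom (cube {0, n} {..n}) (op_space Q (map (F 0) (fibre \<alpha> 0 n b)) (F n b)) (fill b)"
    and bx: "\<And>m U. U \<in> complex_splx m (box {0, n} {..n} i) \<Longrightarrow> fill b m U = box_val b m U"
    using someI_ex[OF fill_exists, folded fill_def] b by blast+
  note hU = h[unfolded complex_hom_def, rule_format, OF in_box(1)[THEN iffD2, OF U]]
  show "fill b m U \<in> op_set (lvl Q m) (map (F 0) (fibre \<alpha> 0 n b)) (F n b)"
    using hU[THEN conjunct1] by (simp add: op_space_def)
  show "\<psi> \<in> simplex_maps m' m \<Longrightarrow> fill b m' (seq_op m' \<psi> U) = oact Q m' m \<psi> (fill b m U)"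
    using hU[THEN conjunct2] by (simp add: op_space_def)
  show "fill b m U = cop (x k) m 0 n U b" if k: "k \<le> n" "k \<noteq> i" "k \<notin> U m"
  proof -
    have "U \<in> complex_splx m (box {0, n} {..n} i)" unfolding in_box using U k by blast
    then show ?thesis using bx box_val_face[OF U b k] by simp
  qed
  show "fill b m U = through k m U b" if k: "0 < k" "k < n" "k \<in> U 0"
  proof -
    have "U \<in> complex_splx m (box {0, n} {..n} i)" unfolding in_box using U k by blast
    then show ?thesis using bx box_val_through[OF U b k] by simp
  qed
qed

definition "GG m p q U b = (if p = 0 \<and> q = n then fill b m U else G m p q U b)"

lemma GG_G: "\<not> (p = 0 \<and> q = n) \<Longrightarrow> GG m p q U b = G m p q U b"
  by (simp only: GG_def if_False)

lemma GG_0n: "GG m 0 n U b = fill b m U"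
  by (simp add: GG_def)

lemma GG_typed:
  assumes U: "U \<in> thick_mor m p q" "q \<le> n" "b < A q"
  shows "GG m p q U b \<in> op_set (lvl Q m) (map (F p) (fibre \<alpha> p q b)) (F q b)"
proof (cases "p = 0 \<and> q = n")
  case True then show ?thesis using fill(1)[of U m b] U by (simp add: GG_0n)
next
  case False show ?thesis unfolding GG_G[OF False] by (rule G_typed[OF U False])
qed

lemma GG_id:
  assumes "p \<le> n" "a < A p"
  shows "GG m p p (\<lambda>_. {p}) a = idop (lvl Q m) (F p a)"
proof -
  have "GG m p p (\<lambda>_. {p}) a = G m p p (\<lambda>_. {p}) a" by (rule GG_G) (use i in auto)
  then show ?thesis
    using coherentD(5)[OF coh[OF ix(1,2)], of p a p m] lev_x[of p "ix p"] ix[of p] assms by (simp add: G_def F_def)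
qed

text \<open>A composite from 0 to n at an inner level \<open>q\<close> lies in the box, where the
  filler has the prescribed value \<open>through q\<close>. A trivial factor is absorbed by the
  operad units, and everything else is \<open>G_comp\<close>.\<close>

lemma GG_comp:
  assumes U: "U \<in> thick_mor m p q" and V: "V \<in> thick_mor m q r" and r: "r \<le> n" "b < A r"
  shows "GG m p r (\<lambda>s. V s \<union> U s) b = ocomp (lvl Q m) (GG m q r V b) (map (GG m p q U) (fibre \<alpha> q r b))"
proof -
  note pq = thick_morD(1)[OF U] and qr = thick_morD(1)[OF V]
  have T: "GG m q r V b \<in> op_set (lvl Q m) (map (F q) (fibre \<alpha> q r b)) (F r b)" by (rule GG_typed[OF V r])
  consider "q = p" | "q = r" | "p < q" "q < r" "p = 0" "r = n" | "\<not> (p = 0 \<and> r = n)" using pq qr by linarith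
  then show ?thesis
  proof cases
    case 1
    then have U1: "U = (\<lambda>_. {q})" using U thick_mor_diag by simp
    have VU: "(\<lambda>s. V s \<union> U s) = V" using thick_morD(2)[OF V] U1 by (auto simp: fun_eq_iff)
    have m: "map (GG m p q U) (fibre \<alpha> q r b) = map (idop (lvl Q m)) (map (F q) (fibre \<alpha> q r b))"
      using GG_id[of q _ m] fibre_A[of q _ r b] qr r(1) U1 1 by simp
    have "GG m q r V b \<in> Ops (lvl Q m)" "src (lvl Q m) (GG m q r V b) = map (F q) (fibre \<alpha> q r b)"
      using T by (simp_all add: op_set_def)
    then show ?thesis unfolding VU m using operad_unit_right[OF opQ, of "GG m q r V b" m] 1 by (simp only:)
  next
    case 2
    then have V1: "V = (\<lambda>_. {q})" using V thick_mor_diag by simp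
    have VU: "(\<lambda>s. V s \<union> U s) = U" using thick_morD(3)[OF U] V1 by (auto simp: fun_eq_iff)
    have fb: "fibre \<alpha> q r b = [b]" using fibre_id[OF alpha] 2 r by simp
    have "GG m p q U b \<in> op_set (lvl Q m) (map (F p) (fibre \<alpha> p q b)) (F q b)"
      by (rule GG_typed[OF U]) (use 2 r in auto)
    then show ?thesis unfolding VU fb using operad_unit_left[OF opQ, of "GG m p q U b" m] GG_id[of r b m] 2 V1 r
      by (simp add: op_set_def)
  next
    case 3
    note u = thick_morD[OF U] and v = thick_morD[OF V]
    have UV: "(\<lambda>s. V s \<union> U s) \<in> thick_mor m 0 n" using thick_mor_union[OF U V] 3 by simp
    have "GG m p r (\<lambda>s. V s \<union> U s) b = through q m (\<lambda>s. V s \<union> U s) b"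
      using fill(4)[OF UV, of b q] v(2)[of 0] r 3 by (simp add: GG_0n)
    \<comment> \<open>Cutting the union at \<open>q\<close> returns the factors: \<open>U\<close>
      lies below \<open>q\<close>, \<open>V\<close> above, and both contain
      \<open>q\<close>.\<close>
    moreover have "(\<lambda>s. (V s \<union> U s) \<inter> {q..n}) = V"
    proof
      fix s show "(V s \<union> U s) \<inter> {q..n} = V s" using u(4)[of s] v(2)[of s] v(4)[of s] 3 by force
    qed
    moreover have "(\<lambda>s. (V s \<union> U s) \<inter> {0..q}) = U"
    proof
      fix s show "(V s \<union> U s) \<inter> {0..q} = U s" using v(4)[of s] u(3)[of s] u(4)[of s] 3 by force
    qed
    moreover have "GG m q r V b = G m q n V b" "GG m p q U = G m 0 q U" using 3 GG_G by (auto intro!: ext)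
    ultimately show ?thesis using 3(4) by (simp add: through_def)
  next
    case 4
    then have n: "\<not> (q = 0 \<and> r = n)" "\<not> (p = 0 \<and> q = n)" using pq qr r(1) by auto
    have "GG m p q U = G m p q U" using GG_G[OF n(2)] by (intro ext)
    then show ?thesis using G_comp[OF U V r 4] GG_G[OF n(1)] GG_G[OF 4] by simp
  qed
qed

definition "filler = mk_cdata n \<alpha> F GG"

lemma coherent_filler: "coherent Q n filler"
  unfolding filler_def
proof (rule coherentI[OF alpha], goal_cases)
  case (1 p a) then show ?case by (simp add: F_col)
next
  case (2 m p q U b) then show ?case by (intro GG_typed) simp_all
next
  case (3 m p a) then show ?case by (intro GG_id) simp_all
next
  case (4 m p q r U V b) then show ?case by (intro GG_comp) simp_all
next
  case (5 m m' \<psi> p q U b)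
  then have b: "b < A q" by simp
  show ?case
  proof (cases "p = 0 \<and> q = n")
    case True then show ?thesis using fill(2)[of U m b \<psi> m'] 5 b by (simp add: GG_0n)
  next
    case False show ?thesis unfolding GG_G[OF False] by (rule G_nat[OF 5(2,4) b False 5(1)])
  qed
qed

lemma agree_filler:
  assumes k: "k \<le> n" "k \<noteq> i"
  shows "agree n ({..n} - {k}) filler (x k)"
  unfolding agree_def
proof (intro conjI ballI allI impI, goal_cases)
  case (1 p) then show ?case using lev_x[of p k] k by (simp add: filler_def)
next
  case (2 p q a) then show ?case using lmap_x[of p q k a] k by (simp add: filler_def) (simp add: \<alpha>_def)
next
  case (3 p a) then show ?case using col_x[of p k a] k by (simp add: filler_def)
next
  case (4 m p q U b)
  then have b: "b < A q" and kU: "k \<notin> U m" by (auto simp: filler_def)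
  have "GG m p q U b = cop (x k) m p q U b"
  proof (cases "p = 0 \<and> q = n")
    case True then show ?thesis using fill(3)[of U m b k] 4 b k kU by (simp add: GG_0n)
  next
    case False show ?thesis unfolding GG_G[OF False] by (rule G_eq[OF 4(1,2) b False k kU, symmetric])
  qed
  then show ?case using 4 by (simp add: filler_def)
qed

end

theorem coherent_inner_horn:
  assumes Q: "simplicial_operad Q"
    and kan: "\<And>as b. as \<in> lists (Col (lvl Q 0)) \<Longrightarrow> b \<in> Col (lvl Q 0) \<Longrightarrow> kan_complex (op_space Q as b)"
    and i: "0 < i" "i < n"
  shows "fills_horn (coherent_sset Q) n i"
  unfolding fills_horn_def
proof (intro allI impI)
  fix f assume f: "sset_hom (horn n i) (coherent_sset Q) f"
  \<comment> \<open>A proper subset \<open>B\<close> containing \<open>i\<close> spans a simplex of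
    the horn, so the retraction onto \<open>B\<close> belongs to the horn. As it fixes
    \<open>B\<close>, every simplex with vertices in \<open>B\<close> is a restriction of
    it.\<close>
  have fB: "coherent Q n (f n (retract n B))"
    "\<And>k \<theta>. \<theta> \<in> simplex_maps k n \<Longrightarrow> \<theta> ` {..k} \<subseteq> B \<Longrightarrow> f k \<theta> = cpull k \<theta> (f n (retract n B))"
    if B: "B \<subseteq> {..n}" "i \<in> B" "B \<noteq> {..n}" for B
  proof -
    have B0: "B \<noteq> {}" using B(2) by blast
    note r = retract[OF B(1) B0]
    have h: "retract n B \<in> splx (horn n i) n" proof -
      have "insert i (retract n B ` {..n}) \<subseteq> B" using r(3) B(2) by blast
      then have "insert i (retract n B ` {..n}) \<noteq> {..n}" using B(1,3) by blast
      then show ?thesis using r(1) by (simp add: horn_def)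
    qed
    then show "coherent Q n (f n (retract n B))" using f by (simp add: sset_hom_def coherent_sset_def)
    fix k \<theta> assume \<theta>: "\<theta> \<in> simplex_maps k n" "\<theta> ` {..k} \<subseteq> B"
    have c: "compose {..k} (retract n B) \<theta> = \<theta>"
    proof (rule simplex_maps_eqI[OF simplex_maps_comp[OF r(1) \<theta>(1)] \<theta>(1)])
      fix p assume "p \<le> k"
      then show "compose {..k} (retract n B) \<theta> p = \<theta> p" using r(2)[of "\<theta> p"] \<theta>(2) by (auto simp: compose_def)
    qed
    have "f k (sact (horn n i) k n \<theta> (retract n B)) = sact (coherent_sset Q) k n \<theta> (f n (retract n B))"
      using f h \<theta>(1) unfolding sset_hom_def by blast
    then show "f k \<theta> = cpull k \<theta> (f n (retract n B))" by (simp add: horn_def coherent_sset_def c)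
  qed
  let ?B = "\<lambda>k. {..n} - {k}"
  define x where "x k = f n (retract n (?B k))" for k
  have B: "?B k \<subseteq> {..n}" "i \<in> ?B k" "?B k \<noteq> {..n}" if "k \<le> n" "k \<noteq> i" for k using that i by auto
  have x: "coherent Q n (x k)" if "k \<le> n" "k \<noteq> i" for k unfolding x_def by (rule fB(1)[OF B[OF that]])
  have xf: "f m \<theta> = cpull m \<theta> (x k)" if "k \<le> n" "k \<noteq> i" "\<theta> \<in> simplex_maps m n" "\<theta> ` {..m} \<subseteq> ?B k" for k m \<theta>
    unfolding x_def by (rule fB(2)[OF B[OF that(1,2)] that(3,4)])
  \<comment> \<open>Both \<open>x k\<close> and \<open>x l\<close> restrict along the retraction
    onto the common face to the same value of \<open>f\<close>, and each agrees with its restriction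
    there.\<close>
  have ag: "agree n ({..n} - {k, l}) (x k) (x l)" if kl: "k \<le> n" "k \<noteq> i" "l \<le> n" "l \<noteq> i" for k l
  proof -
    let ?C = "{..n} - {k, l}"
    have "i \<in> ?C" using i kl by simp
    then have C: "?C \<subseteq> {..n}" "?C \<noteq> {}" by blast+
    note r = retract[OF C]
    have "agree n ?C (cpull n (retract n ?C) (x p)) (x p)" if "p \<le> n" "p \<noteq> i" for p
      using agree_fixed[OF r(1,2) C(1) coherentD(1)[OF x[OF that]]] by simp
    moreover have "cpull n (retract n ?C) (x p) = f n (retract n ?C)" if "p = k \<or> p = l" for p
    proof -
      have "retract n ?C ` {..n} \<subseteq> ?B p" using r(3) that by blast
      then show ?thesis using xf[of p "retract n ?C" n] r(1) kl that by metis
    qed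
    ultimately have "agree n ?C (f n (retract n ?C)) (x k)" "agree n ?C (f n (retract n ?C)) (x l)"
      using kl by metis+
    then show ?thesis using agree_sym agree_trans by blast
  qed
  interpret inner_horn Q n i x by unfold_locales (use Q kan i x ag in auto)
  note d = coherent_filler
  let ?g = "\<lambda>k \<theta>. cpull k \<theta> filler"
  have "sset_hom (std_simplex n) (coherent_sset Q) ?g"
    using coherent_cpull[OF d] cpull_comp[OF coherentD(1)[OF d]]
    by (simp add: sset_hom_def std_simplex_def coherent_sset_def)
  moreover have "?g m \<theta> = f m \<theta>" if \<theta>: "\<theta> \<in> splx (horn n i) m" for m \<theta>
  proof -
    have t: "\<theta> \<in> simplex_maps m n" "insert i (\<theta> ` {..m}) \<noteq> {..n}" using \<theta> by (auto simp: horn_def)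
    have "\<theta> ` {..m} \<subseteq> {..n}" using simplex_mapsD(2)[OF t(1) order.refl] by auto
    moreover from this have "\<not> {..n} \<subseteq> insert i (\<theta> ` {..m})" using t(2) i by auto
    ultimately obtain k where k: "k \<le> n" "k \<noteq> i" "\<theta> ` {..m} \<subseteq> ?B k" by blast
    show ?thesis
      using agree_cpull[OF agree_filler[OF k(1,2)] t(1) k(3) coherentD(1)[OF d] x_chain[OF k(1,2)]] xf[OF k(1,2) t(1) k(3)]
      by simp
  qed
  ultimately show "\<exists>g. sset_hom (std_simplex n) (coherent_sset Q) g \<and> (\<forall>k. \<forall>\<theta>\<in>splx (horn n i) k. g k \<theta> = f k \<theta>)"
    by blast
qed

subsection \<open>The coherent list nerve is a quasi-operad\<close>

theorem theorem1p2:
  fixes Q :: "('c, 'o) soperad"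
  assumes "simplicial_operad Q"
    and "\<And>as b. as \<in> lists (Col (lvl Q 0)) \<Longrightarrow> b \<in> Col (lvl Q 0) \<Longrightarrow> kan_complex (op_space Q as b)"
  shows "quasi_operad (coherent_list_nerve Q)"
proof -
  interpret soperad Q by unfold_locales (rule assms(1))
  have bij: "bij_betw (total n) (splx (list_sset N) n) (splx (coherent_sset Q) n)" for n
    using total_bij[of n] by (simp add: list_sset_def coherent_sset_def)
  have S: "simplicial_set (list_sset N)" by (rule simplicial_set_list_sset[OF simplicial_list_nerve])
  \<comment> \<open>Horns of lists are filled among coherent data and carried back along the
    isomorphism \<open>total\<close>.\<close>
  have "fills_horn (list_sset N) n i" if "0 < i" "i < n" for n i
    by (rule fills_horn_iso[OF S total_hom bij coherent_inner_horn[OF assms that]])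
  then show ?thesis
    using S simplicial_list_nerve operadic_nerve by (simp add: quasi_operad_def quasi_category_def)
qed

end
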